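(* Every $\aleph_0$-categorical metric structure $M$, with automorphism group $G=\operatorname{Aut}(M)$, satisfies $\operatorname{Def}(M)=\operatorname{RUC}_G(M)$. Thus the maximal equivariant compactification of the system $\operatorname{Aut}(M)\curvearrowright M$ can be identified with the space $S_1(M)$ of $1$-types over $M$, and is in particular metrizable.
   Context: Metric structures (continuous logic): a metric structure $M$ is a complete bounded metric space $(M,d)$ with a family of distinguished bounded, uniformly continuous real-valued predicates on finite powers of $M$ (interpretations of the symbols of a relational language). The definable predicates of $M$ (interpretations of formulas) are the functions $\varphi\colon M^n\to\mathbb R$, $n\le\omega$, obtained from the distinguished predicates and the metric by continuous combinations, quantification (suprema or infima with respect to given variables) and uniform limits. $\operatorname{Aut}(M)$ is the group of invertible isometries of $M$ preserving the distinguished predicates, with the topology of pointwise convergence on $M$. $M$ is $\aleph_0$-categorical (separably categorical) if it is, up to isomorphism, the unique separable model of its (continuous) first-order theory; the language is then assumed countable (possibly up to interdefinability). $\operatorname{Def}(M)$ is the closed algebra of functions $M\to\mathbb R$, $x\mapsto\varphi(x,b)$, where $\varphi\colon M\times M^n\to\mathbb R$ is a definable predicate and $b\in M^n$, $n\le\omega$. $S_1(M)$ is the maximal ideal space (Stone--Gelfand dual) of $\operatorname{Def}(M)$, with its compact topology. $\operatorname{RUC}_G(M)$ is the algebra of continuous bounded $f\colon M\to\mathbb R$ such that for every $\varepsilon>0$ there is a neighborhood $V$ of the identity in $G$ with $\sup_{x\in M}|f(vx)-f(x)|<\varepsilon$ for every $v\in V$. An equivariant compactification of a $G$-space $X$ is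 a compact Hausdorff $G$-space $K$ (continuous action) with a continuous $G$-equivariant map $X\to K$ with dense image; the maximal one, $\beta_G\colon X\to\beta_GX$, is the one through which every other equivariant compactification factors; it corresponds by Stone--Gelfand duality to $\operatorname{RUC}_G(X)$. *)

theory Defs
  imports "HOL-Analysis.Analysis" "HOL-Algebra.Bij" "HOL-Algebra.Group_Action" "HOL-Algebra.Ideal"
begin

section \<open>Metric structures\<close>

record 'p language =
  symbols :: "'p set"
  arity :: "'p \<Rightarrow> nat"

record ('a, 'p) metric_struct =
  metric :: "'a metric"
  pred :: "'p \<Rightarrow> 'a list \<Rightarrow> real"

abbreviation universe :: "('a, 'p) metric_struct \<Rightarrow> 'a set"
  where "universe M \<equiv> mspace (metric M)"

abbreviation distance :: "('a, 'p) metric_struct \<Rightarrow> 'a \<Rightarrow> 'a \<Rightarrow> real"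
  where "distance M \<equiv> mdist (metric M)"

abbreviation space_topology :: "('a, 'p) metric_struct \<Rightarrow> 'a topology"
  where "space_topology M \<equiv> mtopology_of (metric M)"

text \<open>The \<open>n\<close>-th power of the universe, as the set of lists of length \<open>n\<close>.\<close>

definition tuples :: "('a, 'p) metric_struct \<Rightarrow> nat \<Rightarrow> 'a list set"
  where "tuples M n = {xs. set xs \<subseteq> universe M \<and> length xs = n}"

definition metric_structure :: "'p language \<Rightarrow> ('a, 'p) metric_struct \<Rightarrow> bool"
  where "metric_structure L M \<longleftrightarrow>
    universe M \<noteq> {} \<and>
    mcomplete_of (metric M) \<and>
    (\<exists>B. \<forall>x\<in>universe M. \<forall>y\<in>universe M. distance M x y \<le> B) \<and>
    (\<forall>p\<in>symbols L.
       bounded (pred M p ` tuples M (arity L p)) \<and>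
       (\<forall>\<epsilon>>0. \<exists>\<delta>>0. \<forall>xs\<in>tuples M (arity L p). \<forall>ys\<in>tuples M (arity L p).
          (\<forall>i<arity L p. distance M (xs ! i) (ys ! i) < \<delta>) \<longrightarrow>
          \<bar>pred M p xs - pred M p ys\<bar> < \<epsilon>))"

definition isomorphism ::
    "'p language \<Rightarrow> ('a, 'p) metric_struct \<Rightarrow> ('b, 'p) metric_struct \<Rightarrow> ('a \<Rightarrow> 'b) \<Rightarrow> bool"
  where "isomorphism L M N h \<longleftrightarrow>
    bij_betw h (universe M) (universe N) \<and>
    (\<forall>x\<in>universe M. \<forall>y\<in>universe M. distance N (h x) (h y) = distance M x y) \<and>
    (\<forall>p\<in>symbols L. \<forall>xs\<in>tuples M (arity L p). pred N p (map h xs) = pred M p xs)"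

section \<open>Formulas and theories\<close>

text \<open>Variables are natural numbers. In \<open>Conn u \<phi>s\<close> with \<open>\<phi>s\<close> of length \<open>k\<close>, the connective is the
  restriction of \<open>u\<close> to the copy of \<open>\<real>\<^sup>k\<close> in \<open>\<real>\<^sup>\<omega>\<close> given by the sequences vanishing from index \<open>k\<close>
  on. As this copy is a retract of \<open>\<real>\<^sup>\<omega>\<close>, the continuous functions \<open>u\<close> induce exactly the
  continuous functions on \<open>\<real>\<^sup>k\<close>.\<close>

datatype 'p formula =
    Pred 'p "nat list"
  | Dist nat nat
  | Conn "(nat \<Rightarrow> real) \<Rightarrow> real" "'p formula list"
  | SupQ nat "'p formula"
  | InfQ nat "'p formula"

primrec interp :: "('a, 'p) metric_struct \<Rightarrow> 'p formula \<Rightarrow> (nat \<Rightarrow> 'a) \<Rightarrow> real"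
  where
    "interp M (Pred p vs) = (\<lambda>e. pred M p (map e vs))"
  | "interp M (Dist i j) = (\<lambda>e. distance M (e i) (e j))"
  | "interp M (Conn u \<phi>s) =
       (\<lambda>e. u (\<lambda>i. if i < length \<phi>s then (map (interp M) \<phi>s ! i) e else 0))"
  | "interp M (SupQ i \<phi>) = (\<lambda>e. SUP a\<in>universe M. interp M \<phi> (e(i := a)))"
  | "interp M (InfQ i \<phi>) = (\<lambda>e. INF a\<in>universe M. interp M \<phi> (e(i := a)))"

primrec formula_of :: "'p language \<Rightarrow> 'p formula \<Rightarrow> bool"
  where
    "formula_of L (Pred p vs) \<longleftrightarrow> p \<in> symbols L \<and> length vs = arity L p"
  | "formula_of L (Dist i j) \<longleftrightarrow> True"
  | "formula_of L (Conn u \<phi>s) \<longleftrightarrow> continuous_on UNIV u \<and> list_all (formula_of L) \<phi>s"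
  | "formula_of L (SupQ i \<phi>) \<longleftrightarrow> formula_of L \<phi>"
  | "formula_of L (InfQ i \<phi>) \<longleftrightarrow> formula_of L \<phi>"

primrec free_vars :: "'p formula \<Rightarrow> nat set"
  where
    "free_vars (Pred p vs) = set vs"
  | "free_vars (Dist i j) = {i, j}"
  | "free_vars (Conn u \<phi>s) = \<Union> (set (map free_vars \<phi>s))"
  | "free_vars (SupQ i \<phi>) = free_vars \<phi> - {i}"
  | "free_vars (InfQ i \<phi>) = free_vars \<phi> - {i}"

definition valuations :: "('a, 'p) metric_struct \<Rightarrow> (nat \<Rightarrow> 'a) set"
  where "valuations M = UNIV \<rightarrow> universe M"

definition satisfies :: "('a, 'p) metric_struct \<Rightarrow> 'p formula \<Rightarrow> bool"
  where "satisfies M \<phi> \<longleftrightarrow> (\<forall>e\<in>valuations M. interp M \<phi> e = 0)"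

text \<open>A sentence \<open>\<phi>\<close> in a theory stands for the condition \<open>\<phi> = 0\<close>.\<close>

definition theory_of :: "'p language \<Rightarrow> ('a, 'p) metric_struct \<Rightarrow> 'p formula set"
  where "theory_of L M = {\<phi>. formula_of L \<phi> \<and> free_vars \<phi> = {} \<and> satisfies M \<phi>}"

definition model_of :: "'p language \<Rightarrow> ('a, 'p) metric_struct \<Rightarrow> 'p formula set \<Rightarrow> bool"
  where "model_of L N T \<longleftrightarrow> metric_structure L N \<and> (\<forall>\<phi>\<in>T. satisfies N \<phi>)"

definition separable_structure :: "('a, 'p) metric_struct \<Rightarrow> bool"
  where "separable_structure M \<longleftrightarrow> separable_space (space_topology M)"

text \<open>A separable metric space has at most the cardinality of the continuum, so every separable
  structure is isomorphic to one whose universe is a set of reals (with a metric unrelated to that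
  of the reals). Quantifying over those is quantifying over all separable models.\<close>

definition aleph0_categorical :: "'p language \<Rightarrow> ('a, 'p) metric_struct \<Rightarrow> bool"
  where "aleph0_categorical L M \<longleftrightarrow>
    separable_structure M \<and>
    (\<forall>N :: (real, 'p) metric_struct.
       model_of L N (theory_of L M) \<and> separable_structure N \<longrightarrow> (\<exists>h. isomorphism L M N h))"

section \<open>Definable predicates\<close>

text \<open>Definable predicates are represented as functions of \<open>\<omega>\<close> variables; those of finitely many
  variables are the ones that do not depend on the others. Only the values on valuations matter:
  by \<open>limit\<close>, a function agreeing with a definable predicate on valuations is definable.\<close>

inductive definable_predicate ::
    "'p language \<Rightarrow> ('a, 'p) metric_struct \<Rightarrow> ((nat \<Rightarrow> 'a) \<Rightarrow> real) \<Rightarrow> bool"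
  for L :: "'p language" and M :: "('a, 'p) metric_struct"
  where
    predicate: "p \<in> symbols L \<Longrightarrow> length vs = arity L p \<Longrightarrow>
      definable_predicate L M (\<lambda>e. pred M p (map e vs))"
  | distance: "definable_predicate L M (\<lambda>e. distance M (e i) (e j))"
  | connective: "continuous_on UNIV (u :: (nat \<Rightarrow> real) \<Rightarrow> real) \<Longrightarrow>
      (\<And>i. i < k \<Longrightarrow> definable_predicate L M (\<phi>s i)) \<Longrightarrow>
      definable_predicate L M (\<lambda>e. u (\<lambda>i. if i < (k::nat) then \<phi>s i e else 0))"
  | supremum: "definable_predicate L M \<phi> \<Longrightarrow>
      definable_predicate L M (\<lambda>e. SUP a\<in>universe M. \<phi> (e(i := a)))"
  | infimum: "definable_predicate L M \<phi> \<Longrightarrow>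
      definable_predicate L M (\<lambda>e. INF a\<in>universe M. \<phi> (e(i := a)))"
  | limit: "(\<And>n. definable_predicate L M (\<phi>s n)) \<Longrightarrow>
      uniform_limit (valuations M) \<phi>s \<phi> sequentially \<Longrightarrow> definable_predicate L M \<phi>"

definition interdefinable ::
    "'p language \<Rightarrow> ('a, 'p) metric_struct \<Rightarrow> 'q language \<Rightarrow> ('a, 'q) metric_struct \<Rightarrow> bool"
  where "interdefinable L M L' M' \<longleftrightarrow>
    metric M = metric M' \<and>
    (\<forall>p\<in>symbols L. definable_predicate L' M' (\<lambda>e. pred M p (map e [0..<arity L p]))) \<and>
    (\<forall>q\<in>symbols L'. definable_predicate L M (\<lambda>e. pred M' q (map e [0..<arity L' q])))"

definition essentially_countable_language :: "'p language \<Rightarrow> ('a, 'p) metric_struct \<Rightarrow> bool"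
  where "essentially_countable_language L M \<longleftrightarrow>
    (\<exists>(L' :: nat language) M'. metric_structure L' M' \<and> interdefinable L M L' M')"

text \<open>Real functions on a set \<open>X\<close> are represented by the elements of \<open>extensional X\<close>. In \<open>\<phi>(x,b)\<close>
  the variable \<open>x\<close> gets index \<open>0\<close>, and \<open>b\<close> fills the remaining ones; a finite tuple of parameters
  is extended arbitrarily.\<close>

definition Def :: "'p language \<Rightarrow> ('a, 'p) metric_struct \<Rightarrow> ('a \<Rightarrow> real) set"
  where "Def L M =
    {(\<lambda>x\<in>universe M. \<phi> (case_nat x b)) | \<phi> b. definable_predicate L M \<phi> \<and> b \<in> valuations M}"

section \<open>Automorphism groups\<close>

definition Aut :: "'p language \<Rightarrow> ('a, 'p) metric_struct \<Rightarrow> ('a \<Rightarrow> 'a) set"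
  where "Aut L M = {g \<in> extensional (universe M). isomorphism L M M g}"

definition Aut_group :: "'p language \<Rightarrow> ('a, 'p) metric_struct \<Rightarrow> ('a \<Rightarrow> 'a) monoid"
  where "Aut_group L M = BijGroup (universe M) \<lparr>carrier := Aut L M\<rparr>"

definition Aut_topology :: "'p language \<Rightarrow> ('a, 'p) metric_struct \<Rightarrow> ('a \<Rightarrow> 'a) topology"
  where "Aut_topology L M =
    subtopology (product_topology (\<lambda>_. space_topology M) (universe M)) (Aut L M)"

definition RUC ::
    "('g, 'm) monoid_scheme \<Rightarrow> 'g topology \<Rightarrow> 'x topology \<Rightarrow> ('g \<Rightarrow> 'x \<Rightarrow> 'x) \<Rightarrow> ('x \<Rightarrow> real) set"
  where "RUC G T X \<alpha> =
    {f \<in> extensional (topspace X).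
       continuous_map X euclideanreal f \<and> bounded (f ` topspace X) \<and>
       (\<forall>\<epsilon>>0. \<exists>V. openin T V \<and> \<one>\<^bsub>G\<^esub> \<in> V \<and>
          (\<forall>v\<in>V. (SUP x\<in>topspace X. \<bar>f (\<alpha> v x) - f x\<bar>) < \<epsilon>))}"

section \<open>Equivariant compactifications\<close>

definition G_space ::
    "('g, 'm) monoid_scheme \<Rightarrow> 'g topology \<Rightarrow> 'x topology \<Rightarrow> ('g \<Rightarrow> 'x \<Rightarrow> 'x) \<Rightarrow> bool"
  where "G_space G T X \<alpha> \<longleftrightarrow>
    group_action G (topspace X) \<alpha> \<and>
    continuous_map (prod_topology T X) X (\<lambda>(g, x). \<alpha> g x)"

definition equivariant ::
    "('g, 'm) monoid_scheme \<Rightarrow> 'x set \<Rightarrow> ('g \<Rightarrow> 'x \<Rightarrow> 'x) \<Rightarrow> ('g \<Rightarrow> 'y \<Rightarrow> 'y) \<Rightarrow> ('x \<Rightarrow> 'y) \<Rightarrow> bool"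
  where "equivariant G X \<alpha> \<beta> h \<longleftrightarrow> (\<forall>g\<in>carrier G. \<forall>x\<in>X. h (\<alpha> g x) = \<beta> g (h x))"

definition equivariant_compactification ::
    "('g, 'm) monoid_scheme \<Rightarrow> 'g topology \<Rightarrow> 'x topology \<Rightarrow> ('g \<Rightarrow> 'x \<Rightarrow> 'x) \<Rightarrow>
     'k topology \<Rightarrow> ('g \<Rightarrow> 'k \<Rightarrow> 'k) \<Rightarrow> ('x \<Rightarrow> 'k) \<Rightarrow> bool"
  where "equivariant_compactification G T X \<alpha> K \<kappa> j \<longleftrightarrow>
    compact_space K \<and> Hausdorff_space K \<and> G_space G T K \<kappa> \<and>
    continuous_map X K j \<and> equivariant G (topspace X) \<alpha> \<kappa> j \<and>
    K closure_of (j ` topspace X) = topspace K"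

text \<open>The universal property is restricted to compactifications with points in the type \<open>'c\<close>; it is
  meant to be used with \<open>'c\<close> an arbitrary type variable.\<close>

definition maximal_equivariant_compactification ::
    "'c itself \<Rightarrow> ('g, 'm) monoid_scheme \<Rightarrow> 'g topology \<Rightarrow> 'x topology \<Rightarrow> ('g \<Rightarrow> 'x \<Rightarrow> 'x) \<Rightarrow>
     'k topology \<Rightarrow> ('g \<Rightarrow> 'k \<Rightarrow> 'k) \<Rightarrow> ('x \<Rightarrow> 'k) \<Rightarrow> bool"
  where "maximal_equivariant_compactification _ G T X \<alpha> K \<kappa> j \<longleftrightarrow>
    equivariant_compactification G T X \<alpha> K \<kappa> j \<and>
    (\<forall>(K' :: 'c topology) \<kappa>' j'.
       equivariant_compactification G T X \<alpha> K' \<kappa>' j' \<longrightarrow>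
       (\<exists>\<pi>. continuous_map K K' \<pi> \<and> equivariant G (topspace K) \<kappa> \<kappa>' \<pi> \<and>
            (\<forall>x\<in>topspace X. \<pi> (j x) = j' x)))"

section \<open>The space of 1-types\<close>

definition function_ring :: "'x set \<Rightarrow> ('x \<Rightarrow> real) set \<Rightarrow> ('x \<Rightarrow> real) ring"
  where "function_ring X A =
    \<lparr>carrier = A,
     mult = (\<lambda>f g. \<lambda>x\<in>X. f x * g x),
     one = (\<lambda>x\<in>X. 1),
     zero = (\<lambda>x\<in>X. 0),
     add = (\<lambda>f g. \<lambda>x\<in>X. f x + g x)\<rparr>"

text \<open>For a maximal ideal \<open>I\<close> of a uniformly closed algebra \<open>A\<close> of bounded real functions, the residue
  field \<open>A/I\<close> is \<open>\<real>\<close>; the Gelfand transform of \<open>f\<close> at \<open>I\<close> is the residue of \<open>f\<close>.\<close>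

definition gelfand_transform :: "'x set \<Rightarrow> ('x \<Rightarrow> real) \<Rightarrow> ('x \<Rightarrow> real) set \<Rightarrow> real"
  where "gelfand_transform X f I = (THE r. (\<lambda>x\<in>X. f x - r) \<in> I)"

text \<open>The coarsest topology making all Gelfand transforms continuous.\<close>

definition maximal_ideal_space :: "'x set \<Rightarrow> ('x \<Rightarrow> real) set \<Rightarrow> ('x \<Rightarrow> real) set topology"
  where "maximal_ideal_space X A =
    pullback_topology {I. maximalideal I (function_ring X A)}
      (\<lambda>I. \<lambda>f\<in>A. gelfand_transform X f I) (product_topology (\<lambda>_. euclideanreal) A)"

definition S1 :: "'p language \<Rightarrow> ('a, 'p) metric_struct \<Rightarrow> ('a \<Rightarrow> real) set topology"
  where "S1 L M = maximal_ideal_space (universe M) (Def L M)"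

text \<open>The type of \<open>a\<close> over \<open>M\<close> is the kernel of evaluation at \<open>a\<close>.\<close>

definition tp :: "'p language \<Rightarrow> ('a, 'p) metric_struct \<Rightarrow> 'a \<Rightarrow> ('a \<Rightarrow> real) set"
  where "tp L M a = {f \<in> Def L M. f a = 0}"

text \<open>The action on ideals induced by \<open>(g f)(x) = f(g\<^sup>-\<^sup>1 x)\<close>, so that \<open>g (tp a) = tp (g a)\<close>.\<close>

definition S1_action ::
    "'p language \<Rightarrow> ('a, 'p) metric_struct \<Rightarrow> ('a \<Rightarrow> 'a) \<Rightarrow> ('a \<Rightarrow> real) set \<Rightarrow> ('a \<Rightarrow> real) set"
  where "S1_action L M g =
    (\<lambda>I\<in>topspace (S1 L M). {f \<in> Def L M. compose (universe M) f g \<in> I})"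

end

theory Submission
  imports Defs
begin

text \<open>A function \<open>x \<mapsto> \<phi>(x,b)\<close> is right uniformly continuous because \<open>\<phi>\<close> is uniformly continuous and
  invariant under automorphisms. For the converse one needs a Ryll-Nardzewski theorem. View the
  \<open>\<omega>\<close>-types of \<open>M\<close> as the compact closure of the evaluations at sequences. A Henkin type, for which
  every infimum is approached at one of its variables, has a separable model, which must be \<open>M\<close>; so
  it is the type of a dense sequence of \<open>M\<close>. Henkin types are comeagre, whence by Baire's theorem
  every \<open>\<omega>\<close>-type is realized in \<open>M\<close>, and, for \<open>\<epsilon> > 0\<close> and \<open>n\<close>, all sequences whose types are close to
  that of \<open>a\<close> agree up to \<open>\<epsilon>\<close> in the first \<open>n\<close> entries with some \<open>g a\<close>, \<open>g\<close> an automorphism. Hence,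
  given a dense sequence \<open>s\<close>, a right uniformly continuous \<open>f\<close> oscillates little on the set of those
  \<open>x\<close> for which the type of \<open>(x,s)\<close> is close to a given one. By compactness finitely many such sets
  cover \<open>M\<close>, and a definable partition of unity approximates \<open>f\<close> by some \<open>\<phi>(x,s)\<close>.

  The maximal ideals of \<open>Def(M)\<close> are the kernels of the points in the closure of the evaluations at
  points of \<open>M\<close>. The universal property follows since continuous functions on an equivariant
  compactification pull back to \<open>RUC\<^sub>G(M) = Def(M)\<close>, and metrizability since \<open>Def(M)\<close> is separable.\<close>

section \<open>The spectrum of a family of functions\<close>

text \<open>A type is handled as a functional on all definable predicates at once: compactness is
  Tychonoff's theorem, and sequences of points suffice as long as only finitely many predicates are
  involved. Three obstacles shape the rest. A neighbourhood of a type gives approximate agreement of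
  types only; exact agreement needs an iteration with summable errors, and an automorphism matches
  two sequences of the same type exactly only when both are dense, whence the errors \<epsilon> in
  all statements about orbits. A Henkin witness needs a variable that nothing else mentions,
  although an \<omega>-type may mention all of them; so a given type is first copied to the even
  variables and the odd ones receive the witnesses. Categoricity quantifies over models whose points
  are reals; so the variables of a Henkin type are embedded isometrically by their distance
  functions, completed, and copied into the reals. Finally, functions in \<open>Def\<close> come
  with different parameters, so closure under sums is not immediate; proving the equality with
  \<open>RUC\<close> for one dense sequence of parameters at once settles this too.\<close>

definition spectrum :: "'x set \<Rightarrow> ('x \<Rightarrow> real) set \<Rightarrow> (('x \<Rightarrow> real) \<Rightarrow> real) set"
  where "spectrum X A = {\<Phi> \<in> extensional A.
    \<forall>F\<subseteq>A. finite F \<longrightarrow> (\<forall>\<epsilon>>0. \<exists>x\<in>X. \<forall>f\<in>F. \<bar>f x - \<Phi> f\<bar> < \<epsilon>)}"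

abbreviation "spectrum_topology X A \<equiv> subtopology (powertop_real A) (spectrum X A)"

lemma openin_powertop_real_imp_nbhd:
  assumes "openin (powertop_real A) T" "\<Phi> \<in> T"
  obtains F \<epsilon> where "finite F" "F \<subseteq> A" "0 < \<epsilon>"
    "\<And>\<Psi>. \<Psi> \<in> extensional A \<Longrightarrow> (\<And>f. f \<in> F \<Longrightarrow> \<bar>\<Psi> f - \<Phi> f\<bar> < \<epsilon>) \<Longrightarrow> \<Psi> \<in> T"
proof -
  obtain U where U: "finite {i \<in> A. U i \<noteq> UNIV}" "\<forall>i\<in>A. open (U i)" "\<Phi> \<in> PiE A U" "PiE A U \<subseteq> T"
    using assms unfolding openin_product_topology_alt topspace_euclidean open_openin[symmetric] by meson
  define F where "F = {i \<in> A. U i \<noteq> UNIV}"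
  have "\<exists>e>0. \<forall>y. \<bar>y - \<Phi> f\<bar> < e \<longrightarrow> y \<in> U f" if "f \<in> F" for f
  proof -
    have "open (U f)" "\<Phi> f \<in> U f" using U that by (auto simp: F_def)
    then show ?thesis by (simp add: open_dist dist_real_def)
  qed
  then obtain e where e: "\<And>f. f \<in> F \<Longrightarrow> e f > 0" "\<And>f y. f \<in> F \<Longrightarrow> \<bar>y - \<Phi> f\<bar> < e f \<Longrightarrow> y \<in> U f"
    by metis
  \<comment> \<open>The inserted 1 gives the minimum a value when \<open>F\<close> is empty, that
    is, when the box restricts no coordinate.\<close>
  define \<epsilon> where "\<epsilon> = Min (insert 1 (e ` F))"
  have fin: "finite F" using U F_def by simp
  have "\<epsilon> > 0" unfolding \<epsilon>_def using fin e by (subst Min_gr_iff) auto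
  moreover have "\<Psi> \<in> T" if "\<Psi> \<in> extensional A" "\<And>f. f \<in> F \<Longrightarrow> \<bar>\<Psi> f - \<Phi> f\<bar> < \<epsilon>" for \<Psi>
  proof -
    have "\<epsilon> \<le> e f" if "f \<in> F" for f unfolding \<epsilon>_def using fin that by simp
    then have "\<Psi> f \<in> U f" if "f \<in> A" for f
      using that e(2)[of f "\<Psi> f"] \<open>\<And>f. f \<in> F \<Longrightarrow> \<bar>\<Psi> f - \<Phi> f\<bar> < \<epsilon>\<close>[of f] unfolding F_def by fastforce
    then show ?thesis using U(4) that(1) by (auto simp: PiE_def)
  qed
  ultimately show ?thesis using fin by (intro that[of F \<epsilon>]) (auto simp: F_def)
qed

lemma continuous_map_eval:
  "f \<in> A \<Longrightarrow> continuous_map (powertop_real A) euclideanreal (\<lambda>\<Phi>. \<Phi> f)"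
  by (rule continuous_map_product_projection)

lemma closure_of_point_evaluations:
  "powertop_real A closure_of ((\<lambda>x. \<lambda>f\<in>A. f x) ` X) = spectrum X A"
proof (intro equalityI subsetI)
  fix \<Phi> assume \<Phi>: "\<Phi> \<in> powertop_real A closure_of ((\<lambda>x. \<lambda>f\<in>A. f x) ` X)"
  have "\<exists>x\<in>X. \<forall>f\<in>F. \<bar>f x - \<Phi> f\<bar> < \<epsilon>" if F: "F \<subseteq> A" "finite F" "\<epsilon> > 0" for F \<epsilon>
  proof -
    have "openin (powertop_real A) (PiE A (\<lambda>f. if f \<in> F then {\<Phi> f - \<epsilon> <..< \<Phi> f + \<epsilon>} else UNIV))"
      using F by (intro product_topology_basis) (auto simp flip: open_openin intro: finite_subset[of _ F])
    moreover have "\<Phi> \<in> PiE A (\<lambda>f. if f \<in> F then {\<Phi> f - \<epsilon> <..< \<Phi> f + \<epsilon>} else UNIV)"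
      using \<Phi> F by (auto simp: in_closure_of PiE_def)
    ultimately obtain x where "x \<in> X"
      "(\<lambda>f\<in>A. f x) \<in> PiE A (\<lambda>f. if f \<in> F then {\<Phi> f - \<epsilon> <..< \<Phi> f + \<epsilon>} else UNIV)"
      using \<Phi> unfolding in_closure_of by blast
    then have "\<forall>f\<in>F. f x \<in> {\<Phi> f - \<epsilon> <..< \<Phi> f + \<epsilon>}"
      using F(1) by (fastforce simp: PiE_iff split: if_splits)
    then show ?thesis using \<open>x \<in> X\<close> by (intro bexI[of _ x]) (auto simp: abs_less_iff)
  qed
  then show "\<Phi> \<in> spectrum X A"
    using \<Phi> unfolding spectrum_def by (auto simp: in_closure_of PiE_def)
next
  fix \<Phi> assume \<Phi>: "\<Phi> \<in> spectrum X A"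
  then have ext: "\<Phi> \<in> extensional A" by (simp add: spectrum_def)
  have "\<exists>y\<in>(\<lambda>x. \<lambda>f\<in>A. f x) ` X. y \<in> T" if T: "\<Phi> \<in> T" "openin (powertop_real A) T" for T
  proof -
    obtain F \<epsilon> where F: "finite F" "F \<subseteq> A" "0 < \<epsilon>"
      "\<And>\<Psi>. \<Psi> \<in> extensional A \<Longrightarrow> (\<And>f. f \<in> F \<Longrightarrow> \<bar>\<Psi> f - \<Phi> f\<bar> < \<epsilon>) \<Longrightarrow> \<Psi> \<in> T"
      using openin_powertop_real_imp_nbhd[OF T(2,1)] by metis
    then obtain x where x: "x \<in> X" "\<forall>f\<in>F. \<bar>f x - \<Phi> f\<bar> < \<epsilon>"
      using \<Phi> unfolding spectrum_def by blast
    have "(\<lambda>f\<in>A. f x) \<in> T"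
      using F(2) x by (intro F(4)) auto
    then show ?thesis using x by blast
  qed
  then show "\<Phi> \<in> powertop_real A closure_of ((\<lambda>x. \<lambda>f\<in>A. f x) ` X)"
    unfolding in_closure_of using ext by (simp add: PiE_def)
qed

lemma spectrum_point_evaluation: "x \<in> X \<Longrightarrow> (\<lambda>f\<in>A. f x) \<in> spectrum X A"
  unfolding spectrum_def mem_Collect_eq
  by (intro conjI allI impI bexI[of _ x]) auto

lemma spectrum_subset_extensional: "\<Phi> \<in> spectrum X A \<Longrightarrow> \<Phi> \<in> extensional A"
  by (simp add: spectrum_def)

lemma spectrum_approx:
  "\<lbrakk>\<Phi> \<in> spectrum X A; finite F; F \<subseteq> A; 0 < \<epsilon>\<rbrakk> \<Longrightarrow> \<exists>x\<in>X. \<forall>f\<in>F. \<bar>f x - \<Phi> f\<bar> < \<epsilon>"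
  by (simp add: spectrum_def)

text \<open>On a finite set of functions, sequences of points replace nets. Every inequality or
  continuous identity between finitely many functions thus passes from points to functionals by an
  ordinary limit.\<close>

lemma spectrum_approx_seq:
  assumes "\<Phi> \<in> spectrum X A" "finite F" "F \<subseteq> A"
  obtains x where "\<And>n::nat. x n \<in> X" "\<And>f. f \<in> F \<Longrightarrow> (\<lambda>n. f (x n)) \<longlonglongrightarrow> \<Phi> f"
proof -
  have "\<forall>n::nat. \<exists>x\<in>X. \<forall>f\<in>F. \<bar>f x - \<Phi> f\<bar> < inverse (Suc n)"
    using spectrum_approx[OF assms] by simp
  then obtain x where x: "\<And>n::nat. x n \<in> X" "\<And>n f. f \<in> F \<Longrightarrow> \<bar>f (x n) - \<Phi> f\<bar> < inverse (Suc n)"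
    by metis
  have "(\<lambda>n. f (x n)) \<longlonglongrightarrow> \<Phi> f" if "f \<in> F" for f
  proof -
    have "\<forall>\<^sub>F n in sequentially. norm (f (x n) - \<Phi> f) \<le> inverse (real (Suc n))"
      using x(2)[OF that] by (auto intro!: always_eventually less_imp_le)
    then have "(\<lambda>n. f (x n) - \<Phi> f) \<longlonglongrightarrow> 0"
      using LIMSEQ_inverse_real_of_nat by (rule Lim_null_comparison)
    then show ?thesis by (simp add: LIM_zero_iff)
  qed
  with x(1) that show ?thesis by blast
qed

lemma spectrum_le:
  assumes "\<Phi> \<in> spectrum X A" "f \<in> A" "g \<in> A" "\<And>x. x \<in> X \<Longrightarrow> f x \<le> g x + c"
  shows "\<Phi> f \<le> \<Phi> g + c"
proof -
  obtain x where x: "\<And>n::nat. x n \<in> X" "\<And>h. h \<in> {f,g} \<Longrightarrow> (\<lambda>n. h (x n)) \<longlonglongrightarrow> \<Phi> h"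
    using spectrum_approx_seq[OF assms(1), of "{f,g}"] assms by auto
  show ?thesis
    by (rule LIMSEQ_le[of "\<lambda>n. f (x n)" _ "\<lambda>n. g (x n) + c"]) (use x(1) assms(4) in \<open>auto intro!: tendsto_add tendsto_const x(2)\<close>)
qed

lemma spectrum_abs_le:
  assumes "\<Phi> \<in> spectrum X A" "f \<in> A" "g \<in> A" "\<And>x. x \<in> X \<Longrightarrow> \<bar>f x - g x\<bar> \<le> c"
  shows "\<bar>\<Phi> f - \<Phi> g\<bar> \<le> c"
proof -
  have "f x \<le> g x + c" "g x \<le> f x + c" if "x \<in> X" for x
    using assms(4)[OF that] by linarith+
  then have "\<Phi> f \<le> \<Phi> g + c" "\<Phi> g \<le> \<Phi> f + c"
    using spectrum_le[OF assms(1-3)] spectrum_le[OF assms(1,3,2)] by blast+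
  then show ?thesis by linarith
qed

lemma spectrum_bounds:
  assumes "\<Phi> \<in> spectrum X A" "f \<in> A"
  shows "(\<And>x. x \<in> X \<Longrightarrow> f x \<le> c) \<Longrightarrow> \<Phi> f \<le> c" "(\<And>x. x \<in> X \<Longrightarrow> c \<le> f x) \<Longrightarrow> c \<le> \<Phi> f"
proof -
  obtain x where x: "\<And>n::nat. x n \<in> X" "(\<lambda>n. f (x n)) \<longlonglongrightarrow> \<Phi> f"
    using spectrum_approx_seq[OF assms(1), of "{f}"] assms by auto
  show "(\<And>x. x \<in> X \<Longrightarrow> f x \<le> c) \<Longrightarrow> \<Phi> f \<le> c" "(\<And>x. x \<in> X \<Longrightarrow> c \<le> f x) \<Longrightarrow> c \<le> \<Phi> f"
    by (use x(1) in \<open>auto intro!: LIMSEQ_le_const2[OF x(2)] LIMSEQ_le_const[OF x(2)]\<close>)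
qed

lemma spectrum_closed: "closedin (powertop_real A) (spectrum X A)"
  unfolding closure_of_point_evaluations[symmetric] by simp

text \<open>Tychonoff: the spectrum is closed and lies in the product of the intervals
  \<open>{-B f..B f}\<close>.\<close>

lemma spectrum_compact:
  assumes "\<And>f. f \<in> A \<Longrightarrow> bounded (f ` X)"
  shows "compactin (powertop_real A) (spectrum X A)"
proof -
  have "\<forall>f\<in>A. \<exists>B. \<forall>x\<in>X. \<bar>f x\<bar> \<le> B"
    using assms by (auto simp: bounded_iff)
  then obtain B where B: "\<And>f x. f \<in> A \<Longrightarrow> x \<in> X \<Longrightarrow> \<bar>f x\<bar> \<le> B f" by metis
  have "compactin (powertop_real A) (PiE A (\<lambda>f. {-B f..B f}))"
    by (simp add: compactin_PiE)
  moreover have "spectrum X A \<subseteq> PiE A (\<lambda>f. {-B f..B f})"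
  proof
    fix \<Phi> assume \<Phi>: "\<Phi> \<in> spectrum X A"
    have "\<Phi> f \<in> {-B f..B f}" if "f \<in> A" for f
      using spectrum_bounds[OF \<Phi> that, of "B f"] spectrum_bounds[OF \<Phi> that, of "- B f"] B[OF that]
      by (simp add: abs_le_iff minus_le_iff)
    then show "\<Phi> \<in> PiE A (\<lambda>f. {-B f..B f})"
      using spectrum_subset_extensional[OF \<Phi>] by (auto simp: PiE_def)
  qed
  ultimately show ?thesis using spectrum_closed closed_compactin by blast
qed

lemma Hausdorff_powertop_real: "Hausdorff_space (powertop_real A)"
  by (simp add: Hausdorff_space_product_topology)

text \<open>The restriction map sends the compact spectrum over \<open>C\<close> to a compact, hence
  closed set. It contains all evaluations on \<open>A\<close>, hence their closure.\<close>

lemma spectrum_restrict: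
  assumes "A \<subseteq> C" and "\<And>f. f \<in> C \<Longrightarrow> bounded (f ` X)" and \<Phi>: "\<Phi> \<in> spectrum X A"
  obtains \<Psi> where "\<Psi> \<in> spectrum X C" "\<And>f. f \<in> A \<Longrightarrow> \<Psi> f = \<Phi> f"
proof -
  have cm: "continuous_map (powertop_real C) (powertop_real A) (\<lambda>\<Psi>. restrict \<Psi> A)"
    using assms(1) by (auto simp: continuous_map_componentwise intro!: continuous_map_eval)
  have "compactin (powertop_real A) ((\<lambda>\<Psi>. restrict \<Psi> A) ` spectrum X C)"
    using spectrum_compact[OF assms(2)] cm by (rule image_compactin)
  then have "closedin (powertop_real A) ((\<lambda>\<Psi>. restrict \<Psi> A) ` spectrum X C)"
    using compactin_imp_closedin Hausdorff_powertop_real by blast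
  moreover have "(\<lambda>x. \<lambda>f\<in>A. f x) ` X \<subseteq> (\<lambda>\<Psi>. restrict \<Psi> A) ` spectrum X C"
  proof
    fix y assume "y \<in> (\<lambda>x. \<lambda>f\<in>A. f x) ` X"
    then obtain x where x: "x \<in> X" "y = (\<lambda>f\<in>A. f x)" by auto
    have "y = restrict (\<lambda>f\<in>C. f x) A" using x assms(1) by (auto simp: restrict_def fun_eq_iff)
    then show "y \<in> (\<lambda>\<Psi>. restrict \<Psi> A) ` spectrum X C"
      using spectrum_point_evaluation[OF x(1)] by blast
  qed
  ultimately have "spectrum X A \<subseteq> (\<lambda>\<Psi>. restrict \<Psi> A) ` spectrum X C"
    by (metis closure_of_minimal closure_of_point_evaluations)
  then obtain \<Psi> where "\<Psi> \<in> spectrum X C" "\<Phi> = restrict \<Psi> A" using \<Phi> by blast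
  then show ?thesis using that[of \<Psi>] by simp
qed

text \<open>A map \<open>w\<close> need not extend to the spectra; compactness only gives points in the closure of
  its graph.\<close>

lemma spectrum_transfer:
  fixes w :: "'x \<Rightarrow> 'y"
  assumes \<Phi>: "\<Phi> \<in> spectrum X A" and w: "\<And>x. x \<in> X \<Longrightarrow> w x \<in> Y"
    and A: "\<And>f. f \<in> A \<Longrightarrow> bounded (f ` X)" and B: "\<And>f. f \<in> B \<Longrightarrow> bounded (f ` Y)"
  obtains \<Psi> where "\<Psi> \<in> spectrum Y B"
    "\<And>F G \<epsilon>. finite F \<Longrightarrow> F \<subseteq> A \<Longrightarrow> finite G \<Longrightarrow> G \<subseteq> B \<Longrightarrow> 0 < \<epsilon> \<Longrightarrow>
       \<exists>x\<in>X. (\<forall>f\<in>F. \<bar>f x - \<Phi> f\<bar> < \<epsilon>) \<and> (\<forall>g\<in>G. \<bar>g (w x) - \<Psi> g\<bar> < \<epsilon>)"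
proof -
  \<comment> \<open>Adjoining the pullbacks \<open>g \<circ> w\<close> to \<open>A\<close> reduces
    the search for \<Psi> to extending \<Phi> to a larger family on the same set
    \<open>X\<close>.\<close>
  define C where "C = A \<union> (\<lambda>g. g \<circ> w) ` B"
  have "bounded (f ` X)" if "f \<in> C" for f
  proof (cases "f \<in> A")
    case False
    then obtain g where "g \<in> B" "f = g \<circ> w" using \<open>f \<in> C\<close> unfolding C_def by blast
    moreover have "(g \<circ> w) ` X \<subseteq> g ` Y" using w by auto
    ultimately show ?thesis using B bounded_subset by metis
  qed (rule A)
  then obtain \<Psi> where \<Psi>: "\<Psi> \<in> spectrum X C" "\<And>f. f \<in> A \<Longrightarrow> \<Psi> f = \<Phi> f"
    using spectrum_restrict[of A C X \<Phi>] \<Phi> unfolding C_def by blast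
  define \<Psi>' where "\<Psi>' = (\<lambda>g\<in>B. \<Psi> (g \<circ> w))"
  have *: "\<exists>x\<in>X. (\<forall>f\<in>F. \<bar>f x - \<Phi> f\<bar> < \<epsilon>) \<and> (\<forall>g\<in>G. \<bar>g (w x) - \<Psi>' g\<bar> < \<epsilon>)"
    if "finite F" "F \<subseteq> A" "finite G" "G \<subseteq> B" "0 < \<epsilon>" for F G \<epsilon>
  proof -
    have "F \<union> (\<lambda>g. g \<circ> w) ` G \<subseteq> C" "finite (F \<union> (\<lambda>g. g \<circ> w) ` G)"
      using that unfolding C_def by auto
    then obtain x where x: "x \<in> X" "\<forall>f\<in>F \<union> (\<lambda>g. g \<circ> w) ` G. \<bar>f x - \<Psi> f\<bar> < \<epsilon>"
      using spectrum_approx[OF \<Psi>(1)] \<open>0 < \<epsilon>\<close> by meson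
    show ?thesis
    proof (intro bexI[of _ x] conjI ballI)
      show "\<bar>f x - \<Phi> f\<bar> < \<epsilon>" if "f \<in> F" for f
        using bspec[OF x(2), of f] \<Psi>(2)[OF subsetD[OF \<open>F \<subseteq> A\<close> that]] that by simp
      show "\<bar>g (w x) - \<Psi>' g\<bar> < \<epsilon>" if "g \<in> G" for g
        using bspec[OF x(2), of "g \<circ> w"] subsetD[OF \<open>G \<subseteq> B\<close> that] that by (simp add: \<Psi>'_def)
    qed (rule x)
  qed
  show ?thesis
  proof (rule that)
  show "\<Psi>' \<in> spectrum Y B"
    unfolding spectrum_def
  proof (intro CollectI conjI allI impI)
    fix G \<epsilon> assume "G \<subseteq> B" "finite G" "(0::real) < \<epsilon>"
    then obtain x where "x \<in> X" "\<forall>g\<in>G. \<bar>g (w x) - \<Psi>' g\<bar> < \<epsilon>" using *[of "{}" G \<epsilon>] by auto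
    then show "\<exists>y\<in>Y. \<forall>g\<in>G. \<bar>g y - \<Psi>' g\<bar> < \<epsilon>" using w by blast
  qed (simp add: \<Psi>'_def)
  qed (rule *)
qed

section \<open>Definable predicates\<close>

lemma SUP_diff_le:
  fixes f g :: "'x \<Rightarrow> real"
  assumes "X \<noteq> {}" "bounded (f ` X)" "bounded (g ` X)" "\<And>x. x \<in> X \<Longrightarrow> \<bar>f x - g x\<bar> \<le> c"
  shows "\<bar>(SUP x\<in>X. f x) - (SUP x\<in>X. g x)\<bar> \<le> c"
proof -
  have bdd: "bdd_above (f ` X)" "bdd_above (g ` X)"
    using assms bounded_imp_bdd_above by auto
  have "(SUP x\<in>X. f x) \<le> (SUP x\<in>X. g x) + c"
  proof (rule cSUP_least[OF assms(1)])
    fix x assume x: "x \<in> X"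
    then show "f x \<le> (SUP x\<in>X. g x) + c"
      using cSUP_upper[OF x bdd(2)] assms(4)[OF x] by linarith
  qed
  moreover have "(SUP x\<in>X. g x) \<le> (SUP x\<in>X. f x) + c"
  proof (rule cSUP_least[OF assms(1)])
    fix x assume x: "x \<in> X"
    then show "g x \<le> (SUP x\<in>X. f x) + c"
      using cSUP_upper[OF x bdd(1)] assms(4)[OF x] by linarith
  qed
  ultimately show ?thesis by linarith
qed

lemma SUP_real_eq_uminus_INF:
  fixes f :: "'x \<Rightarrow> real"
  shows "(SUP x\<in>X. f x) = - (INF x\<in>X. - f x)"
  unfolding Inf_real_def by (simp add: image_image)

lemma INF_diff_le:
  fixes f g :: "'x \<Rightarrow> real"
  assumes "X \<noteq> {}" "bounded (f ` X)" "bounded (g ` X)" "\<And>x. x \<in> X \<Longrightarrow> \<bar>f x - g x\<bar> \<le> c"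
  shows "\<bar>(INF x\<in>X. f x) - (INF x\<in>X. g x)\<bar> \<le> c"
proof -
  have "bounded ((\<lambda>x. - f x) ` X)" "bounded ((\<lambda>x. - g x) ` X)"
    using assms(2,3) by (auto simp: bounded_iff)
  moreover have "\<bar>- f x - - g x\<bar> \<le> c" if "x \<in> X" for x
    using assms(4)[OF that] by linarith
  ultimately have "\<bar>(SUP x\<in>X. - f x) - (SUP x\<in>X. - g x)\<bar> \<le> c"
    using SUP_diff_le[OF assms(1)] by blast
  then show ?thesis by (simp add: SUP_real_eq_uminus_INF)
qed

text \<open>Stone--Weierstrass reduces closure under arbitrary continuous connectives to closure under
  sums, products and uniform limits.\<close>

lemma connective_closure:
  fixes V :: "'e set" and C :: "('e \<Rightarrow> real) set" and u :: "(nat \<Rightarrow> real) \<Rightarrow> real"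
  assumes bdd: "\<And>\<phi>. \<phi> \<in> C \<Longrightarrow> bounded (\<phi> ` V)"
    and const: "\<And>c. (\<lambda>_. c) \<in> C"
    and add: "\<And>\<phi> \<psi>. \<phi> \<in> C \<Longrightarrow> \<psi> \<in> C \<Longrightarrow> (\<lambda>e. \<phi> e + \<psi> e) \<in> C"
    and mult: "\<And>\<phi> \<psi>. \<phi> \<in> C \<Longrightarrow> \<psi> \<in> C \<Longrightarrow> (\<lambda>e. \<phi> e * \<psi> e) \<in> C"
    and lim: "\<And>\<phi>. (\<And>\<epsilon>. \<epsilon> > 0 \<Longrightarrow> \<exists>\<psi>\<in>C. \<forall>e\<in>V. \<bar>\<psi> e - \<phi> e\<bar> < \<epsilon>) \<Longrightarrow> \<phi> \<in> C"
    and u: "continuous_on UNIV u" and \<phi>s: "\<And>i. i < k \<Longrightarrow> \<phi>s i \<in> C"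
  shows "(\<lambda>e. u (\<lambda>i. if i < k then \<phi>s i e else 0)) \<in> C"
proof -
  have "\<forall>i. \<exists>B. i < k \<longrightarrow> (\<forall>e\<in>V. \<bar>\<phi>s i e\<bar> \<le> B)"
    using bdd[OF \<phi>s] by (force simp: bounded_iff)
  then obtain B where B: "\<And>i e. i < k \<Longrightarrow> e \<in> V \<Longrightarrow> \<bar>\<phi>s i e\<bar> \<le> B i" by metis
  \<comment> \<open>The compact box in which the arguments of \<open>u\<close> lie: the first
    \<open>k\<close> coordinates are bounded because the predicates are, the others are pinned to 0.
    Stone--Weierstrass is applied on it.\<close>
  define K where "K = (\<Pi>\<^sub>E i\<in>UNIV. if i < k then {- B i..B i} else {0})"
  define p where "p e = (\<lambda>i. if i < k then \<phi>s i e else 0)" for e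
  define R where "R = {g. continuous_on K g \<and> (\<lambda>e. g (p e)) \<in> C}"
  have "compactin (product_topology (\<lambda>i. euclidean) UNIV) K"
    unfolding K_def compactin_PiE by auto
  then have K: "compact K" by (simp add: euclidean_product_topology)
  have pK: "p e \<in> K" if "e \<in> V" for e
    using B[OF _ that] by (auto simp: p_def K_def abs_le_iff minus_le_iff)
  have coord: "(\<lambda>x. x i) \<in> R" for i
  proof -
    have "(\<lambda>e. p e i) \<in> C"
      unfolding p_def using \<phi>s[of i] const[of 0] by (cases "i < k") auto
    then show ?thesis
      unfolding R_def by (auto intro: continuous_on_subset[OF continuous_on_product_coordinates])
  qed
  interpret function_ring_on R K
  proof
    show "\<exists>f\<in>R. f x \<noteq> f y" if ne: "x \<noteq> y" for x y :: "nat \<Rightarrow> real"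
    proof -
      obtain i where "x i \<noteq> y i" using ne by blast
      then show ?thesis using coord[of i] by (intro bexI[of _ "\<lambda>x. x i"])
    qed
  qed (use K const add mult in \<open>auto simp: R_def intro: continuous_intros\<close>)
  have "(\<lambda>e. u (p e)) \<in> C"
  proof (rule lim)
    fix \<epsilon> :: real assume "\<epsilon> > 0"
    have "continuous_on K u" using u continuous_on_subset by blast
    then obtain g where g: "g \<in> R" "\<forall>x\<in>K. \<bar>u x - g x\<bar> < \<epsilon>"
      using Stone_Weierstrass_basic \<open>\<epsilon> > 0\<close> by blast
    then have "\<forall>e\<in>V. \<bar>g (p e) - u (p e)\<bar> < \<epsilon>" using pK by (auto simp: abs_minus_commute)
    then show "\<exists>\<psi>\<in>C. \<forall>e\<in>V. \<bar>\<psi> e - u (p e)\<bar> < \<epsilon>"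
      using g(1) unfolding R_def by (intro bexI[of _ "\<lambda>e. g (p e)"]) auto
  qed
  then show ?thesis by (simp add: p_def)
qed

section \<open>Closure properties, boundedness and uniform continuity of definable
  predicates\<close>

locale mstruct =
  fixes L :: "'p language" and M :: "('a, 'p) metric_struct"
  assumes ms: "metric_structure L M"
begin

abbreviation "X \<equiv> universe M"
abbreviation "d \<equiv> distance M"
abbreviation "Val \<equiv> valuations M"
abbreviation "dp \<equiv> definable_predicate L M"

lemma X_ne: "X \<noteq> {}"
  and X_complete: "mcomplete_of (metric M)"
  and X_bounded: "\<exists>B. \<forall>x\<in>X. \<forall>y\<in>X. d x y \<le> B"
  and pred_bounded: "p \<in> symbols L \<Longrightarrow> bounded (pred M p ` tuples M (arity L p))"
  and pred_ucont: "p \<in> symbols L \<Longrightarrow> \<epsilon> > 0 \<Longrightarrow> \<exists>\<delta>>0. \<forall>xs\<in>tuples M (arity L p). \<forall>ys\<in>tuples M (arity L p).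
          (\<forall>i<arity L p. d (xs ! i) (ys ! i) < \<delta>) \<longrightarrow> \<bar>pred M p xs - pred M p ys\<bar> < \<epsilon>"
  using ms unfolding metric_structure_def by auto

lemma Val_iff: "e \<in> Val \<longleftrightarrow> (\<forall>i. e i \<in> X)"
  by (auto simp: valuations_def)

lemma Val_in [simp]: "e \<in> Val \<Longrightarrow> e i \<in> X"
  by (simp add: Val_iff)

lemma Val_upd [simp]: "e \<in> Val \<Longrightarrow> a \<in> X \<Longrightarrow> e(i := a) \<in> Val"
  by (simp add: Val_iff)

lemma Val_comp [simp]: "e \<in> Val \<Longrightarrow> e \<circ> \<sigma> \<in> Val"
  by (simp add: Val_iff)

lemma Val_comp': "e \<in> Val \<Longrightarrow> (\<lambda>i. e (\<sigma> i)) \<in> Val"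
  by (simp add: Val_iff)

lemma Val_ne: "Val \<noteq> {}"
proof -
  obtain a where "a \<in> X" using X_ne by blast
  then have "(\<lambda>_. a) \<in> Val" by (simp add: Val_iff)
  then show ?thesis by blast
qed

lemma dist_self [simp]: "a \<in> X \<Longrightarrow> d a a = 0"
  by simp

lemma map_Val_tuples: "e \<in> Val \<Longrightarrow> length vs = n \<Longrightarrow> map e vs \<in> tuples M n"
  by (auto simp: tuples_def)

text \<open>Choosing approximants with error below \<open>1/(n+1)\<close> turns the sequential limit
  rule into an \<epsilon>-statement, the form in which closure under uniform limits is always
  applied.\<close>

lemma dp_limit:
  assumes "\<And>\<epsilon>. \<epsilon> > 0 \<Longrightarrow> \<exists>\<psi>. dp \<psi> \<and> (\<forall>e\<in>Val. \<bar>\<psi> e - \<phi> e\<bar> < \<epsilon>)"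
  shows "dp \<phi>"
proof -
  have "\<forall>n::nat. \<exists>\<psi>. dp \<psi> \<and> (\<forall>e\<in>Val. \<bar>\<psi> e - \<phi> e\<bar> < inverse (Suc n))"
    using assms by simp
  then obtain \<psi> where \<psi>: "\<And>n. dp (\<psi> n)" "\<And>n e. e \<in> Val \<Longrightarrow> \<bar>\<psi> n e - \<phi> e\<bar> < inverse (Suc n)"
    by metis
  have "uniform_limit Val \<psi> \<phi> sequentially"
  proof (rule uniform_limitI)
    fix \<epsilon> :: real assume "\<epsilon> > 0"
    then obtain N where N: "inverse (real (Suc N)) < \<epsilon>"
      using reals_Archimedean by blast
    have "dist (\<psi> n e) (\<phi> e) < \<epsilon>" if "n \<ge> N" "e \<in> Val" for n e
    proof -
      have "inverse (real (Suc n)) \<le> inverse (real (Suc N))" using that by (simp add: field_simps)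
      then show ?thesis using \<psi>(2)[OF that(2), of n] N unfolding dist_real_def by linarith
    qed
    then show "\<forall>\<^sub>F n in sequentially. \<forall>e\<in>Val. dist (\<psi> n e) (\<phi> e) < \<epsilon>"
      by (auto simp: eventually_sequentially)
  qed
  with \<psi>(1) show ?thesis by (rule definable_predicate.limit)
qed

lemma dp_cong: "dp \<phi> \<Longrightarrow> (\<And>e. e \<in> Val \<Longrightarrow> \<psi> e = \<phi> e) \<Longrightarrow> dp \<psi>"
  by (rule dp_limit) auto

lemma dp_binary:
  assumes "dp \<phi>" "dp \<psi>" "continuous_on UNIV (\<lambda>x::nat \<Rightarrow> real. u (x 0) (x 1) :: real)"
  shows "dp (\<lambda>e. u (\<phi> e) (\<psi> e))"
proof -
  have "dp (\<lambda>e. (\<lambda>x. u (x 0) (x 1)) (\<lambda>i. if i < (2::nat) then (if i = 0 then \<phi> else \<psi>) e else 0))"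
    by (rule definable_predicate.connective[OF assms(3)]) (use assms in auto)
  then show ?thesis by simp
qed

lemma dp_distance: "dp (\<lambda>e. d (e i) (e j))"
  by (rule definable_predicate.distance)

lemma dp_const: "dp (\<lambda>_. c)"
  using dp_binary[OF dp_distance dp_distance, of "\<lambda>_ _. c" 0 0 0 0] by simp

text \<open>Division is made total by \<open>max \<kappa>\<close>: the denominator stays positive,
  so the connective is continuous on the whole plane, and it is genuine division wherever
  \<open>\<psi> e \<ge> \<kappa>\<close>.\<close>

lemma dp_add: "dp \<phi> \<Longrightarrow> dp \<psi> \<Longrightarrow> dp (\<lambda>e. \<phi> e + \<psi> e)"
  and dp_mult: "dp \<phi> \<Longrightarrow> dp \<psi> \<Longrightarrow> dp (\<lambda>e. \<phi> e * \<psi> e)"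
  and dp_diff: "dp \<phi> \<Longrightarrow> dp \<psi> \<Longrightarrow> dp (\<lambda>e. \<phi> e - \<psi> e)"
  and dp_max: "dp \<phi> \<Longrightarrow> dp \<psi> \<Longrightarrow> dp (\<lambda>e. max (\<phi> e) (\<psi> e))"
  and dp_min: "dp \<phi> \<Longrightarrow> dp \<psi> \<Longrightarrow> dp (\<lambda>e. min (\<phi> e) (\<psi> e))"
  and dp_divide: "\<kappa> > 0 \<Longrightarrow> dp \<phi> \<Longrightarrow> dp \<psi> \<Longrightarrow> dp (\<lambda>e. \<phi> e / max \<kappa> (\<psi> e))"
  by (rule dp_binary; force intro!: continuous_intros continuous_on_product_coordinates)+

lemma dp_uminus: "dp \<phi> \<Longrightarrow> dp (\<lambda>e. - \<phi> e)"
  using dp_diff[OF dp_const[of 0]] by simp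

lemma dp_abs: "dp \<phi> \<Longrightarrow> dp (\<lambda>e. \<bar>\<phi> e\<bar>)"
  using dp_cong[OF dp_max[OF _ dp_uminus, of \<phi> \<phi>], of "\<lambda>e. \<bar>\<phi> e\<bar>"] by (simp add: abs_real_def max_def)

lemma dp_sum: "finite I \<Longrightarrow> (\<And>i. i \<in> I \<Longrightarrow> dp (\<phi> i)) \<Longrightarrow> dp (\<lambda>e. \<Sum>i\<in>I. \<phi> i e)"
  by (induction I rule: finite_induct) (auto intro: dp_const dp_add)

text \<open>Uniform continuity for the product uniformity on sequences: closeness in finitely many
  coordinates is enough. This is what allows substitutions and blocks of quantifiers that are
  infinite to be truncated.\<close>

definition ucont :: "((nat \<Rightarrow> 'a) \<Rightarrow> real) \<Rightarrow> bool"
  where "ucont \<phi> \<longleftrightarrow> (\<forall>\<epsilon>>0. \<exists>n. \<exists>\<delta>>0. \<forall>e\<in>Val. \<forall>e'\<in>Val.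
    (\<forall>i<n. d (e i) (e' i) < \<delta>) \<longrightarrow> \<bar>\<phi> e - \<phi> e'\<bar> < \<epsilon>)"

lemma ucontD:
  assumes "ucont \<phi>" "\<epsilon> > 0"
  obtains n \<delta> where "\<delta> > 0"
    "\<And>e e'. e \<in> Val \<Longrightarrow> e' \<in> Val \<Longrightarrow> (\<And>i. i < n \<Longrightarrow> d (e i) (e' i) < \<delta>) \<Longrightarrow> \<bar>\<phi> e - \<phi> e'\<bar> < \<epsilon>"
  using assms unfolding ucont_def by metis

lemma ucont_binary:
  assumes "ucont \<phi>" "ucont \<psi>" and \<eta>: "\<And>\<epsilon>. \<epsilon> > 0 \<Longrightarrow> \<exists>\<eta>>0. \<forall>e\<in>Val. \<forall>e'\<in>Val.
    \<bar>\<phi> e - \<phi> e'\<bar> < \<eta> \<longrightarrow> \<bar>\<psi> e - \<psi> e'\<bar> < \<eta> \<longrightarrow> \<bar>\<theta> e - \<theta> e'\<bar> < \<epsilon>"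
  shows "ucont \<theta>"
  unfolding ucont_def
proof (intro allI impI)
  fix \<epsilon> :: real assume "\<epsilon> > 0"
  then obtain \<eta> where \<eta>: "\<eta> > 0" "\<And>e e'. e \<in> Val \<Longrightarrow> e' \<in> Val \<Longrightarrow>
    \<bar>\<phi> e - \<phi> e'\<bar> < \<eta> \<Longrightarrow> \<bar>\<psi> e - \<psi> e'\<bar> < \<eta> \<Longrightarrow> \<bar>\<theta> e - \<theta> e'\<bar> < \<epsilon>"
    using \<eta> by metis
  obtain n \<delta> where 1: "\<delta> > 0" "\<And>e e'. e \<in> Val \<Longrightarrow> e' \<in> Val \<Longrightarrow> (\<And>i. i < n \<Longrightarrow> d (e i) (e' i) < \<delta>) \<Longrightarrow> \<bar>\<phi> e - \<phi> e'\<bar> < \<eta>"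
    using ucontD[OF assms(1) \<eta>(1)] by metis
  obtain n' \<delta>' where 2: "\<delta>' > 0" "\<And>e e'. e \<in> Val \<Longrightarrow> e' \<in> Val \<Longrightarrow> (\<And>i. i < n' \<Longrightarrow> d (e i) (e' i) < \<delta>') \<Longrightarrow> \<bar>\<psi> e - \<psi> e'\<bar> < \<eta>"
    using ucontD[OF assms(2) \<eta>(1)] by metis
  show "\<exists>n. \<exists>\<delta>>0. \<forall>e\<in>Val. \<forall>e'\<in>Val. (\<forall>i<n. d (e i) (e' i) < \<delta>) \<longrightarrow> \<bar>\<theta> e - \<theta> e'\<bar> < \<epsilon>"
    by (rule exI[of _ "max n n'"], rule exI[of _ "min \<delta> \<delta>'"]) (use 1 2 \<eta> in auto)
qed

text \<open>Only the Lipschitz bound 1 of a quantifier in the uniform norm matters, so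
  \<open>Q\<close> stands for supremum and infimum alike.\<close>

lemma ucont_quantifier:
  assumes "ucont \<phi>" and Q: "\<And>f g c. bounded (f ` X) \<Longrightarrow> bounded (g ` X) \<Longrightarrow>
      (\<And>a. a \<in> X \<Longrightarrow> \<bar>f a - g a\<bar> \<le> c) \<Longrightarrow> \<bar>Q f - Q g\<bar> \<le> (c::real)"
    and "bounded (\<phi> ` Val)"
  shows "ucont (\<lambda>e. Q (\<lambda>a. \<phi> (e(i := a))))"
  unfolding ucont_def
proof (intro allI impI)
  fix \<epsilon> :: real assume "\<epsilon> > 0"
  obtain n \<delta> where 1: "\<delta> > 0" "\<And>e e'. e \<in> Val \<Longrightarrow> e' \<in> Val \<Longrightarrow> (\<And>i. i < n \<Longrightarrow> d (e i) (e' i) < \<delta>) \<Longrightarrow> \<bar>\<phi> e - \<phi> e'\<bar> < \<epsilon>/2"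
    using ucontD[OF assms(1) half_gt_zero[OF \<open>\<epsilon> > 0\<close>]] by metis
  have "\<bar>Q (\<lambda>a. \<phi> (e(i := a))) - Q (\<lambda>a. \<phi> (e'(i := a)))\<bar> < \<epsilon>"
    if e: "e \<in> Val" "e' \<in> Val" "\<forall>i<n. d (e i) (e' i) < \<delta>" for e e'
  proof -
    have "bounded ((\<lambda>a. \<phi> (e(i := a))) ` X)" "bounded ((\<lambda>a. \<phi> (e'(i := a))) ` X)"
      using e by (auto intro!: bounded_subset[OF assms(3)])
    moreover have "\<bar>\<phi> (e(i := a)) - \<phi> (e'(i := a))\<bar> \<le> \<epsilon>/2" if "a \<in> X" for a
      by (rule less_imp_le, rule 1(2)) (use e that 1(1) in auto)
    ultimately have "\<bar>Q (\<lambda>a. \<phi> (e(i := a))) - Q (\<lambda>a. \<phi> (e'(i := a)))\<bar> \<le> \<epsilon>/2"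
      by (rule Q)
    then show ?thesis using \<open>\<epsilon> > 0\<close> by linarith
  qed
  then show "\<exists>n. \<exists>\<delta>>0. \<forall>e\<in>Val. \<forall>e'\<in>Val. (\<forall>i<n. d (e i) (e' i) < \<delta>) \<longrightarrow>
      \<bar>Q (\<lambda>a. \<phi> (e(i := a))) - Q (\<lambda>a. \<phi> (e'(i := a)))\<bar> < \<epsilon>"
    using 1(1) by blast
qed

lemma ucont_uniform_limit:
  assumes "\<And>\<epsilon>. \<epsilon> > 0 \<Longrightarrow> \<exists>\<psi>. ucont \<psi> \<and> (\<forall>e\<in>Val. \<bar>\<psi> e - \<phi> e\<bar> < \<epsilon>)"
  shows "ucont \<phi>"
  unfolding ucont_def
proof (intro allI impI)
  fix \<epsilon> :: real assume "\<epsilon> > 0"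
  then obtain \<psi> where \<psi>: "ucont \<psi>" "\<And>e. e \<in> Val \<Longrightarrow> \<bar>\<psi> e - \<phi> e\<bar> < \<epsilon>/3"
    using assms[of "\<epsilon>/3"] by auto
  have "\<epsilon>/3 > 0" using \<open>\<epsilon> > 0\<close> by simp
  from ucontD[OF \<psi>(1) this]
  obtain n \<delta> where 1: "\<delta> > 0" "\<And>e e'. e \<in> Val \<Longrightarrow> e' \<in> Val \<Longrightarrow> (\<And>i. i < n \<Longrightarrow> d (e i) (e' i) < \<delta>) \<Longrightarrow> \<bar>\<psi> e - \<psi> e'\<bar> < \<epsilon>/3"
    by metis
  have "\<bar>\<phi> e - \<phi> e'\<bar> < \<epsilon>" if "e \<in> Val" "e' \<in> Val" "\<forall>i<n. d (e i) (e' i) < \<delta>" for e e'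
  proof -
    have "\<bar>\<psi> e - \<psi> e'\<bar> < \<epsilon>/3" using 1(2)[OF that(1,2)] that(3) by blast
    then show ?thesis using \<psi>(2)[OF that(1)] \<psi>(2)[OF that(2)] by linarith
  qed
  then show "\<exists>n. \<exists>\<delta>>0. \<forall>e\<in>Val. \<forall>e'\<in>Val. (\<forall>i<n. d (e i) (e' i) < \<delta>) \<longrightarrow> \<bar>\<phi> e - \<phi> e'\<bar> < \<epsilon>"
    using 1(1) by blast
qed

lemma bounded_uniform_limit:
  assumes "bounded (\<psi> ` V)" "\<And>e. e \<in> V \<Longrightarrow> \<bar>\<psi> e - \<phi> e\<bar> < (c::real)"
  shows "bounded (\<phi> ` V)"
proof -
  obtain B where "\<And>e. e \<in> V \<Longrightarrow> \<bar>\<psi> e\<bar> \<le> B" using assms(1) by (auto simp: bounded_iff)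
  then have "\<bar>\<phi> e\<bar> \<le> B + c" if "e \<in> V" for e
    using assms(2)[OF that] that by fastforce
  then show ?thesis by (auto simp: bounded_iff)
qed

text \<open>The two properties have to be proved together: products are uniformly continuous only
  when the factors are bounded, quantifiers are Lipschitz only over bounded sets of values, and
  connectives are treated on a compact box of values.\<close>

lemma dp_bounded_ucont: "dp \<phi> \<Longrightarrow> bounded (\<phi> ` Val) \<and> ucont \<phi>"
proof (induction rule: definable_predicate.induct)
  case (predicate p vs)
  have "(\<lambda>e. pred M p (map e vs)) ` Val \<subseteq> pred M p ` tuples M (arity L p)"
    using map_Val_tuples predicate by auto
  then have "bounded ((\<lambda>e. pred M p (map e vs)) ` Val)"
    using pred_bounded[OF predicate(1)] bounded_subset by blast
  moreover have "ucont (\<lambda>e. pred M p (map e vs))"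
    unfolding ucont_def
  proof (intro allI impI)
    fix \<epsilon> :: real assume "\<epsilon> > 0"
    then obtain \<delta> where \<delta>: "\<delta> > 0" "\<And>xs ys. xs\<in>tuples M (arity L p) \<Longrightarrow> ys\<in>tuples M (arity L p) \<Longrightarrow>
          (\<forall>i<arity L p. d (xs ! i) (ys ! i) < \<delta>) \<Longrightarrow> \<bar>pred M p xs - pred M p ys\<bar> < \<epsilon>"
      using pred_ucont[OF predicate(1)] by meson
    have lt: "vs ! i < Suc (Max (set vs))" if "i < length vs" for i
      using that by (simp add: le_imp_less_Suc)
    show "\<exists>n. \<exists>\<delta>>0. \<forall>e\<in>Val. \<forall>e'\<in>Val. (\<forall>i<n. d (e i) (e' i) < \<delta>) \<longrightarrow>
        \<bar>pred M p (map e vs) - pred M p (map e' vs)\<bar> < \<epsilon>"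
      using \<delta>(1) by (intro exI[of _ "Suc (Max (set vs))"] exI[of _ \<delta>] conjI ballI impI \<delta>(2))
        (use map_Val_tuples predicate lt in auto)
  qed
  ultimately show ?case by blast
next
  case (distance i j)
  obtain B where B: "\<forall>x\<in>X. \<forall>y\<in>X. d x y \<le> B" using X_bounded by blast
  have "ucont (\<lambda>e. d (e i) (e j))"
    unfolding ucont_def
  proof (intro allI impI)
    fix \<epsilon> :: real assume "\<epsilon> > 0"
    have "\<bar>d (e i) (e j) - d (e' i) (e' j)\<bar> < \<epsilon>"
      if e: "e \<in> Val" "e' \<in> Val" and lt: "\<forall>k<Suc (max i j). d (e k) (e' k) < \<epsilon>/2" for e e'
    proof -
      have "d (e i) (e' i) < \<epsilon>/2" "d (e j) (e' j) < \<epsilon>/2" using lt by auto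
      then show ?thesis
        using e mdist_triangle[of "e i" "metric M" "e' i" "e j"] mdist_triangle[of "e' i" "metric M" "e' j" "e j"]
          mdist_triangle[of "e' i" "metric M" "e i" "e' j"] mdist_triangle[of "e i" "metric M" "e j" "e' j"]
        by (simp add: mdist_commute abs_less_iff)
    qed
    then show "\<exists>n. \<exists>\<delta>>0. \<forall>e\<in>Val. \<forall>e'\<in>Val. (\<forall>i<n. d (e i) (e' i) < \<delta>) \<longrightarrow>
        \<bar>d (e i) (e j) - d (e' i) (e' j)\<bar> < \<epsilon>"
      using \<open>\<epsilon> > 0\<close> by (intro exI[of _ "Suc (max i j)"] exI[of _ "\<epsilon>/2"]) auto
  qed
  moreover have "bounded ((\<lambda>e. d (e i) (e j)) ` Val)"
    using B by (auto simp: bounded_iff intro!: exI[of _ B])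
  ultimately show ?case by blast
next
  case (connective u k \<phi>s)
  have "(\<lambda>e. u (\<lambda>i. if i < k then \<phi>s i e else 0)) \<in> {\<phi>. bounded (\<phi> ` Val) \<and> ucont \<phi>}"
  proof (rule connective_closure[where V = Val])
    fix \<phi> \<psi> assume *: "\<phi> \<in> {\<phi>. bounded (\<phi> ` Val) \<and> ucont \<phi>}" "\<psi> \<in> {\<phi>. bounded (\<phi> ` Val) \<and> ucont \<phi>}"
    then obtain B B' where B: "\<forall>e\<in>Val. \<bar>\<phi> e\<bar> \<le> B" "\<forall>e\<in>Val. \<bar>\<psi> e\<bar> \<le> B'"
      by (auto simp: bounded_iff)
    have "ucont (\<lambda>e. \<phi> e + \<psi> e)"
    proof (rule ucont_binary[of \<phi> \<psi>])
      fix \<epsilon> :: real assume "\<epsilon> > 0"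
      have "\<bar>\<phi> e + \<psi> e - (\<phi> e' + \<psi> e')\<bar> < \<epsilon>"
        if "\<bar>\<phi> e - \<phi> e'\<bar> < \<epsilon>/2" "\<bar>\<psi> e - \<psi> e'\<bar> < \<epsilon>/2" for e e'
        using that by linarith
      then show "\<exists>\<eta>>0. \<forall>e\<in>Val. \<forall>e'\<in>Val. \<bar>\<phi> e - \<phi> e'\<bar> < \<eta> \<longrightarrow> \<bar>\<psi> e - \<psi> e'\<bar> < \<eta> \<longrightarrow>
          \<bar>\<phi> e + \<psi> e - (\<phi> e' + \<psi> e')\<bar> < \<epsilon>"
        using \<open>\<epsilon> > 0\<close> half_gt_zero by blast
    qed (use * in auto)
    moreover have "bounded ((\<lambda>e. \<phi> e + \<psi> e) ` Val)"
      unfolding bounded_iff by (rule exI[of _ "B+B'"]) (use B in \<open>auto intro!: order_trans[OF abs_triangle_ineq] add_mono\<close>)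
    ultimately show "(\<lambda>e. \<phi> e + \<psi> e) \<in> {\<phi>. bounded (\<phi> ` Val) \<and> ucont \<phi>}" by simp
    have "ucont (\<lambda>e. \<phi> e * \<psi> e)"
    proof (rule ucont_binary[of \<phi> \<psi>])
      fix \<epsilon> :: real assume "\<epsilon> > 0"
      \<comment> \<open>\<open>b\<close> bounds both factors and is positive even if the bounds
        vanish; with differences below \<open>\<epsilon> / (3*b)\<close> each of the two terms of
        the product rule is at most \<open>\<epsilon>/3\<close>.\<close>
      define b where "b = 1 + \<bar>B\<bar> + \<bar>B'\<bar>"
      have b: "b > 0" by (simp add: b_def)
      have "\<bar>\<phi> e * \<psi> e - \<phi> e' * \<psi> e'\<bar> < \<epsilon>" if e: "e \<in> Val" "e' \<in> Val"
        "\<bar>\<phi> e - \<phi> e'\<bar> < \<epsilon> / (3*b)" "\<bar>\<psi> e - \<psi> e'\<bar> < \<epsilon> / (3*b)" for e e'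
      proof -
        have le: "\<bar>\<phi> e\<bar> \<le> b" "\<bar>\<psi> e'\<bar> \<le> b"
          using bspec[OF B(1) e(1)] bspec[OF B(2) e(2)] by (auto simp: b_def)
        have "\<phi> e * \<psi> e - \<phi> e' * \<psi> e' = \<phi> e * (\<psi> e - \<psi> e') + \<psi> e' * (\<phi> e - \<phi> e')"
          by (simp add: algebra_simps)
        moreover have "\<bar>\<phi> e * (\<psi> e - \<psi> e')\<bar> \<le> b * (\<epsilon> / (3*b))"
          unfolding abs_mult by (rule mult_mono) (use le e b in auto)
        moreover have "\<bar>\<psi> e' * (\<phi> e - \<phi> e')\<bar> \<le> b * (\<epsilon> / (3*b))"
          unfolding abs_mult by (rule mult_mono) (use le e b in auto)
        moreover have "b * (\<epsilon> / (3*b)) = \<epsilon>/3" using b by simp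
        ultimately show ?thesis using \<open>\<epsilon> > 0\<close> by linarith
      qed
      then show "\<exists>\<eta>>0. \<forall>e\<in>Val. \<forall>e'\<in>Val. \<bar>\<phi> e - \<phi> e'\<bar> < \<eta> \<longrightarrow> \<bar>\<psi> e - \<psi> e'\<bar> < \<eta> \<longrightarrow>
          \<bar>\<phi> e * \<psi> e - \<phi> e' * \<psi> e'\<bar> < \<epsilon>"
        using b \<open>\<epsilon> > 0\<close> by (intro exI[of _ "\<epsilon> / (3*b)"]) auto
    qed (use * in auto)
    moreover have "bounded ((\<lambda>e. \<phi> e * \<psi> e) ` Val)"
    proof -
      have "\<bar>\<phi> e * \<psi> e\<bar> \<le> \<bar>B\<bar> * \<bar>B'\<bar>" if "e \<in> Val" for e
        unfolding abs_mult by (rule mult_mono) (use bspec[OF B(1) that] bspec[OF B(2) that] in auto)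
      then show ?thesis by (auto simp: bounded_iff)
    qed
    ultimately show "(\<lambda>e. \<phi> e * \<psi> e) \<in> {\<phi>. bounded (\<phi> ` Val) \<and> ucont \<phi>}" by simp
  next
    fix \<phi> assume *: "\<And>\<epsilon>. \<epsilon> > 0 \<Longrightarrow> \<exists>\<psi>\<in>{\<phi>. bounded (\<phi> ` Val) \<and> ucont \<phi>}. \<forall>e\<in>Val. \<bar>\<psi> e - \<phi> e\<bar> < \<epsilon>"
    obtain \<psi> where "bounded (\<psi> ` Val)" "\<forall>e\<in>Val. \<bar>\<psi> e - \<phi> e\<bar> < 1" using *[of 1] by auto
    then have "bounded (\<phi> ` Val)" using bounded_uniform_limit[of \<psi> Val \<phi> 1] by blast
    moreover have "ucont \<phi>" using * by (intro ucont_uniform_limit) blast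
    ultimately show "\<phi> \<in> {\<phi>. bounded (\<phi> ` Val) \<and> ucont \<phi>}" by simp
  qed (use connective in \<open>auto simp: ucont_def bounded_iff intro: exI[of _ 1]\<close>)
  then show ?case by simp
next
  case (supremum \<phi> i)
  then obtain B where B: "\<And>e. e \<in> Val \<Longrightarrow> \<bar>\<phi> e\<bar> \<le> B" by (auto simp: bounded_iff)
  have "bounded ((\<lambda>e. SUP a\<in>X. \<phi> (e(i := a))) ` Val)"
    unfolding bounded_iff by (rule exI[of _ B]) (use B X_ne in \<open>auto intro!: cSup_abs_le\<close>)
  moreover have "ucont (\<lambda>e. SUP a\<in>X. \<phi> (e(i := a)))"
    using supremum by (intro ucont_quantifier[of \<phi> "\<lambda>f. SUP a\<in>X. f a"] SUP_diff_le[OF X_ne]) auto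
  ultimately show ?case by blast
next
  case (infimum \<phi> i)
  then obtain B where B: "\<And>e. e \<in> Val \<Longrightarrow> \<bar>\<phi> e\<bar> \<le> B" by (auto simp: bounded_iff)
  have "bounded ((\<lambda>e. INF a\<in>X. \<phi> (e(i := a))) ` Val)"
    unfolding bounded_iff by (rule exI[of _ B]) (use B X_ne in \<open>auto intro!: cInf_abs_ge\<close>)
  moreover have "ucont (\<lambda>e. INF a\<in>X. \<phi> (e(i := a)))"
    using infimum by (intro ucont_quantifier[of \<phi> "\<lambda>f. INF a\<in>X. f a"] INF_diff_le[OF X_ne]) auto
  ultimately show ?case by blast
next
  case (limit \<phi>s \<phi>)
  have ex: "\<exists>n. \<forall>e\<in>Val. \<bar>\<phi>s n e - \<phi> e\<bar> < \<epsilon>" if "\<epsilon> > 0" for \<epsilon>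
    using uniform_limitD[OF limit(2) that] by (auto simp: eventually_sequentially dist_real_def)
  have "bounded (\<phi> ` Val)" using ex[of 1] limit(3) bounded_uniform_limit by (metis zero_less_one)
  moreover have "ucont \<phi>" using ex limit(3) by (intro ucont_uniform_limit) blast
  ultimately show ?case by blast
qed

lemmas dp_bounded = dp_bounded_ucont[THEN conjunct1]
  and dp_ucont = dp_bounded_ucont[THEN conjunct2]

lemma dp_bounded_upd: "dp \<phi> \<Longrightarrow> e \<in> Val \<Longrightarrow> bounded ((\<lambda>a. \<phi> (e(i := a))) ` X)"
  by (rule bounded_subset[OF dp_bounded[of \<phi>]]) auto

section \<open>Substitution, and quantification over infinitely many variables\<close>

lemma dp_subst_finite_range: "dp \<phi> \<Longrightarrow> finite (range \<sigma>) \<Longrightarrow> dp (\<lambda>e. \<phi> (e \<circ> \<sigma>))"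
proof (induction arbitrary: \<sigma> rule: definable_predicate.induct)
  case (predicate p vs)
  then have "dp (\<lambda>e. pred M p (map e (map \<sigma> vs)))"
    by (intro definable_predicate.predicate) auto
  then show ?case by (simp add: comp_def)
next
  case (distance i j)
  then show ?case using dp_distance by simp
next
  case (connective u k \<phi>s)
  then show ?case by (intro definable_predicate.connective)
next
  case (supremum \<phi> i)
  \<comment> \<open>Binding a variable \<open>j\<close> outside the range of \<sigma> instead of
    \<open>i\<close> avoids capture; such a \<open>j\<close> exists because the range is
    finite.\<close>
  obtain j where j: "j \<notin> range \<sigma>" using supremum(3) ex_new_if_finite[OF infinite_UNIV_nat] by blast
  have "finite (range (\<sigma>(i := j)))"
    by (rule finite_subset[OF _ finite.insertI[OF supremum(3), of j]]) auto
  then have "dp (\<lambda>e. SUP a\<in>X. \<phi> (e(j := a) \<circ> (\<sigma>(i := j))))"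
    using supremum(2) by (intro definable_predicate.supremum) blast
  moreover have "e(j := a) \<circ> (\<sigma>(i := j)) = (e \<circ> \<sigma>)(i := a)" for e :: "nat \<Rightarrow> 'a" and a
    using j by (auto simp: fun_eq_iff)
  ultimately show ?case by (simp only:)
next
  case (infimum \<phi> i)
  obtain j where j: "j \<notin> range \<sigma>" using infimum(3) ex_new_if_finite[OF infinite_UNIV_nat] by blast
  have "finite (range (\<sigma>(i := j)))"
    by (rule finite_subset[OF _ finite.insertI[OF infimum(3), of j]]) auto
  then have "dp (\<lambda>e. INF a\<in>X. \<phi> (e(j := a) \<circ> (\<sigma>(i := j))))"
    using infimum(2) by (intro definable_predicate.infimum) blast
  moreover have "e(j := a) \<circ> (\<sigma>(i := j)) = (e \<circ> \<sigma>)(i := a)" for e :: "nat \<Rightarrow> 'a" and a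
    using j by (auto simp: fun_eq_iff)
  ultimately show ?case by (simp only:)
next
  case (limit \<phi>s \<phi>)
  show ?case
  proof (rule dp_limit)
    fix \<epsilon> :: real assume "\<epsilon> > 0"
    then obtain n where "\<forall>e\<in>Val. \<bar>\<phi>s n e - \<phi> e\<bar> < \<epsilon>"
      using uniform_limitD[OF limit(2)] by (fastforce simp: eventually_sequentially dist_real_def)
    then show "\<exists>\<psi>. dp \<psi> \<and> (\<forall>e\<in>Val. \<bar>\<psi> e - \<phi> (e \<circ> \<sigma>)\<bar> < \<epsilon>)"
      by (intro exI[of _ "\<lambda>e. \<phi>s n (e \<circ> \<sigma>)"] conjI limit(3)[OF limit(4)]) simp
  qed
qed

text \<open>A substitution with infinite range may leave no fresh variable for a quantifier; it is a
  uniform limit of substitutions with finite range.\<close>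

lemma dp_subst:
  assumes "dp \<phi>"
  shows "dp (\<lambda>e. \<phi> (e \<circ> \<sigma>))"
proof (rule dp_limit)
  fix \<epsilon> :: real assume "\<epsilon> > 0"
  from ucontD[OF dp_ucont[OF assms] this] obtain n \<delta> where 1: "\<delta> > 0"
    "\<And>e e'. e \<in> Val \<Longrightarrow> e' \<in> Val \<Longrightarrow> (\<And>i. i < n \<Longrightarrow> d (e i) (e' i) < \<delta>) \<Longrightarrow> \<bar>\<phi> e - \<phi> e'\<bar> < \<epsilon>"
    by metis
  define \<tau> where "\<tau> i = (if i < n then \<sigma> i else 0)" for i
  have "range \<tau> \<subseteq> insert 0 (\<sigma> ` {..<n})" by (auto simp: \<tau>_def)
  then have "finite (range \<tau>)" by (rule finite_subset) simp
  then have "dp (\<lambda>e. \<phi> (e \<circ> \<tau>))" by (rule dp_subst_finite_range[OF assms])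
  moreover have "\<bar>\<phi> (e \<circ> \<tau>) - \<phi> (e \<circ> \<sigma>)\<bar> < \<epsilon>" if "e \<in> Val" for e
    using that 1(1) by (intro 1(2)) (auto simp: \<tau>_def)
  ultimately show "\<exists>\<psi>. dp \<psi> \<and> (\<forall>e\<in>Val. \<bar>\<psi> e - \<phi> (e \<circ> \<sigma>)\<bar> < \<epsilon>)" by blast
qed

lemma dp_subst': "dp \<phi> \<Longrightarrow> dp (\<lambda>e. \<phi> (\<lambda>i. e (\<sigma> i)))"
  using dp_subst[of \<phi> \<sigma>] by (simp add: comp_def)

lemma INF_less_dp:
  assumes "bounded (\<phi> ` Val)" "g ` I \<subseteq> Val" "I \<noteq> {}"
  shows "(INF x\<in>I. \<phi> (g x)) < c \<longleftrightarrow> (\<exists>x\<in>I. \<phi> (g x) < (c::real))"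
proof -
  have "bounded ((\<lambda>x. \<phi> (g x)) ` I)"
    by (rule bounded_subset[OF assms(1)]) (use assms(2) in auto)
  then show ?thesis using assms(3) by (intro cINF_less_iff bounded_imp_bdd_below)
qed

text \<open>As \<open>INF < c\<close> is an existential statement, comparing strict upper bounds
  turns equations between iterated infima into exchanges of witnesses.\<close>

lemma real_eq_if_less_iff: "(\<And>c. a < c \<longleftrightarrow> b < c) \<Longrightarrow> a = (b::real)"
  by (meson linorder_neqE_linordered_idom order_less_irrefl)

definition override :: "nat set \<Rightarrow> (nat \<Rightarrow> 'a) \<Rightarrow> (nat \<Rightarrow> 'a) \<Rightarrow> nat \<Rightarrow> 'a"
  where "override A x e = (\<lambda>k. if k \<in> A then x k else e k)"

lemma override_Val [simp]: "x \<in> Val \<Longrightarrow> e \<in> Val \<Longrightarrow> override A x e \<in> Val"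
  by (simp add: Val_iff override_def)

lemma dp_INF_finite:
  assumes "dp \<phi>" "finite A"
  shows "dp (\<lambda>e. INF x\<in>Val. \<phi> (override A x e))"
  using assms(2)
proof (induction A rule: finite_induct)
  case empty
  then show ?case using assms(1) Val_ne by (simp add: override_def)
next
  case (insert i A)
  define \<psi> where "\<psi> e = (INF x\<in>Val. \<phi> (override A x e))" for e
  have "dp (\<lambda>e. INF a\<in>X. \<psi> (e(i := a)))"
    using insert(3) by (intro definable_predicate.infimum) (simp add: \<psi>_def)
  moreover have "(INF x\<in>Val. \<phi> (override (insert i A) x e)) = (INF a\<in>X. \<psi> (e(i := a)))" if e: "e \<in> Val" for e
  proof (rule real_eq_if_less_iff)
    fix c
    have b: "bounded (\<phi> ` Val)" using assms(1) by (rule dp_bounded)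
    have "bounded (\<psi> ` Val)" unfolding \<psi>_def[abs_def] using insert(3) by (rule dp_bounded)
    then have "(INF a\<in>X. \<psi> (e(i := a))) < c \<longleftrightarrow> (\<exists>a\<in>X. \<psi> (e(i := a)) < c)"
      by (intro INF_less_dp image_subsetI Val_upd X_ne e)
    also have "\<dots> \<longleftrightarrow> (\<exists>a\<in>X. \<exists>x\<in>Val. \<phi> (override A x (e(i := a))) < c)"
      unfolding \<psi>_def by (intro bex_cong refl INF_less_dp b image_subsetI override_Val Val_upd[OF e] Val_ne)
    also have "\<dots> \<longleftrightarrow> (\<exists>x\<in>Val. \<phi> (override (insert i A) x e) < c)"
    proof
      assume "\<exists>a\<in>X. \<exists>x\<in>Val. \<phi> (override A x (e(i := a))) < c"
      then obtain a x where a: "a \<in> X" "x \<in> Val" "\<phi> (override A x (e(i := a))) < c" by blast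
      have "override A x (e(i := a)) = override (insert i A) (x(i := a)) e"
        using insert(2) by (auto simp: override_def fun_eq_iff)
      then show "\<exists>x\<in>Val. \<phi> (override (insert i A) x e) < c" using a by (intro bexI[of _ "x(i := a)"]) auto
    next
      assume "\<exists>x\<in>Val. \<phi> (override (insert i A) x e) < c"
      then obtain x where x: "x \<in> Val" "\<phi> (override (insert i A) x e) < c" by blast
      have "override A x (e(i := x i)) = override (insert i A) x e"
        using insert(2) by (auto simp: override_def fun_eq_iff)
      then show "\<exists>a\<in>X. \<exists>x\<in>Val. \<phi> (override A x (e(i := a))) < c"
        using x by (intro bexI[of _ "x i"] bexI[of _ x]) auto
    qed
    also have "\<dots> \<longleftrightarrow> (INF x\<in>Val. \<phi> (override (insert i A) x e)) < c"
      using e b Val_ne by (intro INF_less_dp[symmetric]) auto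
    finally show "((INF x\<in>Val. \<phi> (override (insert i A) x e)) < c) = ((INF a\<in>X. \<psi> (e(i := a))) < c)" by simp
  qed
  ultimately show ?case by (rule dp_cong)
qed

text \<open>By uniform continuity only the variables of \<open>A\<close> below some \<open>n\<close>
  matter up to \<epsilon>, so an infimum over infinitely many variables is a uniform limit of
  iterated infima.\<close>

lemma dp_INF:
  assumes "dp \<phi>"
  shows "dp (\<lambda>e. INF x\<in>Val. \<phi> (override A x e))"
proof (rule dp_limit)
  fix \<epsilon> :: real assume "\<epsilon> > 0"
  from ucontD[OF dp_ucont[OF assms] half_gt_zero[OF this]] obtain n \<delta> where 1: "\<delta> > 0"
    "\<And>e e'. e \<in> Val \<Longrightarrow> e' \<in> Val \<Longrightarrow> (\<And>i. i < n \<Longrightarrow> d (e i) (e' i) < \<delta>) \<Longrightarrow> \<bar>\<phi> e - \<phi> e'\<bar> < \<epsilon>/2"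
    by metis
  define B where "B = A \<inter> {..<n}"
  have "\<bar>(INF x\<in>Val. \<phi> (override B x e)) - (INF x\<in>Val. \<phi> (override A x e))\<bar> < \<epsilon>" if e: "e \<in> Val" for e
  proof -
    have "\<bar>(INF x\<in>Val. \<phi> (override B x e)) - (INF x\<in>Val. \<phi> (override A x e))\<bar> \<le> \<epsilon>/2"
    proof (rule INF_diff_le[OF Val_ne])
      show "bounded ((\<lambda>x. \<phi> (override B x e)) ` Val)" "bounded ((\<lambda>x. \<phi> (override A x e)) ` Val)"
        using e by (auto intro!: bounded_subset[OF dp_bounded[OF assms]])
      show "\<bar>\<phi> (override B x e) - \<phi> (override A x e)\<bar> \<le> \<epsilon>/2" if "x \<in> Val" for x
        by (rule less_imp_le, rule 1(2)[OF override_Val override_Val]) (use e that 1(1) in \<open>auto simp: override_def B_def\<close>)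
    qed
    then show ?thesis using \<open>\<epsilon> > 0\<close> by linarith
  qed
  moreover have "dp (\<lambda>e. INF x\<in>Val. \<phi> (override B x e))"
    by (rule dp_INF_finite[OF assms]) (simp add: B_def)
  ultimately show "\<exists>\<psi>. dp \<psi> \<and> (\<forall>e\<in>Val. \<bar>\<psi> e - (INF x\<in>Val. \<phi> (override A x e))\<bar> < \<epsilon>)" by blast
qed

text \<open>Codes two \<omega>-tuples as one valuation, so that a relation between \<omega>-tuples
  can be expressed by a definable predicate.\<close>

definition interleave :: "(nat \<Rightarrow> 'a) \<Rightarrow> (nat \<Rightarrow> 'a) \<Rightarrow> nat \<Rightarrow> 'a"
  where "interleave e x = (\<lambda>k. if even k then e (k div 2) else x (k div 2))"

lemma interleave_Val [simp]: "x \<in> Val \<Longrightarrow> e \<in> Val \<Longrightarrow> interleave e x \<in> Val"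
  by (simp add: Val_iff interleave_def)

lemma interleave_simps [simp]: "interleave e x (2 * k) = e k" "interleave e x (Suc (2 * k)) = x k"
  by (simp_all add: interleave_def)

lemma INF_interleave_less:
  assumes "dp \<phi>" "e \<in> Val"
  shows "(INF x\<in>Val. \<phi> (interleave e x)) < c \<longleftrightarrow> (\<exists>x\<in>Val. \<phi> (interleave e x) < c)"
  using assms Val_ne by (intro INF_less_dp dp_bounded) auto

text \<open>Existential quantification over a whole second tuple: the substitution
  \<open>i div 2\<close> spreads \<open>e\<close> over all positions, and the infimum then
  overwrites the odd ones.\<close>

lemma dp_INF_interleave:
  assumes "dp \<phi>"
  shows "dp (\<lambda>e. INF x\<in>Val. \<phi> (interleave e x))"
proof -
  have "dp (\<lambda>e. INF x\<in>Val. \<phi> (override {k. odd k} x (\<lambda>i. e (i div 2))))"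
    using dp_subst'[OF dp_INF[OF assms], of "{k. odd k}" "\<lambda>i. i div 2"] .
  moreover have "(INF x\<in>Val. \<phi> (interleave e x)) = (INF x\<in>Val. \<phi> (override {k. odd k} x (\<lambda>i. e (i div 2))))"
    if e: "e \<in> Val" for e
  proof (rule real_eq_if_less_iff)
    fix c
    have "(\<exists>x\<in>Val. \<phi> (interleave e x) < c) \<longleftrightarrow> (\<exists>x\<in>Val. \<phi> (override {k. odd k} x (\<lambda>i. e (i div 2))) < c)"
    proof
      assume "\<exists>x\<in>Val. \<phi> (interleave e x) < c"
      then obtain x where x: "x \<in> Val" "\<phi> (interleave e x) < c" by blast
      have "override {k. odd k} (\<lambda>k. x (k div 2)) (\<lambda>i. e (i div 2)) = interleave e x"
        by (auto simp: override_def interleave_def)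
      then show "\<exists>x\<in>Val. \<phi> (override {k. odd k} x (\<lambda>i. e (i div 2))) < c"
        using x by (intro bexI[of _ "\<lambda>k. x (k div 2)"]) (auto simp: Val_iff)
    next
      assume "\<exists>x\<in>Val. \<phi> (override {k. odd k} x (\<lambda>i. e (i div 2))) < c"
      then obtain x where x: "x \<in> Val" "\<phi> (override {k. odd k} x (\<lambda>i. e (i div 2))) < c" by blast
      have "override {k. odd k} x (\<lambda>i. e (i div 2)) = interleave e (\<lambda>k. x (Suc (2 * k)))"
        by (auto simp: override_def interleave_def fun_eq_iff elim!: oddE)
      then show "\<exists>x\<in>Val. \<phi> (interleave e x) < c"
        using x by (intro bexI[of _ "\<lambda>k. x (Suc (2 * k))"]) (auto simp: Val_iff)
    qed
    moreover have "(INF x\<in>Val. \<phi> (override {k. odd k} x (\<lambda>i. e (i div 2)))) < c \<longleftrightarrow>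
        (\<exists>x\<in>Val. \<phi> (override {k. odd k} x (\<lambda>i. e (i div 2))) < c)"
      by (intro INF_less_dp dp_bounded[OF assms] image_subsetI override_Val Val_comp'[OF e] Val_ne)
    ultimately show "((INF x\<in>Val. \<phi> (interleave e x)) < c) =
        ((INF x\<in>Val. \<phi> (override {k. odd k} x (\<lambda>i. e (i div 2)))) < c)"
      using INF_interleave_less[OF assms e] by simp
  qed
  ultimately show ?thesis by (rule dp_cong)
qed

lemma dp_interp: "formula_of L \<phi> \<Longrightarrow> dp (interp M \<phi>)"
proof (induction \<phi>)
  case (Conn u \<phi>s)
  have "dp (\<lambda>e. u (\<lambda>i. if i < length \<phi>s then (map (interp M) \<phi>s ! i) e else 0))"
    by (rule definable_predicate.connective) (use Conn in \<open>auto simp: list_all_length\<close>)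
  then show ?case by simp
qed (auto intro: definable_predicate.predicate dp_distance definable_predicate.supremum
    definable_predicate.infimum)

text \<open>Successive corrections are clamped to a summable bound, so that they converge uniformly on all
  valuations although the approximation is only known on \<open>A\<close>.\<close>

lemma dp_forced_limit:
  assumes "A \<subseteq> Val" "\<And>\<epsilon>. \<epsilon> > 0 \<Longrightarrow> \<exists>\<phi>. dp \<phi> \<and> (\<forall>e\<in>A. \<bar>\<phi> e - f e\<bar> < \<epsilon>)"
  obtains \<phi> where "dp \<phi>" "\<And>e. e \<in> A \<Longrightarrow> \<phi> e = f e"
proof -
  have "\<forall>n::nat. \<exists>\<phi>. dp \<phi> \<and> (\<forall>e\<in>A. \<bar>\<phi> e - f e\<bar> < (1/2)^n)"
    using assms(2) by simp
  then obtain \<phi> where \<phi>: "\<And>n. dp (\<phi> n)" "\<And>n e. e \<in> A \<Longrightarrow> \<bar>\<phi> n e - f e\<bar> < (1/2)^n" by metis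
  \<comment> \<open>On \<open>A\<close> consecutive approximants differ by less than
    \<open>(1/2)^n + (1/2)^Suc n\<close>, hence by less than \<open>2 * (1/2)^n\<close>, so the
    clamp changes nothing there.\<close>
  define t where "t n e = max (- (2 * (1/2)^n)) (min (2 * (1/2)^n) (\<phi> (Suc n) e - \<phi> n e))" for n e
  have dpt: "dp (t n)" for n
    unfolding t_def using \<phi>(1) by (intro dp_max dp_min dp_diff dp_const)
  have "\<bar>max (- c) (min c y)\<bar> \<le> c" if "0 \<le> c" for c y :: real
    using that by linarith
  then have "norm (t n e) \<le> 2 * (1/2)^n" for n e
    unfolding t_def real_norm_def by simp
  moreover have "summable (\<lambda>n. 2 * (1/2::real)^n)"
    by (intro summable_mult summable_geometric) simp
  ultimately have lim: "uniform_limit Val (\<lambda>n e. \<Sum>i<n. t i e) (\<lambda>e. \<Sum>i. t i e) sequentially"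
    by (intro Weierstrass_m_test)
  have "dp (\<lambda>e. \<Sum>i<n. t i e)" for n
    using dpt by (intro dp_sum) auto
  then have "dp (\<lambda>e. \<Sum>i. t i e)"
    using lim by (rule definable_predicate.limit)
  then have "dp (\<lambda>e. \<phi> 0 e + (\<Sum>i. t i e))" by (intro dp_add \<phi>(1))
  moreover have "\<phi> 0 e + (\<Sum>i. t i e) = f e" if e: "e \<in> A" for e
  proof -
    have "t n e = \<phi> (Suc n) e - \<phi> n e" for n
    proof -
      have "(1/2::real)^Suc n \<le> (1/2)^n" by simp
      then have "\<bar>\<phi> (Suc n) e - \<phi> n e\<bar> \<le> 2 * (1/2)^n"
        using \<phi>(2)[OF e, of n] \<phi>(2)[OF e, of "Suc n"] by linarith
      then show ?thesis unfolding t_def by (simp add: abs_le_iff)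
    qed
    then have "(\<Sum>i<n. t i e) = \<phi> n e - \<phi> 0 e" for n
      by (induction n) auto
    then have "(\<lambda>n. \<phi> n e - \<phi> 0 e) \<longlonglongrightarrow> (\<Sum>i. t i e)"
      using tendsto_uniform_limitI[OF lim, of e] e assms(1) by auto
    moreover have "(\<lambda>n. \<phi> n e - f e) \<longlonglongrightarrow> 0"
      by (rule Lim_null_comparison[of _ "\<lambda>n. (1/2)^n"])
        (use \<phi>(2)[OF e] in \<open>auto intro!: always_eventually less_imp_le LIMSEQ_power_zero\<close>)
    then have "(\<lambda>n. (\<phi> n e - f e) + (f e - \<phi> 0 e)) \<longlonglongrightarrow> 0 + (f e - \<phi> 0 e)"
      by (intro tendsto_add tendsto_const)
    ultimately have "(\<Sum>i. t i e) = f e - \<phi> 0 e"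
      by (intro LIMSEQ_unique[of "\<lambda>n. \<phi> n e - \<phi> 0 e"]) auto
    then show ?thesis by simp
  qed
  ultimately show ?thesis using that by blast
qed

end

section \<open>A countable, uniformly dense set of definable predicates\<close>

datatype qterm =
    QPred nat "nat list"
  | QDist nat nat
  | QConst rat
  | QAdd qterm qterm
  | QMult qterm qterm
  | QSup nat qterm
  | QInf nat qterm

instance qterm :: countable
  by countable_datatype

primrec qeval :: "('a, nat) metric_struct \<Rightarrow> qterm \<Rightarrow> (nat \<Rightarrow> 'a) \<Rightarrow> real"
  where
    "qeval M (QPred p vs) = (\<lambda>e. pred M p (map e vs))"
  | "qeval M (QDist i j) = (\<lambda>e. distance M (e i) (e j))"
  | "qeval M (QConst c) = (\<lambda>e. of_rat c)"
  | "qeval M (QAdd s t) = (\<lambda>e. qeval M s e + qeval M t e)"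
  | "qeval M (QMult s t) = (\<lambda>e. qeval M s e * qeval M t e)"
  | "qeval M (QSup i t) = (\<lambda>e. SUP a\<in>universe M. qeval M t (e(i := a)))"
  | "qeval M (QInf i t) = (\<lambda>e. INF a\<in>universe M. qeval M t (e(i := a)))"

primrec qwf :: "nat language \<Rightarrow> qterm \<Rightarrow> bool"
  where
    "qwf L (QPred p vs) \<longleftrightarrow> p \<in> symbols L \<and> length vs = arity L p"
  | "qwf L (QDist i j) \<longleftrightarrow> True"
  | "qwf L (QConst c) \<longleftrightarrow> True"
  | "qwf L (QAdd s t) \<longleftrightarrow> qwf L s \<and> qwf L t"
  | "qwf L (QMult s t) \<longleftrightarrow> qwf L s \<and> qwf L t"
  | "qwf L (QSup i t) \<longleftrightarrow> qwf L t"
  | "qwf L (QInf i t) \<longleftrightarrow> qwf L t"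

lemma dp_qeval:
  assumes "metric_structure L M" "qwf L t"
  shows "definable_predicate L M (qeval M t)"
proof -
  interpret mstruct L M using assms(1) by unfold_locales
  show ?thesis using assms(2)
    by (induction t) (auto intro: definable_predicate.predicate dp_distance dp_const dp_add dp_mult
        definable_predicate.supremum definable_predicate.infimum)
qed

text \<open>The uniform limits \<open>C\<close> of these countably many terms are closed under all
  formation rules. For connectives, \<open>connective_closure\<close> asks only for constants, sums,
  products and limits, and real constants are limits of rational ones.\<close>

lemma qeval_dense:
  assumes "metric_structure L M" "definable_predicate L M \<phi>"
  shows "\<forall>\<epsilon>>0. \<exists>t. qwf L t \<and> (\<forall>e\<in>valuations M. \<bar>qeval M t e - \<phi> e\<bar> < \<epsilon>)"
proof -
  interpret mstruct L M using assms(1) by unfold_locales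
  define C where "C = {\<phi>. \<forall>\<epsilon>>0. \<exists>t. qwf L t \<and> (\<forall>e\<in>valuations M. \<bar>qeval M t e - \<phi> e\<bar> < \<epsilon>)}"
  have qb: "\<exists>B. \<forall>e\<in>Val. \<bar>qeval M t e\<bar> \<le> B" if "qwf L t" for t
    using dp_bounded[OF dp_qeval[OF ms that]] by (auto simp: bounded_iff)
  have CI: "qeval M t \<in> C" if "qwf L t" for t
    using that unfolding C_def by (auto intro!: exI[of _ t])
  have CD: "\<exists>t. qwf L t \<and> (\<forall>e\<in>Val. \<bar>qeval M t e - \<phi> e\<bar> < \<epsilon>)" if "\<phi> \<in> C" "\<epsilon> > 0" for \<phi> \<epsilon>
    using that unfolding C_def by blast
  have Cb: "bounded (\<phi> ` Val)" if \<phi>C: "\<phi> \<in> C" for \<phi>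
  proof -
    obtain t where "qwf L t" "\<forall>e\<in>Val. \<bar>qeval M t e - \<phi> e\<bar> < 1"
      using CD[OF \<phi>C zero_less_one] by blast
    then show ?thesis
      using bounded_uniform_limit[of "qeval M t" Val \<phi> 1] dp_bounded[OF dp_qeval[OF ms]] by blast
  qed
  have Clim: "\<phi> \<in> C" if lim: "\<And>\<epsilon>. \<epsilon> > 0 \<Longrightarrow> \<exists>\<psi>\<in>C. \<forall>e\<in>Val. \<bar>\<psi> e - \<phi> e\<bar> < \<epsilon>" for \<phi>
    unfolding C_def
  proof (intro CollectI allI impI)
    fix \<epsilon> :: real assume "\<epsilon> > 0"
    then obtain \<psi> where \<psi>: "\<psi> \<in> C" "\<forall>e\<in>Val. \<bar>\<psi> e - \<phi> e\<bar> < \<epsilon>/2"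
      using lim[OF half_gt_zero] by blast
    obtain t where t: "qwf L t" "\<forall>e\<in>Val. \<bar>qeval M t e - \<psi> e\<bar> < \<epsilon>/2"
      using CD[OF \<psi>(1) half_gt_zero[OF \<open>\<epsilon> > 0\<close>]] by blast
    have "\<bar>qeval M t e - \<phi> e\<bar> < \<epsilon>" if "e \<in> Val" for e
      using bspec[OF \<psi>(2) that] bspec[OF t(2) that] by linarith
    with t(1) show "\<exists>t. qwf L t \<and> (\<forall>e\<in>Val. \<bar>qeval M t e - \<phi> e\<bar> < \<epsilon>)" by blast
  qed
  \<comment> \<open>Stated for an abstract quantifier \<open>Q\<close> with Lipschitz bound 1, to
    serve suprema and infima at once.\<close>
  have Cquant: "\<exists>t'\<in>C. \<forall>e\<in>Val. \<bar>t' e - Q (\<lambda>a. \<phi> (e(i := a)))\<bar> < \<epsilon>"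
    if \<phi>C: "\<phi> \<in> C" and \<epsilon>: "\<epsilon> > 0" and Q: "\<And>f g c. bounded (f ` X) \<Longrightarrow> bounded (g ` X) \<Longrightarrow>
      (\<And>a. a \<in> X \<Longrightarrow> \<bar>f a - g a\<bar> \<le> c) \<Longrightarrow> \<bar>Q f - Q g\<bar> \<le> (c::real)"
      and S: "\<And>t. qwf L t \<Longrightarrow> (\<lambda>e. Q (\<lambda>a. qeval M t (e(i := a)))) \<in> C" for \<phi> \<epsilon> Q i
  proof -
    obtain t where t: "qwf L t" "\<forall>e\<in>Val. \<bar>qeval M t e - \<phi> e\<bar> < \<epsilon>/2"
      using CD[OF \<phi>C half_gt_zero[OF \<epsilon>]] by blast
    have "\<bar>Q (\<lambda>a. qeval M t (e(i := a))) - Q (\<lambda>a. \<phi> (e(i := a)))\<bar> \<le> \<epsilon>/2" if e: "e \<in> Val" for e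
    proof (rule Q)
      show "bounded ((\<lambda>a. \<phi> (e(i := a))) ` X)"
        by (rule bounded_subset[OF Cb[OF \<open>\<phi> \<in> C\<close>]]) (use e in \<open>auto simp del: fun_upd_apply\<close>)
      show "bounded ((\<lambda>a. qeval M t (e(i := a))) ` X)"
        by (rule dp_bounded_upd[OF dp_qeval[OF ms t(1)] e])
      show "\<bar>qeval M t (e(i := a)) - \<phi> (e(i := a))\<bar> \<le> \<epsilon>/2" if "a \<in> X" for a
        by (rule less_imp_le, rule bspec[OF t(2)], rule Val_upd[OF e that])
    qed
    moreover have "\<epsilon>/2 < \<epsilon>" using \<epsilon> by simp
    ultimately show ?thesis
      by (intro bexI[OF _ S[OF t(1)]] ballI) (rule le_less_trans)
  qed
  have "\<phi> \<in> C"
    using assms(2)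
  proof (induction rule: definable_predicate.induct)
    case (predicate p vs)
    then show ?case using CI[of "QPred p vs"] by simp
  next
    case (distance i j)
    then show ?case using CI[of "QDist i j"] by simp
  next
    case (connective u k \<phi>s)
    show ?case
    proof (rule connective_closure[OF Cb _ _ _ Clim connective(1,3)])
      show "(\<lambda>_. c) \<in> C" for c
      proof (rule Clim)
        fix \<epsilon> :: real assume "\<epsilon> > 0"
        then obtain q where "of_rat q > c - \<epsilon>" "of_rat q < c + \<epsilon>"
          using of_rat_dense[of "c - \<epsilon>" "c + \<epsilon>"] by auto
        then have "\<forall>e\<in>Val. \<bar>qeval M (QConst q) e - c\<bar> < \<epsilon>" by (auto simp: abs_less_iff)
        then show "\<exists>\<psi>\<in>C. \<forall>e\<in>Val. \<bar>\<psi> e - c\<bar> < \<epsilon>" by (intro bexI[OF _ CI[of "QConst q"]]) auto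
      qed
      fix \<phi> \<psi> assume *: "\<phi> \<in> C" "\<psi> \<in> C"
      show "(\<lambda>e. \<phi> e + \<psi> e) \<in> C"
      proof (rule Clim)
        fix \<epsilon> :: real assume "\<epsilon> > 0"
        obtain s where s: "qwf L s" "\<forall>e\<in>Val. \<bar>qeval M s e - \<phi> e\<bar> < \<epsilon>/2"
          using CD[OF *(1) half_gt_zero[OF \<open>\<epsilon> > 0\<close>]] by blast
        obtain t where t: "qwf L t" "\<forall>e\<in>Val. \<bar>qeval M t e - \<psi> e\<bar> < \<epsilon>/2"
          using CD[OF *(2) half_gt_zero[OF \<open>\<epsilon> > 0\<close>]] by blast
        have "\<bar>qeval M (QAdd s t) e - (\<phi> e + \<psi> e)\<bar> < \<epsilon>" if "e \<in> Val" for e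
          using bspec[OF s(2) that] bspec[OF t(2) that] unfolding qeval.simps by linarith
        then show "\<exists>\<theta>\<in>C. \<forall>e\<in>Val. \<bar>\<theta> e - (\<phi> e + \<psi> e)\<bar> < \<epsilon>"
          using s(1) t(1) by (intro bexI[OF _ CI[of "QAdd s t"]]) auto
      qed
      show "(\<lambda>e. \<phi> e * \<psi> e) \<in> C"
      proof (rule Clim)
        fix \<epsilon> :: real assume "\<epsilon> > 0"
        obtain B where B: "\<forall>e\<in>Val. \<bar>\<psi> e\<bar> \<le> B" using Cb[OF *(2)] by (auto simp: bounded_iff)
        define b where "b = 1 + \<bar>B\<bar>"
        have b: "b > 0" by (simp add: b_def)
        then have e1: "\<epsilon> / (3*b) > 0" using \<open>\<epsilon> > 0\<close> by simp
        obtain s where s: "qwf L s" "\<forall>e\<in>Val. \<bar>qeval M s e - \<phi> e\<bar> < \<epsilon> / (3*b)"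
          using CD[OF *(1) e1] by blast
        \<comment> \<open>The accuracy demanded of \<open>t\<close> depends on a bound for
          \<open>s\<close>, so \<open>t\<close> is chosen only after \<open>s\<close>.\<close>
        obtain B' where B': "\<forall>e\<in>Val. \<bar>qeval M s e\<bar> \<le> B'" using qb[OF s(1)] by blast
        define b' where "b' = 1 + \<bar>B'\<bar>"
        have b': "b' > 0" by (simp add: b'_def)
        then have e2: "\<epsilon> / (3*b') > 0" using \<open>\<epsilon> > 0\<close> by simp
        obtain t where t: "qwf L t" "\<forall>e\<in>Val. \<bar>qeval M t e - \<psi> e\<bar> < \<epsilon> / (3*b')"
          using CD[OF *(2) e2] by blast
        have "\<bar>qeval M (QMult s t) e - (\<phi> e * \<psi> e)\<bar> < \<epsilon>" if e: "e \<in> Val" for e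
        proof -
          have "qeval M (QMult s t) e - \<phi> e * \<psi> e =
            qeval M s e * (qeval M t e - \<psi> e) + \<psi> e * (qeval M s e - \<phi> e)"
            by (simp add: algebra_simps)
          moreover have "\<bar>qeval M s e * (qeval M t e - \<psi> e)\<bar> \<le> b' * (\<epsilon> / (3*b'))"
            unfolding abs_mult by (rule mult_mono)
              (use bspec[OF B' e] bspec[OF t(2) e] b' in \<open>auto simp: b'_def\<close>)
          moreover have "\<bar>\<psi> e * (qeval M s e - \<phi> e)\<bar> \<le> b * (\<epsilon> / (3*b))"
            unfolding abs_mult by (rule mult_mono)
              (use bspec[OF B e] bspec[OF s(2) e] b in \<open>auto simp: b_def\<close>)
          moreover have "b * (\<epsilon> / (3*b)) = \<epsilon>/3" "b' * (\<epsilon> / (3*b')) = \<epsilon>/3" using b b' by auto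
          ultimately show ?thesis using \<open>\<epsilon> > 0\<close> by linarith
        qed
        then show "\<exists>\<theta>\<in>C. \<forall>e\<in>Val. \<bar>\<theta> e - (\<phi> e * \<psi> e)\<bar> < \<epsilon>"
          using s(1) t(1) by (intro bexI[OF _ CI[of "QMult s t"]]) auto
      qed
    qed
  next
    case (supremum \<phi> i)
    show ?case
    proof (rule Clim)
      fix \<epsilon> :: real assume "\<epsilon> > 0"
      show "\<exists>\<psi>\<in>C. \<forall>e\<in>Val. \<bar>\<psi> e - (SUP a\<in>X. \<phi> (e(i := a)))\<bar> < \<epsilon>"
        by (rule Cquant[OF supremum(2) \<open>\<epsilon> > 0\<close> SUP_diff_le[OF X_ne]])
          (use CI[of "QSup i _"] in auto)
    qed
  next
    case (infimum \<phi> i)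
    show ?case
    proof (rule Clim)
      fix \<epsilon> :: real assume "\<epsilon> > 0"
      show "\<exists>\<psi>\<in>C. \<forall>e\<in>Val. \<bar>\<psi> e - (INF a\<in>X. \<phi> (e(i := a)))\<bar> < \<epsilon>"
        by (rule Cquant[OF infimum(2) \<open>\<epsilon> > 0\<close> INF_diff_le[OF X_ne]])
          (use CI[of "QInf i _"] in auto)
    qed
  next
    case (limit \<phi>s \<phi>)
    show ?case
    proof (rule Clim)
      fix \<epsilon> :: real assume "\<epsilon> > 0"
      then obtain n where "\<forall>e\<in>Val. \<bar>\<phi>s n e - \<phi> e\<bar> < \<epsilon>"
        using uniform_limitD[OF limit(2)] by (fastforce simp: eventually_sequentially dist_real_def)
      then show "\<exists>\<psi>\<in>C. \<forall>e\<in>Val. \<bar>\<psi> e - \<phi> e\<bar> < \<epsilon>" using limit(3) by blast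
    qed
  qed
  then show ?thesis by (simp add: C_def)
qed

lemma definable_predicate_change_language:
  assumes "metric_structure L' M'" "metric M = metric M'"
    and p: "\<And>p. p \<in> symbols L \<Longrightarrow> definable_predicate L' M' (\<lambda>e. pred M p (map e [0..<arity L p]))"
    and "definable_predicate L M \<phi>"
  shows "definable_predicate L' M' \<phi>"
proof -
  interpret mstruct L' M' using assms(1) by unfold_locales
  have Val: "valuations M = Val" using assms(2) by (simp add: valuations_def)
  show ?thesis
    using assms(4)
  proof (induction rule: definable_predicate.induct)
    case (predicate p vs)
    \<comment> \<open>Interdefinability speaks of a symbol applied to the variables
      \<open>0, 1, ...\<close> in order; the substitution \<open>i \<mapsto> vs ! i\<close> yields
      it at an arbitrary list of variables.\<close>
    have eq: "map (e \<circ> (\<lambda>i. vs ! i)) [0..<arity L p] = map e vs" for e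
      using predicate(2) by (auto intro: nth_equalityI)
    show ?case
      using dp_subst[OF p[OF predicate(1)], of "\<lambda>i. vs ! i"] by (simp only: eq)
  next
    case (distance i j)
    then show ?case using dp_distance assms(2) by simp
  next
    case (connective u k \<phi>s)
    then show ?case by (intro definable_predicate.connective)
  next
    case (supremum \<phi> i)
    then show ?case unfolding assms(2) by (intro definable_predicate.supremum)
  next
    case (infimum \<phi> i)
    then show ?case unfolding assms(2) by (intro definable_predicate.infimum)
  next
    case (limit \<phi>s \<phi>)
    show ?case
      by (rule definable_predicate.limit[OF limit(3)]) (use limit(2) in \<open>simp only: Val\<close>)
  qed
qed

text \<open>Countability comes from the symbols of \<open>L'\<close>, which are natural numbers.
  Definability in the two languages coincides, so the dense set can be carried back to
  \<open>L\<close>.\<close>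

lemma countable_dense_definable_predicates:
  assumes "metric_structure L M" "essentially_countable_language L M"
  obtains Q where "countable Q" "\<And>q. q \<in> Q \<Longrightarrow> definable_predicate L M q"
    "\<And>\<phi> \<epsilon>. definable_predicate L M \<phi> \<Longrightarrow> 0 < \<epsilon> \<Longrightarrow> \<exists>q\<in>Q. \<forall>e\<in>valuations M. \<bar>q e - \<phi> e\<bar> < \<epsilon>"
proof -
  obtain L' :: "nat language" and M' where ms': "metric_structure L' M'" and "interdefinable L M L' M'"
    using assms(2) unfolding essentially_countable_language_def by blast
  then have m: "metric M = metric M'"
    and 1: "\<And>p. p \<in> symbols L \<Longrightarrow> definable_predicate L' M' (\<lambda>e. pred M p (map e [0..<arity L p]))"
    and 2: "\<And>p. p \<in> symbols L' \<Longrightarrow> definable_predicate L M (\<lambda>e. pred M' p (map e [0..<arity L' p]))"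
    by (auto simp: interdefinable_def)
  have Val: "valuations M = valuations M'" by (simp add: valuations_def m)
  define Q where "Q = qeval M' ` Collect (qwf L')"
  show ?thesis
  proof (rule that[of Q])
    show "countable Q" unfolding Q_def by simp
    show "definable_predicate L M q" if "q \<in> Q" for q
      using that definable_predicate_change_language[OF assms(1) m[symmetric] 2] dp_qeval[OF ms']
      by (auto simp: Q_def)
    show "\<exists>q\<in>Q. \<forall>e\<in>valuations M. \<bar>q e - \<phi> e\<bar> < \<epsilon>" if "definable_predicate L M \<phi>" "0 < \<epsilon>" for \<phi> \<epsilon>
      using qeval_dense[OF ms' definable_predicate_change_language[OF ms' m 1 that(1)]] that(2)
      unfolding Q_def Val by blast
  qed
qed

section \<open>Henkin types and their models\<close>

text \<open>Reals are coded by sets of naturals, so a sequence of reals is coded by a set of pairs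
  of naturals. This is needed because \<open>aleph0_categorical\<close> ranges over models with
  universe in the reals, while the model to be built consists of bounded sequences.\<close>

lemma ex_inj_bcontfun_real: "\<exists>J :: (nat \<Rightarrow>\<^sub>C real) \<Rightarrow> real. inj J"
proof -
  obtain b :: "real \<Rightarrow> nat set" where b: "inj b"
    using eqpoll_imp_lepoll[OF eqpoll_sym[OF nat_sets_eqpoll_reals]] by (auto simp: lepoll_def)
  obtain c :: "nat set \<Rightarrow> real" where c: "inj c"
    using eqpoll_imp_lepoll[OF nat_sets_eqpoll_reals] by (auto simp: lepoll_def)
  define h where "h f = {prod_encode (i, k) | i k. k \<in> b (apply_bcontfun f i)}" for f :: "nat \<Rightarrow>\<^sub>C real"
  have "inj h"
  proof
    fix f g assume "h f = h g"
    then have "prod_encode (i, k) \<in> h f \<longleftrightarrow> prod_encode (i, k) \<in> h g" for i k by simp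
    then have "k \<in> b (apply_bcontfun f i) \<longleftrightarrow> k \<in> b (apply_bcontfun g i)" for i k
      unfolding h_def by (auto simp: inj_eq[OF inj_prod_encode])
    then have "b (apply_bcontfun f i) = b (apply_bcontfun g i)" for i by blast
    then show "f = g" by (intro bcontfun_eqI injD[OF b])
  qed
  then have "inj (c \<circ> h)" using c by (rule inj_compose[rotated])
  then show ?thesis by blast
qed

lemma tendsto_funI:
  fixes f :: "'b \<Rightarrow> 'i \<Rightarrow> real"
  assumes "\<And>i. ((\<lambda>n. f n i) \<longlongrightarrow> l i) F"
  shows "(f \<longlongrightarrow> l) F"
proof -
  have "limitin (product_topology (\<lambda>_. euclidean) UNIV) f l F"
    unfolding limitin_componentwise using assms by simp
  then show ?thesis by (simp add: euclidean_product_topology)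
qed

section \<open>Types as functionals, and Henkin types\<close>

context mstruct
begin

abbreviation "S \<equiv> spectrum Val (Collect dp)"

text \<open>Witnesses are demanded up to \<epsilon> and after every substitution \<sigma>, because
  the points of the model will be limits of variables. Suprema are covered through negation.\<close>

definition henkin :: "(((nat \<Rightarrow> 'a) \<Rightarrow> real) \<Rightarrow> real) \<Rightarrow> bool"
  where "henkin \<Phi> \<longleftrightarrow> \<Phi> \<in> S \<and> (\<forall>\<phi> \<sigma> i \<epsilon>. dp \<phi> \<longrightarrow> \<epsilon> > 0 \<longrightarrow>
    (\<exists>k. \<Phi> (\<lambda>e. \<phi> (e \<circ> \<sigma>(i := k))) \<le> \<Phi> (\<lambda>e. INF a\<in>X. \<phi> ((e \<circ> \<sigma>)(i := a))) + \<epsilon>))"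

lemma S_seq:
  assumes "\<Phi> \<in> S" "finite G" "\<And>g. g \<in> G \<Longrightarrow> dp g"
  obtains x where "\<And>n::nat. x n \<in> Val" "\<And>f. f \<in> G \<Longrightarrow> (\<lambda>n. f (x n)) \<longlonglongrightarrow> \<Phi> f"
proof -
  have "G \<subseteq> Collect dp" using assms(3) by blast
  then show ?thesis using spectrum_approx_seq[OF assms(1,2)] that by blast
qed

lemma dp_subst_inf: "dp \<phi> \<Longrightarrow> dp (\<lambda>e. INF a\<in>X. \<phi> ((e \<circ> \<sigma>)(i := a)))"
  by (rule dp_subst[OF definable_predicate.infimum])

text \<open>One sequence of valuations approximates \<Phi> on all the predicates involved, and
  \<open>u\<close> is continuous for coordinatewise convergence.\<close>

lemma S_connective:
  fixes u :: "(nat \<Rightarrow> real) \<Rightarrow> real" and k :: nat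
  assumes \<Phi>: "\<Phi> \<in> S" and u: "continuous_on UNIV u" and dp: "\<And>i. i < k \<Longrightarrow> dp (\<phi>s i)"
  shows "\<Phi> (\<lambda>e. u (\<lambda>i. if i < k then \<phi>s i e else 0)) = u (\<lambda>i. if i < k then \<Phi> (\<phi>s i) else 0)"
proof -
  define \<psi> where "\<psi> = (\<lambda>e. u (\<lambda>i. if i < k then \<phi>s i e else 0))"
  have \<psi>: "dp \<psi>" unfolding \<psi>_def by (rule definable_predicate.connective[where u = u and k = k and \<phi>s = \<phi>s, OF u dp])
  obtain x where x: "\<And>n::nat. x n \<in> Val" "\<And>f. f \<in> insert \<psi> (\<phi>s ` {..<k}) \<Longrightarrow> (\<lambda>n. f (x n)) \<longlonglongrightarrow> \<Phi> f"
    using S_seq[OF \<Phi>, of "insert \<psi> (\<phi>s ` {..<k})"] \<psi> dp by auto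
  have "(\<lambda>n. (\<lambda>i. if i < k then \<phi>s i (x n) else 0)) \<longlonglongrightarrow> (\<lambda>i. if i < k then \<Phi> (\<phi>s i) else 0)"
    by (rule tendsto_funI) (use x(2) in auto)
  moreover have "isCont u (\<lambda>i. if i < k then \<Phi> (\<phi>s i) else 0)"
    using u by (simp add: continuous_on_eq_continuous_at)
  ultimately have "(\<lambda>n. \<psi> (x n)) \<longlonglongrightarrow> u (\<lambda>i. if i < k then \<Phi> (\<phi>s i) else 0)"
    unfolding \<psi>_def by (rule isCont_tendsto_compose[rotated])
  then show ?thesis using x(2)[of \<psi>] LIMSEQ_unique unfolding \<psi>_def by blast
qed

lemma S_uminus:
  assumes "\<Phi> \<in> S" "dp \<phi>"
  shows "\<Phi> (\<lambda>e. - \<phi> e) = - \<Phi> \<phi>"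
proof -
  have "finite {\<phi>, \<lambda>e. - \<phi> e}" "\<And>g. g \<in> {\<phi>, \<lambda>e. - \<phi> e} \<Longrightarrow> dp g"
    using assms(2) dp_uminus[OF assms(2)] by auto
  then obtain x where x: "\<And>n::nat. x n \<in> Val" "\<And>f. f \<in> {\<phi>, \<lambda>e. - \<phi> e} \<Longrightarrow> (\<lambda>n. f (x n)) \<longlonglongrightarrow> \<Phi> f"
    by (rule S_seq[OF assms(1)]) (assumption, rule that)
  have "(\<lambda>n. - \<phi> (x n)) \<longlonglongrightarrow> - \<Phi> \<phi>" using x(2) by (intro tendsto_minus) simp
  then show ?thesis using x(2)[of "\<lambda>e. - \<phi> e"] LIMSEQ_unique by blast
qed

end

section \<open>The completion of the variables of a Henkin type\<close>

locale henkin_model = mstruct L M for L :: "'p language" and M :: "('a, 'p) metric_struct" +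
  fixes \<Phi>
  assumes henkin: "henkin \<Phi>"
begin

lemma \<Phi>_S: "\<Phi> \<in> S"
  using henkin by (simp add: henkin_def)

definition \<rho> :: "nat \<Rightarrow> nat \<Rightarrow> real"
  where "\<rho> i j = \<Phi> (\<lambda>e. d (e i) (e j))"

lemma \<rho>_self [simp]: "\<rho> i i = 0"
proof -
  have "\<bar>\<Phi> (\<lambda>e. d (e i) (e i)) - \<Phi> (\<lambda>_. 0)\<bar> \<le> 0"
    by (rule spectrum_abs_le[OF \<Phi>_S]) (auto intro: dp_distance dp_const)
  moreover have "\<Phi> (\<lambda>_. 0) = 0"
    by (intro antisym spectrum_bounds[OF \<Phi>_S]) (auto simp: dp_const)
  ultimately show ?thesis by (simp add: \<rho>_def)
qed

lemma \<rho>_commute: "\<rho> i j = \<rho> j i"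
  unfolding \<rho>_def by (simp add: mdist_commute)

lemma \<rho>_triangle: "\<rho> i k \<le> \<rho> i j + \<rho> j k"
proof -
  define G where "G = {\<lambda>e. d (e i) (e k), \<lambda>e. d (e i) (e j), \<lambda>e. d (e j) (e k)}"
  obtain x where x: "\<And>n::nat. x n \<in> Val" "\<And>f. f \<in> G \<Longrightarrow> (\<lambda>n. f (x n)) \<longlonglongrightarrow> \<Phi> f"
    using S_seq[OF \<Phi>_S, of G] dp_distance by (auto simp: G_def)
  have "(\<lambda>n. d (x n i) (x n k)) \<longlonglongrightarrow> \<rho> i k" "(\<lambda>n. d (x n i) (x n j)) \<longlonglongrightarrow> \<rho> i j"
    "(\<lambda>n. d (x n j) (x n k)) \<longlonglongrightarrow> \<rho> j k"
    using x(2) unfolding G_def \<rho>_def by auto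
  then show ?thesis
    by (intro LIMSEQ_le[of "\<lambda>n. d (x n i) (x n k)" _ "\<lambda>n. d (x n i) (x n j) + d (x n j) (x n k)"] tendsto_add)
      (use x(1) in \<open>auto intro!: exI[of _ 0] mdist_triangle\<close>)
qed

lemma \<rho>_bounded: "\<exists>B. \<forall>i j. \<bar>\<rho> i j\<bar> \<le> B"
proof -
  obtain B where B: "\<forall>x\<in>X. \<forall>y\<in>X. d x y \<le> B" using X_bounded by blast
  have "\<rho> i j \<le> B" "0 \<le> \<rho> i j" for i j
    unfolding \<rho>_def using spectrum_bounds[OF \<Phi>_S, of "\<lambda>e. d (e i) (e j)"] dp_distance B by auto
  then show ?thesis by (auto simp: abs_le_iff intro!: exI[of _ B])
qed

text \<open>The Kuratowski embedding of the pseudometric \<rho>: in the supremum metric,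
  \<open>i \<mapsto> \<rho> i\<close> is isometric. It identifies variables at distance 0, and the
  completion is simply the closure of the range.\<close>

definition F :: "nat \<Rightarrow> (nat \<Rightarrow>\<^sub>C real)"
  where "F i = Bcontfun (\<rho> i)"

lemma apply_F: "apply_bcontfun (F i) = \<rho> i"
  unfolding F_def using \<rho>_bounded by (intro Bcontfun_inverse) (auto simp: bcontfun_def bounded_iff)

lemma dist_F: "dist (F i) (F j) = \<rho> i j"
proof (rule antisym)
  show "dist (F i) (F j) \<le> \<rho> i j"
  proof (rule dist_bound)
    show "dist (apply_bcontfun (F i) k) (apply_bcontfun (F j) k) \<le> \<rho> i j" for k
      using \<rho>_triangle[of i k j] \<rho>_triangle[of j k i] \<rho>_commute[of i j]
      by (simp add: apply_F dist_real_def abs_le_iff)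
  qed
  show "\<rho> i j \<le> dist (F i) (F j)"
    using dist_bounded[of "F i" j "F j"] by (simp add: apply_F dist_real_def)
qed

abbreviation "N0 \<equiv> closure (range F)"

lemma F_N0 [simp]: "F i \<in> N0"
  by (rule subsetD[OF closure_subset]) simp

definition app :: "(nat \<Rightarrow> nat \<Rightarrow>\<^sub>C real) \<Rightarrow> nat \<Rightarrow> nat \<Rightarrow> nat"
  where "app e n j = (SOME k. dist (F k) (e j) < inverse (Suc n))"

text \<open>The value of \<phi> in the model. At points named by variables \<Phi> prescribes it; an
  arbitrary point is reached through the substitutions \<open>app e n\<close>, which name each
  coordinate up to \<open>1/(n+1)\<close>.\<close>

definition ext :: "((nat \<Rightarrow> 'a) \<Rightarrow> real) \<Rightarrow> (nat \<Rightarrow> nat \<Rightarrow>\<^sub>C real) \<Rightarrow> real"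
  where "ext \<phi> e = lim (\<lambda>n. \<Phi> (\<lambda>v. \<phi> (v \<circ> app e n)))"

lemma app_tendsto:
  assumes "e j \<in> N0"
  shows "(\<lambda>n. F (app e n j)) \<longlonglongrightarrow> e j"
proof -
  have *: "dist (F (app e n j)) (e j) < inverse (Suc n)" for n
  proof -
    have "0 < inverse (real (Suc n))" by simp
    from assms[unfolded closure_approachable, rule_format, OF this]
    obtain k where "dist (F k) (e j) < inverse (Suc n)" by auto
    then show ?thesis unfolding app_def by (rule someI)
  qed
  show ?thesis
    by (rule tendsto_dist_iff[THEN iffD2], rule tendsto_sandwich[OF _ _ tendsto_const LIMSEQ_inverse_real_of_nat])
      (use * in \<open>auto intro!: always_eventually less_imp_le\<close>)
qed

text \<open>Apply uniform continuity of \<phi> along a sequence representing \<Phi> on both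
  substituted predicates and on the \<open>n\<close> distances: eventually these distances are below
  \<delta>.\<close>

lemma \<Phi>_close:
  assumes "dp \<phi>" "\<epsilon> > 0"
  obtains n \<delta> where "\<delta> > 0" "\<And>\<sigma> \<tau>. (\<And>i. i < n \<Longrightarrow> \<rho> (\<sigma> i) (\<tau> i) < \<delta>) \<Longrightarrow>
    \<bar>\<Phi> (\<lambda>v. \<phi> (v \<circ> \<sigma>)) - \<Phi> (\<lambda>v. \<phi> (v \<circ> \<tau>))\<bar> \<le> \<epsilon>"
proof -
  from ucontD[OF dp_ucont[OF assms(1)] assms(2)] obtain n \<delta> where 1: "\<delta> > 0"
    "\<And>e e'. e \<in> Val \<Longrightarrow> e' \<in> Val \<Longrightarrow> (\<And>i. i < n \<Longrightarrow> d (e i) (e' i) < \<delta>) \<Longrightarrow> \<bar>\<phi> e - \<phi> e'\<bar> < \<epsilon>"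
    by metis
  have "\<bar>\<Phi> (\<lambda>v. \<phi> (v \<circ> \<sigma>)) - \<Phi> (\<lambda>v. \<phi> (v \<circ> \<tau>))\<bar> \<le> \<epsilon>"
    if *: "\<And>i. i < n \<Longrightarrow> \<rho> (\<sigma> i) (\<tau> i) < \<delta>" for \<sigma> \<tau>
  proof -
    define G where "G = {\<lambda>v. \<phi> (v \<circ> \<sigma>), \<lambda>v. \<phi> (v \<circ> \<tau>)} \<union> (\<lambda>i v. d (v (\<sigma> i)) (v (\<tau> i))) ` {..<n}"
    have "dp g" if "g \<in> G" for g
      using that dp_subst[OF assms(1)] dp_distance unfolding G_def by blast
    then obtain x where x: "\<And>m::nat. x m \<in> Val" "\<And>f. f \<in> G \<Longrightarrow> (\<lambda>m. f (x m)) \<longlonglongrightarrow> \<Phi> f"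
      using S_seq[OF \<Phi>_S, of G] by (auto simp: G_def)
    have "\<forall>\<^sub>F m in sequentially. d (x m (\<sigma> i)) (x m (\<tau> i)) < \<delta>" if "i < n" for i
      using x(2)[of "\<lambda>v. d (v (\<sigma> i)) (v (\<tau> i))"] *[OF that] that order_tendstoD(2)
      by (force simp: \<rho>_def G_def)
    then have "\<forall>\<^sub>F m in sequentially. \<forall>i\<in>{..<n}. d (x m (\<sigma> i)) (x m (\<tau> i)) < \<delta>"
      by (intro eventually_ball_finite) auto
    then have "\<forall>\<^sub>F m in sequentially. \<bar>\<phi> (x m \<circ> \<sigma>) - \<phi> (x m \<circ> \<tau>)\<bar> \<le> \<epsilon>"
    proof eventually_elim
      case (elim m)
      show ?case by (rule less_imp_le, rule 1(2)) (use x elim in auto)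
    qed
    moreover have "(\<lambda>m. \<bar>\<phi> (x m \<circ> \<sigma>) - \<phi> (x m \<circ> \<tau>)\<bar>) \<longlonglongrightarrow> \<bar>\<Phi> (\<lambda>v. \<phi> (v \<circ> \<sigma>)) - \<Phi> (\<lambda>v. \<phi> (v \<circ> \<tau>))\<bar>"
      using x(2)[of "\<lambda>v. \<phi> (v \<circ> \<sigma>)"] x(2)[of "\<lambda>v. \<phi> (v \<circ> \<tau>)"] unfolding G_def
      by (intro tendsto_rabs tendsto_diff) auto
    ultimately show ?thesis by (intro tendsto_upperbound) auto
  qed
  with 1(1) that show ?thesis by blast
qed

text \<open>Two systems of names are allowed on purpose: equal ones give convergence in
  \<open>ext\<close>, different ones give independence of the names chosen.\<close>

lemma \<Phi>_Cauchy:
  assumes "dp \<phi>" "\<And>j. (\<lambda>n. F (\<sigma> n j)) \<longlonglongrightarrow> e j" "\<And>j. (\<lambda>n. F (\<tau> n j)) \<longlonglongrightarrow> e j" "\<epsilon> > 0"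
  shows "\<exists>N. \<forall>m\<ge>N. \<forall>n\<ge>N. \<bar>\<Phi> (\<lambda>v. \<phi> (v \<circ> \<sigma> m)) - \<Phi> (\<lambda>v. \<phi> (v \<circ> \<tau> n))\<bar> \<le> \<epsilon>"
proof -
  from \<Phi>_close[OF assms(1,4)] obtain n0 \<delta> where 1: "\<delta> > 0" "\<And>\<sigma> \<tau>. (\<And>i. i < n0 \<Longrightarrow> \<rho> (\<sigma> i) (\<tau> i) < \<delta>) \<Longrightarrow>
    \<bar>\<Phi> (\<lambda>v. \<phi> (v \<circ> \<sigma>)) - \<Phi> (\<lambda>v. \<phi> (v \<circ> \<tau>))\<bar> \<le> \<epsilon>" by metis
  have "\<forall>\<^sub>F m in sequentially. dist (F (\<sigma> m j)) (e j) < \<delta>/2 \<and> dist (F (\<tau> m j)) (e j) < \<delta>/2" for j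
    using tendstoD[OF assms(2)[of j], of "\<delta>/2"] tendstoD[OF assms(3)[of j], of "\<delta>/2"] 1(1)
    by (auto intro: eventually_conj)
  then have "\<forall>\<^sub>F m in sequentially. \<forall>j\<in>{..<n0}. dist (F (\<sigma> m j)) (e j) < \<delta>/2 \<and> dist (F (\<tau> m j)) (e j) < \<delta>/2"
    by (intro eventually_ball_finite) auto
  then obtain N where N: "\<And>m j. m \<ge> N \<Longrightarrow> j < n0 \<Longrightarrow> dist (F (\<sigma> m j)) (e j) < \<delta>/2 \<and> dist (F (\<tau> m j)) (e j) < \<delta>/2"
    unfolding eventually_sequentially by blast
  have "\<rho> (\<sigma> m i) (\<tau> n i) < \<delta>" if "m \<ge> N" "n \<ge> N" "i < n0" for m n i
    unfolding dist_F[symmetric] using N[OF that(1,3)] N[OF that(2,3)] dist_triangle_half_l by blast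
  then show ?thesis using 1(2) by blast
qed

lemma ext_tendsto:
  assumes "dp \<phi>" "\<And>j. (\<lambda>n. F (\<sigma> n j)) \<longlonglongrightarrow> e j"
  shows "(\<lambda>n. \<Phi> (\<lambda>v. \<phi> (v \<circ> \<sigma> n))) \<longlonglongrightarrow> ext \<phi> e"
proof -
  have e: "e j \<in> N0" for j
    by (rule closed_sequentially[OF closed_closure _ assms(2)]) simp
  define a where "a n = \<Phi> (\<lambda>v. \<phi> (v \<circ> app e n))" for n
  have "Cauchy a"
  proof (rule metric_CauchyI)
    fix \<epsilon> :: real assume "\<epsilon> > 0"
    have "0 < \<epsilon>/2 \<Longrightarrow> \<exists>N. \<forall>m\<ge>N. \<forall>n\<ge>N. \<bar>a m - a n\<bar> \<le> \<epsilon>/2"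
      unfolding a_def by (rule \<Phi>_Cauchy[OF assms(1) app_tendsto[OF e] app_tendsto[OF e]])
    moreover have "\<epsilon>/2 < \<epsilon>" using \<open>\<epsilon> > 0\<close> by simp
    ultimately show "\<exists>N. \<forall>m\<ge>N. \<forall>n\<ge>N. dist (a m) (a n) < \<epsilon>"
      unfolding dist_real_def using half_gt_zero[OF \<open>\<epsilon> > 0\<close>] by (meson le_less_trans)
  qed
  then have a: "a \<longlonglongrightarrow> ext \<phi> e"
    unfolding ext_def a_def[symmetric] using Cauchy_convergent convergent_LIMSEQ_iff by blast
  have "(\<lambda>n. \<Phi> (\<lambda>v. \<phi> (v \<circ> \<sigma> n)) - a n) \<longlonglongrightarrow> 0"
  proof (rule LIMSEQ_I)
    fix \<epsilon> :: real assume "\<epsilon> > 0"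
    have "\<exists>N. \<forall>m\<ge>N. \<forall>n\<ge>N. \<bar>\<Phi> (\<lambda>v. \<phi> (v \<circ> \<sigma> m)) - a n\<bar> \<le> \<epsilon>/2"
      unfolding a_def by (rule \<Phi>_Cauchy[OF assms app_tendsto[OF e] half_gt_zero[OF \<open>\<epsilon> > 0\<close>]])
    then obtain N where N: "\<forall>m\<ge>N. \<forall>n\<ge>N. \<bar>\<Phi> (\<lambda>v. \<phi> (v \<circ> \<sigma> m)) - a n\<bar> \<le> \<epsilon>/2"
      by (rule exE)
    show "\<exists>N. \<forall>n\<ge>N. norm (\<Phi> (\<lambda>v. \<phi> (v \<circ> \<sigma> n)) - a n - 0) < \<epsilon>"
    proof (intro exI allI impI)
      show "norm (\<Phi> (\<lambda>v. \<phi> (v \<circ> \<sigma> n)) - a n - 0) < \<epsilon>" if "n \<ge> N" for n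
        using N[rule_format, OF that that] \<open>\<epsilon> > 0\<close> by simp
    qed
  qed
  from tendsto_add[OF this a] show ?thesis by simp
qed

abbreviation "Val0 \<equiv> (UNIV :: nat set) \<rightarrow> N0"

lemma ext_app:
  assumes "dp \<phi>" "e \<in> Val0"
  shows "(\<lambda>n. \<Phi> (\<lambda>v. \<phi> (v \<circ> app e n))) \<longlonglongrightarrow> ext \<phi> e"
  by (rule ext_tendsto[OF assms(1)]) (use assms(2) in \<open>auto intro!: app_tendsto\<close>)

lemma ext_F: "dp \<phi> \<Longrightarrow> ext \<phi> (\<lambda>j. F (\<sigma> j)) = \<Phi> (\<lambda>v. \<phi> (v \<circ> \<sigma>))"
  using ext_tendsto[of \<phi> "\<lambda>_. \<sigma>" "\<lambda>j. F (\<sigma> j)"] by (auto dest: LIMSEQ_unique[OF tendsto_const])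

lemma ext_abs_le:
  assumes "dp \<phi>" "dp \<psi>" "e \<in> Val0" "\<And>v. v \<in> Val \<Longrightarrow> \<bar>\<phi> v - \<psi> v\<bar> \<le> c"
  shows "\<bar>ext \<phi> e - ext \<psi> e\<bar> \<le> c"
proof (rule LIMSEQ_le_const2)
  show "(\<lambda>n. \<bar>\<Phi> (\<lambda>v. \<phi> (v \<circ> app e n)) - \<Phi> (\<lambda>v. \<psi> (v \<circ> app e n))\<bar>) \<longlonglongrightarrow> \<bar>ext \<phi> e - ext \<psi> e\<bar>"
    using assms by (intro tendsto_rabs tendsto_diff ext_app)
  have "\<bar>\<Phi> (\<lambda>v. \<phi> (v \<circ> app e n)) - \<Phi> (\<lambda>v. \<psi> (v \<circ> app e n))\<bar> \<le> c" for n
    using assms(4) dp_subst assms(1,2) by (intro spectrum_abs_le[OF \<Phi>_S]) auto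
  then show "\<exists>N. \<forall>n\<ge>N. \<bar>\<Phi> (\<lambda>v. \<phi> (v \<circ> app e n)) - \<Phi> (\<lambda>v. \<psi> (v \<circ> app e n))\<bar> \<le> c" by blast
qed

lemma ext_cong:
  "\<lbrakk>dp \<phi>; dp \<psi>; e \<in> Val0; \<And>v. v \<in> Val \<Longrightarrow> \<phi> v = \<psi> v\<rbrakk> \<Longrightarrow> ext \<phi> e = ext \<psi> e"
  using ext_abs_le[of \<phi> \<psi> e 0] by simp

lemma ext_const: "e \<in> Val0 \<Longrightarrow> ext (\<lambda>_. c) e = c"
proof -
  assume e: "e \<in> Val0"
  have "\<Phi> (\<lambda>_. c) = c"
    by (intro antisym spectrum_bounds[OF \<Phi>_S]) (auto simp: dp_const)
  then have "(\<lambda>n. c) \<longlonglongrightarrow> ext (\<lambda>_. c) e"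
    using ext_app[OF dp_const e, of c] by simp
  then show ?thesis by (simp add: LIMSEQ_const_iff)
qed

lemma ext_distance:
  assumes "e \<in> Val0"
  shows "ext (\<lambda>v. d (v i) (v j)) e = dist (e i) (e j)"
proof (rule LIMSEQ_unique)
  show "(\<lambda>n. dist (F (app e n i)) (F (app e n j))) \<longlonglongrightarrow> ext (\<lambda>v. d (v i) (v j)) e"
    using ext_app[OF dp_distance assms, of i j] by (simp add: dist_F \<rho>_def)
  show "(\<lambda>n. dist (F (app e n i)) (F (app e n j))) \<longlonglongrightarrow> dist (e i) (e j)"
    using assms by (intro tendsto_dist app_tendsto) auto
qed

lemma ext_uminus:
  assumes "dp \<phi>" "e \<in> Val0"
  shows "ext (\<lambda>v. - \<phi> v) e = - ext \<phi> e"
proof (rule LIMSEQ_unique)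
  show "(\<lambda>n. - \<Phi> (\<lambda>v. \<phi> (v \<circ> app e n))) \<longlonglongrightarrow> ext (\<lambda>v. - \<phi> v) e"
    using ext_app[OF dp_uminus[OF assms(1)] assms(2)] S_uminus[OF \<Phi>_S dp_subst[OF assms(1)]] by simp
  show "(\<lambda>n. - \<Phi> (\<lambda>v. \<phi> (v \<circ> app e n))) \<longlonglongrightarrow> - ext \<phi> e"
    using assms by (intro tendsto_minus ext_app)
qed

lemma ext_connective:
  fixes u :: "(nat \<Rightarrow> real) \<Rightarrow> real" and k :: nat
  assumes u: "continuous_on UNIV u" and dp: "\<And>i. i < k \<Longrightarrow> dp (\<phi>s i)" and e: "e \<in> Val0"
  shows "ext (\<lambda>v. u (\<lambda>i. if i < k then \<phi>s i v else 0)) e = u (\<lambda>i. if i < k then ext (\<phi>s i) e else 0)"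
proof (rule LIMSEQ_unique)
  have eq: "\<Phi> (\<lambda>v. u (\<lambda>i. if i < k then \<phi>s i (v \<circ> app e n) else 0)) =
      u (\<lambda>i. if i < k then \<Phi> (\<lambda>v. \<phi>s i (v \<circ> app e n)) else 0)" for n
    by (rule S_connective[OF \<Phi>_S u]) (rule dp_subst[OF dp])
  show "(\<lambda>n. u (\<lambda>i. if i < k then \<Phi> (\<lambda>v. \<phi>s i (v \<circ> app e n)) else 0)) \<longlonglongrightarrow>
      ext (\<lambda>v. u (\<lambda>i. if i < k then \<phi>s i v else 0)) e"
    using ext_app[OF definable_predicate.connective[where u = u and k = k and \<phi>s = \<phi>s, OF u dp] e]
    by (simp add: eq)
  have "(\<lambda>n. (\<lambda>i. if i < k then \<Phi> (\<lambda>v. \<phi>s i (v \<circ> app e n)) else 0)) \<longlonglongrightarrow>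
      (\<lambda>i. if i < k then ext (\<phi>s i) e else 0)"
    by (rule tendsto_funI) (use ext_app[OF dp e] in auto)
  moreover have "isCont u (\<lambda>i. if i < k then ext (\<phi>s i) e else 0)"
    using u by (simp add: continuous_on_eq_continuous_at)
  ultimately show "(\<lambda>n. u (\<lambda>i. if i < k then \<Phi> (\<lambda>v. \<phi>s i (v \<circ> app e n)) else 0)) \<longlonglongrightarrow>
      u (\<lambda>i. if i < k then ext (\<phi>s i) e else 0)"
    by (rule isCont_tendsto_compose[rotated])
qed

lemma ext_ucont:
  assumes "dp \<phi>" "\<epsilon> > 0"
  obtains n \<delta> where "\<delta> > 0" "\<And>e e'. e \<in> Val0 \<Longrightarrow> e' \<in> Val0 \<Longrightarrow>
    (\<And>i. i < n \<Longrightarrow> dist (e i) (e' i) < \<delta>) \<Longrightarrow> \<bar>ext \<phi> e - ext \<phi> e'\<bar> \<le> \<epsilon>"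
proof -
  from \<Phi>_close[OF assms] obtain n \<delta> where 1: "\<delta> > 0" "\<And>\<sigma> \<tau>. (\<And>i. i < n \<Longrightarrow> \<rho> (\<sigma> i) (\<tau> i) < \<delta>) \<Longrightarrow>
    \<bar>\<Phi> (\<lambda>v. \<phi> (v \<circ> \<sigma>)) - \<Phi> (\<lambda>v. \<phi> (v \<circ> \<tau>))\<bar> \<le> \<epsilon>" by metis
  have "\<bar>ext \<phi> e - ext \<phi> e'\<bar> \<le> \<epsilon>" if e: "e \<in> Val0" "e' \<in> Val0"
    and close: "\<And>i. i < n \<Longrightarrow> dist (e i) (e' i) < \<delta>" for e e'
  proof (rule tendsto_upperbound)
    show "(\<lambda>m. \<bar>\<Phi> (\<lambda>v. \<phi> (v \<circ> app e m)) - \<Phi> (\<lambda>v. \<phi> (v \<circ> app e' m))\<bar>) \<longlonglongrightarrow> \<bar>ext \<phi> e - ext \<phi> e'\<bar>"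
      using assms e by (intro tendsto_rabs tendsto_diff ext_app)
    have "\<forall>\<^sub>F m in sequentially. dist (F (app e m i)) (F (app e' m i)) < \<delta>" if "i < n" for i
    proof (rule order_tendstoD(2)[OF tendsto_dist close[OF that]])
      show "(\<lambda>m. F (app e m i)) \<longlonglongrightarrow> e i" "(\<lambda>m. F (app e' m i)) \<longlonglongrightarrow> e' i"
        using e by (auto intro!: app_tendsto)
    qed
    then have "\<forall>\<^sub>F m in sequentially. \<forall>i\<in>{..<n}. dist (F (app e m i)) (F (app e' m i)) < \<delta>"
      by (intro eventually_ball_finite) auto
    then show "\<forall>\<^sub>F m in sequentially. \<bar>\<Phi> (\<lambda>v. \<phi> (v \<circ> app e m)) - \<Phi> (\<lambda>v. \<phi> (v \<circ> app e' m))\<bar> \<le> \<epsilon>"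
      by eventually_elim (auto intro!: 1(2) simp: dist_F)
  qed simp
  with 1(1) that show ?thesis by blast
qed

lemma ext_bounded:
  assumes "dp \<phi>"
  shows "\<exists>B. \<forall>e\<in>Val0. \<bar>ext \<phi> e\<bar> \<le> B"
proof -
  obtain B where B: "\<forall>v\<in>Val. \<bar>\<phi> v\<bar> \<le> B" using dp_bounded[OF assms] by (auto simp: bounded_iff)
  have "\<bar>ext \<phi> e - ext (\<lambda>_. 0) e\<bar> \<le> B" if "e \<in> Val0" for e
    by (rule ext_abs_le[OF assms dp_const that]) (use B in auto)
  then show ?thesis by (auto simp: ext_const intro!: exI[of _ B])
qed

text \<open>The Tarski--Vaught step. The inequality \<le> holds for the extension of any type; the
  reverse one is where the Henkin witnesses enter.\<close>

lemma ext_infimum: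
  assumes "dp \<phi>" "e \<in> Val0"
  shows "ext (\<lambda>v. INF a\<in>X. \<phi> (v(i := a))) e = (INF b\<in>N0. ext \<phi> (e(i := b)))"
proof (rule antisym)
  let ?\<psi> = "\<lambda>v. INF a\<in>X. \<phi> (v(i := a))"
  have \<psi>: "dp ?\<psi>" using assms(1) by (rule definable_predicate.infimum)
  have upd: "e(i := b) \<in> Val0" if "b \<in> N0" for b using assms(2) that by auto
  show "ext ?\<psi> e \<le> (INF b\<in>N0. ext \<phi> (e(i := b)))"
  proof (rule cINF_greatest)
    fix b assume b: "b \<in> N0"
    define \<sigma> where "\<sigma> n = app (e(i := b)) n" for n
    have \<sigma>: "(\<lambda>n. F (\<sigma> n j)) \<longlonglongrightarrow> (e(i := b)) j" for j
      unfolding \<sigma>_def by (intro app_tendsto funcset_mem[OF upd[OF b]] UNIV_I)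
    have 1: "(\<lambda>n. \<Phi> (\<lambda>v. \<phi> (v \<circ> \<sigma> n))) \<longlonglongrightarrow> ext \<phi> (e(i := b))"
      by (rule ext_tendsto[OF assms(1) \<sigma>])
    \<comment> \<open>\<sigma> names \<open>e(i := b)\<close>. Renaming coordinate \<open>i\<close>
      gives names of \<open>e\<close> that agree with \<sigma> elsewhere, so that the infimum under
      \<tau> can be compared with the single value under \<sigma>.\<close>
    define \<tau> where "\<tau> n = (\<sigma> n)(i := app e n i)" for n
    have "(\<lambda>n. F (\<tau> n j)) \<longlonglongrightarrow> e j" for j
    proof (cases "j = i")
      case True
      then show ?thesis unfolding \<tau>_def using assms(2) by (auto intro!: app_tendsto)
    next
      case False
      then show ?thesis using \<sigma>[of j] by (simp add: \<tau>_def)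
    qed
    then have 2: "(\<lambda>n. \<Phi> (\<lambda>v. ?\<psi> (v \<circ> \<tau> n))) \<longlonglongrightarrow> ext ?\<psi> e"
      by (rule ext_tendsto[OF \<psi>])
    have "\<Phi> (\<lambda>v. ?\<psi> (v \<circ> \<tau> n)) \<le> \<Phi> (\<lambda>v. \<phi> (v \<circ> \<sigma> n)) + 0" for n
    proof (rule spectrum_le[OF \<Phi>_S])
      fix v assume v: "v \<in> Val"
      have "v \<circ> \<sigma> n = (v \<circ> \<tau> n)(i := v (\<sigma> n i))" by (auto simp: \<tau>_def fun_eq_iff)
      moreover have "?\<psi> (v \<circ> \<tau> n) \<le> \<phi> ((v \<circ> \<tau> n)(i := v (\<sigma> n i)))"
        by (rule cINF_lower[OF bounded_imp_bdd_below[OF dp_bounded_upd[OF assms(1)]]]) (use v in auto)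
      ultimately show "?\<psi> (v \<circ> \<tau> n) \<le> \<phi> (v \<circ> \<sigma> n) + 0" by simp
    qed (use dp_subst[OF \<psi>] dp_subst[OF assms(1)] in blast)+
    then show "ext ?\<psi> e \<le> ext \<phi> (e(i := b))"
      using LIMSEQ_le[OF 2 1] by auto
  qed auto
  show "(INF b\<in>N0. ext \<phi> (e(i := b))) \<le> ext ?\<psi> e"
  proof (rule field_le_epsilon)
    fix \<epsilon> :: real assume "\<epsilon> > 0"
    then have e3: "\<epsilon>/3 > 0" by simp
    from ext_ucont[OF assms(1) e3] obtain n \<delta> where 1: "\<delta> > 0" "\<And>e e'. e \<in> Val0 \<Longrightarrow> e' \<in> Val0 \<Longrightarrow>
      (\<And>i. i < n \<Longrightarrow> dist (e i) (e' i) < \<delta>) \<Longrightarrow> \<bar>ext \<phi> e - ext \<phi> e'\<bar> \<le> \<epsilon>/3" by metis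
    have "\<forall>\<^sub>F m in sequentially. dist (F (app e m j)) (e j) < \<delta>" for j
      using assms(2) 1(1) by (intro tendstoD app_tendsto) auto
    then have "\<forall>\<^sub>F m in sequentially. \<forall>j\<in>{..<n}. dist (F (app e m j)) (e j) < \<delta>"
      by (intro eventually_ball_finite) auto
    moreover have "\<forall>\<^sub>F m in sequentially. dist (\<Phi> (\<lambda>v. ?\<psi> (v \<circ> app e m))) (ext ?\<psi> e) < \<epsilon>/3"
      by (rule tendstoD[OF ext_app[OF \<psi> assms(2)] e3])
    ultimately have "\<forall>\<^sub>F m in sequentially. (\<forall>j\<in>{..<n}. dist (F (app e m j)) (e j) < \<delta>) \<and>
        dist (\<Phi> (\<lambda>v. ?\<psi> (v \<circ> app e m))) (ext ?\<psi> e) < \<epsilon>/3"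
      by (rule eventually_conj)
    then obtain m where m: "\<And>j. j < n \<Longrightarrow> dist (F (app e m j)) (e j) < \<delta>"
      "dist (\<Phi> (\<lambda>v. ?\<psi> (v \<circ> app e m))) (ext ?\<psi> e) < \<epsilon>/3"
      using eventually_happens'[OF sequentially_bot] by blast
    \<comment> \<open>The Henkin witness for the names of \<open>e\<close> at stage
      \<open>m\<close>. Of the three errors \<open>\<epsilon>/3\<close>, one is the defect of the
      witness, one comes from replacing \<open>e\<close> by its names, one from the value of the
      infimum at these names.\<close>
    obtain k where k: "\<Phi> (\<lambda>v. \<phi> (v \<circ> (app e m)(i := k))) \<le> \<Phi> (\<lambda>v. ?\<psi> (v \<circ> app e m)) + \<epsilon>/3"
      using henkin assms(1) e3 unfolding henkin_def by blast
    have "\<bar>ext \<phi> (e(i := F k)) - ext \<phi> (\<lambda>j. F (((app e m)(i := k)) j))\<bar> \<le> \<epsilon>/3"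
      using m(1) 1(1) upd[OF F_N0] by (intro 1(2)) (auto simp: dist_commute)
    then have "ext \<phi> (e(i := F k)) \<le> \<Phi> (\<lambda>v. \<phi> (v \<circ> (app e m)(i := k))) + \<epsilon>/3"
      unfolding ext_F[OF assms(1)] by linarith
    moreover have "(INF b\<in>N0. ext \<phi> (e(i := b))) \<le> ext \<phi> (e(i := F k))"
    proof (rule cINF_lower)
      obtain B where "\<forall>e\<in>Val0. \<bar>ext \<phi> e\<bar> \<le> B" using ext_bounded[OF assms(1)] by blast
      then have "- B \<le> ext \<phi> (e(i := b))" if "b \<in> N0" for b
        using upd[OF that] by (simp add: abs_le_iff minus_le_iff)
      then show "bdd_below ((\<lambda>b. ext \<phi> (e(i := b))) ` N0)" by (auto intro!: bdd_belowI)
    qed simp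
    ultimately show "(INF b\<in>N0. ext \<phi> (e(i := b))) \<le> ext ?\<psi> e + \<epsilon>"
      using k m(2) unfolding dist_real_def by linarith
  qed
qed

lemma ext_supremum:
  assumes "dp \<phi>" "e \<in> Val0"
  shows "ext (\<lambda>v. SUP a\<in>X. \<phi> (v(i := a))) e = (SUP b\<in>N0. ext \<phi> (e(i := b)))"
proof -
  have n: "dp (\<lambda>v. - \<phi> v)" using assms(1) by (rule dp_uminus)
  have "ext (\<lambda>v. SUP a\<in>X. \<phi> (v(i := a))) e = ext (\<lambda>v. - (INF a\<in>X. - \<phi> (v(i := a)))) e"
    by (simp only: SUP_real_eq_uminus_INF)
  also have "\<dots> = - (INF b\<in>N0. ext (\<lambda>v. - \<phi> v) (e(i := b)))"
    using ext_uminus[OF definable_predicate.infimum[OF n] assms(2)] ext_infimum[OF n assms(2)] by simp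
  also have "(INF b\<in>N0. ext (\<lambda>v. - \<phi> v) (e(i := b))) = (INF b\<in>N0. - ext \<phi> (e(i := b)))"
    using assms(2) by (intro INF_cong refl ext_uminus assms(1)) auto
  finally show ?thesis by (simp only: SUP_real_eq_uminus_INF)
qed

end

text \<open>The pointwise limit exists by completeness of the reals; the Cauchy estimate is uniform
  in the index, so the limit is bounded and uniform.\<close>

lemma Cauchy_bcontfun_nat_convergent:
  fixes f :: "nat \<Rightarrow> nat \<Rightarrow>\<^sub>C real"
  assumes "Cauchy f"
  shows "\<exists>l. f \<longlonglongrightarrow> l"
proof -
  have C: "\<exists>N. \<forall>m\<ge>N. \<forall>n\<ge>N. \<forall>i. dist (f m i) (f n i) < \<epsilon>" if "\<epsilon> > 0" for \<epsilon>
    using metric_CauchyD[OF assms that] dist_fun_lt_imp_dist_val_lt by meson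
  have "Cauchy (\<lambda>n. f n i)" for i
    unfolding Cauchy_def using C by blast
  then have "\<exists>l. (\<lambda>n. f n i) \<longlonglongrightarrow> l" for i
    by (auto simp: Cauchy_convergent_iff convergent_def)
  then obtain g where g: "\<And>i. (\<lambda>n. f n i) \<longlonglongrightarrow> g i" by metis
  have unif: "\<exists>N. \<forall>m\<ge>N. \<forall>i. dist (f m i) (g i) \<le> \<epsilon>" if \<epsilon>: "\<epsilon> > 0" for \<epsilon>
  proof -
    obtain N where N: "\<And>m n i. m \<ge> N \<Longrightarrow> n \<ge> N \<Longrightarrow> dist (f m i) (f n i) < \<epsilon>" using C[OF \<epsilon>] by blast
    have "dist (f m i) (g i) \<le> \<epsilon>" if "m \<ge> N" for m i
      by (rule LIMSEQ_le_const2[OF tendsto_dist[OF tendsto_const g]])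
        (use N[OF that] in \<open>auto intro!: exI[of _ N] less_imp_le\<close>)
    then show ?thesis by blast
  qed
  obtain m where m: "\<And>i. dist (f m i) (g i) \<le> 1" using unif[OF zero_less_one] by blast
  obtain B where B: "\<And>i. norm (f m i) \<le> B"
    using bounded_apply_bcontfun[of "f m"] by (auto simp: bounded_iff)
  have "norm (g i) \<le> B + 1" for i
    using B[of i] m[of i] by (simp add: dist_real_def abs_le_iff)
  then have gb: "apply_bcontfun (Bcontfun g) = g"
    by (intro Bcontfun_inverse) (auto simp: bcontfun_def bounded_iff)
  have "f \<longlonglongrightarrow> Bcontfun g"
  proof (rule metric_LIMSEQ_I)
    fix \<epsilon> :: real assume "\<epsilon> > 0"
    then obtain N where "\<forall>m\<ge>N. \<forall>i. dist (f m i) (g i) \<le> \<epsilon>/2" using unif half_gt_zero by blast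
    then have "dist (f m) (Bcontfun g) \<le> \<epsilon>/2" if "m \<ge> N" for m
      using that by (intro dist_bound) (auto simp: gb)
    then show "\<exists>N. \<forall>n\<ge>N. dist (f n) (Bcontfun g) < \<epsilon>"
      using \<open>\<epsilon> > 0\<close> by (intro exI[of _ N]) force
  qed
  then show ?thesis by blast
qed

section \<open>The completion as a model on a set of reals\<close>

context henkin_model
begin

definition J :: "(nat \<Rightarrow>\<^sub>C real) \<Rightarrow> real"
  where "J = (SOME J. inj J)"

lemma inj_J: "inj J"
  unfolding J_def using ex_inj_bcontfun_real by (rule someI_ex)

abbreviation "iJ \<equiv> inv_into UNIV J"

lemma iJ_J [simp]: "iJ (J x) = x"
  using inj_J by simp

text \<open>\<open>J\<close> copies the completion injectively into the reals. A symbol is evaluated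
  as its atomic formula in the variables \<open>0, 1, ...\<close>, for which a tuple is padded by
  \<open>F 0\<close> to a valuation.\<close>

definition N :: "(real, 'p) metric_struct"
  where "N = \<lparr>metric = Abstract_Metric_Spaces.metric (J ` N0, \<lambda>x y. dist (iJ x) (iJ y)),
    pred = (\<lambda>p xs. ext (\<lambda>v. pred M p (map v [0..<arity L p]))
      (\<lambda>j. if j < length xs then iJ (xs ! j) else F 0))\<rparr>"

lemma Metric_space_N: "Metric_space (J ` N0) (\<lambda>x y. dist (iJ x) (iJ y))"
  by unfold_locales (auto simp: dist_commute intro: dist_triangle)

lemma universe_N: "universe N = J ` N0"
  and distance_N: "distance N x y = dist (iJ x) (iJ y)"
  unfolding N_def using Metric_space.mspace_metric[OF Metric_space_N] Metric_space.mdist_metric[OF Metric_space_N]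
  by simp_all

lemma pred_N: "pred N p xs = ext (\<lambda>v. pred M p (map v [0..<arity L p]))
    (\<lambda>j. if j < length xs then iJ (xs ! j) else F 0)"
  by (simp add: N_def)

lemma dp_pred: "p \<in> symbols L \<Longrightarrow> dp (\<lambda>v. pred M p (map v [0..<arity L p]))"
  by (rule definable_predicate.predicate) auto

lemma tuples_N_Val0: "xs \<in> tuples N n \<Longrightarrow> (\<lambda>j. if j < length xs then iJ (xs ! j) else F 0) \<in> Val0"
  unfolding tuples_def universe_N by (force dest: nth_mem)

lemma valuations_N_Val0: "e \<in> valuations N \<Longrightarrow> iJ \<circ> e \<in> Val0"
  unfolding valuations_def universe_N Pi_iff by fastforce

lemma pred_N_map:
  assumes p: "p \<in> symbols L" "length vs = arity L p" and e: "e \<in> valuations N"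
  shows "pred N p (map e vs) = ext (\<lambda>v. pred M p (map v vs)) (iJ \<circ> e)"
proof -
  let ?\<phi> = "\<lambda>v. pred M p (map v [0..<arity L p])"
  let ?e = "\<lambda>j. if j < length (map e vs) then iJ (map e vs ! j) else F 0"
  have e0: "(iJ \<circ> e) i \<in> N0" for i using valuations_N_Val0[OF e] by auto
  have dp: "dp (\<lambda>v. pred M p (map v vs))" using p by (rule definable_predicate.predicate)
  \<comment> \<open>These names follow the names of \<open>e\<close> through the list
    \<open>vs\<close>; beyond its length the index 0 names the padding point \<open>F 0\<close>.
    Under them the ordered atomic formula becomes the one with variables \<open>vs\<close>.\<close>
  define \<sigma> where "\<sigma> n j = (if j < length vs then app (iJ \<circ> e) n (vs ! j) else 0)" for n j
  have "(\<lambda>n. F (\<sigma> n j)) \<longlonglongrightarrow> ?e j" for j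
    using app_tendsto[of "iJ \<circ> e", OF e0] by (cases "j < length vs") (simp_all add: \<sigma>_def)
  then have "(\<lambda>n. \<Phi> (\<lambda>v. ?\<phi> (v \<circ> \<sigma> n))) \<longlonglongrightarrow> ext ?\<phi> ?e"
    by (rule ext_tendsto[OF dp_pred[OF p(1)]])
  moreover have "map (v \<circ> \<sigma> n) [0..<arity L p] = map (v \<circ> app (iJ \<circ> e) n) vs" for v :: "nat \<Rightarrow> 'a" and n
    using p(2) by (auto intro!: nth_equalityI simp: \<sigma>_def)
  ultimately have "(\<lambda>n. \<Phi> (\<lambda>v. pred M p (map (v \<circ> app (iJ \<circ> e) n) vs))) \<longlonglongrightarrow> ext ?\<phi> ?e"
    by (simp only:)
  moreover have "(\<lambda>n. \<Phi> (\<lambda>v. pred M p (map (v \<circ> app (iJ \<circ> e) n) vs))) \<longlonglongrightarrow> ext (\<lambda>v. pred M p (map v vs)) (iJ \<circ> e)"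
    using ext_app[OF dp valuations_N_Val0[OF e]] .
  ultimately show ?thesis unfolding pred_N by (rule LIMSEQ_unique)
qed

lemma iJ_upd: "iJ \<circ> e(i := J b) = (iJ \<circ> e)(i := b)"
  by (auto simp: fun_eq_iff)

lemma valuations_N_upd: "e \<in> valuations N \<Longrightarrow> b \<in> N0 \<Longrightarrow> e(i := J b) \<in> valuations N"
  unfolding valuations_def universe_N by (auto simp: Pi_iff)

text \<open>The truth lemma, from which \<open>N\<close> inherits the theory of \<open>M\<close>:
  each connective and quantifier commutes with \<open>ext\<close>, and \<open>J\<close> only renames
  points.\<close>

lemma interp_N: "formula_of L \<phi> \<Longrightarrow> e \<in> valuations N \<Longrightarrow> interp N \<phi> e = ext (interp M \<phi>) (iJ \<circ> e)"
proof (induction \<phi> arbitrary: e)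
  case (Pred p vs)
  then show ?case unfolding interp.simps by (intro pred_N_map) simp_all
next
  case (Dist i j)
  have "ext (\<lambda>v. d (v i) (v j)) (iJ \<circ> e) = dist ((iJ \<circ> e) i) ((iJ \<circ> e) j)"
    by (rule ext_distance[OF valuations_N_Val0[OF Dist(2)]])
  then have "distance N (e i) (e j) = ext (\<lambda>v. d (v i) (v j)) (iJ \<circ> e)"
    unfolding distance_N by simp
  then show ?case by (simp only: interp.simps)
next
  case (Conn u \<phi>s)
  have dp: "dp (map (interp M) \<phi>s ! i)" if "i < length \<phi>s" for i
    using that Conn(2) dp_interp by (simp add: list_all_length)
  have "interp N (Conn u \<phi>s) e = u (\<lambda>i. if i < length \<phi>s then ext (map (interp M) \<phi>s ! i) (iJ \<circ> e) else 0)"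
    unfolding interp.simps
  proof (intro arg_cong[where f = u] HOL.ext)
    fix i
    have "interp N (\<phi>s ! i) e = ext (interp M (\<phi>s ! i)) (iJ \<circ> e)" if "i < length \<phi>s"
      using Conn(2,3) that by (intro Conn(1)) (auto simp: list_all_length)
    then show "(if i < length \<phi>s then (map (interp N) \<phi>s ! i) e else 0) =
        (if i < length \<phi>s then ext (map (interp M) \<phi>s ! i) (iJ \<circ> e) else 0)"
      by (cases "i < length \<phi>s") (simp_all only: if_True if_False nth_map)
  qed
  also have "\<dots> = ext (interp M (Conn u \<phi>s)) (iJ \<circ> e)"
    using ext_connective[of u "length \<phi>s" "\<lambda>i. map (interp M) \<phi>s ! i", OF _ dp valuations_N_Val0[OF Conn(3)]]
      Conn(2) by simp
  finally show ?case .
next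
  case (SupQ i \<phi>)
  then have "interp N (SupQ i \<phi>) e = (SUP b\<in>N0. ext (interp M \<phi>) (iJ \<circ> e(i := J b)))"
    unfolding interp.simps universe_N image_image by (intro SUP_cong refl SupQ.IH valuations_N_upd) auto
  also have "\<dots> = ext (interp M (SupQ i \<phi>)) (iJ \<circ> e)"
    unfolding iJ_upd interp.simps using SupQ(2)
    by (intro ext_supremum[symmetric] dp_interp valuations_N_Val0[OF SupQ(3)]) simp
  finally show ?case .
next
  case (InfQ i \<phi>)
  then have "interp N (InfQ i \<phi>) e = (INF b\<in>N0. ext (interp M \<phi>) (iJ \<circ> e(i := J b)))"
    unfolding interp.simps universe_N image_image by (intro INF_cong refl InfQ.IH valuations_N_upd) auto
  also have "\<dots> = ext (interp M (InfQ i \<phi>)) (iJ \<circ> e)"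
    unfolding iJ_upd interp.simps using InfQ(2)
    by (intro ext_infimum[symmetric] dp_interp valuations_N_Val0[OF InfQ(3)]) simp
  finally show ?case .
qed

lemma mcomplete_N: "mcomplete_of (metric N)"
proof -
  interpret N: Metric_space "J ` N0" "\<lambda>x y. dist (iJ x) (iJ y)" by (rule Metric_space_N)
  have "N.mcomplete"
    unfolding N.mcomplete_def
  proof (intro allI impI)
    fix s assume s: "N.MCauchy s"
    then have s1: "\<And>n. s n \<in> J ` N0" and s2: "Cauchy (\<lambda>n. iJ (s n))"
      unfolding N.MCauchy_def Cauchy_def by auto
    have "iJ (s n) \<in> N0" for n using s1[of n] by auto
    moreover obtain l where "(\<lambda>n. iJ (s n)) \<longlonglongrightarrow> l"
      using Cauchy_bcontfun_nat_convergent[OF s2] by blast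
    ultimately have l: "l \<in> N0" "(\<lambda>n. iJ (s n)) \<longlonglongrightarrow> l"
      using closed_sequentially[OF closed_closure, of "\<lambda>n. iJ (s n)" "range F" l] by blast+
    have "limitin N.mtopology s (J l) sequentially"
      unfolding N.limit_metric_sequentially using l s1 by (auto simp: lim_sequentially)
    then show "\<exists>x. limitin N.mtopology s x sequentially" by blast
  qed
  then show ?thesis
    by (simp add: mcomplete_of_def N_def N.mspace_metric N.mdist_metric)
qed

lemma metric_structure_N: "metric_structure L N"
  unfolding metric_structure_def
proof (intro conjI ballI)
  show "universe N \<noteq> {}" using F_N0 by (auto simp: universe_N)
  show "mcomplete_of (metric N)" by (rule mcomplete_N)
  obtain B where B: "\<forall>e\<in>Val0. \<bar>ext (\<lambda>v. d (v 0) (v 1)) e\<bar> \<le> B"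
    using ext_bounded[OF dp_distance] by blast
  have "dist x y \<le> B" if "x \<in> N0" "y \<in> N0" for x y
  proof -
    have e: "(\<lambda>i::nat. if i = 0 then x else y) \<in> Val0" using that by auto
    then show ?thesis using bspec[OF B e] ext_distance[OF e, of 0 1] by simp
  qed
  then show "\<exists>B. \<forall>x\<in>universe N. \<forall>y\<in>universe N. distance N x y \<le> B"
    by (auto simp: universe_N distance_N)
  fix p assume p: "p \<in> symbols L"
  let ?\<phi> = "\<lambda>v. pred M p (map v [0..<arity L p])"
  let ?e = "\<lambda>xs j. if j < length xs then iJ (xs ! j) else F 0"
  obtain B where B: "\<forall>e\<in>Val0. \<bar>ext ?\<phi> e\<bar> \<le> B" using ext_bounded[OF dp_pred[OF p]] by blast
  have "norm (pred N p xs) \<le> B" if "xs \<in> tuples N (arity L p)" for xs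
    using bspec[OF B tuples_N_Val0[OF that]] by (simp add: pred_N)
  then show "bounded (pred N p ` tuples N (arity L p))" by (auto simp: bounded_iff)
  show "\<forall>\<epsilon>>0. \<exists>\<delta>>0. \<forall>xs\<in>tuples N (arity L p). \<forall>ys\<in>tuples N (arity L p).
      (\<forall>i<arity L p. distance N (xs ! i) (ys ! i) < \<delta>) \<longrightarrow> \<bar>pred N p xs - pred N p ys\<bar> < \<epsilon>"
  proof (intro allI impI)
    fix \<epsilon> :: real assume "\<epsilon> > 0"
    from ext_ucont[OF dp_pred[OF p] half_gt_zero[OF this]]
    obtain n \<delta> where 1: "\<delta> > 0" "\<And>e e'. e \<in> Val0 \<Longrightarrow> e' \<in> Val0 \<Longrightarrow>
      (\<And>i. i < n \<Longrightarrow> dist (e i) (e' i) < \<delta>) \<Longrightarrow> \<bar>ext ?\<phi> e - ext ?\<phi> e'\<bar> \<le> \<epsilon>/2" by metis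
    have "\<bar>pred N p xs - pred N p ys\<bar> < \<epsilon>"
      if xs: "xs \<in> tuples N (arity L p)" "ys \<in> tuples N (arity L p)"
        and close: "\<forall>i<arity L p. distance N (xs ! i) (ys ! i) < \<delta>" for xs ys
    proof -
      have "length xs = arity L p" "length ys = arity L p" using xs by (auto simp: tuples_def)
      then have "\<bar>ext ?\<phi> (?e xs) - ext ?\<phi> (?e ys)\<bar> \<le> \<epsilon>/2"
        using close 1(1) by (intro 1(2) tuples_N_Val0[OF xs(1)] tuples_N_Val0[OF xs(2)]) (auto simp: distance_N)
      then show ?thesis unfolding pred_N using \<open>\<epsilon> > 0\<close> by linarith
    qed
    then show "\<exists>\<delta>>0. \<forall>xs\<in>tuples N (arity L p). \<forall>ys\<in>tuples N (arity L p).
      (\<forall>i<arity L p. distance N (xs ! i) (ys ! i) < \<delta>) \<longrightarrow> \<bar>pred N p xs - pred N p ys\<bar> < \<epsilon>"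
      using 1(1) by blast
  qed
qed

lemma model_of_N: "model_of L N (theory_of L M)"
  unfolding model_of_def
proof (intro conjI metric_structure_N ballI)
  fix \<phi> assume "\<phi> \<in> theory_of L M"
  then have \<phi>: "formula_of L \<phi>" "\<And>v. v \<in> Val \<Longrightarrow> interp M \<phi> v = 0"
    by (auto simp: theory_of_def satisfies_def)
  have "interp N \<phi> e = 0" if "e \<in> valuations N" for e
    unfolding interp_N[OF \<phi>(1) that]
    using ext_cong[OF dp_interp[OF \<phi>(1)] dp_const[of 0] valuations_N_Val0[OF that]] \<phi>(2)
      ext_const[OF valuations_N_Val0[OF that]] by simp
  then show "satisfies N \<phi>" by (simp add: satisfies_def)
qed

lemma separable_N: "separable_structure N"
proof -
  interpret N: Metric_space "J ` N0" "\<lambda>x y. dist (iJ x) (iJ y)" by (rule Metric_space_N)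
  have "N.mtopology closure_of (J ` range F) = J ` N0"
  proof
    show "N.mtopology closure_of (J ` range F) \<subseteq> J ` N0"
      using closure_of_subset_topspace[of N.mtopology] by simp
    show "J ` N0 \<subseteq> N.mtopology closure_of (J ` range F)"
    proof
      fix z assume "z \<in> J ` N0"
      then obtain x where x: "x \<in> N0" "z = J x" by blast
      have "\<exists>y\<in>J ` range F. y \<in> N.mball z r" if "0 < r" for r
      proof -
        obtain k where k: "dist (F k) x < r"
          using x(1) \<open>0 < r\<close> unfolding closure_approachable by blast
        have "J (F k) \<in> N.mball z r"
          unfolding N.in_mball using k x by (simp add: dist_commute)
        then show ?thesis by blast
      qed
      then show "z \<in> N.mtopology closure_of (J ` range F)"
        unfolding N.metric_closure_of using x by blast
    qed
  qed
  moreover have "J ` range F \<subseteq> J ` N0" using F_N0 by auto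
  ultimately have "separable_space N.mtopology"
    unfolding separable_space_def by (intro exI[of _ "J ` range F"]) simp
  then show ?thesis by (simp add: separable_structure_def N_def)
qed

text \<open>An isomorphism is only required to preserve symbols and distances. Induction along the
  generation of \<phi> extends this to everything definable, quantifiers being respected because
  \<open>h\<close> maps onto the universe and limits because \<open>ext\<close> is a contraction in
  the uniform norm.\<close>

lemma definable_isomorphism:
  assumes h: "isomorphism L M N h" and \<phi>: "dp \<phi>"
  shows "\<forall>v\<in>Val. \<phi> v = ext \<phi> (iJ \<circ> (h \<circ> v))"
proof -
  have bij: "h ` X = J ` N0" and dist: "\<And>x y. x \<in> X \<Longrightarrow> y \<in> X \<Longrightarrow> dist (iJ (h x)) (iJ (h y)) = d x y"
    and pred: "\<And>p xs. p \<in> symbols L \<Longrightarrow> xs \<in> tuples M (arity L p) \<Longrightarrow> pred N p (map h xs) = pred M p xs"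
    using h unfolding isomorphism_def universe_N distance_N bij_betw_def by auto
  have hN: "h \<circ> v \<in> valuations N" if "v \<in> Val" for v
    using that bij unfolding valuations_def universe_N by (auto simp: Pi_iff)
  have h0: "iJ \<circ> (h \<circ> v) \<in> Val0" if "v \<in> Val" for v
    using valuations_N_Val0[OF hN[OF that]] .
  have range: "(\<lambda>a. iJ (h a)) ` X = N0"
    using bij by (simp add: image_image[symmetric, of iJ h]) (simp add: image_image)
  have upd: "iJ \<circ> (h \<circ> v(i := a)) = (iJ \<circ> (h \<circ> v))(i := iJ (h a))" for v i a
    by (auto simp: fun_eq_iff)
  show ?thesis
    using \<phi>
  proof (induction rule: definable_predicate.induct)
    case (predicate p vs)
    show ?case
    proof
      fix v assume v: "v \<in> Val"
      have "map (h \<circ> v) vs = map h (map v vs)" by simp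
      then show "pred M p (map v vs) = ext (\<lambda>e. pred M p (map e vs)) (iJ \<circ> (h \<circ> v))"
        using pred_N_map[OF predicate hN[OF v]] pred[OF predicate(1) map_Val_tuples[OF v predicate(2)]] by simp
    qed
  next
    case (distance i j)
    show ?case
    proof
      fix v assume v: "v \<in> Val"
      show "d (v i) (v j) = ext (\<lambda>e. d (e i) (e j)) (iJ \<circ> (h \<circ> v))"
        using ext_distance[OF h0[OF v], of i j] dist[of "v i" "v j"] v by simp
    qed
  next
    case (connective u k \<phi>s)
    show ?case
    proof
      fix v assume v: "v \<in> Val"
      have "(\<lambda>i. if i < k then \<phi>s i v else 0) = (\<lambda>i. if i < k then ext (\<phi>s i) (iJ \<circ> (h \<circ> v)) else 0)"
      proof
        fix i
        show "(if i < k then \<phi>s i v else 0) = (if i < k then ext (\<phi>s i) (iJ \<circ> (h \<circ> v)) else 0)"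
          by (cases "i < k") (use bspec[OF connective(3) v] in \<open>simp_all only: if_True if_False\<close>)
      qed
      then show "u (\<lambda>i. if i < k then \<phi>s i v else 0) = ext (\<lambda>e. u (\<lambda>i. if i < k then \<phi>s i e else 0)) (iJ \<circ> (h \<circ> v))"
        using ext_connective[OF connective(1,2) h0[OF v]] by simp
    qed
  next
    case (supremum \<phi> i)
    show ?case
    proof
      fix v assume v: "v \<in> Val"
      have "(SUP a\<in>X. \<phi> (v(i := a))) = (SUP a\<in>X. ext \<phi> ((iJ \<circ> (h \<circ> v))(i := iJ (h a))))"
        unfolding upd[symmetric] using supremum(2) v by (intro SUP_cong refl bspec[OF supremum(2)] Val_upd)
      also have "\<dots> = (SUP b\<in>(\<lambda>a. iJ (h a)) ` X. ext \<phi> ((iJ \<circ> (h \<circ> v))(i := b)))"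
        by (simp only: image_image)
      finally show "(SUP a\<in>X. \<phi> (v(i := a))) = ext (\<lambda>e. SUP a\<in>X. \<phi> (e(i := a))) (iJ \<circ> (h \<circ> v))"
        unfolding range ext_supremum[OF supremum(1) h0[OF v]] .
    qed
  next
    case (infimum \<phi> i)
    show ?case
    proof
      fix v assume v: "v \<in> Val"
      have "(INF a\<in>X. \<phi> (v(i := a))) = (INF a\<in>X. ext \<phi> ((iJ \<circ> (h \<circ> v))(i := iJ (h a))))"
        unfolding upd[symmetric] using infimum(2) v by (intro INF_cong refl bspec[OF infimum(2)] Val_upd)
      also have "\<dots> = (INF b\<in>(\<lambda>a. iJ (h a)) ` X. ext \<phi> ((iJ \<circ> (h \<circ> v))(i := b)))"
        by (simp only: image_image)
      finally show "(INF a\<in>X. \<phi> (v(i := a))) = ext (\<lambda>e. INF a\<in>X. \<phi> (e(i := a))) (iJ \<circ> (h \<circ> v))"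
        unfolding range ext_infimum[OF infimum(1) h0[OF v]] .
    qed
  next
    case (limit \<phi>s \<phi>)
    have dp\<phi>: "dp \<phi>" using limit(1,2) by (rule definable_predicate.limit)
    show ?case
    proof
      fix v assume v: "v \<in> Val"
      have "\<bar>\<phi> v - ext \<phi> (iJ \<circ> (h \<circ> v))\<bar> \<le> 0"
      proof (rule field_le_epsilon)
        fix \<epsilon> :: real assume "\<epsilon> > 0"
        obtain n where n: "\<And>e. e \<in> Val \<Longrightarrow> \<bar>\<phi>s n e - \<phi> e\<bar> < \<epsilon>/2"
          using uniform_limitD[OF limit(2) half_gt_zero[OF \<open>\<epsilon> > 0\<close>]]
          by (auto simp: eventually_sequentially dist_real_def)
        have "\<bar>ext (\<phi>s n) (iJ \<circ> (h \<circ> v)) - ext \<phi> (iJ \<circ> (h \<circ> v))\<bar> \<le> \<epsilon>/2"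
          by (rule ext_abs_le[OF limit(1) dp\<phi> h0[OF v] less_imp_le[OF n]])
        moreover have "\<phi>s n v = ext (\<phi>s n) (iJ \<circ> (h \<circ> v))" using limit(3) v by blast
        ultimately show "\<bar>\<phi> v - ext \<phi> (iJ \<circ> (h \<circ> v))\<bar> \<le> 0 + \<epsilon>" using n[OF v] by linarith
      qed
      then show "\<phi> v = ext \<phi> (iJ \<circ> (h \<circ> v))" by simp
    qed
  qed
qed

text \<open>The preimages of the points \<open>F i\<close> under an isomorphism with the model
  realize \<Phi>, by \<open>ext_F\<close> for the identity substitution, and they are dense because
  the range of \<open>F\<close> is dense in its closure.\<close>

lemma henkin_realized:
  assumes "aleph0_categorical L M"
  obtains e where "e \<in> Val" "\<And>\<phi>. dp \<phi> \<Longrightarrow> \<phi> e = \<Phi> \<phi>"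
    "\<And>x \<epsilon>. x \<in> X \<Longrightarrow> 0 < \<epsilon> \<Longrightarrow> \<exists>i. d x (e i) < \<epsilon>"
proof -
  obtain h where h: "isomorphism L M N h"
    using assms model_of_N separable_N unfolding aleph0_categorical_def by blast
  then have bij: "h ` X = J ` N0" and dist: "\<And>x y. x \<in> X \<Longrightarrow> y \<in> X \<Longrightarrow> dist (iJ (h x)) (iJ (h y)) = d x y"
    unfolding isomorphism_def universe_N distance_N bij_betw_def by auto
  have "\<exists>x\<in>X. h x = J (F i)" for i
    using bij F_N0[of i] by (metis imageE imageI)
  then obtain e where e: "\<And>i. e i \<in> X" "\<And>i. h (e i) = J (F i)" by metis
  have eV: "e \<in> Val" by (simp add: Val_iff e)
  have he: "iJ \<circ> (h \<circ> e) = F" using e(2) by (auto simp: fun_eq_iff)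
  show ?thesis
  proof (rule that[OF eV])
    show "\<phi> e = \<Phi> \<phi>" if "dp \<phi>" for \<phi>
      using bspec[OF definable_isomorphism[OF h that] eV] ext_F[OF that, of "\<lambda>i. i"]
      unfolding he by (simp add: comp_def)
    show "\<exists>i. d x (e i) < \<epsilon>" if "x \<in> X" "0 < \<epsilon>" for x \<epsilon>
    proof -
      obtain y where y: "y \<in> N0" "h x = J y" using bij \<open>x \<in> X\<close> by blast
      obtain i where "dist (F i) y < \<epsilon>"
        using y(1) \<open>0 < \<epsilon>\<close> unfolding closure_approachable by blast
      then have "d x (e i) < \<epsilon>"
        using dist[OF \<open>x \<in> X\<close> e(1), of i] y(2) e(2) by (simp add: dist_commute)
      then show ?thesis by blast
    qed
  qed
qed

end

section \<open>Existence of Henkin types\<close>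

locale categorical_structure =
  fixes L :: "'p language" and M :: "('a, 'p) metric_struct"
  assumes ms: "metric_structure L M"
    and ess_countable: "essentially_countable_language L M"
    and categorical: "aleph0_categorical L M"

sublocale categorical_structure \<subseteq> mstruct
  by unfold_locales (rule ms)

section \<open>Neighbourhoods of types, and adding witnesses to a type\<close>

context categorical_structure
begin

abbreviation ev :: "(nat \<Rightarrow> 'a) \<Rightarrow> ((nat \<Rightarrow> 'a) \<Rightarrow> real) \<Rightarrow> real"
  where "ev e \<equiv> (\<lambda>\<phi>\<in>Collect dp. \<phi> e)"

lemma ex_dense_Q: "\<exists>Q. countable Q \<and> (\<forall>q\<in>Q. dp q) \<and>
    (\<forall>\<phi> \<epsilon>. dp \<phi> \<longrightarrow> 0 < \<epsilon> \<longrightarrow> (\<exists>q\<in>Q. \<forall>e\<in>Val. \<bar>q e - \<phi> e\<bar> < \<epsilon>))"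
  using countable_dense_definable_predicates[OF ms ess_countable] by metis

definition Q :: "((nat \<Rightarrow> 'a) \<Rightarrow> real) set"
  where "Q = (SOME Q. countable Q \<and> (\<forall>q\<in>Q. dp q) \<and>
    (\<forall>\<phi> \<epsilon>. dp \<phi> \<longrightarrow> 0 < \<epsilon> \<longrightarrow> (\<exists>q\<in>Q. \<forall>e\<in>Val. \<bar>q e - \<phi> e\<bar> < \<epsilon>)))"

lemma countable_Q: "countable Q"
  and dp_Q: "q \<in> Q \<Longrightarrow> dp q"
  and Q_dense: "dp \<phi> \<Longrightarrow> 0 < \<epsilon> \<Longrightarrow> \<exists>q\<in>Q. \<forall>e\<in>Val. \<bar>q e - \<phi> e\<bar> < \<epsilon>"
  using someI_ex[OF ex_dense_Q] unfolding Q_def[symmetric] by blast+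

lemma ev_S: "e \<in> Val \<Longrightarrow> ev e \<in> S"
  by (rule spectrum_point_evaluation)

lemma S_compact: "compactin (powertop_real (Collect dp)) S"
  by (rule spectrum_compact) (simp add: dp_bounded)

text \<open>The finitely many conditions of a basic neighbourhood combine into one,
  \<open>(\<Sum>f\<in>G. \<bar>f e - \<Phi> f\<bar>) < \<epsilon>\<close>. From here on open
  conditions on types have the form \<open>\<xi> < 0\<close>.\<close>

lemma S_nbhd:
  assumes "openin (powertop_real (Collect dp)) T" "\<Phi> \<in> T" "\<Phi> \<in> S"
  obtains \<xi> where "dp \<xi>" "\<Phi> \<xi> < 0" "\<And>\<Psi>. \<Psi> \<in> S \<Longrightarrow> \<Psi> \<xi> < 0 \<Longrightarrow> \<Psi> \<in> T"
proof -
  obtain G \<epsilon> where G: "finite G" "G \<subseteq> Collect dp" "0 < \<epsilon>"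
    "\<And>\<Psi>. \<Psi> \<in> extensional (Collect dp) \<Longrightarrow> (\<And>f. f \<in> G \<Longrightarrow> \<bar>\<Psi> f - \<Phi> f\<bar> < \<epsilon>) \<Longrightarrow> \<Psi> \<in> T"
    using openin_powertop_real_imp_nbhd[OF assms(1,2)] by metis
  define \<xi> where "\<xi> e = (\<Sum>f\<in>G. \<bar>f e - \<Phi> f\<bar>) - \<epsilon>" for e
  have dpa: "dp (\<lambda>e. \<bar>f e - \<Phi> f\<bar>)" if "f \<in> G" for f
    using that G(2) by (intro dp_abs dp_diff dp_const) auto
  have \<xi>: "dp \<xi>"
    unfolding \<xi>_def[abs_def] by (intro dp_diff dp_sum dp_const G(1) dpa)
  have eq: "\<Psi> \<xi> = (\<Sum>f\<in>G. \<bar>\<Psi> f - \<Phi> f\<bar>) - \<epsilon>" if \<Psi>: "\<Psi> \<in> S" for \<Psi>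
  proof -
    have fin: "finite (insert \<xi> G)" "\<And>g. g \<in> insert \<xi> G \<Longrightarrow> dp g"
      using G \<xi> by auto
    obtain x where x: "\<And>n::nat. x n \<in> Val" "\<And>f. f \<in> insert \<xi> G \<Longrightarrow> (\<lambda>n. f (x n)) \<longlonglongrightarrow> \<Psi> f"
      using S_seq[OF \<Psi> fin] by metis
    have "(\<lambda>n. \<xi> (x n)) \<longlonglongrightarrow> (\<Sum>f\<in>G. \<bar>\<Psi> f - \<Phi> f\<bar>) - \<epsilon>"
      unfolding \<xi>_def by (intro tendsto_intros x(2)) simp
    then show ?thesis using x(2)[of \<xi>] LIMSEQ_unique by blast
  qed
  show ?thesis
  proof (rule that[OF \<xi>])
    show "\<Phi> \<xi> < 0" using eq[OF assms(3)] G(3) by simp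
    show "\<Psi> \<in> T" if \<Psi>: "\<Psi> \<in> S" "\<Psi> \<xi> < 0" for \<Psi>
    proof (rule G(4))
      show "\<Psi> \<in> extensional (Collect dp)" using \<Psi>(1) by (rule spectrum_subset_extensional)
      show "\<bar>\<Psi> f - \<Phi> f\<bar> < \<epsilon>" if "f \<in> G" for f
      proof -
        have "\<bar>\<Psi> f - \<Phi> f\<bar> \<le> (\<Sum>f\<in>G. \<bar>\<Psi> f - \<Phi> f\<bar>)"
          by (rule member_le_sum[OF that _ G(1)]) simp
        then show ?thesis using eq[OF \<Psi>(1)] \<Psi>(2) by linarith
      qed
    qed
  qed
qed

lemma openin_S_less:
  assumes "dp \<phi>" "dp \<psi>"
  shows "openin (powertop_real (Collect dp)) {\<Phi> \<in> topspace (powertop_real (Collect dp)). \<Phi> \<phi> < \<Phi> \<psi> + c}"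
proof -
  have "continuous_map (powertop_real (Collect dp)) euclideanreal (\<lambda>\<Phi>. \<Phi> \<phi> - \<Phi> \<psi> - c)"
    using assms by (intro continuous_intros continuous_map_eval) auto
  then have "openin (powertop_real (Collect dp)) {\<Phi> \<in> topspace (powertop_real (Collect dp)). \<Phi> \<phi> - \<Phi> \<psi> - c \<in> {..<0}}"
    by (rule openin_continuous_map_preimage) (simp flip: open_openin)
  then show ?thesis by (simp add: algebra_simps)
qed

text \<open>Realize the witness demanded at \<open>\<phi>, \<sigma>, i\<close> by a fresh variable \<open>k\<close>. As \<open>k\<close> is odd, the type of the
  even variables does not change; as \<open>k\<close> is large, \<open>\<xi>\<close> hardly changes.\<close>

lemma henkin_density:
  assumes \<Psi>: "\<Psi> \<in> S" "dp \<xi>" "\<Psi> \<xi> < 0" and \<phi>: "dp \<phi>" and \<sigma>: "finite (range \<sigma>)" and \<epsilon>: "0 < \<epsilon>"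
  obtains \<Psi>' k where "\<Psi>' \<in> S" "\<Psi>' \<xi> < 0"
    "\<And>\<theta>. dp \<theta> \<Longrightarrow> \<Psi>' (\<lambda>e. \<theta> (\<lambda>i. e (2 * i))) = \<Psi> (\<lambda>e. \<theta> (\<lambda>i. e (2 * i)))"
    "\<Psi>' (\<lambda>e. \<phi> (e \<circ> \<sigma>(i := k))) < \<Psi>' (\<lambda>e. INF a\<in>X. \<phi> ((e \<circ> \<sigma>)(i := a))) + \<epsilon>"
proof -
  \<comment> \<open>Three errors below \<eta> separate \<open>\<Psi>' \<xi>\<close> from
    \<open>\<Psi> \<xi>\<close>: two from approximating the types at \<open>x\<close> and
    \<open>w x\<close>, one from changing variable \<open>k\<close>.\<close>
  define \<eta> where "\<eta> = - \<Psi> \<xi> / 3"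
  have \<eta>: "\<eta> > 0" using \<Psi>(3) by (simp add: \<eta>_def)
  from ucontD[OF dp_ucont[OF \<Psi>(2)] this] obtain n \<delta> where n: "\<delta> > 0"
    "\<And>e e'. e \<in> Val \<Longrightarrow> e' \<in> Val \<Longrightarrow> (\<And>i. i < n \<Longrightarrow> d (e i) (e' i) < \<delta>) \<Longrightarrow> \<bar>\<xi> e - \<xi> e'\<bar> < \<eta>"
    by metis
  \<comment> \<open>Being larger than \<open>Max (range \<sigma>)\<close> as well, \<open>k\<close>
    is not among the variables that \<sigma> uses, so overwriting it leaves
    \<open>e \<circ> \<sigma>\<close>, and with it the infimum to be witnessed, unchanged.\<close>
  define k where "k = 2 * (n + Max (range \<sigma>)) + 1"
  have k: "odd k" "k \<ge> n" by (auto simp: k_def)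
  have k\<sigma>: "\<sigma> j \<noteq> k" for j
    using Max_ge[OF \<sigma>, of "\<sigma> j"] by (simp add: k_def)
  define \<psi> where "\<psi> = (\<lambda>e. INF a\<in>X. \<phi> (e(i := a)))"
  have "\<exists>a\<in>X. \<phi> (e(i := a)) < \<psi> e + \<epsilon>/2" if "e \<in> Val" for e
  proof -
    have "(INF a\<in>X. \<phi> (e(i := a))) < \<psi> e + \<epsilon>/2" using \<epsilon> by (simp add: \<psi>_def)
    then show ?thesis
      using X_ne bounded_imp_bdd_below[OF dp_bounded_upd[OF \<phi> that]] by (subst (asm) cINF_less_iff) auto
  qed
  then obtain a where a: "\<And>e. e \<in> Val \<Longrightarrow> a e \<in> X" "\<And>e. e \<in> Val \<Longrightarrow> \<phi> (e(i := a e)) < \<psi> e + \<epsilon>/2"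
    by metis
  define w where "w e = e(k := a (e \<circ> \<sigma>))" for e
  have w: "w e \<in> Val" if "e \<in> Val" for e
    unfolding w_def using that by (intro Val_upd a Val_comp)
  have w_even: "w e (2 * j) = e (2 * j)" for e j
    using k(1) by (auto simp: w_def)
  have w_n: "w e j = e j" if "j < n" for e j
    using k(2) that by (simp add: w_def)
  have w\<sigma>: "w e \<circ> \<sigma>(i := k) = (e \<circ> \<sigma>)(i := a (e \<circ> \<sigma>))" "w e \<circ> \<sigma> = e \<circ> \<sigma>" for e
    using k\<sigma> by (auto simp: w_def fun_eq_iff)
  obtain \<Psi>' where \<Psi>': "\<Psi>' \<in> S"
    "\<And>F G \<epsilon>. finite F \<Longrightarrow> F \<subseteq> Collect dp \<Longrightarrow> finite G \<Longrightarrow> G \<subseteq> Collect dp \<Longrightarrow> 0 < \<epsilon> \<Longrightarrow>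
       \<exists>x\<in>Val. (\<forall>f\<in>F. \<bar>f x - \<Psi> f\<bar> < \<epsilon>) \<and> (\<forall>g\<in>G. \<bar>g (w x) - \<Psi>' g\<bar> < \<epsilon>)"
    by (rule spectrum_transfer[OF \<Psi>(1), of w Val "Collect dp"]) (auto simp: w dp_bounded)
  show ?thesis
  proof (rule that[OF \<Psi>'(1)])
    obtain x where "x \<in> Val" "\<bar>\<xi> x - \<Psi> \<xi>\<bar> < \<eta>" "\<bar>\<xi> (w x) - \<Psi>' \<xi>\<bar> < \<eta>"
      using \<Psi>'(2)[of "{\<xi>}" "{\<xi>}" \<eta>] \<Psi>(2) \<eta> by auto
    moreover have "\<bar>\<xi> x - \<xi> (w x)\<bar> < \<eta>"
      using \<open>x \<in> Val\<close> w n(1) by (intro n(2)) (auto simp: w_n)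
    ultimately show "\<Psi>' \<xi> < 0" using \<eta> unfolding \<eta>_def by linarith
  next
    fix \<theta> assume \<theta>: "dp \<theta>"
    let ?\<theta> = "\<lambda>e. \<theta> (\<lambda>i. e (2 * i))"
    have dp\<theta>: "dp ?\<theta>" using dp_subst'[OF \<theta>] .
    have "\<bar>\<Psi>' ?\<theta> - \<Psi> ?\<theta>\<bar> \<le> 0"
    proof (rule field_le_epsilon)
      fix \<epsilon> :: real assume "\<epsilon> > 0"
      then obtain x where "x \<in> Val" "\<bar>?\<theta> x - \<Psi> ?\<theta>\<bar> < \<epsilon>/2" "\<bar>?\<theta> (w x) - \<Psi>' ?\<theta>\<bar> < \<epsilon>/2"
        using \<Psi>'(2)[of "{?\<theta>}" "{?\<theta>}" "\<epsilon>/2"] dp\<theta> by auto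
      moreover have "?\<theta> (w x) = ?\<theta> x" by (simp add: w_even)
      ultimately show "\<bar>\<Psi>' ?\<theta> - \<Psi> ?\<theta>\<bar> \<le> 0 + \<epsilon>" by linarith
    qed
    then show "\<Psi>' ?\<theta> = \<Psi> ?\<theta>" by simp
  next
    let ?f = "\<lambda>e. \<phi> (e \<circ> \<sigma>(i := k))" and ?g = "\<lambda>e. \<psi> (e \<circ> \<sigma>)"
    have dpfg: "dp ?f" "dp ?g"
      using dp_subst[OF \<phi>] dp_subst_inf[OF \<phi>] by (simp_all only: \<psi>_def)
    have "\<epsilon>/8 > 0" using \<epsilon> by simp
    then have "\<exists>x\<in>Val. (\<forall>f\<in>{}. \<bar>f x - \<Psi> f\<bar> < \<epsilon>/8) \<and> (\<forall>g\<in>{?f, ?g}. \<bar>g (w x) - \<Psi>' g\<bar> < \<epsilon>/8)"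
      using dpfg by (intro \<Psi>'(2)) auto
    then obtain x where x: "x \<in> Val" "\<forall>g\<in>{?f, ?g}. \<bar>g (w x) - \<Psi>' g\<bar> < \<epsilon>/8" by blast
    have "?f (w x) < ?g (w x) + \<epsilon>/2"
      unfolding w\<sigma> by (rule a(2)[OF Val_comp[OF x(1)]])
    moreover have "\<bar>?f (w x) - \<Psi>' ?f\<bar> < \<epsilon>/8" "\<bar>?g (w x) - \<Psi>' ?g\<bar> < \<epsilon>/8"
      using bspec[OF x(2), of ?f] bspec[OF x(2), of ?g] by (simp_all only: insert_iff simp_thms)
    ultimately have "\<Psi>' ?f < \<Psi>' ?g + \<epsilon>" by linarith
    then show "\<Psi>' (\<lambda>e. \<phi> (e \<circ> \<sigma>(i := k))) < \<Psi>' (\<lambda>e. INF a\<in>X. \<phi> ((e \<circ> \<sigma>)(i := a))) + \<epsilon>"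
      unfolding \<psi>_def .
  qed
qed

text \<open>Countably many substitutions of finite range that imitate any given one on an initial
  segment of the variables.\<close>

definition list_map :: "nat list \<Rightarrow> nat \<Rightarrow> nat"
  where "list_map l j = (if j < length l then l ! j else 0)"

lemma finite_range_list_map: "finite (range (list_map l))"
  by (rule finite_subset[of _ "insert 0 (set l)"]) (auto simp: list_map_def)

text \<open>Makes the Henkin property a countable intersection of open conditions: \<phi> is
  replaced by a nearby element of \<open>Q\<close>, and \<sigma> by a list, as uniform continuity
  lets only finitely many variables count.\<close>

lemma henkin_countable:
  assumes \<Phi>: "\<Phi> \<in> S" and H: "\<And>q l i m. q \<in> Q \<Longrightarrow> \<exists>k. \<Phi> (\<lambda>e. q (e \<circ> (list_map l)(i := k)))
      < \<Phi> (\<lambda>e. INF a\<in>X. q ((e \<circ> list_map l)(i := a))) + inverse (Suc m)"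
  shows "henkin \<Phi>"
  unfolding henkin_def
proof (intro conjI allI impI \<Phi>)
  fix \<phi> i and \<sigma> :: "nat \<Rightarrow> nat" and \<epsilon> :: real assume \<phi>: "dp \<phi>" and "\<epsilon> > 0"
  \<comment> \<open>Replacing \<phi> and replacing \<sigma> cost \<open>\<epsilon>/8\<close> each,
    once at the witness and once in the infimum; together with
    \<open>inverse (Suc m) < \<epsilon>/8\<close> this stays below \<epsilon>.\<close>
  then have \<epsilon>: "\<epsilon>/8 > 0" by simp
  obtain q where q: "q \<in> Q" "\<And>e. e \<in> Val \<Longrightarrow> \<bar>q e - \<phi> e\<bar> < \<epsilon>/8" using Q_dense[OF \<phi> \<epsilon>] by blast
  have dq: "dp q" using dp_Q[OF q(1)] .
  from ucontD[OF dp_ucont[OF dq] \<epsilon>] obtain n \<delta> where n: "\<delta> > 0"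
    "\<And>e e'. e \<in> Val \<Longrightarrow> e' \<in> Val \<Longrightarrow> (\<And>i. i < n \<Longrightarrow> d (e i) (e' i) < \<delta>) \<Longrightarrow> \<bar>q e - q e'\<bar> < \<epsilon>/8"
    by metis
  define l where "l = map \<sigma> [0..<n]"
  have l: "list_map l j = \<sigma> j" if "j < n" for j using that by (simp add: list_map_def l_def)
  have close: "\<bar>q (e \<circ> (list_map l)(i := k)) - \<phi> (e \<circ> \<sigma>(i := k))\<bar> \<le> \<epsilon>/4" if e: "e \<in> Val" for e k
  proof -
    have "\<bar>q (e \<circ> (list_map l)(i := k)) - q (e \<circ> \<sigma>(i := k))\<bar> < \<epsilon>/8"
      using e n(1) by (intro n(2)) (auto simp: l)
    then show ?thesis using q(2)[OF Val_comp[OF e, of "\<sigma>(i := k)"]] by linarith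
  qed
  have close2: "\<bar>q ((e \<circ> list_map l)(i := a)) - \<phi> ((e \<circ> \<sigma>)(i := a))\<bar> \<le> \<epsilon>/4" if e: "e \<in> Val" "a \<in> X" for e a
  proof -
    have "\<bar>q ((e \<circ> list_map l)(i := a)) - q ((e \<circ> \<sigma>)(i := a))\<bar> < \<epsilon>/8"
      by (rule n(2)[OF Val_upd[OF Val_comp[OF e(1)] e(2)] Val_upd[OF Val_comp[OF e(1)] e(2)]])
        (use e n(1) in \<open>auto simp: l\<close>)
    then show ?thesis using q(2)[OF Val_upd[OF Val_comp[OF e(1), of \<sigma>] e(2)], of i] by linarith
  qed
  have close_inf: "\<bar>(INF a\<in>X. q ((e \<circ> list_map l)(i := a))) - (INF a\<in>X. \<phi> ((e \<circ> \<sigma>)(i := a)))\<bar> \<le> \<epsilon>/4"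
    if e: "e \<in> Val" for e
    by (rule INF_diff_le[OF X_ne dp_bounded_upd[OF dq Val_comp[OF e]] dp_bounded_upd[OF \<phi> Val_comp[OF e]] close2[OF e]])
  obtain m where m: "inverse (real (Suc m)) < \<epsilon>/8" using reals_Archimedean[OF \<epsilon>] by blast
  obtain k where k: "\<Phi> (\<lambda>e. q (e \<circ> (list_map l)(i := k)))
      < \<Phi> (\<lambda>e. INF a\<in>X. q ((e \<circ> list_map l)(i := a))) + inverse (Suc m)"
    using H[OF q(1)] by blast
  have "\<bar>\<Phi> (\<lambda>e. q (e \<circ> (list_map l)(i := k))) - \<Phi> (\<lambda>e. \<phi> (e \<circ> \<sigma>(i := k)))\<bar> \<le> \<epsilon>/4"
    by (rule spectrum_abs_le[OF \<Phi> _ _ close]) (use dp_subst[OF dq] dp_subst[OF \<phi>] in auto)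
  moreover have "\<bar>\<Phi> (\<lambda>e. INF a\<in>X. q ((e \<circ> list_map l)(i := a))) - \<Phi> (\<lambda>e. INF a\<in>X. \<phi> ((e \<circ> \<sigma>)(i := a)))\<bar> \<le> \<epsilon>/4"
    by (rule spectrum_abs_le[OF \<Phi> _ _ close_inf])
      (use dp_subst_inf[OF dq] dp_subst_inf[OF \<phi>] in blast)+
  ultimately have "\<Phi> (\<lambda>e. \<phi> (e \<circ> \<sigma>(i := k))) \<le> \<Phi> (\<lambda>e. INF a\<in>X. \<phi> ((e \<circ> \<sigma>)(i := a))) + \<epsilon>"
    using k m by linarith
  then show "\<exists>k. \<Phi> (\<lambda>e. \<phi> (e \<circ> \<sigma>(i := k))) \<le> \<Phi> (\<lambda>e. INF a\<in>X. \<phi> ((e \<circ> \<sigma>)(i := a))) + \<epsilon>" by blast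
qed

text \<open>Baire category in the compact space \<open>C\<close>: each of the countably many witness
  conditions is open, and dense by \<open>henkin_density\<close>. The perturbed type agrees with the
  old one on the even variables, so the stability assumption keeps it in \<open>C\<close>. Further
  dense open conditions can be imposed through \<G>.\<close>

lemma ex_henkin:
  assumes C: "closedin (powertop_real (Collect dp)) C" "C \<subseteq> S" "C \<noteq> {}"
    and stable: "\<And>\<Psi> \<Psi>'. \<Psi> \<in> C \<Longrightarrow> \<Psi>' \<in> S \<Longrightarrow>
      (\<And>\<theta>. dp \<theta> \<Longrightarrow> \<Psi>' (\<lambda>e. \<theta> (\<lambda>i. e (2 * i))) = \<Psi> (\<lambda>e. \<theta> (\<lambda>i. e (2 * i)))) \<Longrightarrow> \<Psi>' \<in> C"
    and G: "countable \<G>" "\<And>T. T \<in> \<G> \<Longrightarrow> openin (subtopology (powertop_real (Collect dp)) C) T"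
      "\<And>T \<Psi> \<xi>. T \<in> \<G> \<Longrightarrow> \<Psi> \<in> C \<Longrightarrow> dp \<xi> \<Longrightarrow> \<Psi> \<xi> < 0 \<Longrightarrow> \<exists>\<Psi>'\<in>T. \<Psi>' \<xi> < 0"
  obtains \<Phi> where "\<Phi> \<in> C" "\<Phi> \<in> \<Inter>\<G>" "henkin \<Phi>"
proof -
  let ?P = "powertop_real (Collect dp)"
  let ?T = "subtopology ?P C"
  have cpt: "compactin ?P C" using closed_compactin[OF S_compact C(2,1)] .
  have top: "topspace ?T = C" using closedin_subset[OF C(1)] by auto
  have "compact_space ?T" using cpt by (simp add: compact_space_subtopology)
  moreover have "Hausdorff_space ?T" by (simp add: Hausdorff_space_subtopology Hausdorff_powertop_real)
  ultimately have baire: "locally_compact_space ?T \<and> regular_space ?T"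
    using compact_imp_locally_compact_space compact_Hausdorff_imp_regular_space by blast
  define H where "H = (\<lambda>(q, l, i, m). {\<Phi> \<in> C. \<exists>k. \<Phi> (\<lambda>e. q (e \<circ> (list_map l)(i := k)))
      < \<Phi> (\<lambda>e. INF a\<in>X. q ((e \<circ> list_map l)(i := a))) + inverse (real (Suc m))})"
  define \<H> where "\<H> = H ` (Q \<times> (UNIV :: nat list set) \<times> (UNIV :: nat set) \<times> (UNIV :: nat set))"
  have "countable \<H>" unfolding \<H>_def using countable_Q by (intro countable_image countable_SIGMA) auto
  have H_open: "openin ?T T" if T': "T \<in> \<H>" for T
  proof -
    obtain q l i m where T: "q \<in> Q" "T = H (q, l, i, m)" using T' unfolding \<H>_def by blast
    let ?U = "\<lambda>k. {\<Phi> \<in> topspace ?P. \<Phi> (\<lambda>e. q (e \<circ> (list_map l)(i := k)))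
      < \<Phi> (\<lambda>e. INF a\<in>X. q ((e \<circ> list_map l)(i := a))) + inverse (real (Suc m))}"
    have "openin ?P (?U k)" for k
      by (rule openin_S_less[OF dp_subst[OF dp_Q[OF T(1)]] dp_subst_inf[OF dp_Q[OF T(1)]]])
    then have "openin ?P (\<Union>k. ?U k)" by (intro openin_Union) blast
    moreover have "T = C \<inter> (\<Union>k. ?U k)"
      unfolding T(2) H_def using closedin_subset[OF C(1)] by auto
    ultimately show ?thesis by (simp add: openin_subtopology_Int2)
  qed
  have H_dense: "\<exists>\<Psi>'\<in>T. \<Psi>' \<xi> < 0" if T': "T \<in> \<H>" and \<Psi>: "\<Psi> \<in> C" "dp \<xi>" "\<Psi> \<xi> < 0" for T \<Psi> \<xi>
  proof -
    obtain q l i m where T: "q \<in> Q" "T = H (q, l, i, m)" using T' unfolding \<H>_def by blast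
    have "inverse (real (Suc m)) > 0" by simp
    from henkin_density[OF subsetD[OF C(2) \<Psi>(1)] \<Psi>(2,3) dp_Q[OF T(1)] finite_range_list_map this]
    obtain \<Psi>' k where "\<Psi>' \<in> S" "\<Psi>' \<xi> < 0"
      "\<And>\<theta>. dp \<theta> \<Longrightarrow> \<Psi>' (\<lambda>e. \<theta> (\<lambda>i. e (2 * i))) = \<Psi> (\<lambda>e. \<theta> (\<lambda>i. e (2 * i)))"
      "\<Psi>' (\<lambda>e. q (e \<circ> (list_map l)(i := k))) < \<Psi>' (\<lambda>e. INF a\<in>X. q ((e \<circ> list_map l)(i := a))) + inverse (real (Suc m))"
      by metis
    then have "\<Psi>' \<in> T" unfolding T(2) H_def using stable[OF \<Psi>(1)] by blast
    then show ?thesis using \<open>\<Psi>' \<xi> < 0\<close> by blast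
  qed
  have dense: "openin ?T T \<and> ?T closure_of T = topspace ?T" if T: "T \<in> \<G> \<union> \<H>" for T
  proof
    show op: "openin ?T T" using T G(2) H_open by blast
    have "\<Psi> \<in> ?T closure_of T" if \<Psi>: "\<Psi> \<in> C" for \<Psi>
      unfolding in_closure_of
    proof (intro conjI allI impI)
      show "\<Psi> \<in> topspace ?T" using \<Psi> top by simp
      fix V assume V: "\<Psi> \<in> V \<and> openin ?T V"
      then obtain W where W: "openin ?P W" "V = W \<inter> C" by (auto simp: openin_subtopology)
      obtain \<xi> where \<xi>: "dp \<xi>" "\<Psi> \<xi> < 0" "\<And>\<Psi>'. \<Psi>' \<in> S \<Longrightarrow> \<Psi>' \<xi> < 0 \<Longrightarrow> \<Psi>' \<in> W"
      proof (rule S_nbhd[OF W(1)])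
        show "\<Psi> \<in> W" "\<Psi> \<in> S" using V W(2) \<Psi> C(2) by auto
      qed (rule that)
      obtain \<Psi>' where "\<Psi>' \<in> T" "\<Psi>' \<xi> < 0"
        using T G(3)[OF _ \<Psi> \<xi>(1,2)] H_dense[OF _ \<Psi> \<xi>(1,2)] by blast
      moreover have "\<Psi>' \<in> C" using \<open>\<Psi>' \<in> T\<close> op openin_subset top by blast
      ultimately show "\<exists>y. y \<in> T \<and> y \<in> V" using \<xi>(3) C(2) W(2) by blast
    qed
    then show "?T closure_of T = topspace ?T"
      using closure_of_subset_topspace[of ?T T] top by blast
  qed
  have "?T closure_of \<Inter>(\<G> \<union> \<H>) = topspace ?T"
    using baire dense \<open>countable \<H>\<close> G(1) by (intro Baire_category) auto
  then have "\<Inter>(\<G> \<union> \<H>) \<inter> C \<noteq> {}"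
    using C(3) top by (metis closure_of_empty closure_of_restrict inf_commute)
  then obtain \<Phi> where \<Phi>: "\<Phi> \<in> C" "\<Phi> \<in> \<Inter>\<G>" "\<Phi> \<in> \<Inter>\<H>" by blast
  have "henkin \<Phi>"
  proof (rule henkin_countable)
    show "\<Phi> \<in> S" using \<Phi>(1) C(2) by blast
    fix q l i m assume "q \<in> Q"
    then have "\<Phi> \<in> H (q, l, i, m)" using \<Phi>(3) unfolding \<H>_def by blast
    then show "\<exists>k. \<Phi> (\<lambda>e. q (e \<circ> (list_map l)(i := k)))
      < \<Phi> (\<lambda>e. INF a\<in>X. q ((e \<circ> list_map l)(i := a))) + inverse (real (Suc m))"
      by (simp add: H_def)
  qed
  with \<Phi>(1,2) that show ?thesis by blast
qed

lemma henkin_imp_realized: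
  assumes "henkin \<Phi>"
  obtains e where "e \<in> Val" "\<Phi> = ev e" "\<And>x \<epsilon>. x \<in> X \<Longrightarrow> 0 < \<epsilon> \<Longrightarrow> \<exists>i. d x (e i) < \<epsilon>"
proof -
  interpret henkin_model L M \<Phi> using assms by unfold_locales
  obtain e where e: "e \<in> Val" "\<And>\<phi>. dp \<phi> \<Longrightarrow> \<phi> e = \<Phi> \<phi>"
    "\<And>x \<epsilon>. x \<in> X \<Longrightarrow> 0 < \<epsilon> \<Longrightarrow> \<exists>i. d x (e i) < \<epsilon>"
    using henkin_realized[OF categorical] by metis
  have "\<Phi> = ev e"
  proof
    show "\<Phi> \<phi> = ev e \<phi>" for \<phi>
      using e(2) spectrum_subset_extensional[OF \<Phi>_S] by (cases "dp \<phi>") (auto simp: extensional_def)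
  qed
  then show ?thesis using e that by blast
qed

section \<open>Saturation\<close>

text \<open>Copying \<Phi> to the even variables frees the odd ones for witnesses. Any Henkin type
  extending this copy is realized, and the even entries of its realization realize \<Phi>.\<close>

lemma saturation:
  assumes \<Phi>: "\<Phi> \<in> S"
  obtains e where "e \<in> Val" "\<Phi> = ev e"
proof -
  let ?P = "powertop_real (Collect dp)"
  define dbl where "dbl \<theta> = (\<lambda>e. \<theta> (\<lambda>i. e (2 * i)))" for \<theta> :: "(nat \<Rightarrow> 'a) \<Rightarrow> real"
  have dp_dbl: "dp (dbl \<theta>)" if "dp \<theta>" for \<theta>
    unfolding dbl_def by (rule dp_subst'[OF that])
  define C where "C = {\<Psi> \<in> S. \<forall>\<theta>. dp \<theta> \<longrightarrow> \<Psi> (dbl \<theta>) = \<Phi> \<theta>}"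
  have "closedin ?P {\<Psi> \<in> topspace ?P. \<Psi> (dbl \<theta>) \<in> {\<Phi> \<theta>}}" if "dp \<theta>" for \<theta>
    by (rule closedin_continuous_map_preimage[OF continuous_map_eval]) (use dp_dbl[OF that] in auto)
  then have "closedin ?P (S \<inter> (\<Inter>\<theta>\<in>Collect dp. {\<Psi> \<in> topspace ?P. \<Psi> (dbl \<theta>) \<in> {\<Phi> \<theta>}}))"
    using dp_const by (intro closedin_Int spectrum_closed closedin_INT) blast+
  moreover have "S \<inter> (\<Inter>\<theta>\<in>Collect dp. {\<Psi> \<in> topspace ?P. \<Psi> (dbl \<theta>) \<in> {\<Phi> \<theta>}}) = C"
    using closedin_subset[OF spectrum_closed, of Val "Collect dp"] unfolding C_def by auto
  ultimately have closed: "closedin ?P C" by simp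
  have "C \<noteq> {}"
  proof -
    \<comment> \<open>\<open>C\<close> is nonempty because each value can be repeated: variables
      \<open>2 * i\<close> and \<open>2 * i + 1\<close> both receive \<open>e i\<close>.\<close>
    define w where "w e = (\<lambda>i. e (i div 2))" for e :: "nat \<Rightarrow> 'a"
    have w: "w e \<in> Val" if "e \<in> Val" for e unfolding w_def by (rule Val_comp'[OF that])
    obtain \<Psi> where \<Psi>: "\<Psi> \<in> S"
      "\<And>F G \<epsilon>. finite F \<Longrightarrow> F \<subseteq> Collect dp \<Longrightarrow> finite G \<Longrightarrow> G \<subseteq> Collect dp \<Longrightarrow> 0 < \<epsilon> \<Longrightarrow>
         \<exists>x\<in>Val. (\<forall>f\<in>F. \<bar>f x - \<Phi> f\<bar> < \<epsilon>) \<and> (\<forall>g\<in>G. \<bar>g (w x) - \<Psi> g\<bar> < \<epsilon>)"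
      by (rule spectrum_transfer[OF \<Phi>, of w Val "Collect dp"]) (auto simp: w dp_bounded)
    have "\<Psi> (dbl \<theta>) = \<Phi> \<theta>" if \<theta>: "dp \<theta>" for \<theta>
    proof -
      have "\<bar>\<Psi> (dbl \<theta>) - \<Phi> \<theta>\<bar> \<le> 0"
      proof (rule field_le_epsilon)
        fix \<epsilon> :: real assume "\<epsilon> > 0"
        then obtain x where "x \<in> Val" "\<bar>\<theta> x - \<Phi> \<theta>\<bar> < \<epsilon>/2" "\<bar>dbl \<theta> (w x) - \<Psi> (dbl \<theta>)\<bar> < \<epsilon>/2"
          using \<Psi>(2)[of "{\<theta>}" "{dbl \<theta>}" "\<epsilon>/2"] \<theta> dp_dbl by auto
        moreover have "dbl \<theta> (w x) = \<theta> x" by (simp add: dbl_def w_def)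
        ultimately show "\<bar>\<Psi> (dbl \<theta>) - \<Phi> \<theta>\<bar> \<le> 0 + \<epsilon>" by linarith
      qed
      then show ?thesis by simp
    qed
    then show ?thesis using \<Psi>(1) unfolding C_def by blast
  qed
  have stable: "\<Psi>' \<in> C" if \<Psi>: "\<Psi> \<in> C" "\<Psi>' \<in> S" and
    eq: "\<And>\<theta>. dp \<theta> \<Longrightarrow> \<Psi>' (\<lambda>e. \<theta> (\<lambda>i. e (2 * i))) = \<Psi> (\<lambda>e. \<theta> (\<lambda>i. e (2 * i)))" for \<Psi> \<Psi>'
    using \<Psi> eq unfolding C_def dbl_def by simp
  have "C \<subseteq> S" by (auto simp: C_def)
  obtain \<Psi> where \<Psi>: "\<Psi> \<in> C" "henkin \<Psi>"
    by (rule ex_henkin[OF closed \<open>C \<subseteq> S\<close> \<open>C \<noteq> {}\<close> stable, where \<G> = "{}"]) auto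
  obtain e where e: "e \<in> Val" "\<Psi> = ev e" using henkin_imp_realized[OF \<Psi>(2)] by metis
  have "\<Phi> = ev (\<lambda>i. e (2 * i))"
  proof
    fix \<theta>
    show "\<Phi> \<theta> = ev (\<lambda>i. e (2 * i)) \<theta>"
    proof (cases "dp \<theta>")
      case True
      then have "\<Phi> \<theta> = \<Psi> (dbl \<theta>)" using \<Psi>(1) by (simp add: C_def)
      then show ?thesis using True dp_dbl[OF True] by (simp add: e(2) dbl_def)
    next
      case False
      then show ?thesis using spectrum_subset_extensional[OF \<Phi>] by (simp add: extensional_def)
    qed
  qed
  then show ?thesis using that[OF Val_comp'[OF e(1)]] by blast
qed

section \<open>Almost homogeneity\<close>

lemma dp_dist_sum: "dp (\<lambda>e. \<Sum>j<n::nat. d (e (\<sigma> j)) (e (\<tau> j)))"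
  by (intro dp_sum dp_distance) simp

text \<open>The types realized by a dense sequence form a comeagre set, and every dense sequence comes
  \<open>\<epsilon>\<close>-close to \<open>a\<close> at some indices \<open>l\<close>. By Baire, for some \<open>l\<close> the types of the sequences which are
  close to \<open>a\<close> at \<open>l\<close> are dense in a nonempty open set.\<close>

lemma somewhere_dense:
  assumes a: "a \<in> Val" and \<epsilon>: "0 < \<epsilon>"
  obtains l \<xi> e0 where "dp \<xi>" "e0 \<in> Val" "\<xi> e0 < 0" "(\<Sum>j<n. d (e0 (l j)) (a j)) < \<epsilon>"
    "\<And>z \<theta>. z \<in> Val \<Longrightarrow> \<xi> z < 0 \<Longrightarrow> dp \<theta> \<Longrightarrow> \<theta> z < 0 \<Longrightarrow>
      \<exists>e\<in>Val. \<theta> e < 0 \<and> (\<Sum>j<n. d (e (l j)) (a j)) < \<epsilon>"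
proof -
  let ?P = "powertop_real (Collect dp)"
  define A where "A l = {e \<in> Val. (\<Sum>j<n. d (e (list_map l j)) (a j)) < \<epsilon>}" for l
  \<comment> \<open>\<open>G l\<close> is the complement in \<open>S\<close> of the closure of the
    types of \<open>A l\<close>. So \<open>ev z \<notin> G l\<close> says that the type of
    \<open>z\<close> is a limit of types of sequences in \<open>A l\<close>.\<close>
  define G where "G l = {\<Phi> \<in> S. \<exists>\<theta>. dp \<theta> \<and> \<Phi> \<theta> < 0 \<and> (\<forall>e\<in>A l. 0 \<le> \<theta> e)}" for l
  have "\<exists>l. \<exists>\<xi> e0. dp \<xi> \<and> e0 \<in> Val \<and> \<xi> e0 < 0 \<and> (\<forall>z\<in>Val. \<xi> z < 0 \<longrightarrow> ev z \<notin> G l)"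
  proof (rule ccontr)
    assume no: "\<not> ?thesis"
    have open_less: "openin ?P {\<Phi> \<in> topspace ?P. \<Phi> \<theta> < 0}" if "dp \<theta>" for \<theta>
    proof -
      have "openin ?P {\<Phi> \<in> topspace ?P. \<Phi> \<theta> \<in> {..<0}}"
        by (rule openin_continuous_map_preimage[OF continuous_map_eval]) (use that in \<open>auto simp flip: open_openin\<close>)
      then show ?thesis by simp
    qed
    obtain \<Phi> where \<Phi>: "\<Phi> \<in> S" "\<Phi> \<in> \<Inter>(range G)" "henkin \<Phi>"
    proof (rule ex_henkin[where \<G> = "range G" and C = S])
      show "closedin ?P S" by (rule spectrum_closed)
      show "S \<noteq> {}" using ev_S[OF a] by blast
      show "openin (subtopology ?P S) T" if T': "T \<in> range G" for T
      proof -
        obtain l where T: "T = G l" using T' by blast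
        have "openin ?P (\<Union>\<theta>\<in>{\<theta>. dp \<theta> \<and> (\<forall>e\<in>A l. 0 \<le> \<theta> e)}. {\<Phi> \<in> topspace ?P. \<Phi> \<theta> < 0})"
          using open_less by (intro openin_Union) blast
        moreover have "T = S \<inter> (\<Union>\<theta>\<in>{\<theta>. dp \<theta> \<and> (\<forall>e\<in>A l. 0 \<le> \<theta> e)}. {\<Phi> \<in> topspace ?P. \<Phi> \<theta> < 0})"
          unfolding T G_def using closedin_subset[OF spectrum_closed, of Val "Collect dp"] by blast
        ultimately show ?thesis by (simp add: openin_subtopology_Int2)
      qed
      show "\<exists>\<Psi>'\<in>T. \<Psi>' \<theta> < 0" if T: "T \<in> range G" and \<Psi>: "\<Psi> \<in> S" "dp \<theta>" "\<Psi> \<theta> < 0" for T \<Psi> \<theta>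
      proof -
        obtain l where l: "T = G l" using T by blast
        obtain e where e: "e \<in> Val" "\<Psi> = ev e" using saturation[OF \<Psi>(1)] by metis
        then have "\<theta> e < 0" using \<Psi>(2,3) by simp
        then obtain z where z: "z \<in> Val" "\<theta> z < 0" "ev z \<in> G l" using no \<Psi>(2) e(1) by blast
        then have "ev z \<theta> < 0" using \<Psi>(2) by simp
        with z(3) l show ?thesis by blast
      qed
    qed auto
    obtain e where e: "e \<in> Val" "\<Phi> = ev e" "\<And>x \<epsilon>. x \<in> X \<Longrightarrow> 0 < \<epsilon> \<Longrightarrow> \<exists>i. d x (e i) < \<epsilon>"
      using henkin_imp_realized[OF \<Phi>(3)] by metis
    \<comment> \<open>Each of the \<open>n\<close> summands gets the share
      \<open>\<epsilon> / (n + 1)\<close>; the added 1 makes the sum strictly smaller than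
      \<epsilon> and covers \<open>n = 0\<close>.\<close>
    have "\<epsilon> / (real n + 1) > 0" using \<epsilon> by simp
    then have "\<exists>i. d (a j) (e i) < \<epsilon> / (real n + 1)" for j using e(3)[OF Val_in[OF a]] by blast
    then obtain f where f: "\<And>j. d (a j) (e (f j)) < \<epsilon> / (real n + 1)" by metis
    define l where "l = map f [0..<n]"
    have "(\<Sum>j<n. d (e (list_map l j)) (a j)) \<le> (\<Sum>j<n. \<epsilon> / (real n + 1))"
    proof (rule sum_mono)
      fix j assume "j \<in> {..<n}"
      then have "list_map l j = f j" by (simp add: list_map_def l_def)
      then show "d (e (list_map l j)) (a j) \<le> \<epsilon> / (real n + 1)"
        using f[of j] by (simp add: mdist_commute)
    qed
    also have "\<dots> = real n * (\<epsilon> / (real n + 1))" by simp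
    also have "\<dots> < \<epsilon>" using \<epsilon> by (simp add: field_simps)
    finally have "e \<in> A l" using e(1) by (simp add: A_def)
    moreover have "\<Phi> \<in> G l" using \<Phi>(2) by blast
    ultimately show False unfolding G_def e(2) by force
  qed
  then obtain l \<xi> e where 1: "dp \<xi>" "e \<in> Val" "\<xi> e < 0" "\<And>z. z \<in> Val \<Longrightarrow> \<xi> z < 0 \<Longrightarrow> ev z \<notin> G l" by metis
  have approx: "\<exists>x\<in>Val. \<theta> x < 0 \<and> (\<Sum>j<n. d (x (list_map l j)) (a j)) < \<epsilon>"
    if z: "z \<in> Val" "\<xi> z < 0" and \<theta>: "dp \<theta>" "\<theta> z < 0" for z \<theta>
  proof -
    have "ev z \<notin> G l" using 1(4) z by blast
    moreover have "ev z \<theta> < 0" using \<theta> by simp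
    ultimately have "\<not> (\<forall>e\<in>A l. 0 \<le> \<theta> e)"
      unfolding G_def using ev_S[OF z(1)] \<theta>(1) by blast
    then obtain x where "x \<in> A l" "\<theta> x < 0" by (meson not_le)
    then show ?thesis unfolding A_def by blast
  qed
  \<comment> \<open>Testing density against \<xi> itself yields a point of the open set that is also
    close to \<open>a\<close> at the indices \<open>l\<close>.\<close>
  obtain e0 where e0: "e0 \<in> Val" "\<xi> e0 < 0" "(\<Sum>j<n. d (e0 (list_map l j)) (a j)) < \<epsilon>"
    using approx[OF 1(2,3) 1(1,3)] by blast
  show ?thesis by (rule that[OF 1(1) e0 approx])
qed

text \<open>Let \<open>\<xi> c\<close> say that some \<open>z\<close> in the open set of
  \<open>somewhere_dense\<close> is close to \<open>c\<close> at the indices \<open>l\<close>;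
  \<open>e0\<close> shows this for \<open>a\<close>. If \<open>z\<close> shows it for
  \<open>b\<close>, the type of \<open>z\<close> is a limit of types of sequences \<open>e\<close>
  close to \<open>a\<close> at \<open>l\<close>. For these, some point satisfying \<theta>, namely
  \<open>a\<close>, is close to \<open>e\<close> at \<open>l\<close>; this definable statement
  passes to \<open>z\<close>, and its witness there is close to \<open>b\<close>.\<close>

lemma weak_extension:
  assumes a: "a \<in> Val" and \<epsilon>: "0 < \<epsilon>"
  obtains \<xi> where "dp \<xi>" "\<xi> a < 0"
    "\<And>b \<theta>. b \<in> Val \<Longrightarrow> \<xi> b < 0 \<Longrightarrow> dp \<theta> \<Longrightarrow> \<theta> a < 0 \<Longrightarrow>
      \<exists>a'\<in>Val. \<theta> a' < 0 \<and> (\<Sum>j<n. d (a' j) (b j)) < \<epsilon>"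
proof -
  have e4: "\<epsilon>/4 > 0" using \<epsilon> by simp
  obtain l \<zeta> e0 where \<zeta>: "dp \<zeta>" "e0 \<in> Val" "\<zeta> e0 < 0" "(\<Sum>j<n. d (e0 (l j)) (a j)) < \<epsilon>/4"
    "\<And>z \<theta>. z \<in> Val \<Longrightarrow> \<zeta> z < 0 \<Longrightarrow> dp \<theta> \<Longrightarrow> \<theta> z < 0 \<Longrightarrow>
      \<exists>e\<in>Val. \<theta> e < 0 \<and> (\<Sum>j<n. d (e (l j)) (a j)) < \<epsilon>/4"
    by (rule somewhere_dense[OF a e4, of n]) (rule that)
  define \<psi>1 where "\<psi>1 v = max (\<zeta> (\<lambda>i. v (Suc (2 * i))))
      ((\<Sum>j<n. d (v (Suc (2 * l j))) (v (2 * j))) - \<epsilon>/2)" for v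
  have \<psi>1: "dp \<psi>1"
    unfolding \<psi>1_def[abs_def]
    by (intro dp_max dp_diff dp_const dp_dist_sum) (rule dp_subst'[OF \<zeta>(1)])
  have \<psi>1_eq: "\<psi>1 (interleave c z) = max (\<zeta> z) ((\<Sum>j<n. d (z (l j)) (c j)) - \<epsilon>/2)" for c z
    by (simp add: \<psi>1_def)
  define \<xi> where "\<xi> c = (INF z\<in>Val. \<psi>1 (interleave c z))" for c
  have dp\<xi>: "dp \<xi>" unfolding \<xi>_def[abs_def] by (rule dp_INF_interleave[OF \<psi>1])
  have \<xi>_less: "\<xi> c < 0 \<longleftrightarrow> (\<exists>z\<in>Val. \<psi>1 (interleave c z) < 0)" if "c \<in> Val" for c
    unfolding \<xi>_def by (rule INF_interleave_less[OF \<psi>1 that])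
  have "\<psi>1 (interleave a e0) < 0" unfolding \<psi>1_eq using \<zeta>(3,4) e4 by simp
  then have "\<xi> a < 0" using \<xi>_less[OF a] \<zeta>(2) by blast
  moreover have "\<exists>a'\<in>Val. \<theta> a' < 0 \<and> (\<Sum>j<n. d (a' j) (b j)) < \<epsilon>"
    if b: "b \<in> Val" "\<xi> b < 0" and \<theta>: "dp \<theta>" "\<theta> a < 0" for b \<theta>
  proof -
    obtain z where z: "z \<in> Val" "\<psi>1 (interleave b z) < 0" using \<xi>_less[OF b(1)] b(2) by blast
    then have z': "\<zeta> z < 0" "(\<Sum>j<n. d (z (l j)) (b j)) < \<epsilon>/2" unfolding \<psi>1_eq by auto
    define \<psi>2 where "\<psi>2 v = max (\<theta> (\<lambda>i. v (Suc (2 * i))))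
      ((\<Sum>j<n. d (v (2 * l j)) (v (Suc (2 * j)))) - \<epsilon>/2)" for v
    have \<psi>2: "dp \<psi>2"
      unfolding \<psi>2_def[abs_def]
      by (intro dp_max dp_diff dp_const dp_dist_sum) (rule dp_subst'[OF \<theta>(1)])
    have \<psi>2_eq: "\<psi>2 (interleave c x) = max (\<theta> x) ((\<Sum>j<n. d (c (l j)) (x j)) - \<epsilon>/2)" for c x
      by (simp add: \<psi>2_def)
    define \<theta>' where "\<theta>' c = (INF x\<in>Val. \<psi>2 (interleave c x))" for c
    have dp\<theta>': "dp \<theta>'" unfolding \<theta>'_def[abs_def] by (rule dp_INF_interleave[OF \<psi>2])
    \<comment> \<open>The margin with which \<open>a\<close> itself shows
      \<open>\<theta>' e < 0\<close>: both \<theta> \<open>a\<close> and the distance term, less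
      than \<open>\<epsilon>/4 - \<epsilon>/2\<close>, are at most \<open>-\<kappa>\<close>. A gap
      independent of \<open>e\<close> is needed, since the types of the \<open>e\<close> merely
      approximate that of \<open>z\<close>.\<close>
    define \<kappa> where "\<kappa> = min (- \<theta> a) (\<epsilon>/4)"
    have \<kappa>: "\<kappa> > 0" using \<theta>(2) e4 by (simp add: \<kappa>_def)
    have "\<theta>' z < 0"
    proof (rule ccontr)
      assume "\<not> \<theta>' z < 0"
      then have "- \<theta>' z - \<kappa>/2 < 0" using \<kappa> by simp
      moreover have "dp (\<lambda>c. - \<theta>' c - \<kappa>/2)" by (intro dp_diff dp_uminus dp_const dp\<theta>')
      ultimately obtain e where e: "e \<in> Val" "- \<theta>' e - \<kappa>/2 < 0" "(\<Sum>j<n. d (e (l j)) (a j)) < \<epsilon>/4"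
        using \<zeta>(5)[OF z(1) z'(1), of "\<lambda>c. - \<theta>' c - \<kappa>/2"] by blast
      have "\<psi>2 (interleave e a) < - \<kappa>/2"
        unfolding \<psi>2_eq using e(3) \<theta>(2) e4 by (auto simp: \<kappa>_def min_def)
      then have "\<theta>' e < - \<kappa>/2"
        unfolding \<theta>'_def using INF_interleave_less[OF \<psi>2 e(1)] a by blast
      with e(2) show False by linarith
    qed
    then obtain x where x: "x \<in> Val" "\<psi>2 (interleave z x) < 0"
      unfolding \<theta>'_def using INF_interleave_less[OF \<psi>2 z(1)] by blast
    then have x': "\<theta> x < 0" "(\<Sum>j<n. d (z (l j)) (x j)) < \<epsilon>/2" unfolding \<psi>2_eq by auto
    have "(\<Sum>j<n. d (x j) (b j)) \<le> (\<Sum>j<n. d (z (l j)) (x j) + d (z (l j)) (b j))"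
      using mdist_triangle[of "x _" "metric M" "z (l _)" "b _"] x(1) z(1) b(1)
      by (intro sum_mono) (metis Val_in mdist_commute)
    also have "\<dots> < \<epsilon>" using x'(2) z'(2) by (simp add: sum.distrib)
    finally show ?thesis using x(1) x'(1) by blast
  qed
  ultimately show ?thesis using that[OF dp\<xi>] by blast
qed

end

section \<open>Automorphisms from dense sequences of the same type\<close>

context mstruct
begin

lemma X_Cauchy:
  assumes "\<And>n::nat. s n \<in> X" "\<And>\<epsilon>. \<epsilon> > 0 \<Longrightarrow> \<exists>N. \<forall>m\<ge>N. \<forall>n\<ge>N. d (s m) (s n) < \<epsilon>"
  obtains l where "l \<in> X" "(\<lambda>n. d (s n) l) \<longlonglongrightarrow> 0"
proof -
  interpret X: Metric_space X d by simp
  have "X.MCauchy s" unfolding X.MCauchy_def using assms by blast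
  moreover have "X.mcomplete" using X_complete by (simp add: mcomplete_of_def)
  ultimately obtain l where "limitin X.mtopology s l sequentially" unfolding X.mcomplete_def by blast
  then show ?thesis using that unfolding X.limitin_metric_dist_null by blast
qed

lemma dist_tendsto:
  assumes "\<And>n. s n \<in> X" "l \<in> X" "(\<lambda>n. d (s n) l) \<longlonglongrightarrow> 0" "z \<in> X"
  shows "(\<lambda>n::nat. d (s n) z) \<longlonglongrightarrow> d l z"
proof -
  have "\<bar>d (s n) z - d l z\<bar> \<le> d (s n) l" for n
    using mdist_triangle[of "s n" "metric M" l z] mdist_triangle[of l "metric M" "s n" z] assms(1,2,4)
    by (simp add: mdist_commute abs_le_iff)
  then have "(\<lambda>n. d (s n) z - d l z) \<longlonglongrightarrow> 0"
    by (intro Lim_null_comparison[OF _ assms(3)]) simp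
  then show ?thesis by (simp add: LIM_zero_iff)
qed

lemma dp_tendsto:
  assumes "dp \<phi>" "\<And>n::nat. x n \<in> Val" "e \<in> Val" "\<And>j. (\<lambda>n. d (x n j) (e j)) \<longlonglongrightarrow> 0"
  shows "(\<lambda>n. \<phi> (x n)) \<longlonglongrightarrow> \<phi> e"
proof (rule tendstoI)
  fix \<epsilon> :: real assume "\<epsilon> > 0"
  from ucontD[OF dp_ucont[OF assms(1)] this] obtain k \<delta> where 1: "\<delta> > 0"
    "\<And>e e'. e \<in> Val \<Longrightarrow> e' \<in> Val \<Longrightarrow> (\<And>i. i < k \<Longrightarrow> d (e i) (e' i) < \<delta>) \<Longrightarrow> \<bar>\<phi> e - \<phi> e'\<bar> < \<epsilon>"
    by metis
  have "\<forall>\<^sub>F n in sequentially. \<forall>j\<in>{..<k}. d (x n j) (e j) < \<delta>"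
    using order_tendstoD(2)[OF assms(4) 1(1)] by (intro eventually_ball_finite) auto
  then show "\<forall>\<^sub>F n in sequentially. dist (\<phi> (x n)) (\<phi> e) < \<epsilon>"
    by eventually_elim (use 1(2)[OF assms(2,3)] in \<open>auto simp: dist_real_def\<close>)
qed

definition dense_seq :: "(nat \<Rightarrow> 'a) \<Rightarrow> bool"
  where "dense_seq e \<longleftrightarrow> e \<in> Val \<and> (\<forall>x\<in>X. \<forall>\<epsilon>>0. \<exists>i. d x (e i) < \<epsilon>)"

definition same_type :: "(nat \<Rightarrow> 'a) \<Rightarrow> (nat \<Rightarrow> 'a) \<Rightarrow> bool"
  where "same_type e e' \<longleftrightarrow> (\<forall>\<phi>. dp \<phi> \<longrightarrow> \<phi> e = \<phi> e')"

lemma same_type_sym: "same_type e e' \<Longrightarrow> same_type e' e"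
  unfolding same_type_def by metis

lemma dense_seqD:
  assumes "dense_seq e" "x \<in> X" "\<epsilon> > 0"
  obtains i where "d x (e i) < \<epsilon>"
  using assms unfolding dense_seq_def by blast

lemma dense_seq_tendsto:
  assumes "dense_seq e" "x \<in> X"
  obtains i where "(\<lambda>n::nat. d (e (i n)) x) \<longlonglongrightarrow> 0" "\<And>n. d (e (i n)) x < inverse (real (Suc n))"
proof -
  have "\<forall>n. \<exists>i. d x (e i) < inverse (real (Suc n))"
    using assms unfolding dense_seq_def by simp
  then obtain i where i: "\<And>n. d x (e (i n)) < inverse (real (Suc n))" by metis
  have i': "d (e (i n)) x < inverse (real (Suc n))" for n using i[of n] by (simp add: mdist_commute)
  moreover have "(\<lambda>n. d (e (i n)) x) \<longlonglongrightarrow> 0"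
    by (rule Lim_null_comparison[OF _ LIMSEQ_inverse_real_of_nat])
      (use i' in \<open>auto intro!: always_eventually less_imp_le\<close>)
  ultimately show ?thesis using that by blast
qed

lemma dense_seq_unique:
  assumes "dense_seq e" "x \<in> X" "y \<in> X" "\<And>i. d x (e i) = d y (e i)"
  shows "x = y"
proof (rule ccontr)
  assume "x \<noteq> y"
  then have "d x y > 0" using assms by (metis mdist_nonneg mdist_zero less_eq_real_def)
  then obtain i where "d x (e i) < d x y / 2" using dense_seqD[OF assms(1,2)] half_gt_zero by blast
  moreover have "e i \<in> X" using assms(1) by (simp add: dense_seq_def)
  ultimately show False
    using mdist_triangle[of x "metric M" "e i" y] assms(2-4) by (simp add: mdist_commute)
qed

text \<open>Distances between entries belong to the type, so the indices of a subsequence of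
  \<open>e\<close> converging to \<open>x\<close> also give a Cauchy sequence in \<open>e'\<close>;
  its limit has the required distances.\<close>

lemma extension_point:
  assumes e: "dense_seq e" "e' \<in> Val" "same_type e e'" and x: "x \<in> X"
  shows "\<exists>y\<in>X. \<forall>i. d y (e' i) = d x (e i)"
proof -
  have eV: "e \<in> Val" using e(1) by (simp add: dense_seq_def)
  have eq: "d (e i) (e j) = d (e' i) (e' j)" for i j
    using e(3) dp_distance[of i j] unfolding same_type_def by blast
  obtain i where i: "(\<lambda>n::nat. d (e (i n)) x) \<longlonglongrightarrow> 0" "\<And>n. d (e (i n)) x < inverse (real (Suc n))"
    using dense_seq_tendsto[OF e(1) x] by metis
  have "\<exists>N. \<forall>m\<ge>N. \<forall>n\<ge>N. d (e' (i m)) (e' (i n)) < \<epsilon>" if \<epsilon>: "\<epsilon> > 0" for \<epsilon>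
  proof -
    obtain N where N: "\<And>n. n \<ge> N \<Longrightarrow> d (e (i n)) x < \<epsilon>/2"
      using order_tendstoD(2)[OF i(1) half_gt_zero[OF \<epsilon>]] by (auto simp: eventually_sequentially)
    have "d (e' (i m)) (e' (i n)) < \<epsilon>" if "m \<ge> N" "n \<ge> N" for m n
      using N[OF that(1)] N[OF that(2)] mdist_triangle[of "e (i m)" "metric M" x "e (i n)"] eV x
      by (simp add: eq[symmetric] mdist_commute)
    then show ?thesis by blast
  qed
  then obtain y where y: "y \<in> X" "(\<lambda>n. d (e' (i n)) y) \<longlonglongrightarrow> 0"
    using X_Cauchy[of "\<lambda>n. e' (i n)"] e(2) by (metis Val_in)
  have "d y (e' j) = d x (e j)" for j
  proof (rule LIMSEQ_unique)
    show "(\<lambda>n. d (e' (i n)) (e' j)) \<longlonglongrightarrow> d y (e' j)"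
      by (rule dist_tendsto[OF _ y]) (use e(2) in auto)
    show "(\<lambda>n. d (e' (i n)) (e' j)) \<longlonglongrightarrow> d x (e j)"
      unfolding eq[symmetric] by (rule dist_tendsto[OF _ x i(1)]) (use eV in auto)
  qed
  then show ?thesis using y(1) by blast
qed

text \<open>A point is determined by its distances to a dense sequence, so these distances define
  \<open>g\<close>, and by symmetry its inverse. Predicates are preserved because each valuation is
  a limit of substitutions \<open>e \<circ> \<sigma>\<close>, and on
  \<open>e \<circ> \<sigma>\<close> and \<open>e' \<circ> \<sigma>\<close> they agree.\<close>

lemma ex_automorphism:
  assumes e: "dense_seq e" "dense_seq e'" "same_type e e'"
  obtains g where "g \<in> Aut L M" "\<And>i. g (e i) = e' i"
proof -
  have V: "e \<in> Val" "e' \<in> Val" using e by (auto simp: dense_seq_def)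
  note st = same_type_sym[OF e(3)]
  obtain g where g: "\<And>x. x \<in> X \<Longrightarrow> g x \<in> X" "\<And>x i. x \<in> X \<Longrightarrow> d (g x) (e' i) = d x (e i)"
    using extension_point[OF e(1) V(2) e(3)] by metis
  obtain g' where g': "\<And>x. x \<in> X \<Longrightarrow> g' x \<in> X" "\<And>x i. x \<in> X \<Longrightarrow> d (g' x) (e i) = d x (e' i)"
    using extension_point[OF e(2) V(1) st] by metis
  have inv: "g' (g x) = x" "g (g' x) = x" if "x \<in> X" for x
    by (rule dense_seq_unique[OF e(1)], use that g g' in auto)
      (rule dense_seq_unique[OF e(2)], use that g g' in auto)
  have eq: "d (e i) (e j) = d (e' i) (e' j)" for i j
    using e(3) dp_distance[of i j] unfolding same_type_def by blast
  have ge: "g (e i) = e' i" for i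
    using g V eq by (intro dense_seq_unique[OF e(2)]) auto
  have iso: "d (g x) (g y) = d x y" if "x \<in> X" "y \<in> X" for x y
  proof -
    obtain i where i: "(\<lambda>n::nat. d (e (i n)) x) \<longlonglongrightarrow> 0" using dense_seq_tendsto[OF e(1) \<open>x \<in> X\<close>] by metis
    have flip: "d (e' j) (g z) = d (e j) z" if "z \<in> X" for j z
      using g(2)[OF that, of j] by (simp add: mdist_commute)
    show ?thesis
    proof (rule LIMSEQ_unique)
      show "(\<lambda>n. d (e' (i n)) (g y)) \<longlonglongrightarrow> d (g x) (g y)"
        by (rule dist_tendsto) (use V g that flip[OF that(1)] i in auto)
      show "(\<lambda>n. d (e' (i n)) (g y)) \<longlonglongrightarrow> d x y"
        unfolding flip[OF that(2)] by (rule dist_tendsto[OF _ _ i]) (use V that in auto)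
    qed
  qed
  have inv_dp: "\<phi> (g \<circ> v) = \<phi> v" if \<phi>: "dp \<phi>" and v: "v \<in> Val" for \<phi> v
  proof -
    have "\<exists>i. (\<lambda>n::nat. d (e (i n)) (v j)) \<longlonglongrightarrow> 0" for j
      using dense_seq_tendsto[OF e(1) Val_in[OF v, of j]] by metis
    then obtain i where i: "\<And>j. (\<lambda>n::nat. d (e (i j n)) (v j)) \<longlonglongrightarrow> 0" by metis
    have "(\<lambda>n. \<phi> (e \<circ> (\<lambda>j. i j n))) \<longlonglongrightarrow> \<phi> v"
      by (rule dp_tendsto[OF \<phi>]) (use V v i in auto)
    moreover have "(\<lambda>n. \<phi> (e' \<circ> (\<lambda>j. i j n))) \<longlonglongrightarrow> \<phi> (g \<circ> v)"
    proof (rule dp_tendsto[OF \<phi>])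
      show "g \<circ> v \<in> Val" using v g by (simp add: Val_iff)
      show "(\<lambda>n. d ((e' \<circ> (\<lambda>j. i j n)) j) ((g \<circ> v) j)) \<longlonglongrightarrow> 0" for j
        using i[of j] iso[of _ "v j"] V v by (simp add: ge[symmetric])
    qed (use V in auto)
    moreover have "\<phi> (e \<circ> \<sigma>) = \<phi> (e' \<circ> \<sigma>)" for \<sigma>
      using e(3) dp_subst[OF \<phi>, of \<sigma>] unfolding same_type_def by blast
    ultimately show ?thesis using LIMSEQ_unique by (simp only:)
  qed
  have pred: "pred M p (map g xs) = pred M p xs" if p: "p \<in> symbols L" and xs: "xs \<in> tuples M (arity L p)" for p xs
  proof -
    define v where "v j = (if j < length xs then xs ! j else e 0)" for j
    have len: "length xs = arity L p" and X: "set xs \<subseteq> X" using xs by (auto simp: tuples_def)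
    have "v \<in> Val" using X V by (auto simp: Val_iff v_def)
    moreover have "map v [0..<arity L p] = xs" by (rule nth_equalityI) (auto simp: v_def len)
    moreover have "map (g \<circ> v) [0..<arity L p] = map g xs" by (rule nth_equalityI) (auto simp: v_def len)
    moreover have "dp (\<lambda>v. pred M p (map v [0..<arity L p]))"
      by (rule definable_predicate.predicate[OF p]) simp
    ultimately show ?thesis using inv_dp[of "\<lambda>v. pred M p (map v [0..<arity L p])" v] by simp
  qed
  have "bij_betw g X X"
    by (rule bij_betwI[of g X X g']) (use g g' inv in auto)
  then have "isomorphism L M M g" unfolding isomorphism_def using iso pred by blast
  define g1 where "g1 = restrict g X"
  have g1: "g1 x = g x" if "x \<in> X" for x using that by (simp add: g1_def)
  have "g1 \<in> Aut L M"
    unfolding Aut_def isomorphism_def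
  proof (intro CollectI conjI ballI)
    show "g1 \<in> extensional X" by (simp add: g1_def)
    show "bij_betw g1 X X" using \<open>bij_betw g X X\<close> g1 by (simp cong: bij_betw_cong)
    show "d (g1 x) (g1 y) = d x y" if "x \<in> X" "y \<in> X" for x y using iso that g1 by simp
    show "pred M p (map g1 xs) = pred M p xs" if "p \<in> symbols L" "xs \<in> tuples M (arity L p)" for p xs
    proof -
      have "map g1 xs = map g xs" using that(2) g1 by (auto simp: tuples_def)
      then show ?thesis using pred[OF that] by (simp only:)
    qed
  qed
  moreover have "g1 (e i) = e' i" for i using ge g1 V by simp
  ultimately show ?thesis using that by blast
qed

end

section \<open>From approximate to exact equality of types\<close>

context categorical_structure
begin

text \<open>Iterating \<open>weak_extension\<close> from \<open>b\<close> gives a sequence of tuples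
  whose types converge to that of \<open>a\<close> and which is Cauchy in each coordinate. By
  completeness it has a limit, which has exactly the type of \<open>a\<close>.\<close>

lemma extension:
  assumes a: "a \<in> Val" and \<epsilon>: "0 < \<epsilon>"
  obtains \<xi> where "dp \<xi>" "\<xi> a < 0"
    "\<And>b. b \<in> Val \<Longrightarrow> \<xi> b < 0 \<Longrightarrow> \<exists>a'\<in>Val. same_type a a' \<and> (\<Sum>j<n. d (a' j) (b j)) < \<epsilon>"
proof -
  \<comment> \<open>These shares sum to \<open>\<epsilon>/2\<close>, so the limit stays strictly
    within \<epsilon> of \<open>b\<close>. At stage \<open>k\<close> they bound the change in
    \<open>n + k\<close> coordinates, so every coordinate is controlled eventually.\<close>
  define r where "r k = \<epsilon> / 2 ^ (k + 2)" for k :: nat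
  have r: "r k > 0" for k using \<epsilon> by (simp add: r_def)
  have "\<exists>\<xi>. dp \<xi> \<and> \<xi> a < 0 \<and> (\<forall>b \<theta>. b \<in> Val \<longrightarrow> \<xi> b < 0 \<longrightarrow> dp \<theta> \<longrightarrow> \<theta> a < 0 \<longrightarrow>
      (\<exists>a'\<in>Val. \<theta> a' < 0 \<and> (\<Sum>j<n+k. d (a' j) (b j)) < r k))" for k
    using weak_extension[OF a r[of k], of "n + k"] by metis
  then obtain \<xi> where \<xi>: "\<And>k. dp (\<xi> k)" "\<And>k. \<xi> k a < 0"
    "\<And>k b \<theta>. b \<in> Val \<Longrightarrow> \<xi> k b < 0 \<Longrightarrow> dp \<theta> \<Longrightarrow> \<theta> a < 0 \<Longrightarrow>
      \<exists>a'\<in>Val. \<theta> a' < 0 \<and> (\<Sum>j<n+k. d (a' j) (b j)) < r k" by metis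
  have "Q \<noteq> {}" using Q_dense[OF dp_const zero_less_one] by blast
  then obtain q :: "nat \<Rightarrow> _" where q: "range q = Q"
    using countable_Q by (metis range_from_nat_into)
  have dq: "dp (q i)" for i using dp_Q q by blast
  \<comment> \<open>What the next tuple must satisfy: the condition \<open>\<xi> (Suc k)\<close>, so
    that the iteration can continue, and agreement with \<open>a\<close> up to
    \<open>1/(k+1)\<close> on the first \<open>k+1\<close> predicates of \<open>Q\<close>.\<close>
  define \<theta> where "\<theta> k e = max (\<xi> (Suc k) e) ((\<Sum>i<Suc k. \<bar>q i e - q i a\<bar>) - inverse (real (Suc k)))" for k e
  have \<theta>: "dp (\<theta> k)" "\<theta> k a < 0" for k
  proof -
    show "dp (\<theta> k)"
      unfolding \<theta>_def[abs_def] by (intro dp_max dp_diff dp_sum dp_abs dp_const \<xi>(1) dq) simp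
    show "\<theta> k a < 0" using \<xi>(2) by (simp add: \<theta>_def)
  qed
  have "\<exists>a'\<in>Val. same_type a a' \<and> (\<Sum>j<n. d (a' j) (b j)) < \<epsilon>" if b: "b \<in> Val" "\<xi> 0 b < 0" for b
  proof -
    have "\<exists>s. \<forall>k. (s k \<in> Val \<and> \<xi> k (s k) < 0 \<and> (k = 0 \<longrightarrow> s k = b)) \<and>
       (\<theta> k (s (Suc k)) < 0 \<and> (\<Sum>j<n+k. d (s (Suc k) j) (s k j)) < r k)"
    proof (rule dependent_nat_choice)
      show "\<exists>x. x \<in> Val \<and> \<xi> 0 x < 0 \<and> (0 = (0::nat) \<longrightarrow> x = b)" using b by blast
      fix x k assume "x \<in> Val \<and> \<xi> k x < 0 \<and> (k = 0 \<longrightarrow> x = b)"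
      then obtain y where "y \<in> Val" "\<theta> k y < 0" "(\<Sum>j<n+k. d (y j) (x j)) < r k"
        using \<xi>(3)[OF _ _ \<theta>, of x k] by blast
      then show "\<exists>y. (y \<in> Val \<and> \<xi> (Suc k) y < 0 \<and> (Suc k = 0 \<longrightarrow> y = b)) \<and>
          (\<theta> k y < 0 \<and> (\<Sum>j<n+k. d (y j) (x j)) < r k)"
        by (auto simp: \<theta>_def)
    qed
    then obtain s where s: "\<And>k. s k \<in> Val" "s 0 = b" "\<And>k. \<theta> k (s (Suc k)) < 0"
      "\<And>k. (\<Sum>j<n+k. d (s (Suc k) j) (s k j)) < r k" by metis
    \<comment> \<open>The right-hand side is the geometric sum of \<open>r k, ..., r (k+m-1)\<close>
      in closed form, which makes the induction telescope.\<close>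
    have step: "(\<Sum>j\<in>I. d (s (k + m) j) (s k j)) \<le> \<epsilon> / 2^(k+1) - \<epsilon> / 2^(k+m+1)"
      if I: "I \<subseteq> {..<n+k}" for I k m
    proof (induction m)
      case 0
      have "(\<Sum>j\<in>I. d (s k j) (s k j)) = 0" using s(1) by simp
      then show ?case by simp
    next
      case (Suc m)
      have "(\<Sum>j\<in>I. d (s (k + Suc m) j) (s (k+m) j)) \<le> (\<Sum>j<n+(k+m). d (s (Suc (k+m)) j) (s (k+m) j))"
        using I by (simp, intro sum_mono2) auto
      also have "\<dots> \<le> r (k+m)" using s(4)[of "k+m"] by simp
      finally have 1: "(\<Sum>j\<in>I. d (s (k + Suc m) j) (s (k+m) j)) \<le> r (k+m)" .
      have "(\<Sum>j\<in>I. d (s (k + Suc m) j) (s k j)) \<le>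
          (\<Sum>j\<in>I. d (s (k + Suc m) j) (s (k+m) j) + d (s (k+m) j) (s k j))"
        using s(1) by (intro sum_mono mdist_triangle) auto
      also have "\<dots> \<le> r (k+m) + (\<epsilon> / 2^(k+1) - \<epsilon> / 2^(k+m+1))"
        using 1 Suc by (simp add: sum.distrib)
      also have "\<dots> = \<epsilon> / 2^(k+1) - \<epsilon> / 2^(k+Suc m+1)"
        by (simp add: r_def field_simps)
      finally show ?case .
    qed
    have step': "(\<Sum>j\<in>I. d (s m j) (s k j)) \<le> \<epsilon> / 2^(k+1)" if "I \<subseteq> {..<n+k}" "k \<le> m" for I k m
    proof -
      have "(\<Sum>j\<in>I. d (s m j) (s k j)) \<le> \<epsilon> / 2^(k+1) - \<epsilon> / 2^(m+1)"
        using step[OF that(1), of "m - k"] that(2) by simp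
      moreover have "\<epsilon> / 2^(m+1) > 0" using \<epsilon> by simp
      ultimately show ?thesis by linarith
    qed
    have pow0: "(\<lambda>k. \<epsilon> / 2^(k+1)) \<longlonglongrightarrow> 0"
    proof -
      have "(\<lambda>k. (\<epsilon>/2) * (1/2)^k) \<longlonglongrightarrow> (\<epsilon>/2) * 0"
        by (intro tendsto_mult tendsto_const LIMSEQ_power_zero) simp
      then show ?thesis by (simp add: power_divide)
    qed
    have "\<exists>l. l \<in> X \<and> (\<lambda>k. d (s k j) l) \<longlonglongrightarrow> 0" for j
    proof -
      have "\<exists>N. \<forall>m\<ge>N. \<forall>k\<ge>N. d (s m j) (s k j) < \<delta>" if "\<delta> > 0" for \<delta>
      proof -
        have "\<forall>\<^sub>F k in sequentially. \<epsilon> / 2^(k+1) < \<delta>/2 \<and> k > j"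
          using order_tendstoD(2)[OF pow0, of "\<delta>/2"] that eventually_gt_at_top[of j]
          by (intro eventually_conj) auto
        \<comment> \<open>\<open>N > j\<close> puts coordinate \<open>j\<close> among the
          \<open>n + N\<close> coordinates that are controlled from stage \<open>N\<close>
          on.\<close>
        then obtain N where N: "\<epsilon> / 2^(N+1) < \<delta>/2" "N > j"
          by (auto simp: eventually_sequentially)
        have near: "d (s m j) (s N j) < \<delta>/2" if "m \<ge> N" for m
          using step'[of "{j}" N m] N that by simp
        have "d (s m j) (s k j) < \<delta>" if "m \<ge> N" "k \<ge> N" for m k
          using near[OF that(1)] near[OF that(2)] s(1)
            mdist_triangle[of "s m j" "metric M" "s N j" "s k j"] by (simp add: mdist_commute)
        then show ?thesis by blast
      qed
      then show ?thesis using X_Cauchy[of "\<lambda>k. s k j"] s(1) by (metis Val_in)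
    qed
    then obtain a' where a': "\<And>j. a' j \<in> X" "\<And>j. (\<lambda>k. d (s k j) (a' j)) \<longlonglongrightarrow> 0" by metis
    have a'V: "a' \<in> Val" using a'(1) by (simp add: Val_iff)
    have lim: "(\<lambda>k. \<phi> (s k)) \<longlonglongrightarrow> \<phi> a'" if "dp \<phi>" for \<phi>
      by (rule dp_tendsto[OF that s(1) a'V a'(2)])
    have qa: "q i a = q i a'" for i
    proof (rule LIMSEQ_unique)
      show "(\<lambda>k. q i (s (Suc k))) \<longlonglongrightarrow> q i a'" using lim[OF dq] by (rule LIMSEQ_Suc)
      have "\<bar>q i (s (Suc k)) - q i a\<bar> \<le> inverse (real (Suc k))" if "k \<ge> i" for k
      proof -
        have "\<bar>q i (s (Suc k)) - q i a\<bar> \<le> (\<Sum>i<Suc k. \<bar>q i (s (Suc k)) - q i a\<bar>)"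
          by (rule member_le_sum) (use that in auto)
        also have "\<dots> < inverse (real (Suc k))" using s(3)[of k] unfolding \<theta>_def by simp
        finally show ?thesis by simp
      qed
      then have "\<forall>\<^sub>F k in sequentially. norm (q i (s (Suc k)) - q i a) \<le> inverse (real (Suc k))"
        unfolding eventually_sequentially real_norm_def by blast
      then have "(\<lambda>k. q i (s (Suc k)) - q i a) \<longlonglongrightarrow> 0"
        by (rule Lim_null_comparison[OF _ LIMSEQ_inverse_real_of_nat])
      then show "(\<lambda>k. q i (s (Suc k))) \<longlonglongrightarrow> q i a" by (simp add: LIM_zero_iff)
    qed
    have "same_type a a'"
      unfolding same_type_def
    proof (intro allI impI)
      fix \<phi> assume \<phi>: "dp \<phi>"
      have "\<bar>\<phi> a - \<phi> a'\<bar> \<le> 0"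
      proof (rule field_le_epsilon)
        fix \<delta> :: real assume "\<delta> > 0"
        then obtain p where p: "p \<in> Q" "\<forall>e\<in>Val. \<bar>p e - \<phi> e\<bar> < \<delta>/2" using Q_dense[OF \<phi>] half_gt_zero by blast
        then obtain i where "p = q i" using q by blast
        then have "p a = p a'" using qa by simp
        then show "\<bar>\<phi> a - \<phi> a'\<bar> \<le> 0 + \<delta>"
          using bspec[OF p(2) a] bspec[OF p(2) a'V] by linarith
      qed
      then show "\<phi> a = \<phi> a'" by simp
    qed
    moreover have "(\<Sum>j<n. d (a' j) (b j)) \<le> \<epsilon>/2"
    proof (rule LIMSEQ_le_const2)
      show "(\<lambda>k. \<Sum>j<n. d (s k j) (b j)) \<longlonglongrightarrow> (\<Sum>j<n. d (a' j) (b j))"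
        using s(1) a' b by (intro tendsto_sum dist_tendsto) auto
      show "\<exists>N. \<forall>k\<ge>N. (\<Sum>j<n. d (s k j) (b j)) \<le> \<epsilon>/2"
        using step'[of "{..<n}" 0] s(2) by auto
    qed
    ultimately show ?thesis using a'V \<epsilon> by (intro bexI[of _ a']) auto
  qed
  with \<xi>(1,2) that show ?thesis by blast
qed

end

section \<open>The completely metrizable space of sequences\<close>

context mstruct
begin

abbreviation "VT \<equiv> product_topology (\<lambda>_::nat. space_topology M) UNIV"

lemma topspace_VT [simp]: "topspace VT = Val"
  by (auto simp: Val_iff PiE_iff)

lemma completely_metrizable_VT: "completely_metrizable_space VT"
proof -
  interpret X: Metric_space X d by simp
  have "completely_metrizable_space X.mtopology"
    using X_complete by (intro X.completely_metrizable_space_mtopology) (simp add: mcomplete_of_def)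
  then have "completely_metrizable_space (space_topology M)" by (simp add: mtopology_of_def)
  then show ?thesis by (simp add: completely_metrizable_space_product_topology)
qed

definition box :: "(nat \<Rightarrow> 'a) \<Rightarrow> nat \<Rightarrow> real \<Rightarrow> (nat \<Rightarrow> 'a) set"
  where "box e n \<delta> = {y \<in> Val. \<forall>i<n. d (e i) (y i) < \<delta>}"

lemma openin_box:
  assumes "e \<in> Val"
  shows "openin VT (box e n \<delta>)"
proof -
  interpret X: Metric_space X d by simp
  define U where "U i = (if i < n then X.mball (e i) \<delta> else X)" for i
  have "openin VT (PiE UNIV U)"
  proof (rule product_topology_basis)
    show "openin (space_topology M) (U i)" for i
      unfolding U_def mtopology_of_def
      using X.openin_mball openin_topspace[of X.mtopology] by simp
    show "finite {i. U i \<noteq> topspace (space_topology M)}"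
      by (rule finite_subset[of _ "{..<n}"]) (auto simp: U_def)
  qed
  moreover have "PiE UNIV U = box e n \<delta>"
    using assms by (auto simp: box_def U_def Val_iff PiE_iff split: if_splits)
  ultimately show ?thesis by simp
qed

lemma openin_VT_box:
  assumes "openin VT U" "e \<in> U"
  obtains n \<delta> where "\<delta> > 0" "box e n \<delta> \<subseteq> U"
proof -
  interpret X: Metric_space X d by simp
  obtain W where W: "finite {i \<in> UNIV. W i \<noteq> topspace (space_topology M)}"
    "\<forall>i\<in>UNIV. openin (space_topology M) (W i)" "e \<in> PiE UNIV W" "PiE UNIV W \<subseteq> U"
    using assms unfolding openin_product_topology_alt by meson
  define I where "I = {i. W i \<noteq> X}"
  have I: "finite I" using W(1) by (simp add: I_def)
  have "\<exists>r>0. X.mball (e i) r \<subseteq> W i" for i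
    using W(2,3) unfolding mtopology_of_def X.openin_mtopology by (auto simp: PiE_iff)
  then obtain r where r: "\<And>i. r i > 0" "\<And>i. X.mball (e i) (r i) \<subseteq> W i" by metis
  define \<delta> where "\<delta> = Min (insert 1 (r ` I))"
  have \<delta>: "\<delta> > 0" unfolding \<delta>_def using I r by (subst Min_gr_iff) auto
  have \<delta>_le: "\<delta> \<le> r i" if "i \<in> I" for i unfolding \<delta>_def using I that by simp
  define n where "n = Suc (Max (insert 0 I))"
  have n: "i < n" if "i \<in> I" for i unfolding n_def using I that by (simp add: le_imp_less_Suc)
  have eX: "e i \<in> X" for i
    using W(2,3) openin_subset[of "space_topology M"] by (fastforce simp: PiE_iff)
  have "box e n \<delta> \<subseteq> U"
  proof
    fix y assume y: "y \<in> box e n \<delta>"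
    have "y i \<in> W i" for i
    proof (cases "i \<in> I")
      case True
      then have "d (e i) (y i) < r i" using y n[OF True] \<delta>_le[OF True] by (fastforce simp: box_def)
      then have "y i \<in> X.mball (e i) (r i)" using eX y by (simp add: box_def)
      then show ?thesis using r(2) by blast
    next
      case False
      then show ?thesis using y by (simp add: I_def box_def)
    qed
    then show "y \<in> U" using W(4) by (auto simp: PiE_iff)
  qed
  with \<delta> that show ?thesis by blast
qed

lemma dp_continuous:
  assumes "dp \<phi>"
  shows "continuous_map VT euclideanreal \<phi>"
  unfolding continuous_map
proof (intro conjI allI impI)
  fix U :: "real set" assume "openin euclideanreal U"
  then have U: "open U" by (simp flip: open_openin)
  show "openin VT {x \<in> topspace VT. \<phi> x \<in> U}"
    unfolding openin_subopen[of _ "{x \<in> topspace VT. \<phi> x \<in> U}"]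
  proof
    fix x assume x: "x \<in> {x \<in> topspace VT. \<phi> x \<in> U}"
    then obtain \<epsilon> where \<epsilon>: "\<epsilon> > 0" "\<And>y. \<bar>y - \<phi> x\<bar> < \<epsilon> \<Longrightarrow> y \<in> U"
      using U unfolding open_dist dist_real_def by blast
    from ucontD[OF dp_ucont[OF assms] \<epsilon>(1)] obtain n \<delta> where 1: "\<delta> > 0"
      "\<And>e e'. e \<in> Val \<Longrightarrow> e' \<in> Val \<Longrightarrow> (\<And>i. i < n \<Longrightarrow> d (e i) (e' i) < \<delta>) \<Longrightarrow> \<bar>\<phi> e - \<phi> e'\<bar> < \<epsilon>"
      by metis
    have xV: "x \<in> Val" using x by (simp only: topspace_VT mem_Collect_eq)
    have "\<phi> y \<in> U" if "y \<in> box x n \<delta>" for y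
      by (rule \<epsilon>(2), rule 1(2)) (use that xV in \<open>auto simp: box_def mdist_commute\<close>)
    then have "box x n \<delta> \<subseteq> {x \<in> topspace VT. \<phi> x \<in> U}" by (auto simp: box_def)
    moreover have "x \<in> box x n \<delta>" using xV 1(1) by (simp add: box_def)
    ultimately show "\<exists>T. openin VT T \<and> x \<in> T \<and> T \<subseteq> {x \<in> topspace VT. \<phi> x \<in> U}"
      using openin_box[OF xV] by blast
  qed
qed auto

end

section \<open>Back and forth by Baire category\<close>

context categorical_structure
begin

lemma ex_dense_seq: "\<exists>s. dense_seq s"
proof -
  have "S \<noteq> {}" using ev_S Val_ne by blast
  obtain \<Phi> where "henkin \<Phi>"
    by (rule ex_henkin[OF spectrum_closed order_refl \<open>S \<noteq> {}\<close>, where \<G> = "{}"]) auto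
  then obtain e where "e \<in> Val" "\<And>x \<epsilon>. x \<in> X \<Longrightarrow> 0 < \<epsilon> \<Longrightarrow> \<exists>i. d x (e i) < \<epsilon>"
    using henkin_imp_realized by metis
  then show ?thesis unfolding dense_seq_def by blast
qed

text \<open>One step of a back-and-forth: \<open>c\<close> is inserted into \<open>e\<close> at
  position \<open>n\<close>, and a matching change is made to \<open>e'\<close>. As types are
  matched only up to \<delta>, the first \<open>n\<close> entries of \<open>e'\<close> may move
  slightly as well.\<close>

lemma same_type_extend:
  assumes e: "e \<in> Val" "e' \<in> Val" "same_type e e'" and c: "c \<in> X" and \<delta>: "\<delta> > 0"
  obtains f f' where "f \<in> box e n \<delta>" "f' \<in> box e' n \<delta>" "same_type f f'" "f n = c"
proof -
  define f where "f i = (if i < n then e i else c)" for i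
  have f: "f \<in> Val" using e c by (auto simp: f_def Val_iff)
  obtain \<xi> where \<xi>: "dp \<xi>" "\<xi> f < 0"
    "\<And>b. b \<in> Val \<Longrightarrow> \<xi> b < 0 \<Longrightarrow> \<exists>a'\<in>Val. same_type f a' \<and> (\<Sum>j<n. d (a' j) (b j)) < \<delta>"
    using extension[OF f \<delta>, of n] by metis
  \<comment> \<open>Quantifying away the variables from \<open>n\<close> on gives a condition that
    depends only on the first \<open>n\<close> entries. It holds at \<open>e\<close>, witnessed by
    \<open>f\<close>, hence at \<open>e'\<close>, which has the same type.\<close>
  define \<eta> where "\<eta> v = (INF y\<in>Val. \<xi> (override {n..} y v))" for v
  have \<eta>: "dp \<eta>" unfolding \<eta>_def[abs_def] by (rule dp_INF[OF \<xi>(1)])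
  have \<eta>_less: "\<eta> v < 0 \<longleftrightarrow> (\<exists>y\<in>Val. \<xi> (override {n..} y v) < 0)" if "v \<in> Val" for v
    unfolding \<eta>_def by (rule INF_less_dp) (use dp_bounded[OF \<xi>(1)] that Val_ne in auto)
  have "override {n..} f e = f" by (auto simp: override_def f_def)
  then have "\<eta> e < 0" using \<eta>_less[OF e(1)] f \<xi>(2) by metis
  moreover have "\<eta> e = \<eta> e'" using e(3) \<eta> unfolding same_type_def by blast
  ultimately have "\<eta> e' < 0" by simp
  then obtain y where y: "y \<in> Val" "\<xi> (override {n..} y e') < 0" using \<eta>_less[OF e(2)] by blast
  obtain f' where f': "f' \<in> Val" "same_type f f'" "(\<Sum>j<n. d (f' j) (override {n..} y e' j)) < \<delta>"
    using \<xi>(3)[OF override_Val[OF y(1) e(2)] y(2)] by blast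
  have "d (e' i) (f' i) < \<delta>" if "i < n" for i
  proof -
    have "d (f' i) (override {n..} y e' i) \<le> (\<Sum>j<n. d (f' j) (override {n..} y e' j))"
      by (rule member_le_sum) (use that in auto)
    moreover have "override {n..} y e' i = e' i" using that by (simp add: override_def)
    ultimately show ?thesis using f'(3) by (simp add: mdist_commute)
  qed
  then have "f' \<in> box e' n \<delta>" using f'(1) by (simp add: box_def)
  moreover have "f \<in> box e n \<delta>" using f e(1) \<delta> by (simp add: box_def) (simp add: f_def)
  moreover have "f n = c" by (simp add: f_def)
  ultimately show ?thesis using that f'(2) by blast
qed

text \<open>Baire's theorem is applied in the space of pairs of sequences of the same type.\<close>

lemma dense_pair:
  assumes a: "a \<in> Val" "a' \<in> Val" "same_type a a'" and \<delta>: "\<delta> > 0"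
  obtains e e' where "e \<in> box a n \<delta>" "e' \<in> box a' n \<delta>" "dense_seq e" "dense_seq e'" "same_type e e'"
proof -
  let ?V2 = "prod_topology VT VT"
  \<comment> \<open>\<open>Z\<close> is closed in a completely metrizable space, being cut out by
    the equations \<open>\<phi> (fst p) = \<phi> (snd p)\<close>; hence Baire's theorem holds in
    \<open>Z\<close> itself.\<close>
  define Z where "Z = {p \<in> Val \<times> Val. same_type (fst p) (snd p)}"
  obtain s where s: "dense_seq s" using ex_dense_seq by blast
  have sX: "s k \<in> X" for k using s by (simp add: dense_seq_def)
  have "closedin ?V2 {p \<in> topspace ?V2. \<phi> (fst p) - \<phi> (snd p) \<in> {0}}" if "dp \<phi>" for \<phi>
  proof (rule closedin_continuous_map_preimage)
    show "continuous_map ?V2 euclideanreal (\<lambda>p. \<phi> (fst p) - \<phi> (snd p))"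
      using continuous_map_compose[OF continuous_map_fst dp_continuous[OF that]]
        continuous_map_compose[OF continuous_map_snd dp_continuous[OF that]]
      by (intro continuous_map_diff) (auto simp: comp_def)
  qed simp
  then have "closedin ?V2 (\<Inter>\<phi>\<in>Collect dp. {p \<in> topspace ?V2. \<phi> (fst p) - \<phi> (snd p) \<in> {0}})"
    using dp_const by (intro closedin_INT) auto
  moreover have "(\<Inter>\<phi>\<in>Collect dp. {p \<in> topspace ?V2. \<phi> (fst p) - \<phi> (snd p) \<in> {0}}) = Z"
    using dp_const unfolding Z_def same_type_def topspace_prod_topology topspace_VT by auto
  ultimately have Z_closed: "closedin ?V2 Z" by simp
  let ?T = "subtopology ?V2 Z"
  have top: "topspace ?T = Z" using closedin_subset[OF Z_closed] by auto
  have cm: "completely_metrizable_space ?T"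
    by (intro completely_metrizable_space_closedin[OF _ Z_closed])
      (simp add: completely_metrizable_space_prod_topology completely_metrizable_VT)
  \<comment> \<open>\<pi> chooses one side of the pair, \<open>k\<close> a point of a fixed dense
    sequence and \<open>m\<close> the accuracy with which that side must approach it. Meeting these
    countably many conditions makes both sides dense.\<close>
  define G where "G \<pi> k m = {p \<in> Z. \<exists>i. d (s k) (\<pi> p i) < inverse (real (Suc m))}"
    for \<pi> :: "(nat \<Rightarrow> 'a) \<times> (nat \<Rightarrow> 'a) \<Rightarrow> nat \<Rightarrow> 'a" and k m
  define \<G> where "\<G> = (\<lambda>(k, m). G fst k m) ` UNIV \<union> (\<lambda>(k, m). G snd k m) ` UNIV"
  have box2: "openin ?V2 (box x n \<delta> \<times> box y n \<delta>)" if "x \<in> Val" "y \<in> Val" for x y n \<delta>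
    using that by (intro openin_prod_Times_iff[THEN iffD2] disjI2 conjI openin_box)
  have nbhd: "\<exists>n \<delta>. \<delta> > 0 \<and> box x n \<delta> \<times> box y n \<delta> \<subseteq> W" if W: "openin ?V2 W" "(x, y) \<in> W" for W x y
  proof -
    obtain A B where AB: "openin VT A" "openin VT B" "x \<in> A" "y \<in> B" "A \<times> B \<subseteq> W"
      using W unfolding openin_prod_topology_alt by meson
    obtain n1 \<delta>1 where 1: "\<delta>1 > 0" "box x n1 \<delta>1 \<subseteq> A" using openin_VT_box[OF AB(1,3)] by metis
    obtain n2 \<delta>2 where 2: "\<delta>2 > 0" "box y n2 \<delta>2 \<subseteq> B" using openin_VT_box[OF AB(2,4)] by metis
    have "box x (max n1 n2) (min \<delta>1 \<delta>2) \<subseteq> A" "box y (max n1 n2) (min \<delta>1 \<delta>2) \<subseteq> B"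
      using 1(2) 2(2) by (auto simp: box_def)
    then show ?thesis using 1(1) 2(1) AB(5)
      by (intro exI[of _ "max n1 n2"] exI[of _ "min \<delta>1 \<delta>2"]) auto
  qed
  have G_open: "openin ?T (G \<pi> k m)" if \<pi>: "continuous_map ?V2 VT \<pi>" for \<pi> k m
  proof -
    interpret X: Metric_space X d by simp
    have "openin ?V2 {p \<in> topspace ?V2. \<pi> p i \<in> X.mball (s k) (inverse (real (Suc m)))}" for i
    proof (rule openin_continuous_map_preimage)
      show "continuous_map ?V2 (space_topology M) (\<lambda>p. \<pi> p i)"
        using continuous_map_compose[OF \<pi> continuous_map_product_projection[of i UNIV]] by (simp add: comp_def)
      show "openin (space_topology M) (X.mball (s k) (inverse (real (Suc m))))"
        by (simp add: mtopology_of_def)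
    qed
    then have op: "openin ?V2 (\<Union>i. {p \<in> topspace ?V2. \<pi> p i \<in> X.mball (s k) (inverse (real (Suc m)))})"
      by (intro openin_Union) blast
    have "\<pi> p i \<in> X" if "p \<in> Z" for p i
    proof -
      have "p \<in> topspace ?V2" using that closedin_subset[OF Z_closed] by blast
      then have "\<pi> p \<in> Val" using funcset_mem[OF continuous_map_funspace[OF \<pi>]] by (simp only: topspace_VT)
      then show ?thesis by simp
    qed
    then have "G \<pi> k m = Z \<inter> (\<Union>i. {p \<in> topspace ?V2. \<pi> p i \<in> X.mball (s k) (inverse (real (Suc m)))})"
      using closedin_subset[OF Z_closed] sX unfolding G_def X.in_mball by blast
    then show ?thesis using op by (simp add: openin_subtopology_Int2)
  qed
  have G_dense: "\<exists>p\<in>G \<pi> k m. p \<in> W"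
    if \<pi>: "\<pi> = fst \<or> \<pi> = snd" and W: "openin ?V2 W" "(x, y) \<in> W" "(x, y) \<in> Z" for \<pi> k m W x y
  proof -
    obtain n \<delta> where n: "\<delta> > 0" "box x n \<delta> \<times> box y n \<delta> \<subseteq> W" using nbhd[OF W(1,2)] by blast
    have xy: "x \<in> Val" "y \<in> Val" "same_type x y" using W(3) by (auto simp: Z_def)
    have box_Val: "v \<in> Val" if "v \<in> box u n \<delta>" for v u using that by (simp add: box_def)
    have 0: "d (s k) (s k) < inverse (real (Suc m))" using sX by simp
    from \<pi> show ?thesis
    proof
      assume \<pi>: "\<pi> = fst"
      obtain f f' where f: "f \<in> box x n \<delta>" "f' \<in> box y n \<delta>" "same_type f f'" "f n = s k"
        by (rule same_type_extend[OF xy sX n(1)])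
      then have "(f, f') \<in> G \<pi> k m"
        using 0 box_Val unfolding G_def Z_def \<pi> by (auto intro!: exI[of _ n])
      then show ?thesis using f n(2) by blast
    next
      \<comment> \<open>Insertion on the second side uses the same extension step with the two
        sequences exchanged.\<close>
      assume \<pi>: "\<pi> = snd"
      obtain f f' where f: "f \<in> box y n \<delta>" "f' \<in> box x n \<delta>" "same_type f f'" "f n = s k"
        by (rule same_type_extend[OF xy(2,1) same_type_sym[OF xy(3)] sX n(1)])
      then have "(f', f) \<in> G \<pi> k m"
        using 0 box_Val same_type_sym unfolding G_def Z_def \<pi> by (auto intro!: exI[of _ n])
      then show ?thesis using f n(2) by blast
    qed
  qed
  have "openin ?T U \<and> ?T closure_of U = topspace ?T" if U: "U \<in> \<G>" for U
  proof
    obtain \<pi> k m where \<pi>: "\<pi> = fst \<or> \<pi> = snd" "U = G \<pi> k m" using U unfolding \<G>_def by auto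
    then show op: "openin ?T U" using G_open continuous_map_fst continuous_map_snd by blast
    have "p \<in> ?T closure_of U" if p: "p \<in> Z" for p
      unfolding in_closure_of
    proof (intro conjI allI impI)
      show "p \<in> topspace ?T" using p top by simp
      fix V assume "p \<in> V \<and> openin ?T V"
      then obtain W where W: "openin ?V2 W" "V = W \<inter> Z" "p \<in> W" by (auto simp: openin_subtopology)
      have "\<exists>p'\<in>G \<pi> k m. p' \<in> W"
        by (rule G_dense[OF \<pi>(1) W(1), of "fst p" "snd p"]) (use W(3) p in simp_all)
      then obtain p' where "p' \<in> U" "p' \<in> W" using \<pi>(2) by blast
      moreover have "p' \<in> Z" using \<open>p' \<in> U\<close> unfolding \<pi>(2) G_def by blast
      ultimately show "\<exists>y. y \<in> U \<and> y \<in> V" using W(2) by blast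
    qed
    then show "?T closure_of U = topspace ?T"
      using closure_of_subset_topspace[of ?T U] top by blast
  qed
  then have "?T closure_of \<Inter>\<G> = topspace ?T"
    using cm by (intro Baire_category) (auto simp: \<G>_def)
  then have "(a, a') \<in> ?T closure_of \<Inter>\<G>" using a top by (simp add: Z_def)
  moreover have "openin ?T (box a n \<delta> \<times> box a' n \<delta> \<inter> Z)"
    using box2[OF a(1,2)] by (auto simp: openin_subtopology)
  moreover have "(a, a') \<in> box a n \<delta> \<times> box a' n \<delta> \<inter> Z" using a \<delta> by (simp add: Z_def box_def)
  ultimately obtain p where p: "p \<in> \<Inter>\<G>" "p \<in> box a n \<delta> \<times> box a' n \<delta> \<inter> Z"
    unfolding in_closure_of by meson
  have dense: "dense_seq (\<pi> p)" if \<pi>: "\<pi> = fst \<or> \<pi> = snd" for \<pi>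
    unfolding dense_seq_def
  proof (intro conjI ballI allI impI)
    show \<pi>V: "\<pi> p \<in> Val" using p(2) \<pi> by (auto simp: Z_def)
    fix x \<epsilon> assume x: "x \<in> X" and \<epsilon>: "\<epsilon> > (0::real)"
    obtain k where k: "d x (s k) < \<epsilon>/2" using dense_seqD[OF s x half_gt_zero[OF \<epsilon>]] by blast
    obtain m where m: "inverse (real (Suc m)) < \<epsilon>/2" using reals_Archimedean[OF half_gt_zero[OF \<epsilon>]] by blast
    have "G \<pi> k m \<in> \<G>" using \<pi> unfolding \<G>_def by auto
    then have "p \<in> G \<pi> k m" using p(1) by blast
    then obtain i where "d (s k) (\<pi> p i) < inverse (real (Suc m))" unfolding G_def by blast
    then have "d x (\<pi> p i) < \<epsilon>"
      using k m mdist_triangle[OF x sX[of k] Val_in[OF \<pi>V, of i]] by linarith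
    then show "\<exists>i. d x (\<pi> p i) < \<epsilon>" by blast
  qed
  show ?thesis
    by (rule that[of "fst p" "snd p"]) (use p(2) dense in \<open>auto simp: Z_def\<close>)
qed

text \<open>Move both sequences by less than \<open>\<epsilon>/2\<close> in the first
  \<open>n\<close> entries to dense ones of the same type. The automorphism matching these is an
  isometry, so it does not enlarge the first error.\<close>

theorem homogeneity:
  assumes a: "a \<in> Val" "a' \<in> Val" "same_type a a'" and \<epsilon>: "\<epsilon> > 0"
  obtains g where "g \<in> Aut L M" "\<And>j. j < n \<Longrightarrow> d (g (a j)) (a' j) < \<epsilon>"
proof -
  obtain e e' where e: "e \<in> box a n (\<epsilon>/2)" "e' \<in> box a' n (\<epsilon>/2)" "dense_seq e" "dense_seq e'" "same_type e e'"
    by (rule dense_pair[OF a half_gt_zero[OF \<epsilon>]])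
  obtain g where g: "g \<in> Aut L M" "\<And>i. g (e i) = e' i" using ex_automorphism[OF e(3-5)] by metis
  have "d (g (a j)) (a' j) < \<epsilon>" if j: "j < n" for j
  proof -
    have eX: "e j \<in> X" "e' j \<in> X" using e(1,2) by (auto simp: box_def)
    have gX: "g (a j) \<in> X" "d (g (a j)) (g (e j)) = d (a j) (e j)"
      using g(1) a(1) eX unfolding Aut_def isomorphism_def by (auto dest: bij_betwE)
    have "d (a j) (e j) < \<epsilon>/2" "d (a' j) (e' j) < \<epsilon>/2" using e(1,2) j by (auto simp: box_def)
    then show ?thesis
      using mdist_triangle[OF gX(1) eX(2) Val_in[OF a(2), of j]] gX(2) g(2) by (simp add: mdist_commute)
  qed
  with g(1) that show ?thesis by blast
qed

text \<open>The form in which the Ryll-Nardzewski theorem is used: \<open>extension\<close> leads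
  from \<open>b\<close> to a tuple of the type of \<open>a\<close>, \<open>homogeneity\<close> from
  there to the orbit of \<open>a\<close>, with error \<open>\<epsilon>/2\<close> each.\<close>

lemma orbit_neighbourhood:
  assumes a: "a \<in> Val" and \<epsilon>: "\<epsilon> > 0"
  obtains \<xi> where "dp \<xi>" "\<xi> a < 0"
    "\<And>b. b \<in> Val \<Longrightarrow> \<xi> b < 0 \<Longrightarrow> \<exists>g\<in>Aut L M. \<forall>j<n. d (g (a j)) (b j) < \<epsilon>"
proof -
  obtain \<xi> where \<xi>: "dp \<xi>" "\<xi> a < 0"
    "\<And>b. b \<in> Val \<Longrightarrow> \<xi> b < 0 \<Longrightarrow> \<exists>a'\<in>Val. same_type a a' \<and> (\<Sum>j<n. d (a' j) (b j)) < \<epsilon>/2"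
    using extension[OF a half_gt_zero[OF \<epsilon>], of n] by metis
  have "\<exists>g\<in>Aut L M. \<forall>j<n. d (g (a j)) (b j) < \<epsilon>" if b: "b \<in> Val" "\<xi> b < 0" for b
  proof -
    obtain a' where a': "a' \<in> Val" "same_type a a'" "(\<Sum>j<n. d (a' j) (b j)) < \<epsilon>/2" using \<xi>(3)[OF b] by blast
    obtain g where g: "g \<in> Aut L M" "\<And>j. j < n \<Longrightarrow> d (g (a j)) (a' j) < \<epsilon>/2"
      using homogeneity[OF a a'(1,2) half_gt_zero[OF \<epsilon>]] by metis
    have "d (g (a j)) (b j) < \<epsilon>" if j: "j < n" for j
    proof -
      have "d (a' j) (b j) \<le> (\<Sum>j<n. d (a' j) (b j))" by (rule member_le_sum) (use j in auto)
      moreover have "g (a j) \<in> X" using g(1) a unfolding Aut_def isomorphism_def by (auto dest: bij_betwE)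
      ultimately show ?thesis
        using a'(3) g(2)[OF j] mdist_triangle[of "g (a j)" "metric M" "a' j" "b j"] a'(1) b(1) by simp
    qed
    then show ?thesis using g(1) by blast
  qed
  with \<xi>(1,2) that show ?thesis by blast
qed

end

section \<open>Definable functions are the right uniformly continuous ones\<close>

context mstruct
begin

lemma Aut_bij: "g \<in> Aut L M \<Longrightarrow> bij_betw g X X"
  and Aut_dist: "g \<in> Aut L M \<Longrightarrow> x \<in> X \<Longrightarrow> y \<in> X \<Longrightarrow> d (g x) (g y) = d x y"
  and Aut_pred: "g \<in> Aut L M \<Longrightarrow> p \<in> symbols L \<Longrightarrow> xs \<in> tuples M (arity L p) \<Longrightarrow> pred M p (map g xs) = pred M p xs"
  and Aut_extensional: "g \<in> Aut L M \<Longrightarrow> g \<in> extensional X"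
  by (auto simp: Aut_def isomorphism_def)

lemma Aut_in [simp]: "g \<in> Aut L M \<Longrightarrow> x \<in> X \<Longrightarrow> g x \<in> X"
  using Aut_bij bij_betwE by blast

lemma Aut_Val: "g \<in> Aut L M \<Longrightarrow> v \<in> Val \<Longrightarrow> g \<circ> v \<in> Val"
  by (simp add: Val_iff)

text \<open>Automorphisms preserve symbols and distances by definition. Quantifiers are respected
  because \<open>g\<close> permutes the universe, so the bound value may be renamed
  \<open>g a\<close>.\<close>

lemma Aut_dp:
  assumes g: "g \<in> Aut L M" and \<phi>: "dp \<phi>"
  shows "\<forall>v\<in>Val. \<phi> (g \<circ> v) = \<phi> v"
  using \<phi>
proof (induction rule: definable_predicate.induct)
  case (predicate p vs)
  show ?case
  proof
    fix v assume "v \<in> Val"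
    then have "pred M p (map g (map v vs)) = pred M p (map v vs)"
      using predicate by (intro Aut_pred[OF g] map_Val_tuples) auto
    then show "pred M p (map (g \<circ> v) vs) = pred M p (map v vs)" by simp
  qed
next
  case (distance i j)
  then show ?case using Aut_dist[OF g] by simp
next
  case (connective u k \<phi>s)
  show ?case
  proof
    fix v assume v: "v \<in> Val"
    have "(\<lambda>i. if i < k then \<phi>s i (g \<circ> v) else 0) = (\<lambda>i. if i < k then \<phi>s i v else 0)"
    proof
      fix i
      show "(if i < k then \<phi>s i (g \<circ> v) else 0) = (if i < k then \<phi>s i v else 0)"
        by (cases "i < k") (use bspec[OF connective(3) v] in \<open>simp_all only: if_True if_False\<close>)
    qed
    then show "u (\<lambda>i. if i < k then \<phi>s i (g \<circ> v) else 0) = u (\<lambda>i. if i < k then \<phi>s i v else 0)"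
      by (simp only:)
  qed
next
  case (supremum \<phi> i)
  show ?case
  proof
    fix v assume v: "v \<in> Val"
    have img: "g ` X = X" using Aut_bij[OF g] by (simp add: bij_betw_def)
    have upd: "(g \<circ> v)(i := g a) = g \<circ> v(i := a)" for a by (auto simp: fun_eq_iff)
    have "(SUP a\<in>X. \<phi> ((g \<circ> v)(i := a))) = (SUP a\<in>g ` X. \<phi> ((g \<circ> v)(i := a)))" by (simp only: img)
    also have "\<dots> = (SUP a\<in>X. \<phi> (g \<circ> v(i := a)))" by (simp only: image_image upd)
    also have "\<dots> = (SUP a\<in>X. \<phi> (v(i := a)))"
      using v by (intro SUP_cong refl bspec[OF supremum(2)] Val_upd)
    finally show "(SUP a\<in>X. \<phi> ((g \<circ> v)(i := a))) = (SUP a\<in>X. \<phi> (v(i := a)))" .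
  qed
next
  case (infimum \<phi> i)
  show ?case
  proof
    fix v assume v: "v \<in> Val"
    have img: "g ` X = X" using Aut_bij[OF g] by (simp add: bij_betw_def)
    have upd: "(g \<circ> v)(i := g a) = g \<circ> v(i := a)" for a by (auto simp: fun_eq_iff)
    have "(INF a\<in>X. \<phi> ((g \<circ> v)(i := a))) = (INF a\<in>g ` X. \<phi> ((g \<circ> v)(i := a)))" by (simp only: img)
    also have "\<dots> = (INF a\<in>X. \<phi> (g \<circ> v(i := a)))" by (simp only: image_image upd)
    also have "\<dots> = (INF a\<in>X. \<phi> (v(i := a)))"
      using v by (intro INF_cong refl bspec[OF infimum(2)] Val_upd)
    finally show "(INF a\<in>X. \<phi> ((g \<circ> v)(i := a))) = (INF a\<in>X. \<phi> (v(i := a)))" .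
  qed
next
  case (limit \<phi>s \<phi>)
  show ?case
  proof
    fix v assume v: "v \<in> Val"
    have "\<phi>s n (g \<circ> v) = \<phi>s n v" for n using limit(3) v by blast
    moreover have "(\<lambda>n. \<phi>s n (g \<circ> v)) \<longlonglongrightarrow> \<phi> (g \<circ> v)" "(\<lambda>n. \<phi>s n v) \<longlonglongrightarrow> \<phi> v"
      using tendsto_uniform_limitI[OF limit(2)] v Aut_Val[OF g v] by blast+
    ultimately show "\<phi> (g \<circ> v) = \<phi> v" using LIMSEQ_unique by (simp only:)
  qed
qed

lemma Aut_compose:
  assumes "g \<in> Aut L M" "h \<in> Aut L M"
  shows "compose X g h \<in> Aut L M"
  unfolding Aut_def isomorphism_def
proof (intro CollectI conjI ballI)
  show "compose X g h \<in> extensional X" by simp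
  show "bij_betw (compose X g h) X X"
    using assms[THEN Aut_bij] by (meson bij_betw_compose)
  show "d (compose X g h x) (compose X g h y) = d x y" if "x \<in> X" "y \<in> X" for x y
    using that assms by (simp add: compose_eq Aut_dist)
  show "pred M p (map (compose X g h) xs) = pred M p xs" if p: "p \<in> symbols L" "xs \<in> tuples M (arity L p)" for p xs
  proof -
    have "map (compose X g h) xs = map g (map h xs)" using p(2) by (auto simp: tuples_def compose_eq)
    moreover have "map h xs \<in> tuples M (arity L p)" using p(2) assms(2) by (auto simp: tuples_def)
    ultimately show ?thesis using Aut_pred[OF assms(1) p(1)] Aut_pred[OF assms(2) p] by (simp only:)
  qed
qed

lemma Aut_id: "(\<lambda>x\<in>X. x) \<in> Aut L M"
  unfolding Aut_def isomorphism_def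
proof (intro CollectI conjI ballI)
  show "bij_betw (\<lambda>x\<in>X. x) X X" by (simp add: bij_betw_def inj_on_def)
  show "pred M p (map (\<lambda>x\<in>X. x) xs) = pred M p xs" if "p \<in> symbols L" "xs \<in> tuples M (arity L p)" for p xs
  proof -
    have "map (\<lambda>x\<in>X. x) xs = xs" using that(2) by (intro map_idI) (auto simp: tuples_def)
    then show ?thesis by (simp only:)
  qed
qed auto

lemma Aut_inv:
  assumes g: "g \<in> Aut L M"
  shows "(\<lambda>x\<in>X. inv_into X g x) \<in> Aut L M"
proof -
  let ?h = "\<lambda>x\<in>X. inv_into X g x"
  note bij = Aut_bij[OF g]
  have gh: "g (?h x) = x" "?h x \<in> X" if "x \<in> X" for x
    using that bij by (auto simp: bij_betw_def f_inv_into_f inv_into_into)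
  show ?thesis
    unfolding Aut_def isomorphism_def
  proof (intro CollectI conjI ballI)
    show "bij_betw ?h X X" using bij_betw_inv_into[OF bij] by (simp cong: bij_betw_cong)
    show "d (?h x) (?h y) = d x y" if "x \<in> X" "y \<in> X" for x y
      using Aut_dist[OF g gh(2)[OF that(1)] gh(2)[OF that(2)]] gh(1)[OF that(1)] gh(1)[OF that(2)] by (simp only:)
    show "pred M p (map ?h xs) = pred M p xs" if p: "p \<in> symbols L" "xs \<in> tuples M (arity L p)" for p xs
    proof -
      have "map ?h xs \<in> tuples M (arity L p)" using p(2) gh(2) by (auto simp: tuples_def)
      moreover have "map g (map ?h xs) = xs"
        unfolding map_map by (intro map_idI) (use p(2) gh(1) in \<open>auto simp: tuples_def\<close>)
      ultimately show ?thesis using Aut_pred[OF g p(1)] by metis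
    qed
  qed auto
qed

lemma Aut_inverse:
  assumes "g \<in> Aut L M"
  obtains h where "h \<in> Aut L M" "\<And>x. x \<in> X \<Longrightarrow> g (h x) = x" "\<And>x. x \<in> X \<Longrightarrow> h (g x) = x"
proof (rule that[OF Aut_inv[OF assms]])
  note bij = Aut_bij[OF assms]
  show "g ((\<lambda>x\<in>X. inv_into X g x) x) = x" if "x \<in> X" for x
    using that bij by (auto simp: bij_betw_def f_inv_into_f)
  show "(\<lambda>x\<in>X. inv_into X g x) (g x) = x" if "x \<in> X" for x
    using that bij assms by (simp add: bij_betw_def)
qed

lemma topspace_Aut_topology: "topspace (Aut_topology L M) = Aut L M"
  unfolding Aut_topology_def using Aut_extensional by (auto simp: PiE_def)

lemma continuous_map_Aut_eval:
  "x \<in> X \<Longrightarrow> continuous_map (Aut_topology L M) (space_topology M) (\<lambda>g. g x)"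
  unfolding Aut_topology_def
  by (rule continuous_map_from_subtopology[OF continuous_map_product_projection])

lemma openin_ball: "x \<in> X \<Longrightarrow> openin (space_topology M) {y \<in> X. d x y < \<delta>}"
proof -
  assume x: "x \<in> X"
  interpret X: Metric_space X d by simp
  have "{y \<in> X. d x y < \<delta>} = X.mball x \<delta>" using x by auto
  then show ?thesis by (simp add: mtopology_of_def)
qed

lemma openin_imp_ball:
  assumes "openin (space_topology M) U" "x \<in> U"
  obtains r where "r > 0" "\<And>y. y \<in> X \<Longrightarrow> d x y < r \<Longrightarrow> y \<in> U"
proof -
  interpret X: Metric_space X d by simp
  obtain r where "r > 0" "X.mball x r \<subseteq> U"
    using assms unfolding mtopology_of_def X.openin_mtopology by blast
  moreover have "x \<in> X" using assms openin_subset by fastforce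
  ultimately show ?thesis using that by (auto simp: subset_iff)
qed

lemma openin_Aut_stabilizer:
  assumes "b \<in> Val"
  shows "openin (Aut_topology L M) {g \<in> Aut L M. \<forall>i<n::nat. d (b i) (g (b i)) < \<delta>}"
proof (induction n)
  case 0
  then show ?case using openin_topspace[of "Aut_topology L M"] by (simp add: topspace_Aut_topology)
next
  case (Suc n)
  have "openin (Aut_topology L M) {g \<in> topspace (Aut_topology L M). g (b n) \<in> {y \<in> X. d (b n) y < \<delta>}}"
    using assms by (intro openin_continuous_map_preimage[OF continuous_map_Aut_eval] openin_ball) auto
  then have "openin (Aut_topology L M) ({g \<in> Aut L M. \<forall>i<n. d (b i) (g (b i)) < \<delta>} \<inter>
      {g \<in> topspace (Aut_topology L M). g (b n) \<in> {y \<in> X. d (b n) y < \<delta>}})"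
    using Suc by blast
  moreover have "{g \<in> Aut L M. \<forall>i<n. d (b i) (g (b i)) < \<delta>} \<inter>
      {g \<in> topspace (Aut_topology L M). g (b n) \<in> {y \<in> X. d (b n) y < \<delta>}} =
      {g \<in> Aut L M. \<forall>i<Suc n. d (b i) (g (b i)) < \<delta>}"
    using assms by (auto simp: topspace_Aut_topology less_Suc_eq)
  ultimately show ?case by simp
qed

text \<open>A pointwise neighbourhood constrains finitely many points of \<open>X\<close>.
  Automorphisms are isometries, so constraining nearby entries of the dense sequence has the same
  effect.\<close>

lemma Aut_nbhd_dense_seq:
  assumes V: "openin (Aut_topology L M) V" "(\<lambda>x\<in>X. x) \<in> V" and s: "dense_seq s"
  obtains n \<delta> where "\<delta> > 0" "\<And>g. g \<in> Aut L M \<Longrightarrow> (\<And>i. i < n \<Longrightarrow> d (g (s i)) (s i) < \<delta>) \<Longrightarrow> g \<in> V"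
proof -
  obtain W where W: "openin (product_topology (\<lambda>_. space_topology M) X) W" "V = W \<inter> Aut L M"
    using V(1) unfolding Aut_topology_def by (auto simp: openin_subtopology)
  obtain U where U: "finite {x \<in> X. U x \<noteq> topspace (space_topology M)}"
    "\<forall>x\<in>X. openin (space_topology M) (U x)" "(\<lambda>x\<in>X. x) \<in> PiE X U" "PiE X U \<subseteq> W"
    using W V(2) unfolding openin_product_topology_alt by (meson IntD1)
  have "\<exists>r>0. \<forall>y\<in>X. d x y < r \<longrightarrow> y \<in> U x" if "x \<in> X" for x
  proof -
    have "x \<in> U x" using U(3) that by (auto simp: PiE_iff)
    then show ?thesis using openin_imp_ball[of "U x" x] U(2) that by metis
  qed
  then obtain r where r: "\<And>x. x \<in> X \<Longrightarrow> r x > 0" "\<And>x y. x \<in> X \<Longrightarrow> y \<in> X \<Longrightarrow> d x y < r x \<Longrightarrow> y \<in> U x" by metis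
  define A where "A = {x \<in> X. U x \<noteq> X}"
  have A: "finite A" "A \<subseteq> X" using U(1) by (auto simp: A_def)
  \<comment> \<open>A third of the smallest radius, for the path from \<open>x\<close> to
    \<open>s (i x)\<close>, on to its image under \<open>g\<close>, and back to
    \<open>g x\<close>.\<close>
  define \<delta> where "\<delta> = Min (insert 1 (r ` A)) / 3"
  have "Min (insert 1 (r ` A)) > 0" using A r(1) by (subst Min_gr_iff) auto
  then have \<delta>: "\<delta> > 0" by (simp add: \<delta>_def)
  have \<delta>_le: "3 * \<delta> \<le> r x" if "x \<in> A" for x using A that by (simp add: \<delta>_def)
  have "\<exists>i. d x (s i) < \<delta>" if "x \<in> A" for x using s \<delta> that A unfolding dense_seq_def by blast
  then obtain i where i: "\<And>x. x \<in> A \<Longrightarrow> d x (s (i x)) < \<delta>" by metis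
  define n where "n = Suc (Max (insert 0 (i ` A)))"
  have n: "i x < n" if "x \<in> A" for x unfolding n_def using A that by (simp add: le_imp_less_Suc)
  have sX: "s k \<in> X" for k using s by (simp add: dense_seq_def)
  have "g \<in> V" if g: "g \<in> Aut L M" and close: "\<And>i. i < n \<Longrightarrow> d (g (s i)) (s i) < \<delta>" for g
  proof -
    have "g x \<in> U x" if x: "x \<in> X" for x
    proof (cases "x \<in> A")
      case True
      have "d (g x) (g (s (i x))) < \<delta>" using Aut_dist[OF g x sX] i[OF True] by simp
      then have "d x (g x) < 3 * \<delta>"
        using close[OF n[OF True]] i[OF True] g x sX[of "i x"]
          mdist_triangle[of x "metric M" "s (i x)" "g x"] mdist_triangle[of "s (i x)" "metric M" "g (s (i x))" "g x"]
        by (simp add: mdist_commute)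
      then show ?thesis using r(2)[OF x Aut_in[OF g x]] \<delta>_le[OF True] by linarith
    next
      case False
      then show ?thesis using x g by (simp add: A_def)
    qed
    then have "g \<in> PiE X U" using Aut_extensional[OF g] by (simp add: PiE_iff)
    then show ?thesis using U(4) g unfolding W(2) by blast
  qed
  with \<delta> that show ?thesis by blast
qed

lemma one_Aut_group: "\<one>\<^bsub>Aut_group L M\<^esub> = (\<lambda>x\<in>X. x)"
  by (simp add: Aut_group_def BijGroup_def)

lemma case_nat_Val: "x \<in> X \<Longrightarrow> b \<in> Val \<Longrightarrow> case_nat x b \<in> Val"
  by (auto simp: Val_iff split: nat.splits)

abbreviation "RUC_M \<equiv> RUC (Aut_group L M) (Aut_topology L M) (space_topology M) (\<lambda>g. g)"

lemma Def_subset_RUC: "Def L M \<subseteq> RUC_M"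
proof
  fix f assume "f \<in> Def L M"
  then obtain \<phi> b where f: "f = (\<lambda>x\<in>X. \<phi> (case_nat x b))" and \<phi>: "dp \<phi>" and b: "b \<in> Val"
    unfolding Def_def by blast
  show "f \<in> RUC_M"
    unfolding RUC_def
  proof (intro CollectI conjI allI impI)
    show "f \<in> extensional (topspace (space_topology M))" by (simp add: f)
    have "continuous_map (space_topology M) VT (\<lambda>x. case_nat x b)"
      unfolding continuous_map_componentwise_UNIV
    proof
      fix k
      show "continuous_map (space_topology M) (space_topology M) (\<lambda>x. case_nat x b k)"
        using b by (cases k) auto
    qed
    from continuous_map_compose[OF this dp_continuous[OF \<phi>]]
    have "continuous_map (space_topology M) euclideanreal (\<lambda>x. \<phi> (case_nat x b))" by (simp add: comp_def)
    then show "continuous_map (space_topology M) euclideanreal f"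
      by (rule continuous_map_eq) (simp add: f)
    have "f ` X \<subseteq> \<phi> ` Val" using b case_nat_Val by (auto simp: f)
    then show "bounded (f ` topspace (space_topology M))"
      using bounded_subset[OF dp_bounded[OF \<phi>]] by simp
    fix \<epsilon> :: real assume "\<epsilon> > 0"
    from ucontD[OF dp_ucont[OF \<phi>] half_gt_zero[OF this]] obtain n \<delta> where 1: "\<delta> > 0"
      "\<And>e e'. e \<in> Val \<Longrightarrow> e' \<in> Val \<Longrightarrow> (\<And>i. i < n \<Longrightarrow> d (e i) (e' i) < \<delta>) \<Longrightarrow> \<bar>\<phi> e - \<phi> e'\<bar> < \<epsilon>/2"
      by metis
    define V where "V = {g \<in> Aut L M. \<forall>i<n. d (b i) (g (b i)) < \<delta>}"
    have "(SUP x\<in>X. \<bar>f (v x) - f x\<bar>) < \<epsilon>" if v: "v \<in> V" for v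
    proof -
      have vA: "v \<in> Aut L M" using v by (simp add: V_def)
      have "\<bar>f (v x) - f x\<bar> \<le> \<epsilon>/2" if x: "x \<in> X" for x
      proof -
        \<comment> \<open>\<open>f x\<close> is the value at \<open>v (x, b)\<close>, by invariance,
          and \<open>f (v x)\<close> the value at \<open>(v x, b)\<close>. These tuples differ in
          the parameters only, and by an amount independent of \<open>x\<close>.\<close>
        have "\<phi> (v \<circ> case_nat x b) = \<phi> (case_nat x b)"
          using bspec[OF Aut_dp[OF vA \<phi>] case_nat_Val[OF x b]] .
        moreover have "\<bar>\<phi> (case_nat (v x) b) - \<phi> (v \<circ> case_nat x b)\<bar> < \<epsilon>/2"
        proof (rule 1(2))
          show "case_nat (v x) b \<in> Val" "v \<circ> case_nat x b \<in> Val"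
            using case_nat_Val Aut_Val vA x b by auto
          show "d (case_nat (v x) b i) ((v \<circ> case_nat x b) i) < \<delta>" if "i < n" for i
            using that v x b vA 1(1) by (cases i) (auto simp: V_def)
        qed
        ultimately show ?thesis using x vA by (simp add: f)
      qed
      then have "(SUP x\<in>X. \<bar>f (v x) - f x\<bar>) \<le> \<epsilon>/2" using X_ne by (intro cSUP_least)
      then show ?thesis using \<open>\<epsilon> > 0\<close> by linarith
    qed
    moreover have "(\<lambda>x\<in>X. x) \<in> V" using Aut_id b 1(1) by (simp add: V_def)
    ultimately show "\<exists>V. openin (Aut_topology L M) V \<and> \<one>\<^bsub>Aut_group L M\<^esub> \<in> V \<and>
        (\<forall>v\<in>V. (SUP x\<in>topspace (space_topology M). \<bar>f (v x) - f x\<bar>) < \<epsilon>)"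
      unfolding one_Aut_group topspace_mtopology_of
      using openin_Aut_stabilizer[OF b, of n \<delta>] unfolding V_def by blast
  qed
qed

text \<open>A real supremum bounds its members only when the set is bounded above; boundedness of
  \<open>f\<close> ensures this and makes the uniform estimate available pointwise.\<close>

lemma RUC_D:
  assumes f: "f \<in> RUC_M"
  shows "f \<in> extensional X" "continuous_map (space_topology M) euclideanreal f" "bounded (f ` X)"
    and "\<And>\<epsilon>. \<epsilon> > 0 \<Longrightarrow> \<exists>V. openin (Aut_topology L M) V \<and> (\<lambda>x\<in>X. x) \<in> V \<and> V \<subseteq> Aut L M \<and>
      (\<forall>v\<in>V. \<forall>x\<in>X. \<bar>f (v x) - f x\<bar> < \<epsilon>)"
proof -
  show "f \<in> extensional X" "continuous_map (space_topology M) euclideanreal f" and bdd: "bounded (f ` X)"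
    using f by (auto simp: RUC_def)
  fix \<epsilon> :: real assume "\<epsilon> > 0"
  then obtain V where V: "openin (Aut_topology L M) V" "(\<lambda>x\<in>X. x) \<in> V"
    "\<forall>v\<in>V. (SUP x\<in>X. \<bar>f (v x) - f x\<bar>) < \<epsilon>"
    using f unfolding RUC_def one_Aut_group by auto
  have VA: "V \<subseteq> Aut L M" using openin_subset[OF V(1)] by (simp add: topspace_Aut_topology)
  obtain B where B: "\<And>x. x \<in> X \<Longrightarrow> \<bar>f x\<bar> \<le> B" using bdd by (auto simp: bounded_iff)
  have "\<bar>f (v x) - f x\<bar> < \<epsilon>" if "v \<in> V" "x \<in> X" for v x
  proof -
    have "\<bar>f (v x) - f x\<bar> \<le> 2 * B" if "x \<in> X" for x
      using B[OF that] B[of "v x"] that VA \<open>v \<in> V\<close> Aut_in by fastforce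
    then have "bdd_above ((\<lambda>x. \<bar>f (v x) - f x\<bar>) ` X)" by (auto intro!: bdd_aboveI)
    then have "\<bar>f (v x) - f x\<bar> \<le> (SUP x\<in>X. \<bar>f (v x) - f x\<bar>)" using that(2) by (intro cSUP_upper)
    then show ?thesis using V(3) that(1) by fastforce
  qed
  then show "\<exists>V. openin (Aut_topology L M) V \<and> (\<lambda>x\<in>X. x) \<in> V \<and> V \<subseteq> Aut L M \<and>
      (\<forall>v\<in>V. \<forall>x\<in>X. \<bar>f (v x) - f x\<bar> < \<epsilon>)" using V VA by blast
qed

end

section \<open>Compactness of sequences, and definable partitions of unity\<close>

context categorical_structure
begin

text \<open>By \<open>saturation\<close> every type is realized, so a family of conditions
  \<open>\<xi> < 0\<close> covering the sequences covers the compact space of types as well.\<close>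

lemma Val_compact:
  assumes dp: "\<And>\<xi>. \<xi> \<in> C \<Longrightarrow> dp \<xi>" and cover: "\<And>e. e \<in> Val \<Longrightarrow> \<exists>\<xi>\<in>C. \<xi> e < 0"
  obtains C0 where "finite C0" "C0 \<subseteq> C" "\<And>e. e \<in> Val \<Longrightarrow> \<exists>\<xi>\<in>C0. \<xi> e < 0"
proof -
  let ?P = "powertop_real (Collect dp)"
  define U where "U \<xi> = {\<Phi> \<in> topspace ?P. \<Phi> \<xi> \<in> {..<0}}" for \<xi>
  have op: "openin ?P (U \<xi>)" if "\<xi> \<in> C" for \<xi>
    unfolding U_def
    by (rule openin_continuous_map_preimage[OF continuous_map_eval]) (use dp[OF that] in \<open>auto simp flip: open_openin\<close>)
  have "S \<subseteq> \<Union>(U ` C)"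
  proof
    fix \<Phi> assume \<Phi>: "\<Phi> \<in> S"
    obtain e where e: "e \<in> Val" "\<Phi> = ev e" using saturation[OF \<Phi>] by metis
    obtain \<xi> where \<xi>: "\<xi> \<in> C" "\<xi> e < 0" using cover[OF e(1)] by blast
    have "\<Phi> \<in> topspace ?P" using \<Phi> closedin_subset[OF spectrum_closed] by blast
    moreover have "\<Phi> \<xi> < 0" unfolding e(2) using \<xi> dp by simp
    ultimately show "\<Phi> \<in> \<Union>(U ` C)" using \<xi>(1) unfolding U_def by blast
  qed
  moreover have "\<forall>T\<in>U ` C. openin ?P T" using op by blast
  ultimately have "\<exists>\<F>. finite \<F> \<and> \<F> \<subseteq> U ` C \<and> S \<subseteq> \<Union>\<F>"
    using conjunct2[OF S_compact[unfolded compactin_def], rule_format, of "U ` C"] by blast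
  then obtain \<F> where "finite \<F>" "\<F> \<subseteq> U ` C" "S \<subseteq> \<Union>\<F>" by blast
  then obtain C0 where C0: "finite C0" "C0 \<subseteq> C" "S \<subseteq> \<Union>(U ` C0)"
    by (metis finite_subset_image)
  have "\<exists>\<xi>\<in>C0. \<xi> e < 0" if e: "e \<in> Val" for e
  proof -
    obtain \<xi> where \<xi>: "\<xi> \<in> C0" "ev e \<in> U \<xi>" using C0(3) ev_S[OF e] by blast
    then have "dp \<xi>" "ev e \<xi> < 0" using dp C0(2) by (auto simp: U_def)
    then show ?thesis using \<xi>(1) by auto
  qed
  with C0(1,2) that show ?thesis by blast
qed

text \<open>The conditions \<open>1/(m+1) < h\<close> cover all sequences and grow with
  \<open>m\<close>, so by compactness a single \<open>m\<close> suffices. Saturation is essential: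
  an infimum 0 would have to be attained.\<close>

lemma Val_positive:
  assumes h: "dp h" "\<And>e. e \<in> Val \<Longrightarrow> 0 < h e"
  obtains \<kappa> where "\<kappa> > 0" "\<And>e. e \<in> Val \<Longrightarrow> \<kappa> < h e"
proof -
  define t where "t m e = inverse (real (Suc m)) - h e" for m e
  have dpt: "dp (t m)" for m unfolding t_def[abs_def] by (intro dp_diff dp_const h)
  obtain C0 where C0: "finite C0" "C0 \<subseteq> range t" "\<And>e. e \<in> Val \<Longrightarrow> \<exists>\<xi>\<in>C0. \<xi> e < 0"
  proof (rule Val_compact[of "range t"])
    show "\<exists>\<xi>\<in>range t. \<xi> e < 0" if "e \<in> Val" for e
      using reals_Archimedean[OF h(2)[OF that]] by (auto simp: t_def)
  qed (use dpt that in auto)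
  obtain A where A: "finite A" "C0 = t ` A" using C0(1,2) finite_subset_image by metis
  define m where "m = Max (insert 0 A)"
  have "inverse (real (Suc m)) < h e" if e: "e \<in> Val" for e
  proof -
    obtain k where k: "k \<in> A" "t k e < 0" using C0(3)[OF e] A(2) by blast
    have "k \<le> m" unfolding m_def using A(1) k(1) by simp
    then have "inverse (real (Suc m)) \<le> inverse (real (Suc k))" by (simp add: field_simps)
    then show ?thesis using k(2) unfolding t_def by linarith
  qed
  then show ?thesis using that[of "inverse (real (Suc m))"] by simp
qed

text \<open>Any two points \<open>x\<close>, \<open>x'\<close> for which \<open>(x, s)\<close>, \<open>(x', s)\<close> are close to the orbit of \<open>a\<close> are nearly
  moved to each other by automorphisms which nearly fix the parameters \<open>s\<close>.\<close>

lemma RUC_local: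
  assumes f: "f \<in> RUC_M" and s: "dense_seq s" and a: "a \<in> Val" and \<epsilon>: "\<epsilon> > 0"
  shows "\<exists>\<xi> t. dp \<xi> \<and> \<xi> a < 0 \<and> (\<forall>x\<in>X. \<xi> (case_nat x s) < 0 \<longrightarrow> \<bar>f x - t\<bar> < 2 * \<epsilon>)"
proof -
  obtain V where V: "openin (Aut_topology L M) V" "(\<lambda>x\<in>X. x) \<in> V"
    "\<forall>v\<in>V. \<forall>x\<in>X. \<bar>f (v x) - f x\<bar> < \<epsilon>"
    using RUC_D(4)[OF f \<epsilon>] by blast
  obtain n \<delta> where \<delta>: "\<delta> > 0" "\<And>g. g \<in> Aut L M \<Longrightarrow> (\<And>i. i < n \<Longrightarrow> d (g (s i)) (s i) < \<delta>) \<Longrightarrow> g \<in> V"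
    using Aut_nbhd_dense_seq[OF V(1,2) s] by metis
  have sX: "s k \<in> X" for k using s by (simp add: dense_seq_def)
  have sV: "s \<in> Val" using s by (simp add: dense_seq_def)
  \<comment> \<open>\<open>Suc n\<close> entries are matched, since in \<open>case_nat x s\<close>
    entry 0 is \<open>x\<close> and the \<open>n\<close> relevant parameters follow.\<close>
  obtain \<xi>1 where \<xi>1: "dp \<xi>1" "\<xi>1 a < 0"
    "\<And>b. b \<in> Val \<Longrightarrow> \<xi>1 b < 0 \<Longrightarrow> \<exists>g\<in>Aut L M. \<forall>j<Suc n. d (g (a j)) (b j) < \<delta>/2"
    using orbit_neighbourhood[OF a half_gt_zero[OF \<delta>(1)], of "Suc n"] by metis
  show ?thesis
  proof (cases "\<exists>x\<in>X. \<xi>1 (case_nat x s) < 0")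
    \<comment> \<open>If no \<open>x\<close> meets the condition, any value of \<open>t\<close>
      satisfies the claim for \<xi>1.\<close>
    case False
    then show ?thesis using \<xi>1(1,2) by blast
  next
    case True
    then obtain x0 where x0: "x0 \<in> X" "\<xi>1 (case_nat x0 s) < 0" by blast
    obtain g0 where g0: "g0 \<in> Aut L M" "\<And>j. j < Suc n \<Longrightarrow> d (g0 (a j)) (case_nat x0 s j) < \<delta>/2"
      using \<xi>1(3)[OF case_nat_Val[OF x0(1) sV] x0(2)] by blast
    define y where "y = g0 (a 0)"
    have y: "y \<in> X" using g0(1) a by (simp add: y_def)
    have "openin (space_topology M) {z \<in> topspace (space_topology M). f z \<in> {f y - \<epsilon> <..< f y + \<epsilon>}}"
      by (rule openin_continuous_map_preimage[OF RUC_D(2)[OF f]]) (simp flip: open_openin)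
    then obtain \<rho> where \<rho>: "\<rho> > 0" "\<And>z. z \<in> X \<Longrightarrow> d y z < \<rho> \<Longrightarrow> \<bar>f z - f y\<bar> < \<epsilon>"
    proof (rule openin_imp_ball)
      show "y \<in> {z \<in> topspace (space_topology M). f z \<in> {f y - \<epsilon> <..< f y + \<epsilon>}}" using y \<epsilon> by simp
      fix r assume "r > 0" "\<And>z. z \<in> X \<Longrightarrow> d y z < r \<Longrightarrow> z \<in> {z \<in> topspace (space_topology M). f z \<in> {f y - \<epsilon> <..< f y + \<epsilon>}}"
      then show thesis by (intro that[of r]) (auto simp: abs_less_iff algebra_simps)
    qed
    \<comment> \<open>Two rounds are needed: the radius \<rho> comes from continuity of
      \<open>f\<close> at \<open>y\<close>, and \<open>y\<close> is known only once the first
      condition \<xi>1 has supplied \<open>x0\<close> and \<open>g0\<close>. The minimum with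
      \<open>\<delta>/2\<close> keeps the parameters under control too.\<close>
    define \<rho>' where "\<rho>' = min \<rho> (\<delta>/2)"
    have \<rho>': "\<rho>' > 0" using \<rho>(1) \<delta>(1) by (simp add: \<rho>'_def)
    obtain \<xi> where \<xi>: "dp \<xi>" "\<xi> a < 0"
      "\<And>b. b \<in> Val \<Longrightarrow> \<xi> b < 0 \<Longrightarrow> \<exists>g\<in>Aut L M. \<forall>j<Suc n. d (g (a j)) (b j) < \<rho>'"
      using orbit_neighbourhood[OF a \<rho>', of "Suc n"] by metis
    have "\<bar>f x - f y\<bar> < 2 * \<epsilon>" if x: "x \<in> X" "\<xi> (case_nat x s) < 0" for x
    proof -
      obtain g where g: "g \<in> Aut L M" "\<And>j. j < Suc n \<Longrightarrow> d (g (a j)) (case_nat x s j) < \<rho>'"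
        using \<xi>(3)[OF case_nat_Val[OF x(1) sV] x(2)] by blast
      obtain h where h: "h \<in> Aut L M" "\<And>x. x \<in> X \<Longrightarrow> g (h x) = x" "\<And>x. x \<in> X \<Longrightarrow> h (g x) = x"
        using Aut_inverse[OF g(1)] by metis
      \<comment> \<open>\<open>v\<close> is \<open>g0\<close> after the inverse of \<open>g\<close>.
        It moves \<open>x\<close>, which is close to \<open>g (a 0)\<close>, close to
        \<open>y\<close>; and it nearly fixes the parameters \<open>s i\<close>, to which both
        \<open>g\<close> and \<open>g0\<close> bring \<open>a (Suc i)\<close> close.\<close>
      define v where "v = compose X g0 h"
      have v: "v \<in> Aut L M" unfolding v_def using g0(1) h(1) by (rule Aut_compose)
      have move: "d (v z) (g0 (a j)) = d (g (a j)) z" if "z \<in> X" for z j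
      proof -
        have "d (v z) (g0 (a j)) = d (h z) (a j)"
          using that h(1) a by (simp add: v_def compose_eq Aut_dist[OF g0(1)])
        also have "\<dots> = d (g (h z)) (g (a j))"
          using that h(1) a by (simp add: Aut_dist[OF g(1)])
        finally show ?thesis using h(2)[OF that] by (simp add: mdist_commute)
      qed
      have "v \<in> V"
      proof (rule \<delta>(2)[OF v])
        fix i assume i: "i < n"
        have "d (v (s i)) (g0 (a (Suc i))) < \<delta>/2"
          using move[OF sX] g(2)[of "Suc i"] i by (simp add: \<rho>'_def)
        moreover have "d (g0 (a (Suc i))) (s i) < \<delta>/2" using g0(2)[of "Suc i"] i by simp
        ultimately show "d (v (s i)) (s i) < \<delta>"
          using mdist_triangle[of "v (s i)" "metric M" "g0 (a (Suc i))" "s i"] v g0(1) a sX by simp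
      qed
      then have "\<bar>f (v x) - f x\<bar> < \<epsilon>" using V(3) x(1) by blast
      moreover have "d y (v x) < \<rho>"
        using move[OF x(1), of 0] g(2)[of 0] by (simp add: y_def \<rho>'_def mdist_commute)
      then have "\<bar>f (v x) - f y\<bar> < \<epsilon>" using \<rho>(2) v x(1) by simp
      ultimately show ?thesis by linarith
    qed
    then show ?thesis using \<xi>(1,2) by blast
  qed
qed

text \<open>One dense sequence \<open>s\<close> serves as parameter for every accuracy. The
  definable approximants are controlled on the tuples \<open>(x, s)\<close> only, so
  \<open>dp_forced_limit\<close> rather than a plain uniform limit is required.\<close>

lemma RUC_definable:
  assumes f: "f \<in> RUC_M" and s: "dense_seq s"
  obtains \<phi> where "dp \<phi>" "\<And>x. x \<in> X \<Longrightarrow> \<phi> (case_nat x s) = f x"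
proof -
  have sV: "s \<in> Val" using s by (simp add: dense_seq_def)
  have approx: "\<exists>\<phi>. dp \<phi> \<and> (\<forall>e\<in>(\<lambda>x. case_nat x s) ` X. \<bar>\<phi> e - f (e 0)\<bar> < \<epsilon>)" if "\<epsilon> > 0" for \<epsilon>
  proof -
    have \<epsilon>: "\<epsilon>/3 > 0" using that by simp
    define C where "C = {\<xi>. dp \<xi> \<and> (\<exists>t. \<forall>x\<in>X. \<xi> (case_nat x s) < 0 \<longrightarrow> \<bar>f x - t\<bar> < 2 * (\<epsilon>/3))}"
    have dpC': "dp \<xi>" if "\<xi> \<in> C" for \<xi> using that by (simp add: C_def)
    have cover: "\<exists>\<xi>\<in>C. \<xi> e < 0" if "e \<in> Val" for e
      using RUC_local[OF f s that \<epsilon>] unfolding C_def by blast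
    obtain C0 where C0: "finite C0" "C0 \<subseteq> C" "\<And>e. e \<in> Val \<Longrightarrow> \<exists>\<xi>\<in>C0. \<xi> e < 0"
      using Val_compact[OF dpC' cover] by metis
    have "\<exists>t. \<forall>x\<in>X. \<xi> (case_nat x s) < 0 \<longrightarrow> \<bar>f x - t\<bar> < 2 * (\<epsilon>/3)" if "\<xi> \<in> C0" for \<xi>
      using that C0(2) unfolding C_def by blast
    then obtain t where t: "\<And>\<xi> x. \<xi> \<in> C0 \<Longrightarrow> x \<in> X \<Longrightarrow> \<xi> (case_nat x s) < 0 \<Longrightarrow> \<bar>f x - t \<xi>\<bar> < 2 * (\<epsilon>/3)"
      by metis
    have dpC: "dp \<xi>" if "\<xi> \<in> C0" for \<xi> using that C0(2) by (auto simp: C_def)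
    \<comment> \<open>The weight of \<xi> is positive exactly where \<open>\<xi> < 0\<close>, where
      \<open>f\<close> is within \<open>2 * (\<epsilon>/3)\<close> of \<open>t \<xi>\<close>; hence
      so is the weighted average below.\<close>
    define w where "w \<xi> e = max 0 (- \<xi> e)" for \<xi> :: "(nat \<Rightarrow> 'a) \<Rightarrow> real" and e
    have dpw: "dp (w \<xi>)" if "\<xi> \<in> C0" for \<xi>
      unfolding w_def by (intro dp_max dp_const dp_uminus dpC that)
    have w0: "w \<xi> e \<ge> 0" for \<xi> e by (simp add: w_def)
    define h where "h e = (\<Sum>\<xi>\<in>C0. w \<xi> e)" for e
    have dph: "dp h" unfolding h_def[abs_def] by (rule dp_sum[OF C0(1) dpw])
    have "h e > 0" if e: "e \<in> Val" for e
    proof -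
      obtain \<xi> where \<xi>: "\<xi> \<in> C0" "\<xi> e < 0" using C0(3)[OF e] by blast
      then have "0 < w \<xi> e" by (simp add: w_def)
      also have "w \<xi> e \<le> h e" unfolding h_def by (rule member_le_sum[OF \<xi>(1)]) (use w0 C0(1) in auto)
      finally show ?thesis .
    qed
    then obtain \<kappa> where \<kappa>: "\<kappa> > 0" "\<And>e. e \<in> Val \<Longrightarrow> \<kappa> < h e" using Val_positive[OF dph] by metis
    \<comment> \<open>On valuations \<open>max \<kappa> (h e)\<close> is just \<open>h e\<close>;
      the maximum turns the quotient into a continuous connective.\<close>
    define \<phi> where "\<phi> e = (\<Sum>\<xi>\<in>C0. t \<xi> * w \<xi> e) / max \<kappa> (h e)" for e
    have "dp \<phi>"
      unfolding \<phi>_def[abs_def]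
      by (intro dp_divide[OF \<kappa>(1) _ dph] dp_sum[OF C0(1)] dp_mult dp_const dpw)
    moreover have "\<bar>\<phi> (case_nat x s) - f x\<bar> < \<epsilon>" if x: "x \<in> X" for x
    proof -
      let ?e = "case_nat x s"
      have h: "h ?e > \<kappa>" using \<kappa>(2)[OF case_nat_Val[OF x sV]] .
      then have h0: "h ?e > 0" using \<kappa>(1) by linarith
      have "\<phi> ?e - f x = ((\<Sum>\<xi>\<in>C0. t \<xi> * w \<xi> ?e) - f x * h ?e) / h ?e"
        using h h0 by (simp add: \<phi>_def field_simps)
      also have "(\<Sum>\<xi>\<in>C0. t \<xi> * w \<xi> ?e) - f x * h ?e = (\<Sum>\<xi>\<in>C0. (t \<xi> - f x) * w \<xi> ?e)"
        by (simp add: h_def sum_distrib_left sum_subtractf left_diff_distrib)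
      finally have eq: "\<phi> ?e - f x = (\<Sum>\<xi>\<in>C0. (t \<xi> - f x) * w \<xi> ?e) / h ?e" .
      have "\<bar>\<Sum>\<xi>\<in>C0. (t \<xi> - f x) * w \<xi> ?e\<bar> \<le> (\<Sum>\<xi>\<in>C0. 2 * (\<epsilon>/3) * w \<xi> ?e)"
      proof (rule order_trans[OF sum_abs sum_mono])
        fix \<xi> assume \<xi>: "\<xi> \<in> C0"
        show "\<bar>(t \<xi> - f x) * w \<xi> ?e\<bar> \<le> 2 * (\<epsilon>/3) * w \<xi> ?e"
        proof (cases "\<xi> ?e < 0")
          case True
          then have "\<bar>t \<xi> - f x\<bar> \<le> 2 * (\<epsilon>/3)" using t[OF \<xi> x] by (simp add: abs_minus_commute)
          then show ?thesis unfolding abs_mult abs_of_nonneg[OF w0] by (rule mult_right_mono[OF _ w0])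
        next
          case False
          then have "w \<xi> ?e = 0" by (simp add: w_def)
          then show ?thesis by (simp only: mult_zero_right abs_zero order_refl)
        qed
      qed
      also have "\<dots> = 2 * (\<epsilon>/3) * h ?e" by (simp only: h_def sum_distrib_left)
      finally have "\<bar>\<phi> ?e - f x\<bar> \<le> 2 * (\<epsilon>/3)"
        unfolding eq abs_divide using h0 by (simp add: divide_le_eq)
      then show ?thesis using \<epsilon> by linarith
    qed
    ultimately show ?thesis by (intro exI[of _ \<phi>]) auto
  qed
  obtain \<phi> where \<phi>: "dp \<phi>" "\<And>e. e \<in> (\<lambda>x. case_nat x s) ` X \<Longrightarrow> \<phi> e = f (e 0)"
    by (rule dp_forced_limit[OF _ approx]) (use case_nat_Val sV in auto)
  show ?thesis by (rule that[OF \<phi>(1)]) (use \<phi>(2) in auto)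
qed

theorem Def_eq_RUC: "Def L M = RUC_M"
proof (rule antisym[OF Def_subset_RUC], rule subsetI)
  fix f assume f: "f \<in> RUC_M"
  obtain s where s: "dense_seq s" using ex_dense_seq by blast
  obtain \<phi> where "dp \<phi>" "\<And>x. x \<in> X \<Longrightarrow> \<phi> (case_nat x s) = f x" using RUC_definable[OF f s] by metis
  moreover have "f = (\<lambda>x\<in>X. \<phi> (case_nat x s))"
    using RUC_D(1)[OF f] calculation(2) by (auto simp: extensional_def fun_eq_iff)
  ultimately show "f \<in> Def L M" using s unfolding Def_def dense_seq_def by blast
qed

end

section \<open>Maximal ideals of uniformly closed function algebras\<close>

locale function_algebra =
  fixes X :: "'x set" and A :: "('x \<Rightarrow> real) set"
  assumes ne: "X \<noteq> {}"
    and ext: "f \<in> A \<Longrightarrow> f \<in> extensional X"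
    and bdd: "f \<in> A \<Longrightarrow> bounded (f ` X)"
    and const: "(\<lambda>x\<in>X. c) \<in> A"
    and add: "f \<in> A \<Longrightarrow> g \<in> A \<Longrightarrow> (\<lambda>x\<in>X. f x + g x) \<in> A"
    and mult: "f \<in> A \<Longrightarrow> g \<in> A \<Longrightarrow> (\<lambda>x\<in>X. f x * g x) \<in> A"
    and lim: "f \<in> extensional X \<Longrightarrow> (\<And>\<epsilon>. \<epsilon> > 0 \<Longrightarrow> \<exists>g\<in>A. \<forall>x\<in>X. \<bar>g x - f x\<bar> < \<epsilon>) \<Longrightarrow> f \<in> A"
begin

abbreviation "R \<equiv> function_ring X A"

lemma R_simps: "carrier R = A" "f \<otimes>\<^bsub>R\<^esub> g = (\<lambda>x\<in>X. f x * g x)" "\<one>\<^bsub>R\<^esub> = (\<lambda>x\<in>X. 1)"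
  "f \<oplus>\<^bsub>R\<^esub> g = (\<lambda>x\<in>X. f x + g x)" "\<zero>\<^bsub>R\<^esub> = (\<lambda>x\<in>X. 0)"
  by (simp_all add: function_ring_def)

lemma A_eqI: "f \<in> extensional X \<Longrightarrow> g \<in> extensional X \<Longrightarrow> (\<And>x. x \<in> X \<Longrightarrow> f x = g x) \<Longrightarrow> f = g"
  by (rule extensionalityI)

lemma smult: "f \<in> A \<Longrightarrow> (\<lambda>x\<in>X. c * f x) \<in> A"
proof -
  assume "f \<in> A"
  then have "(\<lambda>x\<in>X. (\<lambda>x\<in>X. c) x * f x) \<in> A" by (intro mult const)
  moreover have "(\<lambda>x\<in>X. (\<lambda>x\<in>X. c) x * f x) = (\<lambda>x\<in>X. c * f x)" by (rule restrict_ext) simp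
  ultimately show ?thesis by simp
qed

lemma shift: "f \<in> A \<Longrightarrow> (\<lambda>x\<in>X. f x - c) \<in> A"
proof -
  assume "f \<in> A"
  then have "(\<lambda>x\<in>X. f x + (\<lambda>x\<in>X. - c) x) \<in> A" by (intro add const)
  moreover have "(\<lambda>x\<in>X. f x + (\<lambda>x\<in>X. - c) x) = (\<lambda>x\<in>X. f x - c)" by (rule restrict_ext) simp
  ultimately show ?thesis by simp
qed

lemma ring_R: "ring R"
proof (rule ringI)
  show "abelian_group R"
  proof (rule abelian_groupI, unfold R_simps)
    show "\<exists>g\<in>A. (\<lambda>x\<in>X. g x + f x) = (\<lambda>x\<in>X. 0)" if "f \<in> A" for f
      by (rule bexI[OF _ smult[OF that, of "-1"]]) (rule restrict_ext, simp)
    show "(\<lambda>x\<in>X. (\<lambda>x\<in>X. 0) x + f x) = f" if "f \<in> A" for f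
      by (rule A_eqI) (use ext[OF that] in auto)
  qed (auto intro!: add const restrict_ext)
  show "monoid R"
  proof (rule monoidI, unfold R_simps)
    show "(\<lambda>x\<in>X. (\<lambda>x\<in>X. 1) x * f x) = f" "(\<lambda>x\<in>X. f x * (\<lambda>x\<in>X. 1) x) = f" if "f \<in> A" for f
      by (rule A_eqI; use ext[OF that] in auto)+
  qed (auto intro!: mult const restrict_ext)
qed (auto simp: R_simps algebra_simps intro!: restrict_ext)

text \<open>Since \<open>h \<ge> \<epsilon>\<close>, its inverse is the function
  \<open>1 / max \<epsilon> t\<close> of \<open>h\<close>, which is continuous on the whole line, so
  Stone--Weierstrass in the form \<open>connective_closure\<close> applies.\<close>

lemma inverse_closed:
  assumes h: "h \<in> A" and \<epsilon>: "\<epsilon> > 0" "\<And>x. x \<in> X \<Longrightarrow> h x \<ge> \<epsilon>"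
  shows "(\<lambda>x\<in>X. inverse (h x)) \<in> A"
proof -
  define C where "C = {\<phi>. restrict \<phi> X \<in> A}"
  have "(\<lambda>e. (\<lambda>v. inverse (max \<epsilon> (v 0))) (\<lambda>i. if i < (1::nat) then h e else 0)) \<in> C"
  proof (rule connective_closure[where V = X])
    show "bounded (\<phi> ` X)" if "\<phi> \<in> C" for \<phi>
    proof -
      have "restrict \<phi> X ` X = \<phi> ` X" by auto
      then show ?thesis using bdd[of "restrict \<phi> X"] that by (simp add: C_def)
    qed
    show "(\<lambda>_. c) \<in> C" for c using const by (simp add: C_def)
    fix \<phi> \<psi> assume "\<phi> \<in> C" "\<psi> \<in> C"
    then have *: "restrict \<phi> X \<in> A" "restrict \<psi> X \<in> A" by (auto simp: C_def)
    have "(\<lambda>x\<in>X. restrict \<phi> X x + restrict \<psi> X x) = (\<lambda>x\<in>X. \<phi> x + \<psi> x)" by (rule restrict_ext) simp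
    then show "(\<lambda>e. \<phi> e + \<psi> e) \<in> C" using add[OF *] by (simp add: C_def)
    have "(\<lambda>x\<in>X. restrict \<phi> X x * restrict \<psi> X x) = (\<lambda>x\<in>X. \<phi> x * \<psi> x)" by (rule restrict_ext) simp
    then show "(\<lambda>e. \<phi> e * \<psi> e) \<in> C" using mult[OF *] by (simp add: C_def)
  next
    fix \<phi> assume *: "\<And>\<epsilon>. \<epsilon> > 0 \<Longrightarrow> \<exists>\<psi>\<in>C. \<forall>e\<in>X. \<bar>\<psi> e - \<phi> e\<bar> < \<epsilon>"
    have "restrict \<phi> X \<in> A"
    proof (rule lim)
      fix \<epsilon> :: real assume "\<epsilon> > 0"
      then obtain \<psi> where "\<psi> \<in> C" "\<forall>e\<in>X. \<bar>\<psi> e - \<phi> e\<bar> < \<epsilon>" using * by blast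
      then show "\<exists>g\<in>A. \<forall>x\<in>X. \<bar>g x - restrict \<phi> X x\<bar> < \<epsilon>"
        by (intro bexI[of _ "restrict \<psi> X"]) (auto simp: C_def)
    qed simp
    then show "\<phi> \<in> C" by (simp add: C_def)
  next
    have "max \<epsilon> (v 0) \<noteq> 0" for v :: "nat \<Rightarrow> real" using \<epsilon>(1) by linarith
    then show "continuous_on UNIV (\<lambda>v::nat \<Rightarrow> real. inverse (max \<epsilon> (v 0)))"
      by (intro continuous_intros continuous_on_product_coordinates) auto
    show "h \<in> C" using h A_eqI[OF _ ext[OF h], of "restrict h X"] by (simp add: C_def)
  qed
  then have "(\<lambda>x\<in>X. inverse (max \<epsilon> (h x))) \<in> A" by (simp add: C_def)
  moreover have "(\<lambda>x\<in>X. inverse (max \<epsilon> (h x))) = (\<lambda>x\<in>X. inverse (h x))"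
    by (rule restrict_ext) (use \<epsilon>(2) in \<open>simp add: max_absorb2\<close>)
  ultimately show ?thesis by simp
qed

section \<open>Points of the spectrum and maximal ideals\<close>

abbreviation "K \<equiv> spectrum X A"

lemma K_const: "\<Phi> \<in> K \<Longrightarrow> \<Phi> (\<lambda>x\<in>X. c) = c"
  by (intro antisym spectrum_bounds[of \<Phi> X A]) (auto simp: const)

lemma K_add_mult:
  assumes \<Phi>: "\<Phi> \<in> K" and fg: "f \<in> A" "g \<in> A"
  shows "\<Phi> (\<lambda>x\<in>X. f x + g x) = \<Phi> f + \<Phi> g" "\<Phi> (\<lambda>x\<in>X. f x * g x) = \<Phi> f * \<Phi> g"
proof -
  define G where "G = {f, g, \<lambda>x\<in>X. f x + g x, \<lambda>x\<in>X. f x * g x}"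
  have G: "finite G" "G \<subseteq> A" using fg add mult by (auto simp: G_def)
  obtain x where x: "\<And>n::nat. x n \<in> X" "\<And>f. f \<in> G \<Longrightarrow> (\<lambda>n. f (x n)) \<longlonglongrightarrow> \<Phi> f"
    using spectrum_approx_seq[OF \<Phi> G] by metis
  have f: "(\<lambda>n. f (x n)) \<longlonglongrightarrow> \<Phi> f" and g: "(\<lambda>n. g (x n)) \<longlonglongrightarrow> \<Phi> g"
    by (intro x(2); simp add: G_def)+
  have "(\<lambda>n. f (x n) + g (x n)) \<longlonglongrightarrow> \<Phi> (\<lambda>x\<in>X. f x + g x)"
    using x(2)[of "\<lambda>x\<in>X. f x + g x"] x(1) by (simp add: G_def)
  then show "\<Phi> (\<lambda>x\<in>X. f x + g x) = \<Phi> f + \<Phi> g" using tendsto_add[OF f g] LIMSEQ_unique by blast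
  have "(\<lambda>n. f (x n) * g (x n)) \<longlonglongrightarrow> \<Phi> (\<lambda>x\<in>X. f x * g x)"
    using x(2)[of "\<lambda>x\<in>X. f x * g x"] x(1) by (simp add: G_def)
  then show "\<Phi> (\<lambda>x\<in>X. f x * g x) = \<Phi> f * \<Phi> g" using tendsto_mult[OF f g] LIMSEQ_unique by blast
qed

lemma K_shift: "\<Phi> \<in> K \<Longrightarrow> f \<in> A \<Longrightarrow> \<Phi> (\<lambda>x\<in>X. f x - c) = \<Phi> f - c"
proof -
  assume \<Phi>: "\<Phi> \<in> K" and f: "f \<in> A"
  have "(\<lambda>x\<in>X. f x - c) = (\<lambda>x\<in>X. f x + (\<lambda>x\<in>X. - c) x)" by (rule restrict_ext) simp
  then show ?thesis using K_add_mult(1)[OF \<Phi> f const[of "- c"]] K_const[OF \<Phi>, of "- c"] by simp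
qed

definition ker :: "(('x \<Rightarrow> real) \<Rightarrow> real) \<Rightarrow> ('x \<Rightarrow> real) set"
  where "ker \<Phi> = {f \<in> A. \<Phi> f = 0}"

lemma ideal_ker:
  assumes \<Phi>: "\<Phi> \<in> K"
  shows "ideal (ker \<Phi>) R"
proof (rule idealI[OF ring_R])
  interpret R: ring R by (rule ring_R)
  show "subgroup (ker \<Phi>) (add_monoid R)"
  proof (rule R.add.subgroupI)
    show "ker \<Phi> \<subseteq> carrier R" by (auto simp: ker_def R_simps)
    have "(\<lambda>x\<in>X. 0) \<in> ker \<Phi>" using const K_const[OF \<Phi>] by (simp add: ker_def)
    then show "ker \<Phi> \<noteq> {}" by blast
    show "\<ominus>\<^bsub>R\<^esub> f \<in> ker \<Phi>" if f: "f \<in> ker \<Phi>" for f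
    proof -
      have fA: "f \<in> A" "\<Phi> f = 0" using f by (auto simp: ker_def)
      have "\<ominus>\<^bsub>R\<^esub> f = (\<lambda>x\<in>X. -1 * f x)"
      proof (rule R.minus_equality)
        show "(\<lambda>x\<in>X. -1 * f x) \<oplus>\<^bsub>R\<^esub> f = \<zero>\<^bsub>R\<^esub>" unfolding R_simps by (rule restrict_ext) simp
        show "f \<in> carrier R" "(\<lambda>x\<in>X. -1 * f x) \<in> carrier R" unfolding R_simps by (rule fA smult)+
      qed
      moreover have "\<Phi> (\<lambda>x\<in>X. -1 * f x) = 0"
      proof -
        have "(\<lambda>x\<in>X. -1 * f x) = (\<lambda>x\<in>X. (\<lambda>x\<in>X. -1) x * f x)" by (rule restrict_ext) simp
        then show ?thesis using K_add_mult(2)[OF \<Phi> const[of "-1"] fA(1)] fA(2) by simp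
      qed
      ultimately show ?thesis using smult[OF fA(1), of "-1"] by (simp add: ker_def)
    qed
    show "f \<oplus>\<^bsub>R\<^esub> g \<in> ker \<Phi>" if "f \<in> ker \<Phi>" "g \<in> ker \<Phi>" for f g
      unfolding R_simps using that K_add_mult(1)[OF \<Phi>] add by (auto simp: ker_def)
  qed
  show "f \<otimes>\<^bsub>R\<^esub> a \<in> ker \<Phi>" "a \<otimes>\<^bsub>R\<^esub> f \<in> ker \<Phi>" if "a \<in> ker \<Phi>" "f \<in> carrier R" for a f
    using that K_add_mult(2)[OF \<Phi>] mult unfolding R_simps by (auto simp: ker_def)
qed

lemma ideal_with_const:
  assumes I: "ideal I R" and c: "(\<lambda>x\<in>X. c) \<in> I" "c \<noteq> 0"
  shows "I = A"
proof -
  interpret I: ideal I R by (rule I)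
  have "(\<lambda>x\<in>X. inverse c) \<otimes>\<^bsub>R\<^esub> (\<lambda>x\<in>X. c) \<in> I"
    using c(1) const by (intro I.I_l_closed) (simp_all add: R_simps)
  moreover have "(\<lambda>x\<in>X. inverse c) \<otimes>\<^bsub>R\<^esub> (\<lambda>x\<in>X. c) = \<one>\<^bsub>R\<^esub>"
    unfolding R_simps by (rule restrict_ext) (use c(2) in simp)
  ultimately have "\<one>\<^bsub>R\<^esub> \<in> I" by simp
  then show ?thesis using I.one_imp_carrier by (simp add: R_simps)
qed

text \<open>The kernel has codimension one: a larger ideal contains some \<open>f\<close> with
  \<open>\<Phi> f = c \<noteq> 0\<close> and also \<open>f - c\<close>, hence the invertible
  constant \<open>c\<close>.\<close>

lemma maximalideal_ker:
  assumes \<Phi>: "\<Phi> \<in> K"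
  shows "maximalideal (ker \<Phi>) R"
proof (rule maximalidealI[OF ideal_ker[OF \<Phi>]])
  have "(\<lambda>x\<in>X. 1) \<notin> ker \<Phi>" using K_const[OF \<Phi>, of 1] by (simp add: ker_def)
  then show "carrier R \<noteq> ker \<Phi>" using const[of 1] by (auto simp: R_simps)
  fix J assume J: "ideal J R" "ker \<Phi> \<subseteq> J" "J \<subseteq> carrier R"
  show "J = ker \<Phi> \<or> J = carrier R"
  proof (rule disjCI)
    assume "J \<noteq> carrier R"
    have "f \<in> ker \<Phi>" if f: "f \<in> J" for f
    proof (rule ccontr)
      assume nf: "f \<notin> ker \<Phi>"
      have fA: "f \<in> A" using f J(3) by (auto simp: R_simps)
      define c where "c = \<Phi> f"
      have c: "c \<noteq> 0" using nf fA by (simp add: c_def ker_def)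
      interpret J: ideal J R by (rule J(1))
      define g where "g = (\<lambda>x\<in>X. f x - c)"
      have "g \<in> ker \<Phi>" unfolding ker_def g_def using shift[OF fA] K_shift[OF \<Phi> fA, of c] by (simp add: c_def)
      then have "g \<in> J" using J(2) by blast
      moreover have "(\<lambda>x\<in>X. -1) \<otimes>\<^bsub>R\<^esub> f \<in> J" using f const by (intro J.I_l_closed) (simp_all add: R_simps)
      ultimately have "g \<oplus>\<^bsub>R\<^esub> ((\<lambda>x\<in>X. -1) \<otimes>\<^bsub>R\<^esub> f) \<in> J" by (rule additive_subgroup.a_closed[OF ideal.axioms(1)[OF J(1)]])
      moreover have "g \<oplus>\<^bsub>R\<^esub> ((\<lambda>x\<in>X. -1) \<otimes>\<^bsub>R\<^esub> f) = (\<lambda>x\<in>X. - c)"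
        unfolding R_simps g_def by (rule restrict_ext) simp
      ultimately have "(\<lambda>x\<in>X. - c) \<in> J" by simp
      then have "J = A" using ideal_with_const[OF J(1)] c by simp
      then show False using \<open>J \<noteq> carrier R\<close> by (simp add: R_simps)
    qed
    then show "J = ker \<Phi>" using J(2) by blast
  qed
qed

text \<open>Finitely many elements \<open>f\<close> of a proper ideal have a common approximate zero, since otherwise the
  sum of the \<open>f\<^sup>2\<close> would be invertible.\<close>

lemma maximalideal_imp_ker:
  assumes I: "maximalideal I R"
  shows "\<exists>\<Phi>\<in>K. I = ker \<Phi>"
proof -
  interpret I: maximalideal I R by (rule I)
  have IA: "I \<subseteq> A" using I.a_subset by (simp add: R_simps)
  \<comment> \<open>Squares make simultaneous smallness of finitely many elements the smallness of a
    single one, which is still in the ideal.\<close>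
  have sq: "\<exists>h\<in>I. \<forall>x\<in>X. h x = (\<Sum>f\<in>F. (f x)\<^sup>2)" if "finite F" "F \<subseteq> I" for F
    using that
  proof (induction F rule: finite_induct)
    case empty
    have "\<zero>\<^bsub>R\<^esub> \<in> I" by (rule additive_subgroup.zero_closed[OF ideal.axioms(1)[OF I.is_ideal]])
    then show ?case by (intro bexI[of _ "\<zero>\<^bsub>R\<^esub>"]) (simp_all add: R_simps)
  next
    case (insert f F)
    then obtain h where h: "h \<in> I" "\<forall>x\<in>X. h x = (\<Sum>f\<in>F. (f x)\<^sup>2)" by blast
    have "f \<in> I" "f \<in> carrier R" using insert IA by (auto simp: R_simps)
    then have "f \<otimes>\<^bsub>R\<^esub> f \<oplus>\<^bsub>R\<^esub> h \<in> I" using h(1) by (intro additive_subgroup.a_closed[OF ideal.axioms(1)[OF I.is_ideal]] I.I_l_closed)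
    then show ?case
      by (rule bexI[rotated]) (use insert h(2) in \<open>simp add: R_simps power2_eq_square\<close>)
  qed
  have zero: "\<exists>x\<in>X. \<forall>f\<in>F. \<bar>f x\<bar> < \<epsilon>" if F: "finite F" "F \<subseteq> I" and \<epsilon>: "\<epsilon> > 0" for F \<epsilon>
  proof (rule ccontr)
    assume no: "\<not> ?thesis"
    obtain h where h: "h \<in> I" "\<forall>x\<in>X. h x = (\<Sum>f\<in>F. (f x)\<^sup>2)" using sq[OF F] by blast
    have ge: "h x \<ge> \<epsilon>\<^sup>2" if x: "x \<in> X" for x
    proof -
      obtain f where f: "f \<in> F" "\<epsilon> \<le> \<bar>f x\<bar>" using no x by (meson not_le)
      have "\<epsilon>\<^sup>2 \<le> (f x)\<^sup>2" using f(2) \<epsilon> by (simp add: abs_le_square_iff[symmetric])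
      also have "\<dots> \<le> (\<Sum>f\<in>F. (f x)\<^sup>2)" by (rule member_le_sum[OF f(1)]) (use F in auto)
      finally show ?thesis using h(2) x by simp
    qed
    have hA: "h \<in> A" using h(1) IA by blast
    have e2: "\<epsilon>\<^sup>2 > 0" using \<epsilon> by simp
    have "(\<lambda>x\<in>X. inverse (h x)) \<otimes>\<^bsub>R\<^esub> h \<in> I"
      using h(1) inverse_closed[OF hA e2 ge] by (intro I.I_l_closed) (simp_all add: R_simps)
    moreover have "(\<lambda>x\<in>X. inverse (h x)) \<otimes>\<^bsub>R\<^esub> h = (\<lambda>x\<in>X. 1)"
      unfolding R_simps
    proof (rule restrict_ext)
      fix x assume x: "x \<in> X"
      have "h x \<noteq> 0" using ge[OF x] e2 by linarith
      then show "(\<lambda>x\<in>X. inverse (h x)) x * h x = 1" using x by simp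
    qed
    ultimately have "I = A" using ideal_with_const[OF I.is_ideal, of 1] by simp
    then show False using I.I_notcarr by (simp add: R_simps)
  qed
  \<comment> \<open>The closed conditions \<open>\<bar>\<Phi> f\<bar> \<le> \<epsilon>\<close> for
    \<open>f\<close> in the ideal have the finite intersection property by \<open>zero\<close>; a
    common point of them vanishes on the ideal.\<close>
  define U where "U = (\<lambda>(f, \<epsilon>). {\<Phi> \<in> topspace (powertop_real A). \<Phi> f \<in> {-\<epsilon>..\<epsilon>}})"
  define \<U> where "\<U> = U ` (I \<times> {0<..})"
  have "K \<inter> \<Inter>\<U> \<noteq> {}"
  proof (rule conjunct2[OF spectrum_compact[OF bdd, unfolded compactin_fip], rule_format], assumption, intro conjI allI impI ballI)
    show "closedin (powertop_real A) C" if C: "C \<in> \<U>" for C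
    proof -
      obtain p where p: "p \<in> I \<times> {0<..}" "C = U p" using C unfolding \<U>_def by blast
      have "closedin (powertop_real A) {\<Phi> \<in> topspace (powertop_real A). \<Phi> (fst p) \<in> {- snd p..snd p}}"
        by (rule closedin_continuous_map_preimage[OF continuous_map_eval])
          (use p(1) IA in \<open>auto simp flip: closed_closedin\<close>)
      then show ?thesis unfolding p(2) U_def case_prod_beta .
    qed
    fix \<F> assume \<F>: "finite \<F> \<and> \<F> \<subseteq> \<U>"
    then obtain P where P: "finite P" "P \<subseteq> I \<times> {0<..}" "\<F> = U ` P"
      unfolding \<U>_def using finite_subset_image by metis
    define \<epsilon> where "\<epsilon> = Min (insert 1 (snd ` P))"
    have "\<epsilon> > 0" unfolding \<epsilon>_def using P by (subst Min_gr_iff) auto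
    moreover have "finite (fst ` P)" "fst ` P \<subseteq> I" using P(1,2) by auto
    ultimately obtain x where x: "x \<in> X" "\<forall>f\<in>fst ` P. \<bar>f x\<bar> < \<epsilon>" using zero by blast
    let ?e = "\<lambda>f\<in>A. f x"
    have "?e \<in> U p" if p: "p \<in> P" for p
    proof -
      have "p \<in> I \<times> {0<..}" using P(2) p by blast
      then have "fst p \<in> A" using IA by (auto simp: mem_Times_iff)
      moreover have "\<epsilon> \<le> snd p" unfolding \<epsilon>_def using P(1) p by simp
      moreover have "\<bar>fst p x\<bar> < \<epsilon>" using x(2) p by blast
      ultimately have "?e (fst p) \<in> {- snd p..snd p}" by auto
      then show ?thesis unfolding U_def by (auto simp: case_prod_beta)
    qed
    moreover have "?e \<in> K" by (rule spectrum_point_evaluation[OF x(1)])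
    ultimately show "K \<inter> \<Inter>\<F> \<noteq> {}" unfolding P(3) by blast
  qed
  then obtain \<Phi> where \<Phi>: "\<Phi> \<in> K" "\<Phi> \<in> \<Inter>\<U>" by blast
  have "I \<subseteq> ker \<Phi>"
  proof
    fix f assume f: "f \<in> I"
    have "\<bar>\<Phi> f\<bar> \<le> 0 + \<epsilon>" if "\<epsilon> > 0" for \<epsilon>
    proof -
      have "U (f, \<epsilon>) \<in> \<U>" unfolding \<U>_def using f that by blast
      then have "\<Phi> \<in> U (f, \<epsilon>)" using \<Phi>(2) by blast
      then show ?thesis by (simp add: U_def abs_le_iff minus_le_iff)
    qed
    then have "\<bar>\<Phi> f\<bar> \<le> 0" by (rule field_le_epsilon)
    then show "f \<in> ker \<Phi>" using f IA by (auto simp: ker_def)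
  qed
  \<comment> \<open>Properness of the kernel is what maximality of \<open>I\<close> needs to turn
    the inclusion into equality.\<close>
  moreover have "ker \<Phi> \<noteq> carrier R" using maximalideal.I_notcarr[OF maximalideal_ker[OF \<Phi>(1)]] by blast
  moreover have "ker \<Phi> \<subseteq> carrier R" by (auto simp: ker_def R_simps)
  ultimately have "ker \<Phi> = I" using I.I_maximal[OF ideal_ker[OF \<Phi>(1)]] by blast
  then show ?thesis using \<Phi>(1) by blast
qed

lemma gelfand_ker:
  assumes "\<Phi> \<in> K" "f \<in> A"
  shows "gelfand_transform X f (ker \<Phi>) = \<Phi> f"
  unfolding gelfand_transform_def
  by (rule the_equality) (use shift[OF assms(2)] K_shift[OF assms] in \<open>auto simp: ker_def\<close>)

definition gelfand :: "('x \<Rightarrow> real) set \<Rightarrow> ('x \<Rightarrow> real) \<Rightarrow> real"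
  where "gelfand I = (\<lambda>f\<in>A. gelfand_transform X f I)"

lemma gelfand_ker_id: "\<Phi> \<in> K \<Longrightarrow> gelfand (ker \<Phi>) = \<Phi>"
  by (rule extensionalityI[of _ A]) (auto simp: gelfand_def gelfand_ker spectrum_subset_extensional)

lemma topspace_maximal_ideal_space: "topspace (maximal_ideal_space X A) = ker ` K"
proof -
  have "topspace (maximal_ideal_space X A) = {I. maximalideal I R}"
    unfolding maximal_ideal_space_def topspace_pullback_topology by (auto simp: PiE_def)
  also have "\<dots> = ker ` K"
    using maximalideal_imp_ker maximalideal_ker by blast
  finally show ?thesis .
qed

text \<open>The space of maximal ideals carries the topology pulled back along the Gelfand map, and
  \<open>ker\<close> inverts this map, so continuity in both directions is formal.\<close>

lemma gelfand_homeomorphic: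
  "homeomorphic_maps (maximal_ideal_space X A) (spectrum_topology X A) gelfand ker"
  unfolding homeomorphic_maps_def
proof (intro conjI ballI)
  have pull: "maximal_ideal_space X A = pullback_topology {I. maximalideal I R} gelfand (powertop_real A)"
    unfolding maximal_ideal_space_def gelfand_def[abs_def] ..
  have topK: "topspace (spectrum_topology X A) = K"
    using closedin_subset[OF spectrum_closed[of A X]] by auto
  have "continuous_map (maximal_ideal_space X A) (powertop_real A) (id \<circ> gelfand)"
    unfolding pull by (rule continuous_map_pullback) simp
  then show "continuous_map (maximal_ideal_space X A) (spectrum_topology X A) gelfand"
    unfolding continuous_map_in_subtopology topspace_maximal_ideal_space by (auto simp: gelfand_ker_id)
  show "continuous_map (spectrum_topology X A) (maximal_ideal_space X A) ker"
    unfolding pull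
  proof (rule continuous_map_pullback')
    show "continuous_map (spectrum_topology X A) (powertop_real A) (gelfand \<circ> ker)"
      by (rule continuous_map_eq[OF continuous_map_from_subtopology[OF continuous_map_id]])
        (simp add: gelfand_ker_id)
    show "topspace (spectrum_topology X A) \<subseteq> ker -` {I. maximalideal I R}"
      unfolding topK using maximalideal_ker by blast
  qed
  show "ker (gelfand I) = I" if "I \<in> topspace (maximal_ideal_space X A)" for I
    using that unfolding topspace_maximal_ideal_space by (auto simp: gelfand_ker_id)
  show "gelfand (ker \<Phi>) = \<Phi>" if "\<Phi> \<in> topspace (spectrum_topology X A)" for \<Phi>
    using that gelfand_ker_id unfolding topK by blast
qed

lemma compact_spectrum_topology: "compact_space (spectrum_topology X A)"
  using spectrum_compact[OF bdd] by (simp add: compact_space_subtopology)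

text \<open>Restriction to a countable dense subset is injective, because functionals are
  contractions in the uniform norm. Being continuous from a compact space to a Hausdorff one, it
  embeds the spectrum into a countable power of the line.\<close>

lemma metrizable_spectrum_topology:
  assumes D: "countable D" "D \<subseteq> A" "\<And>f \<epsilon>. f \<in> A \<Longrightarrow> 0 < \<epsilon> \<Longrightarrow> \<exists>g\<in>D. \<forall>x\<in>X. \<bar>g x - f x\<bar> < \<epsilon>"
  shows "metrizable_space (spectrum_topology X A)"
proof -
  let ?r = "\<lambda>\<Phi>. restrict \<Phi> D"
  let ?Y = "subtopology (powertop_real D) (?r ` K)"
  have topK: "topspace (spectrum_topology X A) = K"
    using closedin_subset[OF spectrum_closed[of A X]] by auto
  have "continuous_map (powertop_real A) (powertop_real D) ?r"
    using D(2) by (auto simp: continuous_map_componentwise intro!: continuous_map_eval)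
  then have cont: "continuous_map (spectrum_topology X A) ?Y ?r"
    unfolding continuous_map_in_subtopology topK by (auto intro: continuous_map_from_subtopology)
  have Y: "Hausdorff_space ?Y" by (simp add: Hausdorff_space_subtopology Hausdorff_powertop_real)
  have "?r ` K \<subseteq> topspace (powertop_real D)" by (auto simp: PiE_def)
  then have img: "?r ` topspace (spectrum_topology X A) = topspace ?Y" unfolding topK by auto
  have inj: "inj_on ?r (topspace (spectrum_topology X A))"
    unfolding topK
  proof (rule inj_onI)
    fix \<Phi> \<Psi> assume \<Phi>: "\<Phi> \<in> K" "\<Psi> \<in> K" and eq: "?r \<Phi> = ?r \<Psi>"
    show "\<Phi> = \<Psi>"
    proof (rule extensionalityI[of _ A])
      fix f assume f: "f \<in> A"
      have "\<bar>\<Phi> f - \<Psi> f\<bar> \<le> 0"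
      proof (rule field_le_epsilon)
        fix \<epsilon> :: real assume "\<epsilon> > 0"
        then obtain g where g: "g \<in> D" "\<And>x. x \<in> X \<Longrightarrow> \<bar>g x - f x\<bar> < \<epsilon>/2" using D(3)[OF f half_gt_zero] by blast
        have gA: "g \<in> A" using g(1) D(2) by blast
        have "\<bar>\<Phi> g - \<Phi> f\<bar> \<le> \<epsilon>/2"
          by (rule spectrum_abs_le[OF \<Phi>(1) gA f less_imp_le[OF g(2)]])
        moreover have "\<bar>\<Psi> g - \<Psi> f\<bar> \<le> \<epsilon>/2"
          by (rule spectrum_abs_le[OF \<Phi>(2) gA f less_imp_le[OF g(2)]])
        moreover have "\<Phi> g = \<Psi> g" using fun_cong[OF eq, of g] g(1) by simp
        ultimately show "\<bar>\<Phi> f - \<Psi> f\<bar> \<le> 0 + \<epsilon>" by linarith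
      qed
      then show "\<Phi> f = \<Psi> f" by simp
    qed (use \<Phi> spectrum_subset_extensional in blast)+
  qed
  have "homeomorphic_map (spectrum_topology X A) ?Y ?r"
    by (rule continuous_imp_homeomorphic_map[OF cont compact_spectrum_topology Y img inj])
  then have "spectrum_topology X A homeomorphic_space ?Y"
    using homeomorphic_map_imp_homeomorphic_space by blast
  moreover have "countable {i \<in> D. \<not> (\<exists>a. topspace euclideanreal \<subseteq> {a})}"
    using D(1) by (rule countable_subset[rotated]) blast
  then have "metrizable_space (powertop_real D)"
    unfolding metrizable_space_product_topology using metrizable_space_euclidean by blast
  then have "metrizable_space ?Y" by (rule metrizable_space_subtopology)
  ultimately show ?thesis using homeomorphic_metrizable_space by blast
qed

end

section \<open>The maximal equivariant compactification\<close>

lemma continuous_map_realI: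
  assumes "\<And>x \<epsilon>. x \<in> topspace X \<Longrightarrow> 0 < \<epsilon> \<Longrightarrow> \<exists>U. openin X U \<and> x \<in> U \<and> (\<forall>y\<in>U. \<bar>f y - f x\<bar> < \<epsilon>)"
  shows "continuous_map X euclideanreal f"
proof -
  have "continuous_map X Met_TC.mtopology f"
    unfolding Met_TC.continuous_map_to_metric
  proof (intro ballI allI impI)
    fix x \<epsilon> assume "x \<in> topspace X" "(0::real) < \<epsilon>"
    then obtain U where "openin X U" "x \<in> U" "\<forall>y\<in>U. \<bar>f y - f x\<bar> < \<epsilon>" using assms by blast
    then show "\<exists>U. openin X U \<and> x \<in> U \<and> (\<forall>y\<in>U. f y \<in> Met_TC.mball (f x) \<epsilon>)"
      by (intro exI[of _ U]) (auto simp: dist_real_def abs_minus_commute)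
  qed
  then show ?thesis by simp
qed

lemma compact_Hausdorff_separating:
  assumes "compact_space K" "Hausdorff_space K" "closedin K C" "y \<in> topspace K" "y \<notin> C"
  obtains F where "continuous_map K euclideanreal F" "F y = 0" "\<And>z. z \<in> C \<Longrightarrow> F z = (1::real)"
proof -
  have "completely_regular_space K"
    using assms(1,2) by (intro normal_imp_completely_regular_space compact_Hausdorff_or_regular_imp_normal_space) auto
  then have "\<exists>f. continuous_map K (top_of_set {0..1::real}) f \<and> f y = 0 \<and> f ` C \<subseteq> {1}"
    using assms(3-5) unfolding completely_regular_space_def by blast
  then obtain F where "continuous_map K (top_of_set {0..1::real}) F" "F y = 0" "F ` C \<subseteq> {1}" by blast
  then show ?thesis using that[of F] by (auto simp: continuous_map_in_subtopology)
qed

context mstruct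
begin

lemma Aut_subset_Bij: "Aut L M \<subseteq> Bij X"
  using Aut_bij Aut_extensional by (auto simp: Bij_def)

lemma carrier_Aut_group: "carrier (Aut_group L M) = Aut L M"
  by (simp add: Aut_group_def)

lemma mult_Aut_group: "g \<in> Aut L M \<Longrightarrow> h \<in> Aut L M \<Longrightarrow> g \<otimes>\<^bsub>Aut_group L M\<^esub> h = compose X g h"
  using Aut_subset_Bij by (auto simp: Aut_group_def BijGroup_def)

lemma group_Aut_group: "group (Aut_group L M)"
proof -
  interpret B: group "BijGroup X" by (rule group_BijGroup)
  have "subgroup (Aut L M) (BijGroup X)"
  proof (rule B.subgroupI)
    show "Aut L M \<subseteq> carrier (BijGroup X)" using Aut_subset_Bij by (simp add: BijGroup_def)
    show "Aut L M \<noteq> {}" using Aut_id by blast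
    show "inv\<^bsub>BijGroup X\<^esub> g \<in> Aut L M" if "g \<in> Aut L M" for g
    proof -
      have "g \<in> Bij X" using that Aut_subset_Bij by blast
      then show ?thesis using Aut_inv[OF that] by (simp only: inv_BijGroup)
    qed
    show "g \<otimes>\<^bsub>BijGroup X\<^esub> h \<in> Aut L M" if "g \<in> Aut L M" "h \<in> Aut L M" for g h
      using that Aut_subset_Bij Aut_compose by (simp add: BijGroup_def subset_iff)
  qed
  then show ?thesis unfolding Aut_group_def by (rule B.subgroup_imp_group)
qed

end

section \<open>The action on the space of types\<close>

context categorical_structure
begin

text \<open>Passing through \<open>RUC\<close> and back replaces the various parameters by the
  single sequence \<open>s\<close>, so that sums, products and approximations in \<open>Def\<close>
  reduce to those of definable predicates.\<close>

lemma Def_dense_seq: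
  assumes s: "dense_seq s"
  shows "f \<in> Def L M \<longleftrightarrow> (\<exists>\<phi>. dp \<phi> \<and> f = (\<lambda>x\<in>X. \<phi> (case_nat x s)))"
proof
  assume "f \<in> Def L M"
  then have f: "f \<in> RUC_M" using Def_subset_RUC by blast
  obtain \<phi> where \<phi>: "dp \<phi>" "\<And>x. x \<in> X \<Longrightarrow> \<phi> (case_nat x s) = f x" using RUC_definable[OF f s] by metis
  moreover have "f = (\<lambda>x\<in>X. \<phi> (case_nat x s))"
    by (rule extensionalityI[of _ X]) (use RUC_D(1)[OF f] \<phi>(2) in auto)
  ultimately show "\<exists>\<phi>. dp \<phi> \<and> f = (\<lambda>x\<in>X. \<phi> (case_nat x s))" by blast
next
  assume "\<exists>\<phi>. dp \<phi> \<and> f = (\<lambda>x\<in>X. \<phi> (case_nat x s))"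
  then show "f \<in> Def L M" using s unfolding Def_def dense_seq_def by blast
qed

lemma function_algebra_Def: "function_algebra X (Def L M)"
proof -
  obtain s where s: "dense_seq s" using ex_dense_seq by blast
  have sV: "s \<in> Val" using s by (simp add: dense_seq_def)
  note rep = Def_dense_seq[OF s]
  show ?thesis
  proof
    show "X \<noteq> {}" by (rule X_ne)
    fix f assume "f \<in> Def L M"
    then have "f \<in> RUC_M" using Def_subset_RUC by blast
    then show "f \<in> extensional X" "bounded (f ` X)" by (rule RUC_D)+
  next
    fix c show "(\<lambda>x\<in>X. c) \<in> Def L M" unfolding rep by (intro exI[of _ "\<lambda>_. c"] conjI dp_const refl)
  next
    fix f g assume "f \<in> Def L M" "g \<in> Def L M"
    then obtain \<phi> \<psi> where f: "dp \<phi>" "f = (\<lambda>x\<in>X. \<phi> (case_nat x s))" and g: "dp \<psi>" "g = (\<lambda>x\<in>X. \<psi> (case_nat x s))"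
      unfolding rep by blast
    show "(\<lambda>x\<in>X. f x + g x) \<in> Def L M" unfolding rep
      by (intro exI[of _ "\<lambda>e. \<phi> e + \<psi> e"] conjI dp_add f(1) g(1) restrict_ext) (simp add: f(2) g(2))
    show "(\<lambda>x\<in>X. f x * g x) \<in> Def L M" unfolding rep
      by (intro exI[of _ "\<lambda>e. \<phi> e * \<psi> e"] conjI dp_mult f(1) g(1) restrict_ext) (simp add: f(2) g(2))
  next
    fix f assume fe: "f \<in> extensional X" and lim: "\<And>\<epsilon>. \<epsilon> > 0 \<Longrightarrow> \<exists>g\<in>Def L M. \<forall>x\<in>X. \<bar>g x - f x\<bar> < \<epsilon>"
    \<comment> \<open>The functions approximating \<open>f\<close> come from predicates that are
      controlled only on the tuples \<open>(x, s)\<close>, so their limit too has to be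
      forced.\<close>
    have approx: "\<exists>\<phi>. dp \<phi> \<and> (\<forall>e\<in>(\<lambda>x. case_nat x s) ` X. \<bar>\<phi> e - f (e 0)\<bar> < \<epsilon>)" if "\<epsilon> > 0" for \<epsilon>
    proof -
      obtain g where g: "g \<in> Def L M" "\<forall>x\<in>X. \<bar>g x - f x\<bar> < \<epsilon>" using lim[OF \<open>\<epsilon> > 0\<close>] by blast
      obtain \<phi> where \<phi>: "dp \<phi>" "g = (\<lambda>x\<in>X. \<phi> (case_nat x s))" using g(1) unfolding rep by blast
      have "\<forall>e\<in>(\<lambda>x. case_nat x s) ` X. \<bar>\<phi> e - f (e 0)\<bar> < \<epsilon>" using g(2) by (auto simp: \<phi>(2))
      with \<phi>(1) show ?thesis by blast
    qed
    have sub: "(\<lambda>x. case_nat x s) ` X \<subseteq> Val" using case_nat_Val sV by blast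
    obtain \<phi> where \<phi>: "dp \<phi>" "\<And>e. e \<in> (\<lambda>x. case_nat x s) ` X \<Longrightarrow> \<phi> e = f (e 0)"
      by (rule dp_forced_limit[OF sub approx]) (assumption, rule that)
    have "f = (\<lambda>x\<in>X. \<phi> (case_nat x s))"
      by (rule extensionalityI[OF fe]) (use \<phi>(2) in auto)
    then show "f \<in> Def L M" unfolding rep using \<phi>(1) by blast
  qed
qed

interpretation FA: function_algebra X "Def L M"
  by (rule function_algebra_Def)

abbreviation "T \<equiv> Aut_topology L M"
abbreviation "G \<equiv> Aut_group L M"

lemma Def_RUC_D: "f \<in> Def L M \<Longrightarrow> f \<in> RUC_M"
  using Def_subset_RUC by blast

text \<open>By invariance \<open>\<phi>(g x, b) = \<phi>(x, h b)\<close> with \<open>h\<close> the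
  inverse of \<open>g\<close>: translating the function amounts to moving its parameters.\<close>

lemma Def_compose:
  assumes "f \<in> Def L M" "g \<in> Aut L M"
  shows "compose X f g \<in> Def L M"
proof -
  obtain \<phi> b where f: "f = (\<lambda>x\<in>X. \<phi> (case_nat x b))" and \<phi>: "dp \<phi>" and b: "b \<in> Val"
    using assms(1) unfolding Def_def by blast
  obtain h where h: "h \<in> Aut L M" "\<And>x. x \<in> X \<Longrightarrow> g (h x) = x" "\<And>x. x \<in> X \<Longrightarrow> h (g x) = x"
    using Aut_inverse[OF assms(2)] by metis
  have hb: "h \<circ> b \<in> Val" using h(1) b by (rule Aut_Val)
  have "compose X f g = (\<lambda>x\<in>X. \<phi> (case_nat x (h \<circ> b)))"
    unfolding compose_def
  proof (rule restrict_ext)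
    fix x assume x: "x \<in> X"
    have "g \<circ> case_nat x (h \<circ> b) = case_nat (g x) b"
      using h(2) b by (auto simp: fun_eq_iff split: nat.splits)
    then have "\<phi> (case_nat (g x) b) = \<phi> (case_nat x (h \<circ> b))"
      using bspec[OF Aut_dp[OF assms(2) \<phi>] case_nat_Val[OF x hb]] by (simp only:)
    then show "f (g x) = \<phi> (case_nat x (h \<circ> b))" using x assms(2) by (simp add: f)
  qed
  then show ?thesis using \<phi> hb unfolding Def_def by blast
qed

definition act :: "('a \<Rightarrow> 'a) \<Rightarrow> (('a \<Rightarrow> real) \<Rightarrow> real) \<Rightarrow> ('a \<Rightarrow> real) \<Rightarrow> real"
  where "act g \<Phi> = (\<lambda>f\<in>Def L M. \<Phi> (compose X f g))"

lemma act_K: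
  assumes "\<Phi> \<in> FA.K" "g \<in> Aut L M"
  shows "act g \<Phi> \<in> FA.K"
  unfolding spectrum_def
proof (intro CollectI conjI allI impI)
  show "act g \<Phi> \<in> extensional (Def L M)" by (simp add: act_def)
  fix F \<epsilon> assume F: "F \<subseteq> Def L M" "finite F" and \<epsilon>: "(0::real) < \<epsilon>"
  have "finite ((\<lambda>f. compose X f g) ` F)" "(\<lambda>f. compose X f g) ` F \<subseteq> Def L M"
    using F Def_compose[OF _ assms(2)] by auto
  then obtain x where x: "x \<in> X" "\<forall>h\<in>(\<lambda>f. compose X f g) ` F. \<bar>h x - \<Phi> h\<bar> < \<epsilon>"
    using spectrum_approx[OF assms(1) _ _ \<epsilon>] by blast
  have "\<bar>f (g x) - act g \<Phi> f\<bar> < \<epsilon>" if "f \<in> F" for f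
    using x that F(1) by (auto simp: act_def compose_eq)
  moreover have "g x \<in> X" using assms(2) x(1) by simp
  ultimately show "\<exists>x\<in>X. \<forall>f\<in>F. \<bar>f x - act g \<Phi> f\<bar> < \<epsilon>" by blast
qed

lemma topspace_S1: "topspace (S1 L M) = FA.ker ` FA.K"
  unfolding S1_def by (rule FA.topspace_maximal_ideal_space)

lemma S1_action_ker:
  assumes "\<Phi> \<in> FA.K" "g \<in> Aut L M"
  shows "S1_action L M g (FA.ker \<Phi>) = FA.ker (act g \<Phi>)"
  using assms Def_compose[OF _ assms(2)]
  unfolding S1_action_def topspace_S1 by (auto simp: FA.ker_def act_def)

lemma tp_ker: "a \<in> X \<Longrightarrow> tp L M a = FA.ker (\<lambda>f\<in>Def L M. f a)"
  by (auto simp: tp_def FA.ker_def)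

text \<open>Precomposition reverses the order of products, and passing to functionals reverses it
  again; hence a left action.\<close>

lemma act_compose:
  assumes "g \<in> Aut L M" "h \<in> Aut L M"
  shows "act (compose X g h) \<Phi> = act g (act h \<Phi>)"
  unfolding act_def
proof (rule restrict_ext)
  fix f assume f: "f \<in> Def L M"
  have "compose X f (compose X g h) = compose X (compose X f g) h"
    using assms by (auto simp: compose_def fun_eq_iff)
  then show "\<Phi> (compose X f (compose X g h)) = (\<lambda>f\<in>Def L M. \<Phi> (compose X f h)) (compose X f g)"
    using Def_compose[OF f assms(1)] by simp
qed

lemma act_id:
  assumes "\<Phi> \<in> FA.K" "\<And>x. x \<in> X \<Longrightarrow> g x = x"
  shows "act g \<Phi> = \<Phi>"
proof (rule extensionalityI[of _ "Def L M"])
  fix f assume f: "f \<in> Def L M"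
  have "compose X f g = f"
    by (rule extensionalityI[of _ X]) (use FA.ext[OF f] assms(2) in \<open>auto simp: compose_eq\<close>)
  then show "act g \<Phi> f = \<Phi> f" using f by (simp add: act_def)
qed (use assms(1) spectrum_subset_extensional in \<open>auto simp: act_def\<close>)

lemma S1_action_Bij:
  assumes g: "g \<in> Aut L M"
  shows "S1_action L M g \<in> Bij (topspace (S1 L M))"
proof -
  obtain h where h: "h \<in> Aut L M" "\<And>x. x \<in> X \<Longrightarrow> g (h x) = x" "\<And>x. x \<in> X \<Longrightarrow> h (g x) = x"
    using Aut_inverse[OF g] by metis
  have inv: "act g (act h \<Phi>) = \<Phi>" "act h (act g \<Phi>) = \<Phi>" if "\<Phi> \<in> FA.K" for \<Phi>
    using that g h by (auto simp: act_compose[symmetric] compose_eq intro!: act_id)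
  have "bij_betw (S1_action L M g) (topspace (S1 L M)) (topspace (S1 L M))"
    by (rule bij_betwI[where g = "S1_action L M h"])
      (use act_K g h(1) inv in \<open>auto simp: topspace_S1 S1_action_ker\<close>)
  then show ?thesis by (simp add: Bij_def S1_action_def)
qed

lemma group_action_S1: "group_action G (topspace (S1 L M)) (S1_action L M)"
proof (rule group_action.intro, rule group_hom.intro[OF group_Aut_group group_BijGroup], rule group_hom_axioms.intro)
  show "S1_action L M \<in> hom G (BijGroup (topspace (S1 L M)))"
  proof (rule homI)
    show "S1_action L M g \<in> carrier (BijGroup (topspace (S1 L M)))" if "g \<in> carrier G" for g
      using that S1_action_Bij by (simp add: carrier_Aut_group BijGroup_def)
    fix g h assume "g \<in> carrier G" "h \<in> carrier G"
    then have gh: "g \<in> Aut L M" "h \<in> Aut L M" by (simp_all add: carrier_Aut_group)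
    have "S1_action L M (compose X g h) = compose (topspace (S1 L M)) (S1_action L M g) (S1_action L M h)"
    proof (rule extensionalityI[of _ "topspace (S1 L M)"])
      fix I assume "I \<in> topspace (S1 L M)"
      then obtain \<Phi> where \<Phi>: "\<Phi> \<in> FA.K" "I = FA.ker \<Phi>" unfolding topspace_S1 by blast
      show "S1_action L M (compose X g h) I = compose (topspace (S1 L M)) (S1_action L M g) (S1_action L M h) I"
        using \<Phi> gh Aut_compose[OF gh] act_K[OF \<Phi>(1)]
        by (simp add: compose_eq topspace_S1 S1_action_ker act_compose)
    qed (simp_all add: S1_action_def)
    then show "S1_action L M (g \<otimes>\<^bsub>G\<^esub> h) =
        S1_action L M g \<otimes>\<^bsub>BijGroup (topspace (S1 L M))\<^esub> S1_action L M h"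
      using S1_action_Bij gh by (simp add: mult_Aut_group BijGroup_def)
  qed
qed

lemma S1_homeomorphic: "homeomorphic_maps (S1 L M) (spectrum_topology X (Def L M)) FA.gelfand FA.ker"
  unfolding S1_def by (rule FA.gelfand_homeomorphic)

lemma topspace_K: "topspace (spectrum_topology X (Def L M)) = FA.K"
  using closedin_subset[OF spectrum_closed[of "Def L M" X]] by auto

lemma S1_homeomorphic_space: "S1 L M homeomorphic_space spectrum_topology X (Def L M)"
  using S1_homeomorphic unfolding homeomorphic_space_def by blast

lemma compact_S1: "compact_space (S1 L M)"
  using FA.compact_spectrum_topology homeomorphic_compact_space[OF S1_homeomorphic_space] by blast

lemma Hausdorff_S1: "Hausdorff_space (S1 L M)"
  using homeomorphic_Hausdorff_space[OF S1_homeomorphic_space] Hausdorff_powertop_real Hausdorff_space_subtopology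
  by blast

lemma continuous_gelfand:
  assumes "f \<in> Def L M"
  shows "continuous_map (S1 L M) euclideanreal (\<lambda>I. FA.gelfand I f)"
proof -
  have "continuous_map (S1 L M) (spectrum_topology X (Def L M)) FA.gelfand"
    using S1_homeomorphic by (simp add: homeomorphic_maps_def)
  then have "continuous_map (S1 L M) (powertop_real (Def L M)) FA.gelfand"
    by (rule continuous_map_into_fulltopology)
  from continuous_map_compose[OF this continuous_map_eval[OF assms]] show ?thesis by (simp add: comp_def)
qed

lemma continuous_into_S1:
  assumes "\<And>z. z \<in> topspace Z \<Longrightarrow> h z \<in> topspace (S1 L M)"
    and "\<And>f. f \<in> Def L M \<Longrightarrow> continuous_map Z euclideanreal (\<lambda>z. FA.gelfand (h z) f)"
  shows "continuous_map Z (S1 L M) h"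
proof -
  have "continuous_map Z (powertop_real (Def L M)) (\<lambda>z. FA.gelfand (h z))"
    unfolding continuous_map_componentwise using assms(2) by (auto simp: FA.gelfand_def)
  moreover have "FA.gelfand (h z) \<in> FA.K" if "z \<in> topspace Z" for z
    using assms(1)[OF that] FA.gelfand_ker_id unfolding topspace_S1 by auto
  ultimately have "continuous_map Z (spectrum_topology X (Def L M)) (\<lambda>z. FA.gelfand (h z))"
    by (auto simp: continuous_map_in_subtopology)
  moreover have "continuous_map (spectrum_topology X (Def L M)) (S1 L M) FA.ker"
    using S1_homeomorphic by (simp add: homeomorphic_maps_def)
  ultimately have "continuous_map Z (S1 L M) (FA.ker \<circ> (\<lambda>z. FA.gelfand (h z)))"
    by (rule continuous_map_compose)
  then show ?thesis
  proof (rule continuous_map_eq)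
    fix z assume "z \<in> topspace Z"
    then show "(FA.ker \<circ> (\<lambda>z. FA.gelfand (h z))) z = h z"
      using assms(1) FA.gelfand_ker_id unfolding topspace_S1 by force
  qed
qed

lemma gelfand_S1_action:
  assumes "I \<in> topspace (S1 L M)" "g \<in> Aut L M" "f \<in> Def L M"
  shows "FA.gelfand (S1_action L M g I) f = FA.gelfand I (compose X f g)"
proof -
  obtain \<Phi> where \<Phi>: "\<Phi> \<in> FA.K" "I = FA.ker \<Phi>" using assms(1) unfolding topspace_S1 by blast
  show ?thesis
    using \<Phi> assms act_K[OF \<Phi>(1) assms(2)] by (simp add: S1_action_ker FA.gelfand_ker_id) (simp add: act_def)
qed

lemma gelfand_K: "I \<in> topspace (S1 L M) \<Longrightarrow> FA.gelfand I \<in> FA.K"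
  using FA.gelfand_ker_id unfolding topspace_S1 by auto

lemma S1_action_closed: "I \<in> topspace (S1 L M) \<Longrightarrow> g \<in> Aut L M \<Longrightarrow> S1_action L M g I \<in> topspace (S1 L M)"
  unfolding topspace_S1 using S1_action_ker act_K by force

text \<open>Near \<open>g0\<close> write \<open>g = v g0\<close> with \<open>v\<close> close to the
  identity. Right uniform continuity makes \<open>f (g x)\<close> close to \<open>f (g0 x)\<close>
  uniformly in \<open>x\<close>, which passes to functionals; what remains is the value of the fixed
  function \<open>f \<circ> g0\<close>, continuous in the ideal alone.\<close>

lemma G_space_S1: "G_space G T (S1 L M) (S1_action L M)"
  unfolding G_space_def
proof (intro conjI group_action_S1 continuous_into_S1)
  show "(case z of (g, I) \<Rightarrow> S1_action L M g I) \<in> topspace (S1 L M)" if "z \<in> topspace (prod_topology T (S1 L M))" for z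
    using that S1_action_closed by (auto simp: topspace_prod_topology topspace_Aut_topology)
  fix f assume f: "f \<in> Def L M"
  show "continuous_map (prod_topology T (S1 L M)) euclideanreal (\<lambda>z. FA.gelfand (case z of (g, I) \<Rightarrow> S1_action L M g I) f)"
  proof (rule continuous_map_realI)
    fix z \<epsilon> assume "z \<in> topspace (prod_topology T (S1 L M))" and \<epsilon>: "(0::real) < \<epsilon>"
    then obtain g0 I0 where z: "z = (g0, I0)" "g0 \<in> Aut L M" "I0 \<in> topspace (S1 L M)"
      by (auto simp: topspace_prod_topology topspace_Aut_topology)
    obtain h0 where h0: "h0 \<in> Aut L M" "\<And>x. x \<in> X \<Longrightarrow> g0 (h0 x) = x" "\<And>x. x \<in> X \<Longrightarrow> h0 (g0 x) = x"
      using Aut_inverse[OF z(2)] by metis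
    obtain V where V: "openin T V" "(\<lambda>x\<in>X. x) \<in> V" "\<forall>v\<in>V. \<forall>x\<in>X. \<bar>f (v x) - f x\<bar> < \<epsilon>/2"
      using RUC_D(4)[OF Def_RUC_D[OF f] half_gt_zero[OF \<epsilon>]] by blast
    have "continuous_map T T (\<lambda>g. compose X g h0)"
      unfolding Aut_topology_def continuous_map_in_subtopology continuous_map_componentwise
    proof (intro conjI ballI)
      show "continuous_map (subtopology (product_topology (\<lambda>_. space_topology M) X) (Aut L M)) (space_topology M)
          (\<lambda>g. compose X g h0 x)" if "x \<in> X" for x
        using continuous_map_Aut_eval[of "h0 x"] h0(1) that by (simp add: compose_eq Aut_topology_def)
    qed (use Aut_compose h0(1) in auto)
    then have U1: "openin T {g \<in> topspace T. compose X g h0 \<in> V}"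
      using V(1) by (rule openin_continuous_map_preimage)
    let ?f0 = "compose X f g0"
    have f0: "?f0 \<in> Def L M" using Def_compose[OF f z(2)] .
    have U2: "openin (S1 L M) {I \<in> topspace (S1 L M). FA.gelfand I ?f0 \<in> {FA.gelfand I0 ?f0 - \<epsilon>/2 <..< FA.gelfand I0 ?f0 + \<epsilon>/2}}"
      by (rule openin_continuous_map_preimage[OF continuous_gelfand[OF f0]]) (simp flip: open_openin)
    let ?U = "{g \<in> topspace T. compose X g h0 \<in> V} \<times>
      {I \<in> topspace (S1 L M). FA.gelfand I ?f0 \<in> {FA.gelfand I0 ?f0 - \<epsilon>/2 <..< FA.gelfand I0 ?f0 + \<epsilon>/2}}"
    have "compose X g0 h0 = (\<lambda>x\<in>X. x)" unfolding compose_def using h0(2) by (intro restrict_ext) simp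
    then have "z \<in> ?U" using z V(2) \<epsilon> by (simp add: topspace_Aut_topology)
    moreover have "openin (prod_topology T (S1 L M)) ?U"
      using U1 U2 by (simp add: openin_prod_Times_iff)
    moreover have "\<bar>FA.gelfand (case z' of (g, I) \<Rightarrow> S1_action L M g I) f -
        FA.gelfand (case z of (g, I) \<Rightarrow> S1_action L M g I) f\<bar> < \<epsilon>" if z': "z' \<in> ?U" for z'
    proof -
      obtain g I where gI: "z' = (g, I)" "g \<in> Aut L M" "compose X g h0 \<in> V" "I \<in> topspace (S1 L M)"
        "\<bar>FA.gelfand I ?f0 - FA.gelfand I0 ?f0\<bar> < \<epsilon>/2"
      proof (cases z')
        case (Pair g I)
        then have "g \<in> Aut L M" "compose X g h0 \<in> V" "I \<in> topspace (S1 L M)"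
          and b: "FA.gelfand I ?f0 \<in> {FA.gelfand I0 ?f0 - \<epsilon>/2 <..< FA.gelfand I0 ?f0 + \<epsilon>/2}"
          using z' by (auto simp: topspace_Aut_topology)
        moreover have "\<bar>FA.gelfand I ?f0 - FA.gelfand I0 ?f0\<bar> < \<epsilon>/2"
          using b unfolding greaterThanLessThan_iff by linarith
        ultimately show thesis using that Pair by blast
      qed
      have "\<bar>FA.gelfand I (compose X f g) - FA.gelfand I ?f0\<bar> \<le> \<epsilon>/2"
      proof (rule spectrum_abs_le[OF gelfand_K[OF gI(4)] Def_compose[OF f gI(2)] f0])
        fix x assume x: "x \<in> X"
        have gx: "g0 x \<in> X" using z(2) x by simp
        have "compose X g h0 (g0 x) = g x" using gx h0(3)[OF x] by (simp add: compose_eq)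
        then have "\<bar>f (g x) - f (g0 x)\<bar> < \<epsilon>/2" using bspec[OF bspec[OF V(3) gI(3)] gx] by simp
        then show "\<bar>compose X f g x - ?f0 x\<bar> \<le> \<epsilon>/2" using x by (simp add: compose_eq)
      qed
      then show ?thesis
        using gI(5) gelfand_S1_action[OF gI(4,2) f] gelfand_S1_action[OF z(3,2) f]
        unfolding gI(1) z(1) prod.case by linarith
    qed
    ultimately show "\<exists>U. openin (prod_topology T (S1 L M)) U \<and> z \<in> U \<and>
        (\<forall>y\<in>U. \<bar>FA.gelfand (case y of (g, I) \<Rightarrow> S1_action L M g I) f -
          FA.gelfand (case z of (g, I) \<Rightarrow> S1_action L M g I) f\<bar> < \<epsilon>)" by blast
  qed
qed

lemma ev_K: "x \<in> X \<Longrightarrow> (\<lambda>f\<in>Def L M. f x) \<in> FA.K"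
  by (rule spectrum_point_evaluation)

lemma gelfand_tp: "x \<in> X \<Longrightarrow> FA.gelfand (tp L M x) = (\<lambda>f\<in>Def L M. f x)"
  using ev_K FA.gelfand_ker_id tp_ker by simp

lemma tp_in_S1: "x \<in> X \<Longrightarrow> tp L M x \<in> topspace (S1 L M)"
  using ev_K tp_ker unfolding topspace_S1 by blast

lemma equivariant_compactification_S1:
  "equivariant_compactification G T (space_topology M) (\<lambda>g. g) (S1 L M) (S1_action L M) (tp L M)"
  unfolding equivariant_compactification_def
proof (intro conjI compact_S1 Hausdorff_S1 G_space_S1)
  show "continuous_map (space_topology M) (S1 L M) (tp L M)"
  proof (rule continuous_into_S1)
    show "tp L M x \<in> topspace (S1 L M)" if "x \<in> topspace (space_topology M)" for x
      using that tp_in_S1 by simp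
    show "continuous_map (space_topology M) euclideanreal (\<lambda>x. FA.gelfand (tp L M x) f)" if f: "f \<in> Def L M" for f
      by (rule continuous_map_eq[OF RUC_D(2)[OF Def_RUC_D[OF f]]]) (simp add: gelfand_tp f)
  qed
  show "equivariant G (topspace (space_topology M)) (\<lambda>g. g) (S1_action L M) (tp L M)"
    unfolding equivariant_def carrier_Aut_group topspace_mtopology_of
  proof (intro ballI)
    fix g x assume g: "g \<in> Aut L M" and x: "x \<in> X"
    have "act g (\<lambda>f\<in>Def L M. f x) = (\<lambda>f\<in>Def L M. f (g x))"
      unfolding act_def by (rule restrict_ext) (use Def_compose[OF _ g] x in \<open>simp add: compose_eq\<close>)
    then show "tp L M (g x) = S1_action L M g (tp L M x)"
      using S1_action_ker[OF ev_K[OF x] g] g x by (simp add: tp_ker)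
  qed
  have hom: "homeomorphic_map (spectrum_topology X (Def L M)) (S1 L M) FA.ker"
    using S1_homeomorphic homeomorphic_maps_map homeomorphic_maps_sym by blast
  let ?E = "(\<lambda>x. \<lambda>f\<in>Def L M. f x) ` X"
  have sub: "?E \<subseteq> FA.K" using ev_K by blast
  \<comment> \<open>Density is built into the spectrum, the closure of the evaluations; the
    homeomorphism \<open>ker\<close> takes these to the types of points.\<close>
  have "S1 L M closure_of (FA.ker ` ?E) = FA.ker ` (spectrum_topology X (Def L M) closure_of ?E)"
    by (rule homeomorphic_map_closure_of[OF hom]) (use sub in \<open>simp only: topspace_K\<close>)
  also have "spectrum_topology X (Def L M) closure_of ?E = FA.K"
    unfolding closure_of_subtopology_open[OF disjI2[OF sub]] closure_of_point_evaluations by simp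
  also have "FA.ker ` ?E = tp L M ` X" by (auto simp: tp_ker)
  finally show "S1 L M closure_of (tp L M ` topspace (space_topology M)) = topspace (S1 L M)"
    by (simp add: topspace_S1)
qed

text \<open>\<open>F (\<kappa> g y) - F y\<close> vanishes when \<open>g\<close> is the identity. As
  \<open>K'\<close> is compact, the tube lemma makes it small for all \<open>y\<close> at once when
  \<open>g\<close> is near the identity; pulled back along \<open>j\<close>, this is membership in
  \<open>RUC\<close>.\<close>

lemma compactification_function_Def:
  fixes K' :: "'c topology"
  assumes ec: "equivariant_compactification G T (space_topology M) (\<lambda>g. g) K' \<kappa> j"
    and F: "continuous_map K' euclideanreal F"
  shows "(\<lambda>x\<in>X. F (j x)) \<in> Def L M"
proof -
  have cpt: "compact_space K'" and act: "group_action G (topspace K') \<kappa>"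
    and cont: "continuous_map (prod_topology T K') K' (\<lambda>(g, x). \<kappa> g x)"
    and j: "continuous_map (space_topology M) K' j"
    and eq: "\<And>g x. g \<in> Aut L M \<Longrightarrow> x \<in> X \<Longrightarrow> j (g x) = \<kappa> g (j x)"
    using ec unfolding equivariant_compactification_def G_space_def equivariant_def carrier_Aut_group by auto
  have jX: "j x \<in> topspace K'" if "x \<in> X" for x
    using funcset_mem[OF continuous_map_funspace[OF j]] that by simp
  have "(\<lambda>x\<in>X. F (j x)) \<in> RUC_M"
    unfolding RUC_def
  proof (intro CollectI conjI allI impI)
    show "(\<lambda>x\<in>X. F (j x)) \<in> extensional (topspace (space_topology M))" by simp
    show "continuous_map (space_topology M) euclideanreal (\<lambda>x\<in>X. F (j x))"
      by (rule continuous_map_eq[OF continuous_map_compose[OF j F]]) simp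
    have "compactin euclideanreal (F ` topspace K')"
      using cpt F unfolding compact_space_def by (rule image_compactin)
    then have "bounded (F ` topspace K')" by (simp add: compact_imp_bounded)
    then show "bounded ((\<lambda>x\<in>X. F (j x)) ` topspace (space_topology M))"
      by (rule bounded_subset) (use jX in auto)
    fix \<epsilon> :: real assume \<epsilon>: "\<epsilon> > 0"
    let ?D = "\<lambda>p. F (case p of (g, y) \<Rightarrow> \<kappa> g y) - F (snd p)"
    have "continuous_map (prod_topology T K') euclideanreal ?D"
      using continuous_map_compose[OF cont F] continuous_map_compose[OF continuous_map_snd F]
      by (intro continuous_map_diff) (auto simp: comp_def)
    then have W: "openin (prod_topology T K') {p \<in> topspace (prod_topology T K'). ?D p \<in> {- (\<epsilon>/2) <..< \<epsilon>/2}}"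
      by (rule openin_continuous_map_preimage) (simp flip: open_openin)
    have one: "(\<lambda>x\<in>X. x) \<in> topspace T" by (simp add: topspace_Aut_topology Aut_id)
    have "\<kappa> (\<lambda>x\<in>X. x) y = y" if "y \<in> topspace K'" for y
      using fun_cong[OF group_action.id_eq_one[OF act], of y] that unfolding one_Aut_group by simp
    then have "{\<lambda>x\<in>X. x} \<times> topspace K' \<subseteq> {p \<in> topspace (prod_topology T K'). ?D p \<in> {- (\<epsilon>/2) <..< \<epsilon>/2}}"
      using one \<epsilon> by (auto simp: topspace_prod_topology)
    from tube_lemma_right[OF W cpt[unfolded compact_space_def] one this]
    obtain U V where UV: "openin T U" "(\<lambda>x\<in>X. x) \<in> U" "topspace K' \<subseteq> V"
      "U \<times> V \<subseteq> {p \<in> topspace (prod_topology T K'). ?D p \<in> {- (\<epsilon>/2) <..< \<epsilon>/2}}" by blast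
    have "(SUP x\<in>X. \<bar>(\<lambda>x\<in>X. F (j x)) (v x) - (\<lambda>x\<in>X. F (j x)) x\<bar>) < \<epsilon>" if v: "v \<in> U" for v
    proof -
      have vA: "v \<in> Aut L M" using openin_subset[OF UV(1)] v by (auto simp: topspace_Aut_topology)
      have "\<bar>(\<lambda>x\<in>X. F (j x)) (v x) - (\<lambda>x\<in>X. F (j x)) x\<bar> \<le> \<epsilon>/2" if x: "x \<in> X" for x
      proof -
        have "(v, j x) \<in> U \<times> V" using v UV(3) jX[OF x] by blast
        then have "?D (v, j x) \<in> {- (\<epsilon>/2) <..< \<epsilon>/2}" using UV(4) by blast
        then have "- (\<epsilon>/2) < F (\<kappa> v (j x)) - F (j x)" "F (\<kappa> v (j x)) - F (j x) < \<epsilon>/2" by simp_all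
        then have "\<bar>F (\<kappa> v (j x)) - F (j x)\<bar> \<le> \<epsilon>/2" by linarith
        then show ?thesis using x vA eq[OF vA x] by simp
      qed
      then have "(SUP x\<in>X. \<bar>(\<lambda>x\<in>X. F (j x)) (v x) - (\<lambda>x\<in>X. F (j x)) x\<bar>) \<le> \<epsilon>/2"
        using X_ne by (intro cSUP_least)
      then show ?thesis using \<epsilon> by linarith
    qed
    then show "\<exists>V. openin T V \<and> \<one>\<^bsub>G\<^esub> \<in> V \<and>
        (\<forall>v\<in>V. (SUP x\<in>topspace (space_topology M). \<bar>(\<lambda>x\<in>X. F (j x)) (v x) - (\<lambda>x\<in>X. F (j x)) x\<bar>) < \<epsilon>)"
      unfolding one_Aut_group topspace_mtopology_of using UV(1,2) by blast
  qed
  then show ?thesis using Def_eq_RUC by blast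
qed

text \<open>A maximal ideal assigns a value to the pullback of each continuous function on
  \<open>K'\<close>. By compactness some point of \<open>K'\<close> has these values, and Urysohn
  functions make it unique; \<pi> sends the ideal to this point.\<close>

lemma S1_universal:
  fixes K' :: "'c topology"
  assumes ec: "equivariant_compactification G T (space_topology M) (\<lambda>g. g) K' \<kappa> j"
  shows "\<exists>\<pi>. continuous_map (S1 L M) K' \<pi> \<and> equivariant G (topspace (S1 L M)) (S1_action L M) \<kappa> \<pi> \<and>
    (\<forall>x\<in>topspace (space_topology M). \<pi> (tp L M x) = j x)"
proof -
  have cpt: "compact_space K'" and haus: "Hausdorff_space K'" and act: "group_action G (topspace K') \<kappa>"
    and cont: "continuous_map (prod_topology T K') K' (\<lambda>(g, x). \<kappa> g x)"
    and j: "continuous_map (space_topology M) K' j"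
    and eq: "\<And>g x. g \<in> Aut L M \<Longrightarrow> x \<in> X \<Longrightarrow> j (g x) = \<kappa> g (j x)"
    using ec unfolding equivariant_compactification_def G_space_def equivariant_def carrier_Aut_group by auto
  have jX: "j x \<in> topspace K'" if "x \<in> X" for x
    using funcset_mem[OF continuous_map_funspace[OF j]] that by simp
  define C where "C = {F. continuous_map K' euclideanreal F}"
  define pull where "pull F = (\<lambda>x\<in>X. F (j x))" for F :: "'c \<Rightarrow> real"
  have pull: "pull F \<in> Def L M" if "F \<in> C" for F
    using compactification_function_Def[OF ec] that unfolding C_def pull_def by blast
  define lim where "lim I y \<longleftrightarrow> y \<in> topspace K' \<and> (\<forall>F\<in>C. F y = FA.gelfand I (pull F))" for I y
  have ex: "\<exists>y. lim I y" if I: "I \<in> topspace (S1 L M)" for I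
  proof -
    \<comment> \<open>Closed conditions asking for the prescribed values up to an error. Finitely
      many of them are met by \<open>j x\<close> for some \<open>x\<close> that approximates the
      Gelfand functional of \<open>I\<close> on the pullbacks.\<close>
    define U where "U = (\<lambda>(F, \<epsilon>). {y \<in> topspace K'. F y - FA.gelfand I (pull F) \<in> {-\<epsilon>..\<epsilon>}})"
    define \<U> where "\<U> = U ` (C \<times> {0<..})"
    have "\<Inter>\<U> \<noteq> {}"
    proof (rule cpt[unfolded compact_space_fip, rule_format], intro conjI allI impI ballI)
      show "closedin K' B" if B: "B \<in> \<U>" for B
      proof -
        obtain p where p: "p \<in> C \<times> {0<..}" "B = U p" using B unfolding \<U>_def by blast
        have "continuous_map K' euclideanreal (\<lambda>y. fst p y - FA.gelfand I (pull (fst p)))"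
          using p(1) by (intro continuous_map_diff) (auto simp: C_def)
        then have "closedin K' {y \<in> topspace K'. fst p y - FA.gelfand I (pull (fst p)) \<in> {- snd p..snd p}}"
          by (rule closedin_continuous_map_preimage) (simp flip: closed_closedin)
        then show ?thesis unfolding p(2) U_def case_prod_beta .
      qed
      fix \<F> assume \<F>: "finite \<F> \<and> \<F> \<subseteq> \<U>"
      then obtain P where P: "finite P" "P \<subseteq> C \<times> {0<..}" "\<F> = U ` P"
        unfolding \<U>_def using finite_subset_image by metis
      define \<epsilon> where "\<epsilon> = Min (insert 1 (snd ` P))"
      have \<epsilon>: "\<epsilon> > 0" unfolding \<epsilon>_def using P by (subst Min_gr_iff) auto
      have fin: "finite ((pull \<circ> fst) ` P)" "(pull \<circ> fst) ` P \<subseteq> Def L M" using P(1,2) pull by auto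
      obtain x where x: "x \<in> X" "\<forall>f\<in>(pull \<circ> fst) ` P. \<bar>f x - FA.gelfand I f\<bar> < \<epsilon>"
        using spectrum_approx[OF gelfand_K[OF I] fin \<epsilon>] by blast
      have "j x \<in> U p" if p: "p \<in> P" for p
      proof -
        have "\<epsilon> \<le> snd p" unfolding \<epsilon>_def using P(1) p by simp
        moreover have "\<bar>pull (fst p) x - FA.gelfand I (pull (fst p))\<bar> < \<epsilon>" using x(2) p by auto
        then have "\<bar>fst p (j x) - FA.gelfand I (pull (fst p))\<bar> < \<epsilon>" using x(1) by (simp add: pull_def)
        ultimately have "fst p (j x) - FA.gelfand I (pull (fst p)) \<in> {- snd p..snd p}" by auto
        then show ?thesis using jX[OF x(1)] unfolding U_def by (auto simp: case_prod_beta)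
      qed
      then show "\<Inter>\<F> \<noteq> {}" unfolding P(3) by blast
    qed
    then obtain y where y: "y \<in> \<Inter>\<U>" by blast
    have yU: "y \<in> U (F, \<epsilon>)" if "F \<in> C" "\<epsilon> > 0" for F \<epsilon> using y that unfolding \<U>_def by blast
    have "(\<lambda>_. 0) \<in> C" by (simp add: C_def)
    then have "y \<in> topspace K'" using yU[OF _ zero_less_one] unfolding U_def by blast
    moreover have "F y = FA.gelfand I (pull F)" if F: "F \<in> C" for F
    proof -
      have "\<bar>F y - FA.gelfand I (pull F)\<bar> \<le> 0 + \<epsilon>" if "\<epsilon> > 0" for \<epsilon>
        using yU[OF F that] by (auto simp: U_def)
      then have "\<bar>F y - FA.gelfand I (pull F)\<bar> \<le> 0" by (rule field_le_epsilon)
      then show ?thesis by simp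
    qed
    ultimately show ?thesis unfolding lim_def by blast
  qed
  have uniq: "y = y'" if y: "y \<in> topspace K'" "y' \<in> topspace K'" "\<And>F. F \<in> C \<Longrightarrow> F y = F y'" for y y'
  proof (rule ccontr)
    assume "y \<noteq> y'"
    have "closedin K' {y'}" using haus y(2) by (simp add: closedin_Hausdorff_singleton)
    then obtain F where "continuous_map K' euclideanreal F" "F y = 0" "F y' = 1"
      using compact_Hausdorff_separating[OF cpt haus _ y(1), of "{y'}"] \<open>y \<noteq> y'\<close> by (metis singletonD singletonI)
    then show False using y(3)[of F] by (simp add: C_def)
  qed
  define \<pi> where "\<pi> I = (SOME y. lim I y)" for I
  have \<pi>: "\<pi> I \<in> topspace K'" "\<And>F. F \<in> C \<Longrightarrow> F (\<pi> I) = FA.gelfand I (pull F)" if "I \<in> topspace (S1 L M)" for I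
    using someI_ex[OF ex[OF that]] unfolding \<pi>_def lim_def by blast+
  have "continuous_map (S1 L M) K' \<pi>"
    unfolding continuous_map
  proof (intro conjI allI impI)
    show "\<pi> ` topspace (S1 L M) \<subseteq> topspace K'" using \<pi>(1) by blast
    fix W assume W: "openin K' W"
    show "openin (S1 L M) {I \<in> topspace (S1 L M). \<pi> I \<in> W}"
      unfolding openin_subopen[of _ "{I \<in> topspace (S1 L M). \<pi> I \<in> W}"]
    proof
      fix I assume I: "I \<in> {I \<in> topspace (S1 L M). \<pi> I \<in> W}"
      have "closedin K' (topspace K' - W)" using W by blast
      \<comment> \<open>As \<open>F (\<pi> I')\<close> is the Gelfand value of the pullback of
        \<open>F\<close> at \<open>I'\<close>, the requirement that it be below 1 is open in
        \<open>I'\<close>, and it forces \<open>\<pi> I'\<close> into \<open>W\<close>.\<close>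
      then obtain F where F: "continuous_map K' euclideanreal F" "F (\<pi> I) = 0" "\<And>z. z \<in> topspace K' - W \<Longrightarrow> F z = 1"
        using compact_Hausdorff_separating[OF cpt haus, of "topspace K' - W" "\<pi> I"] \<pi>(1)[of I] I by auto
      have FC: "F \<in> C" using F(1) by (simp add: C_def)
      have "openin (S1 L M) {I \<in> topspace (S1 L M). FA.gelfand I (pull F) \<in> {..<1}}"
        by (rule openin_continuous_map_preimage[OF continuous_gelfand[OF pull[OF FC]]]) (simp flip: open_openin)
      moreover have "I \<in> {I \<in> topspace (S1 L M). FA.gelfand I (pull F) \<in> {..<1}}"
        using I \<pi>(2)[OF _ FC, of I] F(2) by simp
      moreover have "{I \<in> topspace (S1 L M). FA.gelfand I (pull F) \<in> {..<1}} \<subseteq> {I \<in> topspace (S1 L M). \<pi> I \<in> W}"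
      proof
        fix I' assume I': "I' \<in> {I \<in> topspace (S1 L M). FA.gelfand I (pull F) \<in> {..<1}}"
        then have "F (\<pi> I') < 1" using \<pi>(2)[OF _ FC, of I'] by simp
        then have "\<pi> I' \<notin> topspace K' - W" using F(3) by fastforce
        then show "I' \<in> {I \<in> topspace (S1 L M). \<pi> I \<in> W}" using I' \<pi>(1)[of I'] by blast
      qed
      ultimately show "\<exists>V. openin (S1 L M) V \<and> I \<in> V \<and> V \<subseteq> {I \<in> topspace (S1 L M). \<pi> I \<in> W}" by blast
    qed
  qed
  moreover have "\<pi> (tp L M x) = j x" if x: "x \<in> X" for x
  proof (rule uniq[OF \<pi>(1)[OF tp_in_S1[OF x]] jX[OF x]])
    show "F (\<pi> (tp L M x)) = F (j x)" if "F \<in> C" for F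
      using \<pi>(2)[OF tp_in_S1[OF x] that] pull[OF that] x by (simp add: gelfand_tp) (simp add: pull_def)
  qed
  moreover have "\<pi> (S1_action L M g I) = \<kappa> g (\<pi> I)" if g: "g \<in> Aut L M" and I: "I \<in> topspace (S1 L M)" for g I
  proof (rule uniq[OF \<pi>(1)[OF S1_action_closed[OF I g]]])
    have \<kappa>g: "continuous_map K' K' (\<kappa> g)"
    proof -
      have "continuous_map K' (prod_topology T K') (\<lambda>y. (g, y))"
        using g by (simp add: continuous_map_pairedI topspace_Aut_topology)
      from continuous_map_compose[OF this cont] show ?thesis by (simp add: comp_def)
    qed
    then show "\<kappa> g (\<pi> I) \<in> topspace K'"
      using funcset_mem[OF continuous_map_funspace[OF \<kappa>g] \<pi>(1)[OF I]] by blast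
    show "F (\<pi> (S1_action L M g I)) = F (\<kappa> g (\<pi> I))" if F: "F \<in> C" for F
    proof -
      \<comment> \<open>Both points are compared through the functions \<open>F\<close> in
        \<open>C\<close>. Since \<open>j\<close> is equivariant, \<open>F \<circ> \<kappa> g\<close>
        pulls back to the pullback of \<open>F\<close> composed with \<open>g\<close>, which is how
        \<open>g\<close> acts on types.\<close>
      have Fg: "F \<circ> \<kappa> g \<in> C" using continuous_map_compose[OF \<kappa>g] F by (simp add: C_def)
      have "pull (F \<circ> \<kappa> g) = compose X (pull F) g"
        unfolding pull_def compose_def by (rule restrict_ext) (use g eq[OF g] in simp)
      then have "F (\<kappa> g (\<pi> I)) = FA.gelfand I (compose X (pull F) g)"
        using \<pi>(2)[OF I Fg] by simp
      then show ?thesis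
        using \<pi>(2)[OF S1_action_closed[OF I g] F] gelfand_S1_action[OF I g pull[OF F]] by simp
    qed
  qed
  ultimately show ?thesis
    unfolding equivariant_def carrier_Aut_group topspace_mtopology_of by blast
qed

lemma metrizable_S1: "metrizable_space (S1 L M)"
proof -
  obtain s where s: "dense_seq s" using ex_dense_seq by blast
  have sV: "s \<in> Val" using s by (simp add: dense_seq_def)
  define D where "D = (\<lambda>q. \<lambda>x\<in>X. q (case_nat x s)) ` Q"
  have "metrizable_space (spectrum_topology X (Def L M))"
  proof (rule FA.metrizable_spectrum_topology)
    show "countable D" unfolding D_def using countable_Q by blast
    show "D \<subseteq> Def L M" unfolding D_def using dp_Q Def_dense_seq[OF s] by blast
    fix f \<epsilon> assume f: "f \<in> Def L M" and \<epsilon>: "(0::real) < \<epsilon>"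
    obtain \<phi> where \<phi>: "dp \<phi>" "f = (\<lambda>x\<in>X. \<phi> (case_nat x s))" using f Def_dense_seq[OF s] by blast
    obtain q where q: "q \<in> Q" "\<forall>e\<in>Val. \<bar>q e - \<phi> e\<bar> < \<epsilon>" using Q_dense[OF \<phi>(1) \<epsilon>] by blast
    have "\<forall>x\<in>X. \<bar>(\<lambda>x\<in>X. q (case_nat x s)) x - f x\<bar> < \<epsilon>"
      using q(2) case_nat_Val[OF _ sV] by (simp add: \<phi>(2))
    then show "\<exists>g\<in>D. \<forall>x\<in>X. \<bar>g x - f x\<bar> < \<epsilon>" using q(1) unfolding D_def by blast
  qed
  then show ?thesis using homeomorphic_metrizable_space[OF S1_homeomorphic_space] by blast
qed

end

theorem theorem4p4:
  fixes L :: "'p language" and M :: "('a, 'p) metric_struct"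
  assumes "metric_structure L M"
    and "essentially_countable_language L M"
    and "aleph0_categorical L M"
  shows "Def L M = RUC (Aut_group L M) (Aut_topology L M) (space_topology M) (\<lambda>g. g) \<and>
    maximal_equivariant_compactification TYPE('c)
      (Aut_group L M) (Aut_topology L M) (space_topology M) (\<lambda>g. g)
      (S1 L M) (S1_action L M) (tp L M) \<and>
    metrizable_space (S1 L M)"
proof -
  interpret categorical_structure L M
    using assms by unfold_locales
  show ?thesis
    unfolding maximal_equivariant_compactification_def
    using Def_eq_RUC equivariant_compactification_S1 S1_universal metrizable_S1 by blast
qed

end
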